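(* Let $G$ be a locally compact group and $H<G$ a closed subgroup satisfying Derighetti's condition: the trivial representation $\mathbf{1}_H$ of $H$ is weakly contained in the restriction to $H$ of the quasi-regular representation of $G$ on $L^2(G/H)$, i.e. $\mathbf{1}_H\prec(\mathrm{Ind}_H^G\mathbf{1}_H)|_H$. If $H$ is amenable relative to $G$, then $H$ is amenable.
   Context: Locally compact groups are Hausdorff. A convex compact $G$-space is a convex compact subset $K$ of any (Hausdorff) locally convex topological vector space endowed with a continuous affine representation of $G$ preserving $K$ (thus $G$ acts on $K$ by affine transformations, with continuous action map $G\times K\to K$). A locally compact group $H$ is amenable if it fixes a point in every non-empty convex compact $H$-space. A closed subgroup $H<G$ is amenable relative to $G$ (relatively amenable) if $H$ fixes a point in every non-empty convex compact $G$-space. The quasi-regular representation of $G$ on $L^2(G/H)$ is the unitarily induced representation $\mathrm{Ind}_H^G\mathbf{1}_H$ of the trivial representation (defined using a $G$-quasi-invariant measure on $G/H$, the translation action being corrected by the square root of the Radon–Nikodym derivative). Weak containment of $\mathbf{1}_H$ means the existence of $H$-almost-invariant unit vectors: for every compact $Q\subseteq H$ and $\varepsilon>0$ there is a unit vector $v$ with $\|hv-v\|<\varepsilon$ for all $h\in Q$. *)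

theory Defs
  imports
    "HOL-Analysis.Analysis"
    "HOL-Algebra.Group_Action"
    "HOL-Algebra.Left_Coset"
    "HOL-Library.Function_Algebras"
begin

section \<open>Locally compact groups\<close>

locale locally_compact_group = group G for G (structure) +
  fixes T
  assumes topspace_eq: "topspace T = carrier G"
    and continuous_mult: "continuous_map (prod_topology T T) T (\<lambda>(x, y). x \<otimes> y)"
    and continuous_inv: "continuous_map T T (\<lambda>x. inv x)"
    and hausdorff: "Hausdorff_space T"
    and locally_compact: "locally_compact_space T"

section \<open>Convex compact G-spaces and amenability\<close>

text \<open>A Hausdorff locally convex topological vector space is given by a topology whose
  underlying set is a linear subspace of an ambient real vector space; the ambient type itself
  carries no topology.\<close>

definition locally_convex_tvs :: "'v::real_vector topology \<Rightarrow> bool" where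
  "locally_convex_tvs E \<longleftrightarrow>
     subspace (topspace E) \<and> Hausdorff_space E \<and>
     continuous_map (prod_topology E E) E (\<lambda>(x, y). x + y) \<and>
     continuous_map (prod_topology euclideanreal E) E (\<lambda>(c, x). c *\<^sub>R x) \<and>
     (\<forall>U. openin E U \<and> 0 \<in> U \<longrightarrow> (\<exists>V. openin E V \<and> 0 \<in> V \<and> convex V \<and> V \<subseteq> U))"

definition affine_map_on :: "'v::real_vector set \<Rightarrow> ('v \<Rightarrow> 'v) \<Rightarrow> bool" where
  "affine_map_on S f \<longleftrightarrow>
     (\<forall>x\<in>S. \<forall>y\<in>S. \<forall>t::real. f ((1 - t) *\<^sub>R x + t *\<^sub>R y) = (1 - t) *\<^sub>R f x + t *\<^sub>R f y)"

text \<open>A continuous affine representation on \<open>E\<close> is an action by continuous affine maps of \<open>E\<close>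
  with continuous orbit maps. On \<open>K\<close> the action is moreover jointly continuous. (Joint
  continuity is not asked on all of \<open>E\<close>: it fails for the duals with their weak-star topology
  that are the standard examples.)\<close>

definition convex_compact_space ::
  "('g, 'b) monoid_scheme \<Rightarrow> 'g topology \<Rightarrow>
   'v::real_vector topology \<Rightarrow> ('g \<Rightarrow> 'v \<Rightarrow> 'v) \<Rightarrow> 'v set \<Rightarrow> bool" where
  "convex_compact_space G T E \<alpha> K \<longleftrightarrow>
     locally_convex_tvs E \<and>
     group_action G (topspace E) \<alpha> \<and>
     (\<forall>g\<in>carrier G. affine_map_on (topspace E) (\<alpha> g) \<and> continuous_map E E (\<alpha> g)) \<and>
     (\<forall>x\<in>topspace E. continuous_map T E (\<lambda>g. \<alpha> g x)) \<and>
     convex K \<and> compactin E K \<and>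
     (\<forall>g\<in>carrier G. \<alpha> g ` K \<subseteq> K) \<and>
     continuous_map (prod_topology T (subtopology E K)) (subtopology E K) (\<lambda>(g, x). \<alpha> g x)"

text \<open>A definition cannot quantify over types, so the two notions of amenability take the type
  in which the locally convex spaces live as a parameter.\<close>

definition amenable ::
  "'v::real_vector itself \<Rightarrow> ('g, 'b) monoid_scheme \<Rightarrow> 'g topology \<Rightarrow> bool" where
  "amenable _ G T \<longleftrightarrow>
     (\<forall>(E :: 'v topology) \<alpha> K. convex_compact_space G T E \<alpha> K \<and> K \<noteq> {} \<longrightarrow>
        (\<exists>x\<in>K. \<forall>g\<in>carrier G. \<alpha> g x = x))"

definition relatively_amenable ::
  "'v::real_vector itself \<Rightarrow> ('g, 'b) monoid_scheme \<Rightarrow> 'g topology \<Rightarrow> 'g set \<Rightarrow> bool" where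
  "relatively_amenable _ G T H \<longleftrightarrow>
     (\<forall>(E :: 'v topology) \<alpha> K. convex_compact_space G T E \<alpha> K \<and> K \<noteq> {} \<longrightarrow>
        (\<exists>x\<in>K. \<forall>h\<in>H. \<alpha> h x = x))"

text \<open>The ambient type \<open>('g \<Rightarrow> real) \<Rightarrow> real\<close> is large enough to test relative amenability in a
  group of type \<open>'g\<close>: the orbit map of a point of a non-empty convex compact G-space extends to
  a continuous affine G-map from the weak-star compact set of means on the bounded uniformly
  continuous functions on G (those with norm-continuous translation orbits), so a fixed mean
  yields a fixed point in every such space, and the dual of the space of these functions is
  isomorphic to a linear subspace of \<open>('g \<Rightarrow> real) \<Rightarrow> real\<close>.\<close>

instantiation "fun" :: (type, real_vector) real_vector
begin

definition scaleR_fun_def: "c *\<^sub>R f = (\<lambda>x. c *\<^sub>R f x)"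

instance
  by standard (simp_all add: scaleR_fun_def fun_eq_iff scaleR_add_right scaleR_add_left)

end

lemma scaleR_fun_apply [simp]: "(c *\<^sub>R f) x = c *\<^sub>R f x"
  by (simp add: scaleR_fun_def)

section \<open>Quasi-invariant measures on the coset space\<close>

definition coset_topology ::
  "('g, 'b) monoid_scheme \<Rightarrow> 'g topology \<Rightarrow> 'g set \<Rightarrow> 'g set topology" where
  "coset_topology G T H =
     topology (\<lambda>U. U \<subseteq> lcosets\<^bsub>G\<^esub> H \<and> openin T {x \<in> topspace T. x <#\<^bsub>G\<^esub> H \<in> U})"

lemma openin_coset_topology:
  "openin (coset_topology G T H) U \<longleftrightarrow>
     U \<subseteq> lcosets\<^bsub>G\<^esub> H \<and> openin T {x \<in> topspace T. x <#\<^bsub>G\<^esub> H \<in> U}"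
proof -
  have "istopology (\<lambda>U. U \<subseteq> lcosets\<^bsub>G\<^esub> H \<and> openin T {x \<in> topspace T. x <#\<^bsub>G\<^esub> H \<in> U})"
    unfolding istopology_def
  proof (intro conjI allI impI; (elim conjE)?)
    fix A B
    assume "openin T {x \<in> topspace T. x <#\<^bsub>G\<^esub> H \<in> A}" "openin T {x \<in> topspace T. x <#\<^bsub>G\<^esub> H \<in> B}"
    then have "openin T ({x \<in> topspace T. x <#\<^bsub>G\<^esub> H \<in> A} \<inter> {x \<in> topspace T. x <#\<^bsub>G\<^esub> H \<in> B})"
      by (rule openin_Int)
    moreover have "{x \<in> topspace T. x <#\<^bsub>G\<^esub> H \<in> A} \<inter> {x \<in> topspace T. x <#\<^bsub>G\<^esub> H \<in> B} =
        {x \<in> topspace T. x <#\<^bsub>G\<^esub> H \<in> A \<inter> B}"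
      by blast
    ultimately show "openin T {x \<in> topspace T. x <#\<^bsub>G\<^esub> H \<in> A \<inter> B}"
      by simp
  next
    fix \<K>
    assume *: "\<forall>A\<in>\<K>. A \<subseteq> lcosets\<^bsub>G\<^esub> H \<and> openin T {x \<in> topspace T. x <#\<^bsub>G\<^esub> H \<in> A}"
    then have "openin T (\<Union>A\<in>\<K>. {x \<in> topspace T. x <#\<^bsub>G\<^esub> H \<in> A})"
      by blast
    moreover have "(\<Union>A\<in>\<K>. {x \<in> topspace T. x <#\<^bsub>G\<^esub> H \<in> A}) =
        {x \<in> topspace T. x <#\<^bsub>G\<^esub> H \<in> \<Union>\<K>}"
      by blast
    ultimately show "openin T {x \<in> topspace T. x <#\<^bsub>G\<^esub> H \<in> \<Union>\<K>}"
      by simp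
  qed auto
  then show ?thesis
    by (simp add: coset_topology_def)
qed

lemma (in locally_compact_group) topspace_coset_topology:
  "topspace (coset_topology G T H) = lcosets H"
proof
  show "topspace (coset_topology G T H) \<subseteq> lcosets H"
    using openin_topspace openin_coset_topology by blast
  have "{x \<in> topspace T. x <# H \<in> lcosets H} = topspace T"
    by (auto simp: LCOSETS_def topspace_eq)
  then have "openin (coset_topology G T H) (lcosets H)"
    by (simp add: openin_coset_topology)
  then show "lcosets H \<subseteq> topspace (coset_topology G T H)"
    by (rule openin_subset)
qed

lemma (in locally_compact_group) quotient_map_coset_topology:
  "quotient_map T (coset_topology G T H) (\<lambda>x. x <# H)"
proof -
  have "(\<lambda>x. x <# H) ` topspace T = lcosets H"
    by (auto simp: LCOSETS_def topspace_eq)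
  then show ?thesis
    by (auto simp: quotient_map_def topspace_coset_topology openin_coset_topology)
qed

definition borel_of :: "'a topology \<Rightarrow> 'a measure" where
  "borel_of X = sigma (topspace X) {U. openin X U}"

definition radon_measure :: "'a topology \<Rightarrow> 'a measure \<Rightarrow> bool" where
  "radon_measure X M \<longleftrightarrow>
     space M = topspace X \<and> sets M = sets (borel_of X) \<and>
     (\<forall>C. compactin X C \<and> C \<in> sets M \<longrightarrow> emeasure M C < \<infinity>) \<and>
     (\<forall>A\<in>sets M. emeasure M A = (INF U\<in>{U. openin X U \<and> A \<subseteq> U}. emeasure M U)) \<and>
     (\<forall>U. openin X U \<longrightarrow>
        emeasure M U = (SUP C\<in>{C. compactin X C \<and> C \<in> sets M \<and> C \<subseteq> U}. emeasure M C))"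

definition translate_measure :: "('g, 'b) monoid_scheme \<Rightarrow> 'g \<Rightarrow> 'g set measure \<Rightarrow> 'g set measure"
  where "translate_measure G g M = distr M M (\<lambda>C. g <#\<^bsub>G\<^esub> C)"

text \<open>The last clause asks for Radon-Nikodym derivatives. By the Radon-Nikodym theorem it follows
  from the equality of null sets when \<open>M\<close> is sigma-finite. For arbitrary G it is satisfied by
  the measures constructed from a continuous rho-function.\<close>

definition quasi_invariant_measure ::
  "('g, 'b) monoid_scheme \<Rightarrow> 'g topology \<Rightarrow> 'g set \<Rightarrow> 'g set measure \<Rightarrow> bool" where
  "quasi_invariant_measure G T H M \<longleftrightarrow>
     radon_measure (coset_topology G T H) M \<and> emeasure M (space M) \<noteq> 0 \<and>
     (\<forall>g\<in>carrier G. null_sets (translate_measure G g M) = null_sets M \<and>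
        (\<exists>f\<in>borel_measurable M. density M f = translate_measure G g M))"

section \<open>The quasi-regular representation and weak containment\<close>

definition square_integrable :: "'x measure \<Rightarrow> ('x \<Rightarrow> complex) \<Rightarrow> bool" where
  "square_integrable M f \<longleftrightarrow> f \<in> borel_measurable M \<and> integrable M (\<lambda>x. (cmod (f x))\<^sup>2)"

definition l2_norm :: "'x measure \<Rightarrow> ('x \<Rightarrow> complex) \<Rightarrow> real" where
  "l2_norm M f = sqrt (\<integral>x. (cmod (f x))\<^sup>2 \<partial>M)"

definition quasi_regular ::
  "('g, 'b) monoid_scheme \<Rightarrow> 'g set measure \<Rightarrow> 'g \<Rightarrow> ('g set \<Rightarrow> complex) \<Rightarrow> 'g set \<Rightarrow> complex" where
  "quasi_regular G M g f C =
     complex_of_real (sqrt (enn2real (RN_deriv M (translate_measure G g M) C))) *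
     f (inv\<^bsub>G\<^esub> g <#\<^bsub>G\<^esub> C)"

text \<open>Elements of \<open>L\<^sup>2(M)\<close> are represented by functions; \<open>\<pi>\<close> is a representation on \<open>L\<^sup>2(M)\<close> of the
  group with topology \<open>T\<close>. As \<open>\<pi> h\<close> maps \<open>L\<^sup>2(M)\<close> to itself, \<open>\<pi> h v - v\<close> is square integrable, so the
  Bochner integral in its norm is the true one.\<close>

definition weakly_contains_trivial ::
  "'g topology \<Rightarrow> 'x measure \<Rightarrow> ('g \<Rightarrow> ('x \<Rightarrow> complex) \<Rightarrow> 'x \<Rightarrow> complex) \<Rightarrow> bool" where
  "weakly_contains_trivial T M \<pi> \<longleftrightarrow>
     (\<forall>Q \<epsilon>. compactin T Q \<and> \<epsilon> > 0 \<longrightarrow>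
        (\<exists>v. square_integrable M v \<and> l2_norm M v = 1 \<and>
           (\<forall>h\<in>Q. l2_norm M (\<lambda>x. \<pi> h v x - v x) < \<epsilon>)))"

end

theory Submission
  imports Defs
begin

text \<open>
  Both fixed point properties are translated into the existence of invariant means. Relative amenability,
  tested on the convex compact space of means on \<open>UC\<close>, the bounded functions on \<open>G\<close> that are uniformly
  continuous for translations on the left, yields an \<open>H\<close>-invariant mean \<open>m\<close> on \<open>UC\<close>
  (\<open>mean_if_relatively_amenable\<close>). Conversely, \<open>H\<close> is amenable as soon as there is an invariant mean on the
  bounded continuous functions on \<open>H\<close> (\<open>amenable_if_invariant_mean\<close>).

  To get from one to the other, a bounded continuous function \<open>f\<close> on \<open>H\<close> is extended \<open>H\<close>-equivariantly to a
  function \<open>E f\<close> on \<open>G\<close> (\<open>equivariant_extension\<close>). As \<open>E f\<close> need not be in \<open>UC\<close>, it is first averaged: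
  \<open>n f = m\<^sub>g (\<integral> (E f)(x g) d\<mu>(x))\<close>, where \<open>\<mu>\<close> is a signed measure of compact support on \<open>G\<close> whose right
  translates are norm continuous. Translating \<open>f\<close> by \<open>h \<in> H\<close> replaces \<open>\<mu>\<close> by its left translate \<open>h\<mu>\<close>. The
  norm of \<open>h\<mu> - \<mu>\<close> cannot be expected to be small. But \<open>m\<close> is \<open>H\<close>-invariant, and this implies that a
  charge contributes to \<open>n\<close> at most the norm of its image on \<open>G/H\<close> (\<open>mean_through_cosets\<close>). So \<open>n\<close> is almost
  invariant if the image of \<open>\<mu>\<close> on \<open>G/H\<close> is almost invariant under \<open>H\<close> in norm.

  This is where Derighetti's condition enters: if \<open>v\<close> is an almost invariant unit vector in \<open>L\<^sup>2(G/H)\<close>, the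
  density \<open>\<bar>v\<bar>\<^sup>2\<close> is almost invariant in \<open>L\<^sup>1(G/H)\<close> (\<open>almost_invariant_density\<close>). It remains to find a
  measure \<open>\<mu>\<close> on \<open>G\<close> whose image is close to this density (\<open>density_lift\<close>). Lifting the measure of \<open>G/H\<close>
  to \<open>G\<close> along the Haar measures of the cosets and smoothing the result gives a measure with norm-continuous
  right translates. Its image on \<open>G/H\<close> dominates the density up to a small error, because the measure on
  \<open>G/H\<close> is quasi-invariant (\<open>absolutely_continuous\<close>), and von Neumann's proof of the Radon-Nikodym theorem
  then provides a continuous function on \<open>G/H\<close> to multiply it with (\<open>density_approximation\<close>). Finally, a
  cluster point of the almost invariant means \<open>n\<close> is an invariant mean.

  Integrals over \<open>G\<close> and \<open>H\<close> are positive functionals on functions of compact support, obtained by Weil's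
  construction (\<open>left_Haar_exists\<close>). They are interchanged with each other and with means through uniform
  Riemann sums (\<open>pf_interchange\<close>), which treat countably additive and finitely additive integrals alike.
\<close>

section \<open>Continuous functions of compact support\<close>

definition Cc :: "'a topology \<Rightarrow> ('a \<Rightarrow> real) set" where
  "Cc X = {f. continuous_map X euclideanreal f \<and>
              (\<exists>C. compactin X C \<and> (\<forall>x\<in>topspace X - C. f x = 0))}"

definition Cb :: "'a topology \<Rightarrow> ('a \<Rightarrow> real) set" where
  "Cb X = {f. continuous_map X euclideanreal f \<and> (\<exists>B. \<forall>x\<in>topspace X. \<bar>f x\<bar> \<le> B)}"

lemma continuous_map_real_iff:
  "continuous_map X euclideanreal f \<longleftrightarrow>
     (\<forall>x\<in>topspace X. \<forall>e>0. \<exists>U. openin X U \<and> x \<in> U \<and> (\<forall>y\<in>U. \<bar>f y - f x\<bar> < e))"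
proof -
  have "continuous_map X euclideanreal f \<longleftrightarrow> continuous_map X (Met_TC.mtopology) f"
    by simp
  also have "\<dots> \<longleftrightarrow> (\<forall>x\<in>topspace X. \<forall>e>0. \<exists>U. openin X U \<and> x \<in> U \<and> (\<forall>y\<in>U. \<bar>f y - f x\<bar> < e))"
    unfolding Met_TC.continuous_map_to_metric
    by (simp add: dist_real_def abs_minus_commute)
  finally show ?thesis .
qed

lemma CcI:
  "continuous_map X euclideanreal f \<Longrightarrow> compactin X C \<Longrightarrow> (\<And>x. x \<in> topspace X \<Longrightarrow> x \<notin> C \<Longrightarrow> f x = 0)
    \<Longrightarrow> f \<in> Cc X"
  by (auto simp: Cc_def)

lemma Cc_continuous: "f \<in> Cc X \<Longrightarrow> continuous_map X euclideanreal f"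
  by (simp add: Cc_def)

lemma Cc_support:
  assumes "f \<in> Cc X"
  obtains C where "compactin X C" "\<And>x. x \<in> topspace X \<Longrightarrow> x \<notin> C \<Longrightarrow> f x = 0"
  using assms by (auto simp: Cc_def)

lemma Cb_continuous: "f \<in> Cb X \<Longrightarrow> continuous_map X euclideanreal f"
  by (simp add: Cb_def)

lemma CbI:
  "continuous_map X euclideanreal f \<Longrightarrow> (\<And>x. x \<in> topspace X \<Longrightarrow> \<bar>f x\<bar> \<le> B) \<Longrightarrow> f \<in> Cb X"
  by (auto simp: Cb_def)

lemma Cb_add: "f \<in> Cb X \<Longrightarrow> g \<in> Cb X \<Longrightarrow> (\<lambda>x. f x + g x) \<in> Cb X"
proof -
  assume f: "f \<in> Cb X" and g: "g \<in> Cb X"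
  obtain A where A: "\<And>x. x \<in> topspace X \<Longrightarrow> \<bar>f x\<bar> \<le> A" using f by (auto simp: Cb_def)
  obtain B where B: "\<And>x. x \<in> topspace X \<Longrightarrow> \<bar>g x\<bar> \<le> B" using g by (auto simp: Cb_def)
  show ?thesis
  proof (rule CbI)
    show "continuous_map X euclideanreal (\<lambda>x. f x + g x)"
      by (rule continuous_map_add[OF Cb_continuous[OF f] Cb_continuous[OF g]])
    show "\<bar>f x + g x\<bar> \<le> A + B" if "x \<in> topspace X" for x using A[OF that] B[OF that] by linarith
  qed
qed

lemma Cb_mult: "f \<in> Cb X \<Longrightarrow> g \<in> Cb X \<Longrightarrow> (\<lambda>x. f x * g x) \<in> Cb X"
proof -
  assume f: "f \<in> Cb X" and g: "g \<in> Cb X"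
  obtain A where A: "\<And>x. x \<in> topspace X \<Longrightarrow> \<bar>f x\<bar> \<le> A" using f by (auto simp: Cb_def)
  obtain B where B: "\<And>x. x \<in> topspace X \<Longrightarrow> \<bar>g x\<bar> \<le> B" using g by (auto simp: Cb_def)
  show ?thesis
  proof (rule CbI)
    show "continuous_map X euclideanreal (\<lambda>x. f x * g x)"
      by (rule continuous_map_real_mult[OF Cb_continuous[OF f] Cb_continuous[OF g]])
    show "\<bar>f x * g x\<bar> \<le> A * B" if x: "x \<in> topspace X" for x
      unfolding abs_mult using A[OF x] B[OF x] by (intro mult_mono) auto
  qed
qed

lemma Cb_const: "(\<lambda>_. c) \<in> Cb X"
  by (rule CbI[of _ _ "\<bar>c\<bar>"]) auto

lemma Cb_scale: "f \<in> Cb X \<Longrightarrow> (\<lambda>x. c * f x) \<in> Cb X"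
  by (rule Cb_mult[OF Cb_const])

lemma Cb_diff: "f \<in> Cb X \<Longrightarrow> g \<in> Cb X \<Longrightarrow> (\<lambda>x. f x - g x) \<in> Cb X"
  using Cb_add[of f X "\<lambda>x. (-1) * g x"] Cb_scale[of g X "-1"] by simp

lemma Cc_combine:
  assumes f: "f \<in> Cc X" and g: "g \<in> Cc X" and cont: "continuous_map X euclideanreal (\<lambda>x. F (f x) (g x))"
    and "F 0 0 = 0"
  shows "(\<lambda>x. F (f x) (g x)) \<in> Cc X"
proof -
  obtain C where C: "compactin X C" "\<And>x. x \<in> topspace X \<Longrightarrow> x \<notin> C \<Longrightarrow> f x = 0"
    using Cc_support[OF f] by metis
  obtain D where D: "compactin X D" "\<And>x. x \<in> topspace X \<Longrightarrow> x \<notin> D \<Longrightarrow> g x = 0"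
    using Cc_support[OF g] by metis
  show ?thesis
    by (rule CcI[OF cont compactin_Un[OF C(1) D(1)]]) (use C D \<open>F 0 0 = 0\<close> in auto)
qed

lemma Cc_add: "f \<in> Cc X \<Longrightarrow> g \<in> Cc X \<Longrightarrow> (\<lambda>x. f x + g x) \<in> Cc X"
  using Cc_continuous[of f X] Cc_continuous[of g X]
  by (intro Cc_combine[where F="(+)"]) (auto intro!: continuous_intros)

lemma Cc_diff: "f \<in> Cc X \<Longrightarrow> g \<in> Cc X \<Longrightarrow> (\<lambda>x. f x - g x) \<in> Cc X"
  using Cc_continuous[of f X] Cc_continuous[of g X]
  by (intro Cc_combine[where F="(-)"]) (auto intro!: continuous_intros)

lemma Cc_max: "f \<in> Cc X \<Longrightarrow> g \<in> Cc X \<Longrightarrow> (\<lambda>x. max (f x) (g x)) \<in> Cc X"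
  using Cc_continuous[of f X] Cc_continuous[of g X]
  by (intro Cc_combine[where F=max]) (auto intro!: continuous_intros)

lemma Cc_mult:
  assumes f: "f \<in> Cc X" and g: "continuous_map X euclideanreal g"
  shows "(\<lambda>x. f x * g x) \<in> Cc X" "(\<lambda>x. g x * f x) \<in> Cc X"
proof -
  obtain C where C: "compactin X C" "\<And>x. x \<in> topspace X \<Longrightarrow> x \<notin> C \<Longrightarrow> f x = 0"
    using Cc_support[OF f] by metis
  show "(\<lambda>x. f x * g x) \<in> Cc X"
    using C(2) by (intro CcI[OF _ C(1)] continuous_map_real_mult Cc_continuous[OF f] g) simp
  then show "(\<lambda>x. g x * f x) \<in> Cc X"
    by (simp add: mult.commute)
qed

lemma Cc_scale: "f \<in> Cc X \<Longrightarrow> (\<lambda>x. c * f x) \<in> Cc X"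
  by (rule Cc_mult(2)) auto

lemma Cc_zero: "(\<lambda>x. 0) \<in> Cc X"
  by (rule CcI[of _ _ "{}"]) auto

lemma Cc_minus: "f \<in> Cc X \<Longrightarrow> (\<lambda>x. - f x) \<in> Cc X"
  using Cc_scale[of f X "-1"] by simp

lemma Cc_sum: "finite P \<Longrightarrow> (\<And>p. p \<in> P \<Longrightarrow> f p \<in> Cc X) \<Longrightarrow> (\<lambda>x. \<Sum>p\<in>P. f p x) \<in> Cc X"
  by (induction P rule: finite_induct) (auto intro: Cc_add Cc_zero)

lemma Cc_cong:
  assumes "f \<in> Cc X" "\<And>x. x \<in> topspace X \<Longrightarrow> f x = g x"
  shows "g \<in> Cc X"
proof -
  have "continuous_map X euclideanreal g"
    by (rule continuous_map_eq[OF Cc_continuous[OF assms(1)]]) (use assms(2) in auto)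
  with assms show ?thesis
    by (auto simp: Cc_def)
qed

lemma continuous_map_bounded_on_compact:
  assumes "continuous_map X euclideanreal f" "compactin X C"
  obtains B where "B > 0" "\<And>x. x \<in> C \<Longrightarrow> \<bar>f x\<bar> \<le> B"
proof -
  have "compact (f ` C)"
    using image_compactin[OF assms(2,1)] by simp
  then have "bounded (f ` C)"
    by (rule compact_imp_bounded)
  then obtain B where "\<And>x. x \<in> C \<Longrightarrow> \<bar>f x\<bar> \<le> B"
    by (auto simp: bounded_iff)
  then show ?thesis
    by (intro that[of "max B 1"]) (auto simp: le_max_iff_disj)
qed

lemma continuous_map_positive_on_compact:
  assumes "continuous_map X euclideanreal f" "compactin X C" "\<And>x. x \<in> C \<Longrightarrow> f x > 0"
  obtains e where "e > 0" "\<And>x. x \<in> C \<Longrightarrow> f x \<ge> e"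
proof (cases "C = {}")
  case False
  have "compact (f ` C)"
    using image_compactin[OF assms(2,1)] by simp
  then obtain y where "y \<in> f ` C" "\<And>z. z \<in> f ` C \<Longrightarrow> y \<le> z"
    using compact_attains_inf[of "f ` C"] False by auto
  with assms(3) that show ?thesis
    by auto
qed (use that[of 1] in auto)

lemma Cc_bounded:
  assumes "f \<in> Cc X"
  obtains B where "B > 0" "\<And>x. x \<in> topspace X \<Longrightarrow> \<bar>f x\<bar> \<le> B"
proof -
  obtain C where C: "compactin X C" "\<And>x. x \<in> topspace X \<Longrightarrow> x \<notin> C \<Longrightarrow> f x = 0"
    using Cc_support[OF assms] by metis
  obtain B where B: "B > 0" "\<And>x. x \<in> C \<Longrightarrow> \<bar>f x\<bar> \<le> B"
    using continuous_map_bounded_on_compact[OF Cc_continuous[OF assms] C(1)] by metis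
  show ?thesis
  proof (rule that[OF B(1)])
    fix x assume "x \<in> topspace X"
    then show "\<bar>f x\<bar> \<le> B"
      using B C(2)[of x] by (cases "x \<in> C") auto
  qed
qed

lemma compactin_subcover_image:
  assumes C: "compactin X C" and "\<And>s. s \<in> S \<Longrightarrow> openin X (W s)" and "\<And>x. x \<in> C \<Longrightarrow> \<exists>s\<in>S. x \<in> W s"
  obtains P where "finite P" "P \<subseteq> S" "\<And>x. x \<in> C \<Longrightarrow> \<exists>s\<in>P. x \<in> W s"
proof -
  have "\<exists>\<F>. finite \<F> \<and> \<F> \<subseteq> W ` S \<and> C \<subseteq> \<Union>\<F>"
    by (rule compactinD[OF C]) (use assms in blast)+
  then obtain P where "finite P" "P \<subseteq> S" "C \<subseteq> \<Union>(W ` P)"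
    by (metis finite_subset_image)
  then show thesis by (intro that[of P]) blast+
qed

lemma Urysohn_function:
  assumes "locally_compact_space X" "Hausdorff_space X" "compactin X Q" "openin X U" "Q \<subseteq> U"
  obtains f where "continuous_map X euclideanreal f" "\<And>x. x \<in> topspace X \<Longrightarrow> 0 \<le> f x"
    "\<And>x. x \<in> topspace X \<Longrightarrow> f x \<le> 1" "\<And>x. x \<in> Q \<Longrightarrow> f x = 1"
    "\<And>x. x \<in> topspace X \<Longrightarrow> x \<notin> U \<Longrightarrow> f x = 0"
proof -
  have "completely_regular_space X"
    using assms locally_compact_regular_imp_completely_regular_space by blast
  moreover have "closedin X (topspace X - U)" "disjnt Q (topspace X - U)"
    using assms by (auto simp: disjnt_def)
  ultimately obtain f where f: "continuous_map X (subtopology euclidean {0..1::real}) f"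
      "f ` (topspace X - U) \<subseteq> {0}" "f ` Q \<subseteq> {1}"
    using Urysohn_completely_regular_compact_closed[of 0 1 X Q "topspace X - U"] assms by auto
  show ?thesis
    by (rule that[of f]) (use f in \<open>auto simp: continuous_map_in_subtopology image_subset_iff Pi_iff\<close>)
qed

lemma bump_function:
  assumes "locally_compact_space X" "Hausdorff_space X" "compactin X Q" "openin X U" "Q \<subseteq> U"
  obtains f where "f \<in> Cc X" "\<And>x. x \<in> topspace X \<Longrightarrow> 0 \<le> f x"
    "\<And>x. x \<in> topspace X \<Longrightarrow> f x \<le> 1" "\<And>x. x \<in> Q \<Longrightarrow> f x = 1"
    "\<And>x. x \<in> topspace X \<Longrightarrow> x \<notin> U \<Longrightarrow> f x = 0"
proof -
  obtain V L where V: "openin X V" "compactin X L" "Q \<subseteq> V" "V \<subseteq> L"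
    using assms locally_compact_space_compact_closed_compact[of X] by meson
  obtain f where f: "continuous_map X euclideanreal f" "\<And>x. x \<in> topspace X \<Longrightarrow> 0 \<le> f x"
    "\<And>x. x \<in> topspace X \<Longrightarrow> f x \<le> 1" "\<And>x. x \<in> Q \<Longrightarrow> f x = 1"
    "\<And>x. x \<in> topspace X \<Longrightarrow> x \<notin> U \<inter> V \<Longrightarrow> f x = 0"
    using Urysohn_function[OF assms(1-3), of "U \<inter> V"] V assms by (metis inf.bounded_iff openin_Int)
  show ?thesis
  proof (rule that[of f])
    show "f \<in> Cc X"
      using f(1,5) V by (intro CcI[of X f L]) auto
  qed (use f in auto)
qed

lemma tube_continuity:
  assumes f: "continuous_map (prod_topology A X) euclideanreal f" and C: "compactin X C"
    and a: "a \<in> topspace A" and e: "e > 0"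
  obtains U where "openin A U" "a \<in> U" "\<And>b x. b \<in> U \<Longrightarrow> x \<in> C \<Longrightarrow> \<bar>f (b, x) - f (a, x)\<bar> < e"
proof -
  have "continuous_map (prod_topology A X) (prod_topology A X) (\<lambda>z. (a, snd z))"
    using a by (auto simp: continuous_map_paired intro!: continuous_intros)
  from continuous_map_compose[OF this f]
  have "continuous_map (prod_topology A X) euclideanreal (\<lambda>z. f z - f (a, snd z))"
    using f by (auto simp: o_def intro!: continuous_intros)
  then have "openin (prod_topology A X) {z \<in> topspace (prod_topology A X). f z - f (a, snd z) \<in> {-e<..<e}}"
    by (rule openin_continuous_map_preimage) auto
  moreover have "{a} \<times> C \<subseteq> {z \<in> topspace (prod_topology A X). f z - f (a, snd z) \<in> {-e<..<e}}"
    using a e compactin_subset_topspace[OF C] by auto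
  ultimately obtain U V where "openin A U" "openin X V" "a \<in> U" "C \<subseteq> V"
      "U \<times> V \<subseteq> {z \<in> topspace (prod_topology A X). f z - f (a, snd z) \<in> {-e<..<e}}"
    using tube_lemma_right[OF _ C a] by meson
  then show ?thesis
    by (intro that[of U]) (fastforce simp: abs_less_iff)+
qed

section \<open>Positive functionals on functions of compact support\<close>

definition positive_functional :: "'a topology \<Rightarrow> (('a \<Rightarrow> real) \<Rightarrow> real) \<Rightarrow> bool" where
  "positive_functional X J \<longleftrightarrow>
     (\<forall>f\<in>Cc X. \<forall>g\<in>Cc X. J (\<lambda>x. f x + g x) = J f + J g) \<and>
     (\<forall>c. \<forall>f\<in>Cc X. J (\<lambda>x. c * f x) = c * J f) \<and>
     (\<forall>f\<in>Cc X. (\<forall>x\<in>topspace X. 0 \<le> f x) \<longrightarrow> 0 \<le> J f)"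

context
  fixes X :: "'a topology" and J
  assumes J: "positive_functional X J"
begin

lemma pf_add: "f \<in> Cc X \<Longrightarrow> g \<in> Cc X \<Longrightarrow> J (\<lambda>x. f x + g x) = J f + J g"
  using J by (simp add: positive_functional_def)

lemma pf_scale: "f \<in> Cc X \<Longrightarrow> J (\<lambda>x. c * f x) = c * J f"
  using J by (simp add: positive_functional_def)

lemma pf_nonneg: "f \<in> Cc X \<Longrightarrow> (\<And>x. x \<in> topspace X \<Longrightarrow> 0 \<le> f x) \<Longrightarrow> 0 \<le> J f"
  using J by (simp add: positive_functional_def)

lemma pf_zero: "J (\<lambda>x. 0) = 0"
  using pf_scale[OF Cc_zero, of 0] by simp

lemma pf_diff: "f \<in> Cc X \<Longrightarrow> g \<in> Cc X \<Longrightarrow> J (\<lambda>x. f x - g x) = J f - J g"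
  using pf_add[of "\<lambda>x. f x - g x" g] Cc_diff[of f X g] by simp

lemma pf_mono:
  assumes "f \<in> Cc X" "g \<in> Cc X" "\<And>x. x \<in> topspace X \<Longrightarrow> f x \<le> g x"
  shows "J f \<le> J g"
  using pf_nonneg[OF Cc_diff[OF assms(2,1)]] pf_diff[OF assms(2,1)] assms(3) by simp

lemma pf_cong:
  assumes "f \<in> Cc X" "\<And>x. x \<in> topspace X \<Longrightarrow> f x = g x"
  shows "J f = J g"
  using assms Cc_cong[OF assms] by (intro antisym pf_mono) auto

lemma pf_abs_le:
  assumes "f \<in> Cc X" "g \<in> Cc X" "\<And>x. x \<in> topspace X \<Longrightarrow> \<bar>f x\<bar> \<le> g x"
  shows "\<bar>J f\<bar> \<le> J g"
proof -
  have "J f \<le> J g"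
    by (rule pf_mono) (use assms in \<open>auto simp: abs_le_iff\<close>)
  moreover have "- J f \<le> J g"
    using pf_mono[OF Cc_minus[OF assms(1)] assms(2)] pf_scale[OF assms(1), of "-1"] assms(3)
    by (auto simp: abs_le_iff)
  ultimately show ?thesis by simp
qed

lemma pf_sum:
  assumes "finite P" "\<And>p. p \<in> P \<Longrightarrow> f p \<in> Cc X"
  shows "J (\<lambda>x. \<Sum>p\<in>P. f p x) = (\<Sum>p\<in>P. J (f p))"
  using assms
proof (induction P rule: finite_induct)
  case (insert p P)
  then show ?case
    by (simp add: pf_add Cc_sum)
qed (simp add: pf_zero)

end

text \<open>Locally in the parameter the integrands live on one compact set, where by compactness they
  converge uniformly; a bump function turns this into convergence of the integrals.\<close>

lemma continuous_map_pf_parameter: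
  assumes J: "positive_functional Y J" and "locally_compact_space Y" "Hausdorff_space Y"
    and f: "continuous_map (prod_topology X Y) euclideanreal (\<lambda>(x, y). f x y)"
    and supp: "\<And>x. x \<in> topspace X \<Longrightarrow>
      \<exists>U C. openin X U \<and> x \<in> U \<and> compactin Y C \<and> (\<forall>u\<in>U. \<forall>y\<in>topspace Y - C. f u y = 0)"
  shows "\<And>x. x \<in> topspace X \<Longrightarrow> f x \<in> Cc Y"
    and "continuous_map X euclideanreal (\<lambda>x. J (f x))"
proof -
  have section_cont: "continuous_map Y euclideanreal (f x)" if "x \<in> topspace X" for x
    using continuous_map_compose[OF _ f, of Y "\<lambda>y. (x, y)"] that
    by (simp add: o_def continuous_map_paired)
  show Cc: "f x \<in> Cc Y" if x: "x \<in> topspace X" for x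
    using supp[OF x] section_cont[OF x] by (auto intro: CcI)
  show "continuous_map X euclideanreal (\<lambda>x. J (f x))"
    unfolding continuous_map_real_iff
  proof (intro ballI allI impI)
    fix x and e :: real
    assume x: "x \<in> topspace X" and e: "e > 0"
    obtain U C where U: "openin X U" "x \<in> U" "compactin Y C" "\<And>u y. u \<in> U \<Longrightarrow> y \<in> topspace Y - C \<Longrightarrow> f u y = 0"
      using supp[OF x] by meson
    obtain \<psi> where \<psi>: "\<psi> \<in> Cc Y" "\<And>y. y \<in> topspace Y \<Longrightarrow> 0 \<le> \<psi> y" "\<And>y. y \<in> C \<Longrightarrow> \<psi> y = 1"
      using bump_function[OF assms(2,3) U(3), of "topspace Y"] compactin_subset_topspace[OF U(3)]
      by (metis openin_topspace)
    have J0: "J \<psi> \<ge> 0"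
      using pf_nonneg[OF J \<psi>(1)] \<psi>(2) by blast
    define d where "d = e / (J \<psi> + 1)"
    have d: "d > 0" "d * J \<psi> < e"
      using e J0 by (auto simp: d_def field_simps)
    obtain V where V: "openin X V" "x \<in> V" "\<And>u y. u \<in> V \<Longrightarrow> y \<in> C \<Longrightarrow> \<bar>f u y - f x y\<bar> < d"
      using tube_continuity[OF f U(3) x d(1)] by auto
    have "\<bar>J (f u) - J (f x)\<bar> < e" if u: "u \<in> U \<inter> V" for u
    proof -
      have uX: "u \<in> topspace X"
        using u U(1) openin_subset by blast
      have "J (f u) - J (f x) = J (\<lambda>y. f u y - f x y)"
        using pf_diff[OF J Cc[OF uX] Cc[OF x]] by simp
      also have "\<bar>\<dots>\<bar> \<le> J (\<lambda>y. d * \<psi> y)"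
      proof (rule pf_abs_le[OF J])
        fix y assume y: "y \<in> topspace Y"
        show "\<bar>f u y - f x y\<bar> \<le> d * \<psi> y"
        proof (cases "y \<in> C")
          case True
          then show ?thesis using V(3)[of u y] u \<psi>(3) by force
        next
          case False
          then show ?thesis using U(2,4) u y \<psi>(2) d(1) by simp
        qed
      qed (use Cc x uX \<psi> in \<open>auto intro: Cc_diff Cc_scale\<close>)
      also have "\<dots> = d * J \<psi>"
        by (rule pf_scale[OF J \<psi>(1)])
      finally show ?thesis using d by simp
    qed
    then show "\<exists>U. openin X U \<and> x \<in> U \<and> (\<forall>y\<in>U. \<bar>J (f y) - J (f x)\<bar> < e)"
      using U V by (intro exI[of _ "U \<inter> V"]) auto
  qed
qed

text \<open>Riemann sums for a partition of unity subordinate to a cover of \<open>Q\<close> on whose members \<open>k\<close> varies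
  little. The index \<open>y\<close> ranges over an arbitrary set: the approximation is uniform in it, and
  therefore survives every linear functional that is bounded for the supremum norm over \<open>Y\<close>.\<close>

lemma pf_Riemann_sum:
  assumes J: "positive_functional X J" and "locally_compact_space X" "Hausdorff_space X"
    and Q: "compactin X Q" and supp: "\<And>h y. h \<in> topspace X - Q \<Longrightarrow> y \<in> Y \<Longrightarrow> k h y = 0"
    and cont: "\<And>h (e::real). h \<in> topspace X \<Longrightarrow> e > 0 \<Longrightarrow>
      \<exists>U. openin X U \<and> h \<in> U \<and> (\<forall>u\<in>U. \<forall>y\<in>Y. \<bar>k u y - k h y\<bar> \<le> e)"
    and e: "e > 0"
  shows "\<exists>P c. finite P \<and> P \<subseteq> topspace X \<and> (\<forall>y\<in>Y. \<bar>J (\<lambda>h. k h y) - (\<Sum>p\<in>P. c p * k p y)\<bar> \<le> e)"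
proof -
  obtain \<psi> where \<psi>: "\<psi> \<in> Cc X" "\<And>x. x \<in> topspace X \<Longrightarrow> 0 \<le> \<psi> x" "\<And>x. x \<in> Q \<Longrightarrow> \<psi> x = 1"
    using bump_function[OF assms(2,3) Q, of "topspace X"] compactin_subset_topspace[OF Q]
    by (metis openin_topspace)
  have J0: "J \<psi> \<ge> 0"
    using pf_nonneg[OF J \<psi>(1)] \<psi>(2) by blast
  define d where "d = e / (J \<psi> + 1)"
  have d: "d > 0" "d * J \<psi> \<le> e"
    using e J0 by (auto simp: d_def field_simps)
  have QX: "Q \<subseteq> topspace X"
    using Q by (rule compactin_subset_topspace)
  have "\<exists>U w. openin X U \<and> h \<in> U \<and> (\<forall>u\<in>U. \<forall>y\<in>Y. \<bar>k u y - k h y\<bar> \<le> d) \<and>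
      continuous_map X euclideanreal w \<and> (\<forall>x\<in>topspace X. 0 \<le> w x) \<and> w h = 1 \<and>
      (\<forall>x\<in>topspace X - U. w x = (0::real))" if h: "h \<in> topspace X" for h
  proof -
    obtain U where U: "openin X U" "h \<in> U" "\<forall>u\<in>U. \<forall>y\<in>Y. \<bar>k u y - k h y\<bar> \<le> d"
      using cont[OF h d(1)] by blast
    have "compactin X {h}"
      using h by simp
    then show ?thesis
      using Urysohn_function[OF assms(2,3) _ U(1), of "{h}"] U
      by (metis DiffE empty_subsetI insert_subset singletonI)
  qed
  then obtain U w where Uw: "\<And>h. h \<in> topspace X \<Longrightarrow> openin X (U h) \<and> h \<in> U h \<and>
      (\<forall>u\<in>U h. \<forall>y\<in>Y. \<bar>k u y - k h y\<bar> \<le> d) \<and>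
      continuous_map X euclideanreal (w h) \<and> (\<forall>x\<in>topspace X. 0 \<le> w h x) \<and> w h h = 1 \<and>
      (\<forall>x\<in>topspace X - U h. w h x = (0::real))"
    by metis
  define Op where "Op h = {x \<in> topspace X. w h x \<in> {1/2<..}}" for h
  have "openin X (Op h)" if "h \<in> Q" for h
    unfolding Op_def using Uw that QX by (intro openin_continuous_map_preimage) auto
  moreover have "Q \<subseteq> \<Union>(Op ` Q)"
  proof
    fix h assume "h \<in> Q"
    then have "h \<in> Op h"
      using Uw[of h] QX by (auto simp: Op_def)
    with \<open>h \<in> Q\<close> show "h \<in> \<Union>(Op ` Q)" by blast
  qed
  ultimately obtain \<F> where "finite \<F>" "\<F> \<subseteq> Op ` Q" "Q \<subseteq> \<Union>\<F>"
    using compactinD[OF Q, of "Op ` Q"] by auto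
  then obtain P where P: "finite P" "P \<subseteq> Q" "Q \<subseteq> \<Union>(Op ` P)"
    by (metis finite_subset_image)
  \<comment> \<open>on \<open>Q\<close> the sum exceeds 1/2, as some \<open>w p\<close> does, so the cut-off only keeps the quotient defined elsewhere\<close>
  define W where "W x = max (1/2) (\<Sum>p\<in>P. w p x)" for x
  have W: "W x > 0" for x
    by (simp add: W_def)
  \<comment> \<open>a partition of unity on \<open>Q\<close>, dominated by \<open>\<psi>\<close> everywhere\<close>
  define \<epsilon> where "\<epsilon> p x = \<psi> x * (w p x / W x)" for p x
  have contw: "continuous_map X euclideanreal (w p)" if "p \<in> P" for p
    using Uw P QX that by blast
  have contW: "continuous_map X euclideanreal W"
    unfolding W_def using contw P(1) by (intro continuous_intros) auto
  have \<epsilon>Cc: "\<epsilon> p \<in> Cc X" if "p \<in> P" for p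
    unfolding \<epsilon>_def
    by (rule Cc_mult(1)[OF \<psi>(1)], rule continuous_map_real_divide[OF contw[OF that] contW])
       (metis W less_irrefl)
  have \<epsilon>0: "\<epsilon> p x \<ge> 0" if "p \<in> P" "x \<in> topspace X" for p x
    using Uw P(2) QX \<psi>(2) W[of x] that by (auto simp: \<epsilon>_def intro!: mult_nonneg_nonneg divide_nonneg_pos)
  have \<epsilon>sum: "(\<Sum>p\<in>P. \<epsilon> p x) = \<psi> x * ((\<Sum>p\<in>P. w p x) / W x)" for x
    by (simp add: \<epsilon>_def sum_distrib_left sum_divide_distrib)
  have \<epsilon>le: "(\<Sum>p\<in>P. \<epsilon> p x) \<le> \<psi> x" if "x \<in> topspace X" for x
    unfolding \<epsilon>sum using \<psi>(2)[OF that] W[of x] by (intro mult_left_le) (auto simp: W_def)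
  have \<epsilon>1: "(\<Sum>p\<in>P. \<epsilon> p x) = 1" if x: "x \<in> Q" for x
  proof -
    obtain p where p: "p \<in> P" "w p x > 1/2"
      using P(3) x by (auto simp: Op_def)
    have "w p x \<le> (\<Sum>p\<in>P. w p x)"
      using Uw P QX x p(1) by (intro member_le_sum) (auto simp: subset_iff)
    then have "(\<Sum>p\<in>P. w p x) > 1/2"
      using p(2) by linarith
    then show ?thesis
      using \<psi>(3)[OF x] by (auto simp: \<epsilon>sum W_def max_def)
  qed
  have kCc: "(\<lambda>h. k h y) \<in> Cc X" if "y \<in> Y" for y
  proof (rule CcI[OF _ Q])
    show "continuous_map X euclideanreal (\<lambda>h. k h y)"
      unfolding continuous_map_real_iff
    proof (intro ballI allI impI)
      fix h and r :: real assume "h \<in> topspace X" "r > 0"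
      then obtain V where "openin X V" "h \<in> V" "\<forall>u\<in>V. \<forall>y\<in>Y. \<bar>k u y - k h y\<bar> \<le> r/2"
        using cont[of h "r/2"] by (meson half_gt_zero)
      with \<open>y \<in> Y\<close> \<open>r > 0\<close> show "\<exists>U. openin X U \<and> h \<in> U \<and> (\<forall>u\<in>U. \<bar>k u y - k h y\<bar> < r)"
        by (intro exI[of _ V]) force
    qed
  qed (use supp that in auto)
  have "\<bar>J (\<lambda>h. k h y) - (\<Sum>p\<in>P. J (\<epsilon> p) * k p y)\<bar> \<le> e" if y: "y \<in> Y" for y
  proof -
    have "J (\<lambda>h. k h y) = J (\<lambda>h. \<Sum>p\<in>P. \<epsilon> p h * k h y)"
    proof (rule pf_cong[OF J kCc[OF y]])
      fix h assume "h \<in> topspace X"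
      then show "k h y = (\<Sum>p\<in>P. \<epsilon> p h * k h y)"
        using supp[of h y] y \<epsilon>1[of h] by (cases "h \<in> Q") (auto simp flip: sum_distrib_right)
    qed
    also have "\<dots> = (\<Sum>p\<in>P. J (\<lambda>h. \<epsilon> p h * k h y))"
      using P(1) \<epsilon>Cc kCc[OF y] by (intro pf_sum[OF J]) (auto intro: Cc_mult Cc_continuous)
    finally have "\<bar>J (\<lambda>h. k h y) - (\<Sum>p\<in>P. J (\<epsilon> p) * k p y)\<bar> =
        \<bar>\<Sum>p\<in>P. J (\<lambda>h. \<epsilon> p h * k h y) - J (\<epsilon> p) * k p y\<bar>"
      by (simp add: sum_subtractf)
    also have "\<dots> \<le> (\<Sum>p\<in>P. d * J (\<epsilon> p))"
    proof (rule order_trans[OF sum_abs sum_mono])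
      fix p assume p: "p \<in> P"
      have 1: "(\<lambda>h. \<epsilon> p h * k h y) \<in> Cc X" "(\<lambda>h. k p y * \<epsilon> p h) \<in> Cc X"
        using \<epsilon>Cc[OF p] kCc[OF y] by (auto intro: Cc_mult Cc_continuous Cc_scale)
      have "J (\<lambda>h. \<epsilon> p h * k h y) - J (\<epsilon> p) * k p y = J (\<lambda>h. \<epsilon> p h * k h y - k p y * \<epsilon> p h)"
        using pf_diff[OF J 1] pf_scale[OF J \<epsilon>Cc[OF p], of "k p y"] by simp
      also have "\<bar>\<dots>\<bar> \<le> J (\<lambda>h. d * \<epsilon> p h)"
      proof (rule pf_abs_le[OF J Cc_diff[OF 1] Cc_scale[OF \<epsilon>Cc[OF p]]])
        fix h assume h: "h \<in> topspace X"
        have pX: "p \<in> topspace X" using p P QX by auto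
        have eq: "\<bar>\<epsilon> p h * k h y - k p y * \<epsilon> p h\<bar> = \<epsilon> p h * \<bar>k h y - k p y\<bar>"
          using \<epsilon>0[OF p h] by (simp add: abs_mult mult.commute flip: right_diff_distrib)
        show "\<bar>\<epsilon> p h * k h y - k p y * \<epsilon> p h\<bar> \<le> d * \<epsilon> p h"
        proof (cases "h \<in> U p")
          case True
          then have "\<bar>k h y - k p y\<bar> \<le> d"
            using Uw[OF pX] y by blast
          from mult_left_mono[OF this \<epsilon>0[OF p h]] show ?thesis
            unfolding eq by (simp add: mult.commute)
        next
          case False
          then show ?thesis
            using Uw[OF pX] h by (simp add: \<epsilon>_def)
        qed
      qed
      finally show "\<bar>J (\<lambda>h. \<epsilon> p h * k h y) - J (\<epsilon> p) * k p y\<bar> \<le> d * J (\<epsilon> p)"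
        using pf_scale[OF J \<epsilon>Cc[OF p], of d] by simp
    qed
    also have "\<dots> = d * J (\<lambda>x. \<Sum>p\<in>P. \<epsilon> p x)"
      using pf_sum[OF J P(1) \<epsilon>Cc] by (simp add: sum_distrib_left)
    also have "\<dots> \<le> d * J \<psi>"
      using d(1) \<epsilon>le P(1) \<epsilon>Cc \<psi>(1) by (intro mult_left_mono pf_mono[OF J]) (auto intro: Cc_sum)
    finally show ?thesis using d(2) by linarith
  qed
  then show ?thesis
    using P QX by (intro exI[of _ P] exI[of _ "\<lambda>p. J (\<epsilon> p)"]) auto
qed

text \<open>Fubini's theorem for a positive functional and a functional bounded for the supremum norm: both
  iterated integrals are approximated by the same Riemann sums.\<close>

lemma pf_interchange:
  assumes J: "positive_functional X J" and X: "locally_compact_space X" "Hausdorff_space X"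
    and Q: "compactin X Q" and supp: "\<And>h y. h \<in> topspace X - Q \<Longrightarrow> y \<in> Y \<Longrightarrow> k h y = 0"
    and cont: "\<And>h (e::real). h \<in> topspace X \<Longrightarrow> e > 0 \<Longrightarrow>
      \<exists>U. openin X U \<and> h \<in> U \<and> (\<forall>u\<in>U. \<forall>y\<in>Y. \<bar>k u y - k h y\<bar> \<le> e)"
    and kS: "\<And>h. h \<in> topspace X \<Longrightarrow> k h \<in> S" and JS: "(\<lambda>y. J (\<lambda>h. k h y)) \<in> S"
    and S0: "(\<lambda>y. 0) \<in> S"
    and Sadd: "\<And>f g. f \<in> S \<Longrightarrow> g \<in> S \<Longrightarrow> (\<lambda>y. f y + g y) \<in> S"
    and Sscale: "\<And>c f. f \<in> S \<Longrightarrow> (\<lambda>y. c * f y) \<in> S"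
    and madd: "\<And>f g. f \<in> S \<Longrightarrow> g \<in> S \<Longrightarrow> m (\<lambda>y. f y + g y) = m f + m g"
    and mscale: "\<And>c f. f \<in> S \<Longrightarrow> m (\<lambda>y. c * f y) = c * m f"
    and mbound: "\<And>f s. f \<in> S \<Longrightarrow> (\<And>y. y \<in> Y \<Longrightarrow> \<bar>f y\<bar> \<le> s) \<Longrightarrow> \<bar>m f\<bar> \<le> D * s" and D: "D \<ge> 0"
  shows "m (\<lambda>y. J (\<lambda>h. k h y)) = J (\<lambda>h. m (k h))"
proof -
  have mdiff: "m (\<lambda>y. f y - g y) = m f - m g" "(\<lambda>y. f y - g y) \<in> S" if "f \<in> S" "g \<in> S" for f g
    using madd[OF that(1) Sscale[OF that(2), of "-1"]] mscale[OF that(2), of "-1"]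
      Sadd[OF that(1) Sscale[OF that(2), of "-1"]] by auto
  have m0: "m (\<lambda>y. 0) = 0"
    using mscale[OF S0, of 0] by simp
  \<comment> \<open>adjoining \<open>m\<close> itself to the index set makes the Riemann sums converge for both sides at once\<close>
  define k' where "k' h z = (case z of None \<Rightarrow> m (k h) | Some y \<Rightarrow> k h y)" for h z
  define Y' where "Y' = insert None (Some ` Y)"
  have close: "\<bar>m (\<lambda>y. J (\<lambda>h. k h y)) - J (\<lambda>h. m (k h))\<bar> \<le> (D + 1) * e" if e: "e > 0" for e
  proof -
    have "\<exists>P c. finite P \<and> P \<subseteq> topspace X \<and> (\<forall>z\<in>Y'. \<bar>J (\<lambda>h. k' h z) - (\<Sum>p\<in>P. c p * k' p z)\<bar> \<le> e)"
    proof (rule pf_Riemann_sum[OF J X Q _ _ e])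
      fix h z assume "h \<in> topspace X - Q" "z \<in> Y'"
      then show "k' h z = 0"
        using supp mbound[of "k h" 0] kS[of h] by (auto simp: k'_def Y'_def)
    next
      fix h and r :: real assume h: "h \<in> topspace X" and r: "r > 0"
      have "r / (D + 1) > 0" using r D by simp
      then obtain U where U: "openin X U" "h \<in> U" "\<And>u y. u \<in> U \<Longrightarrow> y \<in> Y \<Longrightarrow> \<bar>k u y - k h y\<bar> \<le> r / (D + 1)"
        using cont[OF h, of "r / (D + 1)"] by auto
      have r': "r / (D + 1) \<le> r" "D * (r / (D + 1)) \<le> r"
        using r D by (auto simp: field_simps)
      have "\<bar>k' u z - k' h z\<bar> \<le> r" if u: "u \<in> U" and z: "z \<in> Y'" for u z
      proof (cases z)
        case None
        have uX: "u \<in> topspace X" using u U(1) openin_subset by blast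
        have "\<bar>m (\<lambda>y. k u y - k h y)\<bar> \<le> D * (r / (D + 1))"
          using mdiff(2)[OF kS[OF uX] kS[OF h]] U(3)[OF u] by (intro mbound) auto
        then show ?thesis
          using mdiff(1)[OF kS[OF uX] kS[OF h]] r'(2) None by (simp add: k'_def)
      next
        case (Some y)
        then show ?thesis
          using U(3)[OF u, of y] z r'(1) by (auto simp: k'_def Y'_def)
      qed
      with U show "\<exists>U. openin X U \<and> h \<in> U \<and> (\<forall>u\<in>U. \<forall>z\<in>Y'. \<bar>k' u z - k' h z\<bar> \<le> r)"
        by blast
    qed
    then obtain P c where P: "finite P" "P \<subseteq> topspace X"
      and ap: "\<And>z. z \<in> Y' \<Longrightarrow> \<bar>J (\<lambda>h. k' h z) - (\<Sum>p\<in>P. c p * k' p z)\<bar> \<le> e"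
      by blast
    have msum: "(\<lambda>y. \<Sum>p\<in>P. c p * k p y) \<in> S \<and> m (\<lambda>y. \<Sum>p\<in>P. c p * k p y) = (\<Sum>p\<in>P. c p * m (k p))"
      using P
    proof (induction P rule: finite_induct)
      case (insert p P)
      then show ?case
        using madd[of "\<lambda>y. c p * k p y" "\<lambda>y. \<Sum>p\<in>P. c p * k p y"] mscale[of "k p" "c p"]
          Sscale[of "k p" "c p"] Sadd[of "\<lambda>y. c p * k p y" "\<lambda>y. \<Sum>p\<in>P. c p * k p y"] kS[of p]
        by simp
    qed (simp add: S0 m0)
    have "\<bar>m (\<lambda>y. J (\<lambda>h. k h y) - (\<Sum>p\<in>P. c p * k p y))\<bar> \<le> D * e"
    proof (rule mbound)
      show "(\<lambda>y. J (\<lambda>h. k h y) - (\<Sum>p\<in>P. c p * k p y)) \<in> S"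
        using mdiff(2)[OF JS] msum by blast
      show "\<bar>J (\<lambda>h. k h y) - (\<Sum>p\<in>P. c p * k p y)\<bar> \<le> e" if "y \<in> Y" for y
        using ap[of "Some y"] that by (simp add: k'_def Y'_def)
    qed
    moreover have "\<bar>J (\<lambda>h. m (k h)) - (\<Sum>p\<in>P. c p * m (k p))\<bar> \<le> e"
      using ap[of None] by (simp add: k'_def Y'_def)
    ultimately show ?thesis
      using mdiff(1)[OF JS] msum by (simp add: algebra_simps)
  qed
  have "\<bar>m (\<lambda>y. J (\<lambda>h. k h y)) - J (\<lambda>h. m (k h))\<bar> \<le> 0 + e" if "e > 0" for e
    using close[of "e / (D + 1)"] that D by simp
  then have "\<bar>m (\<lambda>y. J (\<lambda>h. k h y)) - J (\<lambda>h. m (k h))\<bar> \<le> 0"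
    by (rule field_le_epsilon)
  then show ?thesis by simp
qed

section \<open>Pointwise cluster points\<close>

text \<open>Tychonoff's theorem for the product of the intervals \<open>[- B a, B a]\<close>. It stands in for limits along
  nets, in the construction of the Haar integral and in the final passage to an invariant mean.\<close>

lemma pointwise_cluster_point:
  fixes B :: "'a \<Rightarrow> real" and \<A> :: "('a \<Rightarrow> real) set set"
  assumes bound: "\<And>A p a. A \<in> \<A> \<Longrightarrow> p \<in> A \<Longrightarrow> \<bar>p a\<bar> \<le> B a"
    and ne: "\<And>A. A \<in> \<A> \<Longrightarrow> A \<noteq> {}" and "\<A> \<noteq> {}"
    and dir: "\<And>A A'. A \<in> \<A> \<Longrightarrow> A' \<in> \<A> \<Longrightarrow> \<exists>A''\<in>\<A>. A'' \<subseteq> A \<inter> A'"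
  obtains I :: "'a \<Rightarrow> real" where "\<And>A F e. A \<in> \<A> \<Longrightarrow> finite F \<Longrightarrow> e > 0 \<Longrightarrow> \<exists>p\<in>A. \<forall>a\<in>F. \<bar>I a - p a\<bar> < e"
proof -
  define X where "X = product_topology (\<lambda>_::'a. euclideanreal) UNIV"
  define K where "K = PiE UNIV (\<lambda>a. {- B a .. B a})"
  have K: "compactin X K"
    unfolding X_def K_def by (subst compactin_PiE) auto
  have top: "topspace X = UNIV"
    by (simp add: X_def PiE_UNIV_domain)
  have AK: "A \<subseteq> K" if "A \<in> \<A>" for A
    using bound[OF that] unfolding K_def PiE_UNIV_domain
    by (metis (no_types, lifting) Pi_I abs_le_D1 abs_le_D2 atLeastAtMost_iff minus_le_iff subsetI)
  have fin: "\<exists>A\<in>\<A>. A \<subseteq> \<Inter>\<F>" if "finite \<F>" "\<F> \<subseteq> \<A>" for \<F>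
    using that
  proof (induction \<F> rule: finite_induct)
    case empty
    then show ?case using \<open>\<A> \<noteq> {}\<close> by auto
  next
    case (insert A \<F>)
    then obtain A' where "A' \<in> \<A>" "A' \<subseteq> \<Inter>\<F>" by auto
    moreover obtain A'' where "A'' \<in> \<A>" "A'' \<subseteq> A \<inter> A'"
      using dir[of A A'] insert.prems \<open>A' \<in> \<A>\<close> by auto
    ultimately show ?case by auto
  qed
  have "K \<inter> \<Inter>((\<lambda>A. X closure_of A) ` \<A>) \<noteq> {}"
  proof -
    have "K \<inter> \<Inter>\<G> \<noteq> {}" if \<G>: "finite \<G>" "\<G> \<subseteq> (\<lambda>A. X closure_of A) ` \<A>" for \<G>
    proof -
      obtain \<F> where \<F>: "finite \<F>" "\<F> \<subseteq> \<A>" "\<G> = (\<lambda>A. X closure_of A) ` \<F>"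
        using finite_subset_image[OF \<G>] by auto
      obtain A where A: "A \<in> \<A>" "A \<subseteq> \<Inter>\<F>"
        using fin[OF \<F>(1,2)] by auto
      have "A \<subseteq> X closure_of A'" if "A' \<in> \<F>" for A'
        using A(2) that closure_of_subset[of A' X] top by auto
      then have "A \<subseteq> K \<inter> \<Inter>\<G>"
        using AK[OF A(1)] \<F>(3) by blast
      with ne[OF A(1)] show ?thesis by blast
    qed
    then show ?thesis
      using K unfolding compactin_fip by (metis (no_types, lifting) closedin_closure_of imageE)
  qed
  then obtain I where I: "\<And>A. A \<in> \<A> \<Longrightarrow> I \<in> X closure_of A"
    by auto
  show thesis
  proof (rule that[of I])
    fix A and F :: "'a set" and e :: real
    assume A: "A \<in> \<A>" and F: "finite F" and e: "e > 0"
    define U where "U = PiE UNIV (\<lambda>a. if a \<in> F then {I a - e <..< I a + e} else UNIV)"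
    have "openin X U"
      unfolding X_def U_def using F
      by (subst openin_PiE_gen) (auto intro: finite_subset[OF _ F])
    moreover have "I \<in> U"
      using e by (auto simp: U_def PiE_UNIV_domain)
    ultimately obtain p where p: "p \<in> A" "p \<in> U"
      using I[OF A] by (auto simp: in_closure_of)
    have "\<bar>I a - p a\<bar> < e" if "a \<in> F" for a
    proof -
      have "p a \<in> (if a \<in> F then {I a - e <..< I a + e} else UNIV)"
        using p(2) unfolding U_def PiE_UNIV_domain by blast
      then show ?thesis using that by (auto simp: abs_less_iff)
    qed
    with p show "\<exists>p\<in>A. \<forall>a\<in>F. \<bar>I a - p a\<bar> < e" by auto
  qed
qed

section \<open>Topology of the group\<close>

context locally_compact_group
begin

lemma continuous_map_mult:
  assumes "continuous_map Z T f" "continuous_map Z T g"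
  shows "continuous_map Z T (\<lambda>z. f z \<otimes> g z)"
  using continuous_map_compose[OF continuous_map_pairedI[OF assms] continuous_mult] by (simp add: o_def)

lemma continuous_map_inv:
  assumes "continuous_map Z T f"
  shows "continuous_map Z T (\<lambda>z. inv f z)"
  using continuous_map_compose[OF assms continuous_inv] by (simp add: o_def)

lemma continuous_translate:
  assumes "t \<in> carrier G"
  shows "continuous_map T T (\<lambda>x. t \<otimes> x)" "continuous_map T T (\<lambda>x. x \<otimes> t)"
  using assms by (auto intro!: continuous_map_mult simp: topspace_eq)

lemma compactin_set_mult:
  assumes "compactin T C" "compactin T D"
  shows "compactin T (C <#> D)"
proof -
  have "compactin (prod_topology T T) (C \<times> D)"
    using assms by (simp add: compactin_Times)
  from image_compactin[OF this continuous_mult] have "compactin T ((\<lambda>(x, y). x \<otimes> y) ` (C \<times> D))" .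
  moreover have "(\<lambda>(x, y). x \<otimes> y) ` (C \<times> D) = C <#> D"
    by (auto simp: set_mult_def)
  ultimately show ?thesis by simp
qed

lemma compactin_inverse: "compactin T C \<Longrightarrow> compactin T (m_inv G ` C)"
  by (rule image_compactin[OF _ continuous_inv])

lemma compactin_carrier: "compactin T C \<Longrightarrow> C \<subseteq> carrier G"
  using compactin_subset_topspace topspace_eq by blast

lemma openin_carrier: "openin T U \<Longrightarrow> U \<subseteq> carrier G"
  using openin_subset topspace_eq by blast

lemma openin_translate:
  assumes "openin T U" "t \<in> carrier G"
  shows "openin T {x \<in> carrier G. t \<otimes> x \<in> U}" "openin T {x \<in> carrier G. x \<otimes> t \<in> U}"
  using openin_continuous_map_preimage[OF continuous_translate(1)[OF assms(2)] assms(1)]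
    openin_continuous_map_preimage[OF continuous_translate(2)[OF assms(2)] assms(1)]
  by (simp_all add: topspace_eq)

lemma compact_neighbourhood_of_one:
  obtains U K where "openin T U" "compactin T K" "\<one> \<in> U" "U \<subseteq> K"
  using locally_compact unfolding locally_compact_space_def topspace_eq by (meson one_closed)

lemma Cc_support_nonempty:
  assumes f: "f \<in> Cc T"
  obtains L where "compactin T L" "L \<noteq> {}" "\<And>x. x \<in> carrier G \<Longrightarrow> x \<notin> L \<Longrightarrow> f x = 0"
proof -
  obtain L where L: "compactin T L" "\<And>x. x \<in> topspace T \<Longrightarrow> x \<notin> L \<Longrightarrow> f x = 0" using Cc_support[OF f] by metis
  have "compactin T (insert \<one> L)" using L(1) compactin_Un[of T "{\<one>}" L] by (simp add: topspace_eq)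
  then show thesis by (rule that) (use L(2) in \<open>auto simp: topspace_eq\<close>)
qed

lemma Cc_left_translate:
  assumes "f \<in> Cc T" "t \<in> carrier G"
  shows "(\<lambda>x. f (t \<otimes> x)) \<in> Cc T"
proof -
  obtain C where C: "compactin T C" "\<And>x. x \<in> topspace T \<Longrightarrow> x \<notin> C \<Longrightarrow> f x = 0"
    using Cc_support[OF assms(1)] by metis
  show ?thesis
  proof (rule CcI)
    show "continuous_map T euclideanreal (\<lambda>x. f (t \<otimes> x))"
      using continuous_map_compose[OF continuous_translate(1)[OF assms(2)] Cc_continuous[OF assms(1)]]
      by (simp add: o_def)
    show "compactin T ((\<lambda>x. inv t \<otimes> x) ` C)"
      by (rule image_compactin[OF C(1) continuous_translate(1)]) (use assms in auto)
    fix x assume x: "x \<in> topspace T" "x \<notin> (\<lambda>x. inv t \<otimes> x) ` C"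
    then have "x = inv t \<otimes> (t \<otimes> x)"
      using assms(2) by (simp add: topspace_eq m_assoc[symmetric])
    with x(2) have "t \<otimes> x \<notin> C" by blast
    then show "f (t \<otimes> x) = 0"
      using C(2)[of "t \<otimes> x"] x(1) assms(2) by (simp add: topspace_eq)
  qed
qed

lemma Cc_inverse:
  assumes "f \<in> Cc T"
  shows "(\<lambda>x. f (inv x)) \<in> Cc T"
proof -
  obtain C where C: "compactin T C" "\<And>x. x \<in> topspace T \<Longrightarrow> x \<notin> C \<Longrightarrow> f x = 0"
    using Cc_support[OF assms(1)] by metis
  show ?thesis
  proof (rule CcI)
    show "continuous_map T euclideanreal (\<lambda>x. f (inv x))"
      using continuous_map_compose[OF continuous_inv Cc_continuous[OF assms(1)]] by (simp add: o_def)
    show "compactin T (m_inv G ` C)"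
      by (rule compactin_inverse[OF C(1)])
    fix x assume x: "x \<in> topspace T" "x \<notin> m_inv G ` C"
    then have "inv x \<notin> C"
      by (metis image_eqI inv_inv topspace_eq)
    then show "f (inv x) = 0"
      using C(2)[of "inv x"] x(1) by (simp add: topspace_eq)
  qed
qed

lemma Cc_right_translate:
  assumes "f \<in> Cc T" "t \<in> carrier G"
  shows "(\<lambda>x. f (x \<otimes> t)) \<in> Cc T"
proof -
  have "(\<lambda>x. f (inv (inv t \<otimes> inv x))) \<in> Cc T"
    using Cc_inverse[OF Cc_left_translate[OF Cc_inverse[OF assms(1)], of "inv t"]] assms(2) by simp
  then show ?thesis
    by (rule Cc_cong) (use assms in \<open>simp add: topspace_eq inv_mult_group\<close>)
qed

text \<open>For \<open>v\<close> in a compact neighbourhood \<open>K\<close> of the identity both terms vanish unless \<open>x\<close> is in the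
  compact set \<open>C K\<^sup>-\<^sup>1\<close>, and on that set the tube lemma applies.\<close>

lemma Cc_uniformly_continuous:
  assumes f: "f \<in> Cc T" and e: "e > 0"
  obtains V where "openin T V" "\<one> \<in> V" "\<And>v x. v \<in> V \<Longrightarrow> x \<in> carrier G \<Longrightarrow> \<bar>f (x \<otimes> v) - f x\<bar> < e"
proof -
  obtain C where C: "compactin T C" "\<And>x. x \<in> topspace T \<Longrightarrow> x \<notin> C \<Longrightarrow> f x = 0"
    using Cc_support[OF f] by metis
  obtain V0 K where K: "openin T V0" "compactin T K" "\<one> \<in> V0" "V0 \<subseteq> K"
    using compact_neighbourhood_of_one .
  define D where "D = C <#> m_inv G ` K"
  have D: "compactin T D"
    unfolding D_def by (intro compactin_set_mult C compactin_inverse K)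
  have "continuous_map (prod_topology T T) T (\<lambda>z. snd z \<otimes> fst z)"
    by (intro continuous_map_mult continuous_map_fst continuous_map_snd)
  from continuous_map_compose[OF this Cc_continuous[OF f]]
  have "continuous_map (prod_topology T T) euclideanreal (\<lambda>(v, x). f (x \<otimes> v))"
    by (simp add: o_def case_prod_unfold)
  from tube_continuity[OF this D _ e, of \<one>] obtain U where
    U: "openin T U" "\<one> \<in> U" "\<And>v x. v \<in> U \<Longrightarrow> x \<in> D \<Longrightarrow> \<bar>f (x \<otimes> v) - f (x \<otimes> \<one>)\<bar> < e"
    by (auto simp: topspace_eq)
  show thesis
  proof (rule that[of "U \<inter> V0"])
    fix v x assume v: "v \<in> U \<inter> V0" and x: "x \<in> carrier G"
    have vG: "v \<in> carrier G"
      using v U(1) openin_carrier by blast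
    show "\<bar>f (x \<otimes> v) - f x\<bar> < e"
    proof (cases "x \<in> D")
      case True
      then show ?thesis using U(3)[of v x] v x by simp
    next
      case False
      have "x = (x \<otimes> v) \<otimes> inv v" "x = x \<otimes> inv \<one>"
        using x vG by (simp_all add: m_assoc)
      then have "x \<otimes> v \<notin> C" "x \<notin> C"
        using False v K(3,4) unfolding D_def set_mult_def by blast+
      then show ?thesis
        using C(2) x vG e by (simp add: topspace_eq)
    qed
  qed (use U K in auto)
qed

section \<open>Haar functionals\<close>

definition left_Haar :: "(('a \<Rightarrow> real) \<Rightarrow> real) \<Rightarrow> bool" where
  "left_Haar J \<longleftrightarrow> positive_functional T J \<and>
     (\<forall>f\<in>Cc T. \<forall>t\<in>carrier G. J (\<lambda>x. f (t \<otimes> x)) = J f) \<and>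
     (\<forall>f\<in>Cc T. (\<forall>x\<in>carrier G. 0 \<le> f x) \<and> (\<exists>x\<in>carrier G. 0 < f x) \<longrightarrow> 0 < J f)"

definition Cc_pos :: "('a \<Rightarrow> real) set" where
  "Cc_pos = {f \<in> Cc T. \<forall>x\<in>carrier G. 0 \<le> f x}"

definition nontrivial :: "('a \<Rightarrow> real) \<Rightarrow> bool" where
  "nontrivial f \<longleftrightarrow> f \<in> Cc_pos \<and> (\<exists>x\<in>carrier G. 0 < f x)"

text \<open>A list of pairs of a weight and a group element encodes a linear combination of left translates.\<close>

definition majorant :: "('a \<Rightarrow> real) \<Rightarrow> ('a \<Rightarrow> real) \<Rightarrow> (real \<times> 'a) list \<Rightarrow> bool" where
  "majorant \<phi> f xs \<longleftrightarrow> (\<forall>(c, s)\<in>set xs. 0 \<le> c \<and> s \<in> carrier G) \<and>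
     (\<forall>x\<in>carrier G. f x \<le> (\<Sum>(c, s)\<leftarrow>xs. c * \<phi> (s \<otimes> x)))"

text \<open>Weil's ratio \<open>(f : \<phi>)\<close>. For \<open>\<phi>\<close> concentrated near the identity it behaves, up to normalization,
  like the Haar integral of \<open>f\<close>.\<close>

definition ratio :: "('a \<Rightarrow> real) \<Rightarrow> ('a \<Rightarrow> real) \<Rightarrow> real" where
  "ratio \<phi> f = Inf {\<Sum>(c, s)\<leftarrow>xs. c |xs. majorant \<phi> f xs}"

lemma majorant_nonneg: "majorant \<phi> f xs \<Longrightarrow> 0 \<le> (\<Sum>(c, s)\<leftarrow>xs. c)"
  by (rule sum_list_nonneg) (auto simp: majorant_def)

lemma majorant_exists:
  assumes f: "f \<in> Cc_pos" and \<phi>: "nontrivial \<phi>"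
  shows "\<exists>xs. majorant \<phi> f xs"
proof -
  have fCc: "f \<in> Cc T" and \<phi>Cc: "\<phi> \<in> Cc T" and \<phi>0: "\<And>x. x \<in> carrier G \<Longrightarrow> 0 \<le> \<phi> x"
    using f \<phi> by (auto simp: Cc_pos_def nontrivial_def)
  obtain s0 where s0: "s0 \<in> carrier G" "\<phi> s0 > 0"
    using \<phi> by (auto simp: nontrivial_def)
  obtain C where C: "compactin T C" "\<And>x. x \<in> topspace T \<Longrightarrow> x \<notin> C \<Longrightarrow> f x = 0"
    using Cc_support[OF fCc] by metis
  obtain B where B: "B > 0" "\<And>x. x \<in> topspace T \<Longrightarrow> \<bar>f x\<bar> \<le> B"
    using Cc_bounded[OF fCc] by metis
  define W where "W s = {x \<in> carrier G. \<phi> (s \<otimes> x) \<in> {\<phi> s0 / 2 <..}}" for s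
  have "openin T (W s)" if "s \<in> carrier G" for s
    unfolding W_def
    using openin_continuous_map_preimage[OF Cc_continuous[OF Cc_left_translate[OF \<phi>Cc that]], of "{\<phi> s0 / 2 <..}"]
    by (simp add: topspace_eq)
  moreover have "\<exists>s\<in>carrier G. x \<in> W s" if "x \<in> C" for x
  proof -
    have x: "x \<in> carrier G" using compactin_carrier[OF C(1)] that by auto
    then have "x \<in> W (s0 \<otimes> inv x)"
      using s0 by (simp add: W_def m_assoc)
    then show ?thesis using x s0 by blast
  qed
  ultimately obtain P where P: "finite P" "P \<subseteq> carrier G" "\<And>x. x \<in> C \<Longrightarrow> \<exists>s\<in>P. x \<in> W s"
    using compactin_subcover_image[OF C(1), of "carrier G" W] by blast
  obtain ps where ps: "set ps = P"
    using P(1) finite_list by auto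
  define c where "c = 2 * B / \<phi> s0"
  have c: "c > 0" using B s0 by (simp add: c_def)
  have "majorant \<phi> f (map (\<lambda>s. (c, s)) ps)"
    unfolding majorant_def
  proof (intro conjI ballI)
    fix x assume x: "x \<in> carrier G"
    have nn: "0 \<le> c * \<phi> (s \<otimes> x)" if "s \<in> set ps" for s
      using that ps P(2) x c \<phi>0 by (intro mult_nonneg_nonneg) auto
    have sum_nn: "0 \<le> (\<Sum>s\<leftarrow>ps. c * \<phi> (s \<otimes> x))"
      using nn by (intro sum_list_nonneg) auto
    have "f x \<le> (\<Sum>s\<leftarrow>ps. c * \<phi> (s \<otimes> x))"
    proof (cases "x \<in> C")
      case True
      then obtain s where s: "s \<in> P" "x \<in> W s" using P(3) by auto
      have "f x \<le> B" using B(2)[of x] x by (simp add: topspace_eq)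
      also have "B = c * (\<phi> s0 / 2)" using s0 by (simp add: c_def)
      also have "\<dots> \<le> c * \<phi> (s \<otimes> x)"
        using s(2) c by (intro mult_left_mono) (auto simp: W_def)
      also have "\<dots> \<le> (\<Sum>s\<leftarrow>ps. c * \<phi> (s \<otimes> x))"
        using nn s(1) ps by (intro member_le_sum_list) auto
      finally show ?thesis .
    next
      case False
      then show ?thesis using C(2)[of x] x sum_nn by (simp add: topspace_eq)
    qed
    then show "f x \<le> (\<Sum>(c, s)\<leftarrow>map (\<lambda>s. (c, s)) ps. c * \<phi> (s \<otimes> x))"
      by (simp add: o_def)
  qed (use ps P(2) c in auto)
  then show ?thesis by blast
qed

lemma ratio_le: "majorant \<phi> f xs \<Longrightarrow> ratio \<phi> f \<le> (\<Sum>(c, s)\<leftarrow>xs. c)"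
  unfolding ratio_def using majorant_nonneg by (intro cInf_lower bdd_belowI[of _ 0]) auto

lemma ratio_greatest:
  assumes "f \<in> Cc_pos" "nontrivial \<phi>" "\<And>xs. majorant \<phi> f xs \<Longrightarrow> b \<le> (\<Sum>(c, s)\<leftarrow>xs. c)"
  shows "b \<le> ratio \<phi> f"
  unfolding ratio_def using majorant_exists[OF assms(1,2)] assms(3) by (intro cInf_greatest) auto

lemma ratio_nonneg: "f \<in> Cc_pos \<Longrightarrow> nontrivial \<phi> \<Longrightarrow> 0 \<le> ratio \<phi> f"
  by (rule ratio_greatest) (auto dest: majorant_nonneg)

lemma ratio_approx:
  assumes "f \<in> Cc_pos" "nontrivial \<phi>" "e > 0"
  obtains xs where "majorant \<phi> f xs" "(\<Sum>(c, s)\<leftarrow>xs. c) < ratio \<phi> f + e"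
proof -
  have "\<not> ratio \<phi> f + e \<le> ratio \<phi> f" using assms(3) by simp
  then obtain xs where "majorant \<phi> f xs" "\<not> ratio \<phi> f + e \<le> (\<Sum>(c, s)\<leftarrow>xs. c)"
    using ratio_greatest[OF assms(1,2), of "ratio \<phi> f + e"] by blast
  then show ?thesis using that by force
qed

lemma ratio_mono:
  assumes "g \<in> Cc_pos" "nontrivial \<phi>" "\<And>x. x \<in> carrier G \<Longrightarrow> f x \<le> g x"
  shows "ratio \<phi> f \<le> ratio \<phi> g"
  using assms by (intro ratio_greatest ratio_le) (auto simp: majorant_def intro: order_trans)

lemma ratio_add:
  assumes "f \<in> Cc_pos" "g \<in> Cc_pos" "nontrivial \<phi>"
  shows "ratio \<phi> (\<lambda>x. f x + g x) \<le> ratio \<phi> f + ratio \<phi> g"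
proof -
  have "ratio \<phi> (\<lambda>x. f x + g x) - (\<Sum>(c, s)\<leftarrow>xs. c) \<le> (\<Sum>(c, s)\<leftarrow>ys. c)"
    if "majorant \<phi> f xs" "majorant \<phi> g ys" for xs ys
  proof -
    have "majorant \<phi> (\<lambda>x. f x + g x) (xs @ ys)"
      using that by (auto simp: majorant_def intro: add_mono)
    from ratio_le[OF this] show ?thesis by simp
  qed
  then have "ratio \<phi> (\<lambda>x. f x + g x) - (\<Sum>(c, s)\<leftarrow>xs. c) \<le> ratio \<phi> g" if "majorant \<phi> f xs" for xs
    using that assms by (intro ratio_greatest) auto
  then have "ratio \<phi> (\<lambda>x. f x + g x) - ratio \<phi> g \<le> ratio \<phi> f"
    using assms by (intro ratio_greatest) (auto simp: algebra_simps)
  then show ?thesis by simp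
qed

lemma ratio_scale_le:
  assumes "f \<in> Cc_pos" "nontrivial \<phi>" "c > 0"
  shows "ratio \<phi> (\<lambda>x. c * f x) \<le> c * ratio \<phi> f"
proof -
  have "ratio \<phi> (\<lambda>x. c * f x) / c \<le> (\<Sum>(a, s)\<leftarrow>xs. a)" if "majorant \<phi> f xs" for xs
  proof -
    have mul: "(\<Sum>z\<leftarrow>zs. c * h z) = c * (\<Sum>z\<leftarrow>zs. h z)" for zs and h :: "real \<times> 'a \<Rightarrow> real"
      by (rule sum_list_const_mult)
    have "majorant \<phi> (\<lambda>x. c * f x) (map (\<lambda>(a, s). (c * a, s)) xs)"
      using that \<open>c > 0\<close>
      by (auto simp: majorant_def o_def case_prod_unfold mul mult.assoc intro!: mult_left_mono)
    from ratio_le[OF this] have "ratio \<phi> (\<lambda>x. c * f x) \<le> c * (\<Sum>(a, s)\<leftarrow>xs. a)"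
      by (simp add: o_def case_prod_unfold mul)
    then show ?thesis using \<open>c > 0\<close> by (simp add: field_simps)
  qed
  then have "ratio \<phi> (\<lambda>x. c * f x) / c \<le> ratio \<phi> f"
    using assms by (intro ratio_greatest) auto
  then show ?thesis using \<open>c > 0\<close> by (simp add: field_simps)
qed

lemma Cc_pos_scale: "f \<in> Cc_pos \<Longrightarrow> 0 \<le> c \<Longrightarrow> (\<lambda>x. c * f x) \<in> Cc_pos"
  by (auto simp: Cc_pos_def intro: Cc_scale)

lemma Cc_pos_add: "f \<in> Cc_pos \<Longrightarrow> g \<in> Cc_pos \<Longrightarrow> (\<lambda>x. f x + g x) \<in> Cc_pos"
  by (auto simp: Cc_pos_def intro: Cc_add)

lemma Cc_pos_translate: "f \<in> Cc_pos \<Longrightarrow> t \<in> carrier G \<Longrightarrow> (\<lambda>x. f (t \<otimes> x)) \<in> Cc_pos"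
  by (auto simp: Cc_pos_def intro: Cc_left_translate)

lemma ratio_scale:
  assumes "f \<in> Cc_pos" "nontrivial \<phi>" "c > 0"
  shows "ratio \<phi> (\<lambda>x. c * f x) = c * ratio \<phi> f"
proof (rule antisym[OF ratio_scale_le[OF assms]])
  have "ratio \<phi> (\<lambda>x. (1 / c) * (c * f x)) \<le> (1 / c) * ratio \<phi> (\<lambda>x. c * f x)"
    using assms by (intro ratio_scale_le Cc_pos_scale) auto
  then show "c * ratio \<phi> f \<le> ratio \<phi> (\<lambda>x. c * f x)"
    using \<open>c > 0\<close> by (simp add: field_simps)
qed

lemma ratio_translate_le:
  assumes "f \<in> Cc_pos" "nontrivial \<phi>" "t \<in> carrier G"
  shows "ratio \<phi> (\<lambda>x. f (t \<otimes> x)) \<le> ratio \<phi> f"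
proof (rule ratio_greatest[OF assms(1,2)])
  fix xs assume xs: "majorant \<phi> f xs"
  have "majorant \<phi> (\<lambda>x. f (t \<otimes> x)) (map (\<lambda>(c, s). (c, s \<otimes> t)) xs)"
    unfolding majorant_def
  proof (intro conjI ballI)
    fix x assume x: "x \<in> carrier G"
    have "f (t \<otimes> x) \<le> (\<Sum>(c, s)\<leftarrow>xs. c * \<phi> (s \<otimes> (t \<otimes> x)))"
      using xs x assms(3) by (auto simp: majorant_def)
    also have "\<dots> = (\<Sum>(c, s)\<leftarrow>map (\<lambda>(c, s). (c, s \<otimes> t)) xs. c * \<phi> (s \<otimes> x))"
      unfolding map_map
      by (intro arg_cong[of _ _ sum_list] map_cong) (use xs x assms(3) in \<open>auto simp: majorant_def m_assoc\<close>)
    finally show "f (t \<otimes> x) \<le> (\<Sum>(c, s)\<leftarrow>map (\<lambda>(c, s). (c, s \<otimes> t)) xs. c * \<phi> (s \<otimes> x))" .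
  qed (use xs assms(3) in \<open>auto simp: majorant_def\<close>)
  from ratio_le[OF this] show "ratio \<phi> (\<lambda>x. f (t \<otimes> x)) \<le> (\<Sum>(c, s)\<leftarrow>xs. c)"
    by (simp add: o_def case_prod_unfold)
qed

lemma ratio_cong:
  "(\<And>x. x \<in> carrier G \<Longrightarrow> f x = g x) \<Longrightarrow> ratio \<phi> f = ratio \<phi> g"
  unfolding ratio_def majorant_def by simp

lemma ratio_translate:
  assumes "f \<in> Cc_pos" "nontrivial \<phi>" "t \<in> carrier G"
  shows "ratio \<phi> (\<lambda>x. f (t \<otimes> x)) = ratio \<phi> f"
proof (rule antisym[OF ratio_translate_le[OF assms]])
  have "ratio \<phi> f = ratio \<phi> (\<lambda>x. f (t \<otimes> (inv t \<otimes> x)))"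
    using assms(3) by (intro ratio_cong) (simp add: m_assoc[symmetric])
  also have "\<dots> \<le> ratio \<phi> (\<lambda>x. f (t \<otimes> x))"
    using ratio_translate_le[OF Cc_pos_translate[OF assms(1,3)] assms(2), of "inv t"] assms(3) by simp
  finally show "ratio \<phi> f \<le> ratio \<phi> (\<lambda>x. f (t \<otimes> x))" .
qed

text \<open>Majorizing \<open>f\<close> by translates of \<open>\<psi>\<close> and these by translates of \<open>\<phi>\<close>. This bounds the normalized
  ratios above and below independently of \<open>\<phi>\<close>, so that they have a non-zero cluster point.\<close>

lemma ratio_trans:
  assumes f: "f \<in> Cc_pos" and \<psi>: "nontrivial \<psi>" and \<phi>: "nontrivial \<phi>"
  shows "ratio \<phi> f \<le> ratio \<psi> f * ratio \<phi> \<psi>"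
proof -
  have \<psi>': "\<psi> \<in> Cc_pos" using \<psi> by (simp add: nontrivial_def)
  have zero: "(\<lambda>x. 0) \<in> Cc_pos" by (simp add: Cc_pos_def Cc_zero)
  have major: "ratio \<phi> f \<le> (\<Sum>(c, s)\<leftarrow>xs. c) * ratio \<phi> \<psi>" if xs: "majorant \<psi> f xs" for xs
  proof -
    have *: "(\<lambda>x. \<Sum>(c, s)\<leftarrow>ys. c * \<psi> (s \<otimes> x)) \<in> Cc_pos \<and>
        ratio \<phi> (\<lambda>x. \<Sum>(c, s)\<leftarrow>ys. c * \<psi> (s \<otimes> x)) \<le> (\<Sum>(c, s)\<leftarrow>ys. c) * ratio \<phi> \<psi>"
      if "\<forall>(c, s)\<in>set ys. 0 \<le> c \<and> s \<in> carrier G" for ys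
      using that
    proof (induction ys)
      case Nil
      have "majorant \<phi> (\<lambda>x. 0) []" by (simp add: majorant_def)
      from ratio_le[OF this] show ?case using zero by simp
    next
      case (Cons y ys)
      obtain c s where y: "y = (c, s)" by force
      have cs: "0 \<le> c" "s \<in> carrier G" using Cons.prems y by auto
      have mem: "(\<lambda>x. c * \<psi> (s \<otimes> x)) \<in> Cc_pos"
        using cs \<psi>' by (intro Cc_pos_scale Cc_pos_translate) auto
      have "ratio \<phi> (\<lambda>x. c * \<psi> (s \<otimes> x)) \<le> c * ratio \<phi> \<psi>"
      proof (cases "c = 0")
        case True
        have "majorant \<phi> (\<lambda>x. c * \<psi> (s \<otimes> x)) []" using True by (simp add: majorant_def)
        from ratio_le[OF this] show ?thesis using True by simp
      next
        case False
        then show ?thesis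
          using ratio_scale[OF Cc_pos_translate[OF \<psi>' cs(2)] \<phi>, of c] ratio_translate[OF \<psi>' \<phi> cs(2)] cs(1)
          by simp
      qed
      moreover have IH: "(\<lambda>x. \<Sum>(c, s)\<leftarrow>ys. c * \<psi> (s \<otimes> x)) \<in> Cc_pos"
          "ratio \<phi> (\<lambda>x. \<Sum>(c, s)\<leftarrow>ys. c * \<psi> (s \<otimes> x)) \<le> (\<Sum>(c, s)\<leftarrow>ys. c) * ratio \<phi> \<psi>"
        using Cons by auto
      ultimately show ?case
        using ratio_add[OF mem IH(1) \<phi>] Cc_pos_add[OF mem IH(1)] by (simp add: y distrib_right)
    qed
    show ?thesis
    proof (rule order_trans)
      have ok: "\<forall>(c, s)\<in>set xs. 0 \<le> c \<and> s \<in> carrier G" using xs by (simp add: majorant_def)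
      show "ratio \<phi> f \<le> ratio \<phi> (\<lambda>x. \<Sum>(c, s)\<leftarrow>xs. c * \<psi> (s \<otimes> x))"
        using *[OF ok] xs by (intro ratio_mono[OF _ \<phi>]) (simp_all add: majorant_def)
      show "ratio \<phi> (\<lambda>x. \<Sum>(c, s)\<leftarrow>xs. c * \<psi> (s \<otimes> x)) \<le> (\<Sum>(c, s)\<leftarrow>xs. c) * ratio \<phi> \<psi>"
        using *[OF ok] by blast
    qed
  qed
  show ?thesis
  proof (rule field_le_epsilon)
    fix e :: real assume e: "e > 0"
    have r: "ratio \<phi> \<psi> \<ge> 0" by (rule ratio_nonneg[OF \<psi>' \<phi>])
    have "e / (ratio \<phi> \<psi> + 1) > 0" using e r by simp
    then obtain xs where xs: "majorant \<psi> f xs" "(\<Sum>(c, s)\<leftarrow>xs. c) < ratio \<psi> f + e / (ratio \<phi> \<psi> + 1)"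
      using ratio_approx[OF f \<psi>] by blast
    have "ratio \<phi> f \<le> (ratio \<psi> f + e / (ratio \<phi> \<psi> + 1)) * ratio \<phi> \<psi>"
      using major[OF xs(1)] mult_right_mono[OF less_imp_le[OF xs(2)] r] by linarith
    also have "\<dots> \<le> ratio \<psi> f * ratio \<phi> \<psi> + e"
      using e r by (simp add: field_simps)
    finally show "ratio \<phi> f \<le> ratio \<psi> f * ratio \<phi> \<psi> + e" .
  qed
qed

lemma ratio_pos:
  assumes f: "nontrivial f" and \<phi>: "nontrivial \<phi>"
  shows "0 < ratio \<phi> f"
proof -
  obtain x where x: "x \<in> carrier G" "f x > 0"
    using f by (auto simp: nontrivial_def)
  obtain B where B: "B > 0" "\<And>x. x \<in> topspace T \<Longrightarrow> \<bar>\<phi> x\<bar> \<le> B"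
    using Cc_bounded[of \<phi> T] \<phi> by (auto simp: nontrivial_def Cc_pos_def)
  have "f x / B \<le> ratio \<phi> f"
  proof (rule ratio_greatest[OF _ \<phi>])
    fix xs assume xs: "majorant \<phi> f xs"
    have "f x \<le> (\<Sum>(c, s)\<leftarrow>xs. c * \<phi> (s \<otimes> x))"
      using xs x by (auto simp: majorant_def)
    also have "\<dots> \<le> (\<Sum>(c, s)\<leftarrow>xs. c * B)"
    proof (rule sum_list_mono)
      fix z assume z: "z \<in> set xs"
      obtain c s where cs: "z = (c, s)" by force
      have "0 \<le> c" "s \<in> carrier G" using xs z cs by (auto simp: majorant_def)
      with B(2)[of "s \<otimes> x"] x show "(case z of (c, s) \<Rightarrow> c * \<phi> (s \<otimes> x)) \<le> (case z of (c, s) \<Rightarrow> c * B)"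
        by (auto simp: cs topspace_eq intro!: mult_left_mono)
    qed
    also have "\<dots> = (\<Sum>(c, s)\<leftarrow>xs. c) * B"
      using sum_list_mult_const[of fst B xs] by (simp add: case_prod_unfold)
    finally show "f x / B \<le> (\<Sum>(c, s)\<leftarrow>xs. c)"
      using B(1) by (simp add: field_simps)
  qed (use f in \<open>simp add: nontrivial_def\<close>)
  moreover have "f x / B > 0" using x B by simp
  ultimately show ?thesis by linarith
qed

text \<open>Where \<open>\<phi> (s \<otimes> x)\<close> does not vanish, \<open>x\<close> is close to \<open>inv s\<close>. Hence a majorant of \<open>f = f\<^sub>1 + f\<^sub>2\<close>
  splits, with the weights \<open>f\<^sub>i / f\<close> taken at \<open>inv s\<close>, into majorants of \<open>f\<^sub>1\<close> and \<open>f\<^sub>2\<close>. A small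
  multiple of a function \<open>f'\<close> equal to 1 on the supports is added to \<open>f\<close> to keep the quotients
  continuous.\<close>

lemma ratio_almost_additive:
  assumes f1: "f1 \<in> Cc_pos" and f2: "f2 \<in> Cc_pos" and d: "d > 0"
    and f'pos: "f' \<in> Cc_pos" and f'1: "\<And>x. x \<in> carrier G \<Longrightarrow> f1 x \<noteq> 0 \<or> f2 x \<noteq> 0 \<Longrightarrow> f' x = 1"
  shows "\<exists>V. openin T V \<and> \<one> \<in> V \<and>
    (\<forall>\<phi>. nontrivial \<phi> \<longrightarrow> (\<forall>x\<in>carrier G - V. \<phi> x = 0) \<longrightarrow>
       ratio \<phi> f1 + ratio \<phi> f2 \<le> (1 + 2 * d) * (ratio \<phi> (\<lambda>x. f1 x + f2 x) + d * ratio \<phi> f'))"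
proof -
  have Cc: "f1 \<in> Cc T" "f2 \<in> Cc T" and nn: "\<And>x. x \<in> carrier G \<Longrightarrow> 0 \<le> f1 x" "\<And>x. x \<in> carrier G \<Longrightarrow> 0 \<le> f2 x"
    using f1 f2 by (auto simp: Cc_pos_def)
  define f where "f x = f1 x + f2 x + d * f' x" for x
  define h where "h i x = (if i then f1 x else f2 x) / max d (f1 x + f2 x + d)" for i :: bool and x
  have hCc: "h i \<in> Cc T" for i
  proof -
    have "continuous_map T euclideanreal (\<lambda>x. max d (f1 x + f2 x + d))"
      using Cc[THEN Cc_continuous] by (intro continuous_intros) auto
    then have "continuous_map T euclideanreal (\<lambda>x. inverse (max d (f1 x + f2 x + d)))"
      by (rule continuous_map_real_inverse) (use d in auto)
    from Cc_mult(1)[OF Cc(1) this] Cc_mult(1)[OF Cc(2) this]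
    have "(\<lambda>x. h i x) \<in> Cc T"
      unfolding h_def by (cases i) (simp_all add: divide_inverse)
    then show ?thesis by simp
  qed
  have hf: "(if i then f1 x else f2 x) = f x * h i x" if x: "x \<in> carrier G" for i x
  proof (cases "f1 x \<noteq> 0 \<or> f2 x \<noteq> 0")
    case True
    then have "f x = max d (f1 x + f2 x + d)" "f x > 0"
      using f'1[OF x] nn[OF x] d by (auto simp: f_def)
    then show ?thesis by (simp add: h_def)
  next
    case False
    then show ?thesis by (simp add: h_def)
  qed
  have h0: "0 \<le> h i x" if "x \<in> carrier G" for i x
    using nn[OF that] d by (auto simp: h_def intro!: divide_nonneg_pos)
  have hsum: "h True x + h False x \<le> 1" if "x \<in> carrier G" for x
    using nn[OF that] d by (simp add: h_def flip: add_divide_distrib)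
  obtain V1 where V1: "openin T V1" "\<one> \<in> V1" "\<And>v x. v \<in> V1 \<Longrightarrow> x \<in> carrier G \<Longrightarrow> \<bar>h True (x \<otimes> v) - h True x\<bar> < d"
    using Cc_uniformly_continuous[OF hCc[of True] d] by metis
  obtain V2 where V2: "openin T V2" "\<one> \<in> V2" "\<And>v x. v \<in> V2 \<Longrightarrow> x \<in> carrier G \<Longrightarrow> \<bar>h False (x \<otimes> v) - h False x\<bar> < d"
    using Cc_uniformly_continuous[OF hCc[of False] d] by metis
  have fpos: "f \<in> Cc_pos"
    unfolding f_def using f1 f2 f'pos d by (intro Cc_pos_add Cc_pos_scale) auto
  show ?thesis
  proof (intro exI[of _ "V1 \<inter> V2"] conjI allI impI)
    fix \<phi> assume \<phi>: "nontrivial \<phi>" and supp: "\<forall>x\<in>carrier G - V1 \<inter> V2. \<phi> x = 0"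
    have \<phi>0: "0 \<le> \<phi> x" if "x \<in> carrier G" for x
      using \<phi> that by (auto simp: nontrivial_def Cc_pos_def)
    have split: "ratio \<phi> f1 + ratio \<phi> f2 \<le> (1 + 2 * d) * (\<Sum>(c, s)\<leftarrow>xs. c)" if xs: "majorant \<phi> f xs" for xs
    proof -
      have xs1: "0 \<le> c" "s \<in> carrier G" if "(c, s) \<in> set xs" for c s
        using xs that by (auto simp: majorant_def)
      define ys where "ys i = map (\<lambda>(c, s). (c * (h i (inv s) + d), s)) xs" for i
      have "majorant \<phi> (\<lambda>x. if i then f1 x else f2 x) (ys i)" for i
        unfolding majorant_def
      proof (intro conjI ballI)
        fix z assume "z \<in> set (ys i)"
        then show "case z of (c, s) \<Rightarrow> 0 \<le> c \<and> s \<in> carrier G"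
          using xs1 h0 d by (auto simp: ys_def intro!: mult_nonneg_nonneg add_nonneg_nonneg)
      next
        fix x assume x: "x \<in> carrier G"
        have "f x * h i x \<le> (\<Sum>(c, s)\<leftarrow>xs. c * \<phi> (s \<otimes> x)) * h i x"
          using xs x h0[OF x] by (intro mult_right_mono) (auto simp: majorant_def)
        also have "\<dots> = (\<Sum>(c, s)\<leftarrow>xs. c * \<phi> (s \<otimes> x) * h i x)"
          using sum_list_mult_const[of "\<lambda>(c, s). c * \<phi> (s \<otimes> x)" "h i x" xs] by (simp add: case_prod_unfold)
        also have "\<dots> \<le> (\<Sum>(c, s)\<leftarrow>xs. c * (h i (inv s) + d) * \<phi> (s \<otimes> x))"
        proof (rule sum_list_mono)
          fix z assume z: "z \<in> set xs"
          obtain c s where cs: "z = (c, s)" by force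
          note c = xs1[OF z[unfolded cs]]
          have "\<phi> (s \<otimes> x) * h i x \<le> (h i (inv s) + d) * \<phi> (s \<otimes> x)"
          proof (cases "s \<otimes> x \<in> V1 \<inter> V2")
            case True
            have "x = inv s \<otimes> (s \<otimes> x)" using c(2) x by (simp add: m_assoc[symmetric])
            moreover have "\<bar>h i (inv s \<otimes> (s \<otimes> x)) - h i (inv s)\<bar> < d"
              using True V1(3)[of "s \<otimes> x" "inv s"] V2(3)[of "s \<otimes> x" "inv s"] c(2) by (cases i) auto
            ultimately have "h i x \<le> h i (inv s) + d" by simp
            from mult_right_mono[OF this \<phi>0[of "s \<otimes> x"]] c(2) x show ?thesis
              by (simp add: mult.commute)
          next
            case False
            then show ?thesis using bspec[OF supp, of "s \<otimes> x"] c(2) x by simp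
          qed
          from mult_left_mono[OF this c(1)]
          show "(case z of (c, s) \<Rightarrow> c * \<phi> (s \<otimes> x) * h i x) \<le> (case z of (c, s) \<Rightarrow> c * (h i (inv s) + d) * \<phi> (s \<otimes> x))"
            by (simp add: cs mult.assoc)
        qed
        finally show "(if i then f1 x else f2 x) \<le> (\<Sum>(c, s)\<leftarrow>ys i. c * \<phi> (s \<otimes> x))"
          using hf[OF x, of i] by (simp add: ys_def o_def case_prod_unfold)
      qed
      from ratio_le[OF this[of True]] ratio_le[OF this[of False]]
      have "ratio \<phi> f1 + ratio \<phi> f2 \<le> (\<Sum>(c, s)\<leftarrow>xs. c * (h True (inv s) + d)) + (\<Sum>(c, s)\<leftarrow>xs. c * (h False (inv s) + d))"
        by (simp add: ys_def o_def case_prod_unfold)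
      also have "\<dots> = (\<Sum>(c, s)\<leftarrow>xs. c * (h True (inv s) + d) + c * (h False (inv s) + d))"
        by (simp add: case_prod_unfold sum_list_addf)
      also have "\<dots> \<le> (\<Sum>(c, s)\<leftarrow>xs. (1 + 2 * d) * c)"
      proof (rule sum_list_mono)
        fix z assume z: "z \<in> set xs"
        obtain c s where cs: "z = (c, s)" by force
        note c = xs1[OF z[unfolded cs]]
        have "c * (h True (inv s) + h False (inv s) + 2 * d) \<le> c * (1 + 2 * d)"
          using hsum[of "inv s"] c by (intro mult_left_mono) auto
        then show "(case z of (c, s) \<Rightarrow> c * (h True (inv s) + d) + c * (h False (inv s) + d)) \<le> (case z of (c, s) \<Rightarrow> (1 + 2 * d) * c)"
          by (simp add: cs algebra_simps)
      qed
      also have "\<dots> = (1 + 2 * d) * (\<Sum>(c, s)\<leftarrow>xs. c)"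
        using sum_list_const_mult[of "1 + 2 * d" fst xs] by (simp add: case_prod_unfold)
      finally show ?thesis .
    qed
    have "(ratio \<phi> f1 + ratio \<phi> f2) / (1 + 2 * d) \<le> ratio \<phi> f"
      using split d by (intro ratio_greatest[OF fpos \<phi>]) (simp add: field_simps)
    also have "\<dots> \<le> ratio \<phi> (\<lambda>x. f1 x + f2 x) + ratio \<phi> (\<lambda>x. d * f' x)"
      unfolding f_def using f1 f2 f'pos d \<phi> by (intro ratio_add Cc_pos_add Cc_pos_scale) auto
    also have "ratio \<phi> (\<lambda>x. d * f' x) = d * ratio \<phi> f'"
      by (rule ratio_scale[OF f'pos \<phi> d])
    finally show "ratio \<phi> f1 + ratio \<phi> f2 \<le> (1 + 2 * d) * (ratio \<phi> (\<lambda>x. f1 x + f2 x) + d * ratio \<phi> f')"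
      using d by (simp add: field_simps)
  qed (use V1 V2 f'pos in auto)
qed

lemma bump_at_one:
  assumes "openin T V" "\<one> \<in> V"
  obtains \<phi> where "\<phi> \<in> Cc T" "\<And>x. x \<in> carrier G \<Longrightarrow> 0 \<le> \<phi> x" "\<And>x. x \<in> carrier G \<Longrightarrow> \<phi> x \<le> 1"
    "\<phi> \<one> = 1" "\<And>x. x \<in> carrier G \<Longrightarrow> x \<notin> V \<Longrightarrow> \<phi> x = 0"
proof -
  have "compactin T {\<one>}" by (simp add: topspace_eq)
  then show thesis
    using bump_function[OF locally_compact hausdorff _ assms(1), of "{\<one>}"] assms(2) that
    by (metis empty_subsetI insert_subset singletonI topspace_eq)
qed

text \<open>Every function of compact support is a difference of two functions in the cone, and by additivity the
  difference of the values is independent of the decomposition.\<close>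

lemma positive_functional_from_cone:
  assumes add: "\<And>f g. f \<in> Cc_pos \<Longrightarrow> g \<in> Cc_pos \<Longrightarrow> I (\<lambda>x. f x + g x) = I f + I g"
    and scale: "\<And>c f. c > 0 \<Longrightarrow> f \<in> Cc_pos \<Longrightarrow> I (\<lambda>x. c * f x) = c * I f"
    and nonneg: "\<And>f. f \<in> Cc_pos \<Longrightarrow> 0 \<le> I f"
    and cong: "\<And>f g. f \<in> Cc_pos \<Longrightarrow> (\<And>x. x \<in> carrier G \<Longrightarrow> f x = g x) \<Longrightarrow> I f = I g"
  defines "J \<equiv> \<lambda>f. I (\<lambda>x. max (f x) 0) - I (\<lambda>x. max (- f x) 0)"
  shows "positive_functional T J" "\<And>f. f \<in> Cc_pos \<Longrightarrow> J f = I f"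
proof -
  have zero: "I (\<lambda>x. 0) = 0"
    using add[of "\<lambda>x. 0" "\<lambda>x. 0"] by (simp add: Cc_pos_def Cc_zero)
  have pos: "(\<lambda>x. max (f x) 0) \<in> Cc_pos" "(\<lambda>x. max (- f x) 0) \<in> Cc_pos" if "f \<in> Cc T" for f
    using that by (auto simp: Cc_pos_def intro!: Cc_max Cc_minus Cc_zero)
  have J_eq: "J f = I a - I b" if "f \<in> Cc T" "a \<in> Cc_pos" "b \<in> Cc_pos" "\<And>x. x \<in> carrier G \<Longrightarrow> f x = a x - b x" for f a b
  proof -
    have "I (\<lambda>x. max (f x) 0 + b x) = I (\<lambda>x. a x + max (- f x) 0)"
      using that by (intro cong Cc_pos_add pos) auto
    then show ?thesis
      using add[OF pos(1)[OF that(1)] that(3)] add[OF that(2) pos(2)[OF that(1)]] by (simp add: J_def)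
  qed
  show J_pos: "J f = I f" if "f \<in> Cc_pos" for f
    using J_eq[of f f "\<lambda>x. 0"] that zero by (simp add: Cc_pos_def Cc_zero)
  show "positive_functional T J"
    unfolding positive_functional_def
  proof (intro conjI ballI allI impI)
    fix f g assume f: "f \<in> Cc T" and g: "g \<in> Cc T"
    have "J (\<lambda>x. f x + g x) = I (\<lambda>x. max (f x) 0 + max (g x) 0) - I (\<lambda>x. max (- f x) 0 + max (- g x) 0)"
      using f g pos by (intro J_eq Cc_add Cc_pos_add) auto
    then show "J (\<lambda>x. f x + g x) = J f + J g"
      using add pos f g by (simp add: J_def)
  next
    fix c :: real and f assume f: "f \<in> Cc T"
    consider "c = 0" | "c > 0" | "c < 0" by linarith
    then show "J (\<lambda>x. c * f x) = c * J f"
    proof cases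
      case 1
      then show ?thesis by (simp add: J_def)
    next
      case 2
      have "J (\<lambda>x. c * f x) = I (\<lambda>x. c * max (f x) 0) - I (\<lambda>x. c * max (- f x) 0)"
        using f pos 2 by (intro J_eq Cc_scale Cc_pos_scale) (auto simp: max_def algebra_simps)
      then show ?thesis
        using scale[OF 2] pos f by (simp add: J_def algebra_simps)
    next
      case 3
      then have 4: "- c > 0" by simp
      have "J (\<lambda>x. c * f x) = I (\<lambda>x. (- c) * max (- f x) 0) - I (\<lambda>x. (- c) * max (f x) 0)"
        using f pos 3 by (intro J_eq Cc_scale Cc_pos_scale) (auto simp: max_def algebra_simps)
      then show ?thesis
        using scale[OF 4] pos f by (simp add: J_def algebra_simps)
    qed
  next
    fix f assume "f \<in> Cc T" "\<forall>x\<in>topspace T. 0 \<le> f x"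
    then have "f \<in> Cc_pos" by (simp add: Cc_pos_def topspace_eq)
    then show "0 \<le> J f" using J_pos nonneg by simp
  qed
qed

text \<open>Weil's construction: the ratios are subadditive and invariant, and almost additive for \<open>\<phi>\<close>
  concentrated near the identity, so a cluster point of \<open>ratio \<phi> / ratio \<phi> f0\<close> as \<open>\<phi>\<close> shrinks to the
  identity is additive. It is strictly positive because \<open>ratio_trans\<close> bounds the quotients from below.\<close>

theorem left_Haar_exists: "\<exists>J. left_Haar J"
proof -
  obtain f0 where "f0 \<in> Cc T" "\<And>x. x \<in> carrier G \<Longrightarrow> 0 \<le> f0 x" "f0 \<one> = 1"
    using bump_at_one[OF openin_topspace] by (metis one_closed topspace_eq)
  then have f0: "nontrivial f0"
    by (auto simp: nontrivial_def Cc_pos_def intro!: bexI[of _ \<one>])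
  have f0': "f0 \<in> Cc_pos" using f0 by (simp add: nontrivial_def)
  \<comment> \<open>the normalization at \<open>f0\<close> makes the values bounded in \<open>\<phi>\<close>\<close>
  define N where "N \<phi> f = (if f \<in> Cc_pos then ratio \<phi> f / ratio \<phi> f0 else 0)" for \<phi> f
  define A where "A V = {N \<phi> |\<phi>. nontrivial \<phi> \<and> (\<forall>x\<in>carrier G - V. \<phi> x = 0)}" for V
  define \<A> where "\<A> = A ` {V. openin T V \<and> \<one> \<in> V}"
  have N_bound: "\<bar>N \<phi> f\<bar> \<le> ratio f0 f" if "nontrivial \<phi>" "f \<in> Cc_pos" for \<phi> f
    using ratio_trans[OF that(2) f0 that(1)] ratio_pos[OF f0 that(1)] ratio_nonneg[OF that(2,1)] that(2)
    by (simp add: N_def abs_of_nonneg pos_divide_le_eq)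
  have "\<exists>I. \<forall>A F e. A \<in> \<A> \<longrightarrow> finite F \<longrightarrow> e > 0 \<longrightarrow> (\<exists>p\<in>A. \<forall>f\<in>F. \<bar>I f - p f\<bar> < e)"
  proof (rule pointwise_cluster_point[of \<A> "\<lambda>f. if f \<in> Cc_pos then ratio f0 f else 0"])
    show "\<bar>p f\<bar> \<le> (if f \<in> Cc_pos then ratio f0 f else 0)" if "B \<in> \<A>" "p \<in> B" for B p f
      using that N_bound by (auto simp: \<A>_def A_def N_def)
    show "B \<noteq> {}" if "B \<in> \<A>" for B
    proof -
      obtain V where V: "openin T V" "\<one> \<in> V" "B = A V" using \<open>B \<in> \<A>\<close> by (auto simp: \<A>_def)
      obtain \<phi> where "\<phi> \<in> Cc T" "\<And>x. x \<in> carrier G \<Longrightarrow> 0 \<le> \<phi> x" "\<phi> \<one> = 1"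
          "\<And>x. x \<in> carrier G \<Longrightarrow> x \<notin> V \<Longrightarrow> \<phi> x = 0"
        using bump_at_one[OF V(1,2)] by metis
      then have "nontrivial \<phi>" "\<forall>x\<in>carrier G - V. \<phi> x = 0"
        by (auto simp: nontrivial_def Cc_pos_def intro!: bexI[of _ \<one>])
      then show ?thesis using V(3) by (auto simp: A_def)
    qed
    show "\<A> \<noteq> {}"
      using openin_topspace[of T] by (auto simp: \<A>_def topspace_eq)
    show "\<exists>B''\<in>\<A>. B'' \<subseteq> B \<inter> B'" if "B \<in> \<A>" "B' \<in> \<A>" for B B'
    proof -
      obtain V V' where V: "openin T V" "\<one> \<in> V" "B = A V" "openin T V'" "\<one> \<in> V'" "B' = A V'"
        using \<open>B \<in> \<A>\<close> \<open>B' \<in> \<A>\<close> by (auto simp: \<A>_def)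
      have "A (V \<inter> V') \<in> \<A>" using V by (auto simp: \<A>_def)
      moreover have "A (V \<inter> V') \<subseteq> B \<inter> B'" unfolding V A_def by blast
      ultimately show ?thesis by blast
    qed
  qed blast
  then obtain I where I: "\<And>B F e. B \<in> \<A> \<Longrightarrow> finite F \<Longrightarrow> e > 0 \<Longrightarrow> \<exists>p\<in>B. \<forall>f\<in>F. \<bar>I f - p f\<bar> < e"
    by blast
  have near: "\<exists>\<phi>. nontrivial \<phi> \<and> (\<forall>x\<in>carrier G - V. \<phi> x = 0) \<and> (\<forall>f\<in>F. \<bar>I f - N \<phi> f\<bar> < e)"
    if "openin T V" "\<one> \<in> V" "finite F" "e > 0" for V F e
    using I[of "A V" F e] that by (auto simp: \<A>_def A_def)
  have near': "\<exists>\<phi>. nontrivial \<phi> \<and> (\<forall>f\<in>F. \<bar>I f - N \<phi> f\<bar> < e)" if "finite F" "e > 0" for F e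
    using near[OF openin_topspace _ that] by (auto simp: topspace_eq)
  have eqI: "a = b" if "\<And>e. e > 0 \<Longrightarrow> \<bar>a - b\<bar> \<le> e" for a b :: real
    using field_le_epsilon[of "\<bar>a - b\<bar>" 0] that by simp
  have lower: "1 / ratio f f0 \<le> I f" if f: "nontrivial f" for f
  proof (rule field_le_epsilon)
    fix e :: real assume "e > 0"
    then obtain \<phi> where \<phi>: "nontrivial \<phi>" "\<bar>I f - N \<phi> f\<bar> < e" using near'[of "{f}" e] by auto
    have "1 / ratio f f0 \<le> N \<phi> f"
      using ratio_trans[OF f0' f \<phi>(1)] ratio_pos[OF f0 \<phi>(1)] ratio_pos[OF f0 f] f
      by (simp add: N_def nontrivial_def pos_le_divide_eq pos_divide_le_eq mult.commute)
    then show "1 / ratio f f0 \<le> I f + e" using \<phi>(2) by linarith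
  qed
  have nonneg: "0 \<le> I f" if f: "f \<in> Cc_pos" for f
  proof (rule field_le_epsilon)
    fix e :: real assume "e > 0"
    then obtain \<phi> where \<phi>: "nontrivial \<phi>" "\<bar>I f - N \<phi> f\<bar> < e" using near'[of "{f}" e] by auto
    have "0 \<le> N \<phi> f"
      using ratio_nonneg[OF f \<phi>(1)] ratio_pos[OF f0 \<phi>(1)] by (simp add: N_def)
    then show "0 \<le> I f + e" using \<phi>(2) by linarith
  qed
  have N_eq: "I f = c * I g" if "\<And>\<phi>. nontrivial \<phi> \<Longrightarrow> N \<phi> f = c * N \<phi> g" for f g c
  proof (rule eqI)
    fix e :: real assume e: "e > 0"
    define d where "d = e / (1 + \<bar>c\<bar>)"
    have d: "d > 0" using e by (simp add: d_def add_pos_nonneg)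
    have "d * (1 + \<bar>c\<bar>) = e" by (simp add: d_def)
    then have d2: "d + \<bar>c\<bar> * d = e" by (simp add: algebra_simps)
    obtain \<phi> where \<phi>: "nontrivial \<phi>" "\<bar>I f - N \<phi> f\<bar> < d" "\<bar>I g - N \<phi> g\<bar> < d"
      using near'[of "{f, g}" d] d by auto
    have "\<bar>c * (I g - N \<phi> g)\<bar> \<le> \<bar>c\<bar> * d"
      unfolding abs_mult using \<phi>(3) by (intro mult_left_mono) auto
    moreover have "I f - c * I g = (I f - N \<phi> f) - c * (I g - N \<phi> g)"
      using that[OF \<phi>(1)] by (simp add: algebra_simps)
    ultimately show "\<bar>I f - c * I g\<bar> \<le> e" using \<phi>(2) d2 by linarith
  qed
  have add: "I (\<lambda>x. f x + g x) = I f + I g" if f: "f \<in> Cc_pos" and g: "g \<in> Cc_pos" for f g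
  proof (rule antisym)
    have fg: "(\<lambda>x. f x + g x) \<in> Cc_pos" by (rule Cc_pos_add[OF f g])
    show "I (\<lambda>x. f x + g x) \<le> I f + I g"
    proof (rule field_le_epsilon)
      fix e :: real assume e: "e > 0"
      obtain \<phi> where \<phi>: "nontrivial \<phi>" "\<bar>I f - N \<phi> f\<bar> < e/3" "\<bar>I g - N \<phi> g\<bar> < e/3"
          "\<bar>I (\<lambda>x. f x + g x) - N \<phi> (\<lambda>x. f x + g x)\<bar> < e/3"
        using near'[of "{f, g, \<lambda>x. f x + g x}" "e/3"] e by auto
      have "N \<phi> (\<lambda>x. f x + g x) \<le> N \<phi> f + N \<phi> g"
        using ratio_add[OF f g \<phi>(1)] ratio_pos[OF f0 \<phi>(1)] f g fg
        by (simp add: N_def divide_right_mono flip: add_divide_distrib)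
      then show "I (\<lambda>x. f x + g x) \<le> I f + I g + e" using \<phi>(2-4) by linarith
    qed
    show "I f + I g \<le> I (\<lambda>x. f x + g x)"
    proof (rule field_le_epsilon)
      fix e :: real assume e: "e > 0"
      have Cc1: "f \<in> Cc T" and Cc2: "g \<in> Cc T" using f g by (auto simp: Cc_pos_def)
      obtain C1 where C1: "compactin T C1" "\<And>x. x \<in> topspace T \<Longrightarrow> x \<notin> C1 \<Longrightarrow> f x = 0"
        using Cc_support[OF Cc1] by metis
      obtain C2 where C2: "compactin T C2" "\<And>x. x \<in> topspace T \<Longrightarrow> x \<notin> C2 \<Longrightarrow> g x = 0"
        using Cc_support[OF Cc2] by metis
      have "compactin T (C1 \<union> C2)" by (rule compactin_Un[OF C1(1) C2(1)])
      then obtain f' where f': "f' \<in> Cc T" "\<And>x. x \<in> topspace T \<Longrightarrow> 0 \<le> f' x" "\<And>x. x \<in> C1 \<union> C2 \<Longrightarrow> f' x = 1"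
        using bump_function[OF locally_compact hausdorff, of "C1 \<union> C2" "topspace T"]
        by (metis compactin_subset_topspace openin_topspace)
      have f'pos: "f' \<in> Cc_pos" using f' by (auto simp: Cc_pos_def topspace_eq)
      have f'1: "f' x = 1" if "x \<in> carrier G" "f x \<noteq> 0 \<or> g x \<noteq> 0" for x
        using that C1(2)[of x] C2(2)[of x] f'(3)[of x] by (auto simp: topspace_eq)
      define R where "R = ratio f0 (\<lambda>x. f x + g x)"
      define R' where "R' = ratio f0 f'"
      have R: "R \<ge> 0" "R' \<ge> 0"
        unfolding R_def R'_def by (rule ratio_nonneg[OF fg f0], rule ratio_nonneg[OF f'pos f0])
      \<comment> \<open>makes the error of almost additivity, relative to the bounds \<open>R\<close> and \<open>R'\<close> on the ratios, at most \<open>e / 4\<close>\<close>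
      define d where "d = min 1 (e / (4 * (2 * R + 3 * R' + 1)))"
      have d: "d > 0" "d \<le> 1" "d * (2 * R + 3 * R' + 1) \<le> e/4"
      proof -
        show "d > 0" "d \<le> 1" using e R by (auto simp: d_def intro!: divide_pos_pos)
        have "d * (2 * R + 3 * R' + 1) \<le> e / (4 * (2 * R + 3 * R' + 1)) * (2 * R + 3 * R' + 1)"
          using R by (intro mult_right_mono) (auto simp: d_def)
        also have "\<dots> = e / 4" using R by (simp add: field_simps)
        finally show "d * (2 * R + 3 * R' + 1) \<le> e/4" .
      qed
      obtain V where V: "openin T V" "\<one> \<in> V"
        "\<And>\<phi>. nontrivial \<phi> \<Longrightarrow> (\<forall>x\<in>carrier G - V. \<phi> x = 0) \<Longrightarrow>
          ratio \<phi> f + ratio \<phi> g \<le> (1 + 2 * d) * (ratio \<phi> (\<lambda>x. f x + g x) + d * ratio \<phi> f')"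
        using ratio_almost_additive[OF f g d(1) f'pos f'1] by blast
      obtain \<phi> where \<phi>: "nontrivial \<phi>" "\<forall>x\<in>carrier G - V. \<phi> x = 0" "\<bar>I f - N \<phi> f\<bar> < e/4" "\<bar>I g - N \<phi> g\<bar> < e/4"
          "\<bar>I (\<lambda>x. f x + g x) - N \<phi> (\<lambda>x. f x + g x)\<bar> < e/4"
        using near[OF V(1,2), of "{f, g, \<lambda>x. f x + g x}" "e/4"] e by auto
      have "N \<phi> f + N \<phi> g = (ratio \<phi> f + ratio \<phi> g) / ratio \<phi> f0"
        using f g by (simp add: N_def add_divide_distrib)
      also have "\<dots> \<le> ((1 + 2 * d) * (ratio \<phi> (\<lambda>x. f x + g x) + d * ratio \<phi> f')) / ratio \<phi> f0"
        using V(3)[OF \<phi>(1)] \<phi>(2) ratio_pos[OF f0 \<phi>(1)] by (intro divide_right_mono) auto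
      also have "\<dots> = (1 + 2 * d) * (N \<phi> (\<lambda>x. f x + g x) + d * N \<phi> f')"
        using fg f'pos by (simp add: N_def flip: add_divide_distrib)
      also have "\<dots> = N \<phi> (\<lambda>x. f x + g x) + d * (2 * N \<phi> (\<lambda>x. f x + g x) + N \<phi> f' + 2 * d * N \<phi> f')"
        by (simp add: algebra_simps)
      also have "\<dots> \<le> N \<phi> (\<lambda>x. f x + g x) + d * (2 * R + 3 * R' + 1)"
      proof -
        have "N \<phi> (\<lambda>x. f x + g x) \<le> R" "N \<phi> f' \<le> R'"
          using N_bound[OF \<phi>(1) fg] N_bound[OF \<phi>(1) f'pos] by (auto simp: R_def R'_def)
        moreover have "0 \<le> N \<phi> f'"
          using ratio_nonneg[OF f'pos \<phi>(1)] ratio_pos[OF f0 \<phi>(1)] by (simp add: N_def)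
        then have "d * N \<phi> f' \<le> N \<phi> f'"
          using d by (intro mult_left_le_one_le) auto
        ultimately have "2 * N \<phi> (\<lambda>x. f x + g x) + N \<phi> f' + 2 * d * N \<phi> f' \<le> 2 * R + 3 * R' + 1"
          by linarith
        then show ?thesis using d(1) by simp
      qed
      finally show "I f + I g \<le> I (\<lambda>x. f x + g x) + e" using \<phi>(3-5) d(3) by linarith
    qed
  qed
  have scale: "I (\<lambda>x. c * f x) = c * I f" if "c > 0" "f \<in> Cc_pos" for c f
    using ratio_scale[OF that(2) _ that(1)] Cc_pos_scale[OF that(2), of c] that
    by (intro N_eq) (simp add: N_def)
  have cong: "I f = I g" if f: "f \<in> Cc_pos" and fg: "\<And>x. x \<in> carrier G \<Longrightarrow> f x = g x" for f g
  proof -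
    have "g \<in> Cc_pos" using f fg Cc_cong[of f T g] by (auto simp: Cc_pos_def topspace_eq)
    then have "I f = 1 * I g"
      using f ratio_cong[OF fg] by (intro N_eq) (simp add: N_def)
    then show ?thesis by simp
  qed
  have translate: "I (\<lambda>x. f (t \<otimes> x)) = I f" if "f \<in> Cc_pos" "t \<in> carrier G" for f t
  proof -
    have "I (\<lambda>x. f (t \<otimes> x)) = 1 * I f"
      using ratio_translate[OF that(1) _ that(2)] Cc_pos_translate[OF that] that(1) by (intro N_eq) (simp add: N_def)
    then show ?thesis by simp
  qed
  define J where "J f = I (\<lambda>x. max (f x) 0) - I (\<lambda>x. max (- f x) 0)" for f
  have J: "positive_functional T J" "\<And>f. f \<in> Cc_pos \<Longrightarrow> J f = I f"
    unfolding J_def using positive_functional_from_cone[of I] add scale nonneg cong by blast+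
  show ?thesis
    unfolding left_Haar_def
  proof (intro exI[of _ J] conjI ballI impI)
    fix f t assume f: "f \<in> Cc T" and t: "t \<in> carrier G"
    have "(\<lambda>x. max (f x) 0) \<in> Cc_pos" "(\<lambda>x. max (- f x) 0) \<in> Cc_pos"
      using f by (auto simp: Cc_pos_def intro!: Cc_max Cc_minus Cc_zero)
    from this[THEN translate, OF t] show "J (\<lambda>x. f (t \<otimes> x)) = J f" by (simp add: J_def)
  next
    fix f assume "f \<in> Cc T" "(\<forall>x\<in>carrier G. 0 \<le> f x) \<and> (\<exists>x\<in>carrier G. 0 < f x)"
    then have f: "nontrivial f" "f \<in> Cc_pos" by (auto simp: nontrivial_def Cc_pos_def)
    have "0 < 1 / ratio f f0" using ratio_pos[OF f0 f(1)] by simp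
    with lower[OF f(1)] J(2)[OF f(2)] show "0 < J f" by linarith
  qed (rule J(1))
qed

end

section \<open>Integration over a closed subgroup\<close>

lemma (in locally_compact_group) locally_compact_group_subgroup:
  assumes "subgroup H G" "closedin T H"
  shows "locally_compact_group (G\<lparr>carrier := H\<rparr>) (subtopology T H)"
proof -
  interpret K: group "G\<lparr>carrier := H\<rparr>"
    using subgroup_imp_group[OF assms(1)] .
  have HG: "H \<subseteq> carrier G" using assms(1) by (rule subgroup.subset)
  have cont: "continuous_map (prod_topology (subtopology T H) (subtopology T H)) T (\<lambda>(x, y). x \<otimes> y)"
    unfolding case_prod_unfold
    by (intro continuous_map_mult continuous_map_into_fulltopology[OF continuous_map_fst]
          continuous_map_into_fulltopology[OF continuous_map_snd])
  show ?thesis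
  proof (unfold_locales)
    show "topspace (subtopology T H) = carrier (G\<lparr>carrier := H\<rparr>)"
      using HG by (auto simp: topspace_eq)
    show "continuous_map (prod_topology (subtopology T H) (subtopology T H)) (subtopology T H)
        (\<lambda>(x, y). x \<otimes>\<^bsub>G\<lparr>carrier := H\<rparr>\<^esub> y)"
      using cont assms(1) by (auto simp: continuous_map_in_subtopology subgroup.m_closed)
    have "continuous_map (subtopology T H) (subtopology T H) (\<lambda>x. inv x)"
      using continuous_map_from_subtopology[OF continuous_inv] assms(1)
      by (auto simp: continuous_map_in_subtopology subgroup.m_inv_closed)
    then show "continuous_map (subtopology T H) (subtopology T H) (\<lambda>x. inv\<^bsub>G\<lparr>carrier := H\<rparr>\<^esub> x)"
      by (rule continuous_map_eq) (use m_inv_consistent[OF assms(1)] in auto)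
    show "Hausdorff_space (subtopology T H)"
      by (rule Hausdorff_space_subtopology[OF hausdorff])
    show "locally_compact_space (subtopology T H)"
      by (rule locally_compact_space_closed_subset[OF locally_compact assms(2)])
  qed
qed

text \<open>Integration \<open>J\<close> against a left Haar measure of a closed subgroup \<open>H\<close>.\<close>

locale Haar_subgroup = locally_compact_group G T for G (structure) and T +
  fixes H and J
  assumes sub: "subgroup H G" and closed: "closedin T H"
    and Haar: "locally_compact_group.left_Haar (G\<lparr>carrier := H\<rparr>) (subtopology T H) J"
begin

abbreviation S where "S \<equiv> subtopology T H"

sublocale K: locally_compact_group "G\<lparr>carrier := H\<rparr>" "subtopology T H"
  by (rule locally_compact_group_subgroup[OF sub closed])

lemma HG: "h \<in> H \<Longrightarrow> h \<in> carrier G"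
  using subgroup.subset[OF sub] by auto

lemma H_closed [simp]: "h \<in> H \<Longrightarrow> k \<in> H \<Longrightarrow> h \<otimes> k \<in> H" "h \<in> H \<Longrightarrow> inv h \<in> H" "\<one> \<in> H"
  using sub by (auto simp: subgroup.m_closed subgroup.m_inv_closed subgroup.one_closed)

lemma topspace_S [simp]: "topspace S = H"
  using HG by (auto simp: topspace_eq)

lemma Cb_S_bounded: "f \<in> Cb S \<Longrightarrow> \<exists>s. \<forall>h\<in>H. \<bar>f h\<bar> \<le> s"
  by (simp add: Cb_def del: topspace_subtopology)

lemma J: "positive_functional S J"
  using Haar by (simp add: K.left_Haar_def)

lemma J_translate: "f \<in> Cc S \<Longrightarrow> t \<in> H \<Longrightarrow> J (\<lambda>h. f (t \<otimes> h)) = J f"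
  using Haar by (simp add: K.left_Haar_def)

lemma J_pos:
  assumes "f \<in> Cc S" "\<And>h. h \<in> H \<Longrightarrow> 0 \<le> f h" "h \<in> H" "0 < f h"
  shows "0 < J f"
proof -
  have "(\<forall>x\<in>H. 0 \<le> f x) \<and> (\<exists>x\<in>H. 0 < f x) \<longrightarrow> 0 < J f"
    using Haar assms(1) by (simp add: K.left_Haar_def)
  with assms(2-4) show ?thesis by blast
qed

lemma continuous_map_from_S: "continuous_map T Z f \<Longrightarrow> continuous_map S Z f"
  by (rule continuous_map_from_subtopology)

lemma compactin_S: "compactin T C \<Longrightarrow> compactin S (H \<inter> C)"
  using closed_Int_compactin[OF closed] by (simp add: compactin_subtopology)

lemma integral_parameter:
  assumes cont: "continuous_map (prod_topology T S) euclideanreal (\<lambda>(x, h). F x h)"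
    and supp: "\<And>K. compactin T K \<Longrightarrow> \<exists>C. compactin T C \<and> (\<forall>x\<in>K. \<forall>h\<in>H - C. F x h = 0)"
  shows "x \<in> carrier G \<Longrightarrow> F x \<in> Cc S" "continuous_map T euclideanreal (\<lambda>x. J (F x))"
proof -
  have *: "\<exists>U C. openin T U \<and> x \<in> U \<and> compactin S C \<and> (\<forall>u\<in>U. \<forall>y\<in>topspace S - C. F u y = 0)"
    if xT: "x \<in> topspace T" for x
  proof -
    obtain U K where U: "openin T U" "compactin T K" "x \<in> U" "U \<subseteq> K"
      using locally_compact xT unfolding locally_compact_space_def by meson
    obtain C where "compactin T C" "\<forall>x\<in>K. \<forall>h\<in>H - C. F x h = 0"
      using supp[OF U(2)] by blast
    then show ?thesis
      using U compactin_S by (intro exI[of _ U] exI[of _ "H \<inter> C"]) auto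
  qed
  show "x \<in> carrier G \<Longrightarrow> F x \<in> Cc S"
    using continuous_map_pf_parameter(1)[OF J K.locally_compact K.hausdorff cont *] by (simp add: topspace_eq)
  show "continuous_map T euclideanreal (\<lambda>x. J (F x))"
    using continuous_map_pf_parameter(2)[OF J K.locally_compact K.hausdorff cont *] by simp
qed

section \<open>From functions on the subgroup to functions on the group\<close>

text \<open>This average intertwines the left translations by \<open>H\<close> of functions on \<open>H\<close> with those of functions
  on \<open>G\<close>.\<close>

definition average :: "('a \<Rightarrow> real) \<Rightarrow> ('a \<Rightarrow> real) \<Rightarrow> 'a \<Rightarrow> real" where
  "average \<beta> f x = J (\<lambda>h. \<beta> (inv h \<otimes> x) * f h)"

lemma average_integrand:
  assumes \<beta>: "\<beta> \<in> Cc T" and f: "continuous_map S euclideanreal f"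
  shows "x \<in> carrier G \<Longrightarrow> (\<lambda>h. \<beta> (inv h \<otimes> x) * f h) \<in> Cc S"
    and "continuous_map T euclideanreal (average \<beta> f)"
proof -
  have snd: "continuous_map (prod_topology T S) T snd"
    by (rule continuous_map_into_fulltopology[OF continuous_map_snd])
  have "continuous_map (prod_topology T S) T (\<lambda>z. inv (snd z) \<otimes> fst z)"
    by (intro continuous_map_mult continuous_map_inv snd continuous_map_fst)
  from continuous_map_compose[OF this Cc_continuous[OF \<beta>]] continuous_map_compose[OF continuous_map_snd f]
  have cont: "continuous_map (prod_topology T S) euclideanreal (\<lambda>(x, h). \<beta> (inv h \<otimes> x) * f h)"
    unfolding case_prod_unfold o_def by (intro continuous_map_real_mult)
  obtain C where C: "compactin T C" "\<And>x. x \<in> topspace T \<Longrightarrow> x \<notin> C \<Longrightarrow> \<beta> x = 0"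
    using Cc_support[OF \<beta>] by metis
  have supp: "\<exists>D. compactin T D \<and> (\<forall>x\<in>K. \<forall>h\<in>H - D. \<beta> (inv h \<otimes> x) * f h = 0)" if K: "compactin T K" for K
  proof (intro exI[of _ "K <#> m_inv G ` C"] conjI ballI)
    show "compactin T (K <#> m_inv G ` C)"
      by (intro compactin_set_mult compactin_inverse K C)
    fix x h assume x: "x \<in> K" and h: "h \<in> H - (K <#> m_inv G ` C)"
    have xG: "x \<in> carrier G" using compactin_carrier[OF K] x by auto
    have hG: "h \<in> carrier G" using h HG by blast
    have "h = x \<otimes> inv (inv h \<otimes> x)"
      using xG hG by (simp add: inv_mult_group m_assoc[symmetric])
    then have "inv h \<otimes> x \<notin> C"
      using h x unfolding set_mult_def by blast
    then show "\<beta> (inv h \<otimes> x) * f h = 0"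
      using C(2) xG h HG by (simp add: topspace_eq)
  qed
  show "x \<in> carrier G \<Longrightarrow> (\<lambda>h. \<beta> (inv h \<otimes> x) * f h) \<in> Cc S"
    using integral_parameter(1)[OF cont supp] .
  show "continuous_map T euclideanreal (average \<beta> f)"
    using integral_parameter(2)[OF cont supp] by (simp add: average_def[abs_def])
qed

lemma continuous_one: "continuous_map X euclideanreal (\<lambda>_. 1)"
  by simp

lemma average_translate:
  assumes \<beta>: "\<beta> \<in> Cc T" and f: "continuous_map S euclideanreal f" and t: "t \<in> H" and x: "x \<in> carrier G"
  shows "average \<beta> (\<lambda>h. f (t \<otimes> h)) x = average \<beta> f (t \<otimes> x)"
proof -
  have tG: "t \<in> carrier G" using t HG by auto
  have mem: "(\<lambda>h. \<beta> (inv h \<otimes> (t \<otimes> x)) * f h) \<in> Cc S"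
    by (rule average_integrand(1)[OF \<beta> f]) (use tG x in auto)
  have "average \<beta> f (t \<otimes> x) = J (\<lambda>h. \<beta> (inv (t \<otimes> h) \<otimes> (t \<otimes> x)) * f (t \<otimes> h))"
    using J_translate[OF mem t] by (simp add: average_def)
  also have "\<dots> = J (\<lambda>h. \<beta> (inv h \<otimes> x) * f (t \<otimes> h))"
  proof (rule pf_cong[OF J])
    show "(\<lambda>h. \<beta> (inv (t \<otimes> h) \<otimes> (t \<otimes> x)) * f (t \<otimes> h)) \<in> Cc S"
      using K.Cc_left_translate[OF mem] t by simp
    fix h assume "h \<in> topspace S"
    then have "inv (t \<otimes> h) \<otimes> (t \<otimes> x) = inv h \<otimes> x"
      using tG x HG by (simp add: inv_mult_group m_assoc inv_solve_left')
    then show "\<beta> (inv (t \<otimes> h) \<otimes> (t \<otimes> x)) * f (t \<otimes> h) = \<beta> (inv h \<otimes> x) * f (t \<otimes> h)" by simp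
  qed
  finally show ?thesis by (simp add: average_def)
qed

lemma average_abs_le:
  assumes \<beta>: "\<beta> \<in> Cc T" "\<And>x. x \<in> carrier G \<Longrightarrow> 0 \<le> \<beta> x" and f: "continuous_map S euclideanreal f"
    and s: "\<And>h. h \<in> H \<Longrightarrow> \<bar>f h\<bar> \<le> s" and x: "x \<in> carrier G"
  shows "\<bar>average \<beta> f x\<bar> \<le> s * average \<beta> (\<lambda>_. 1) x"
proof -
  note mem = average_integrand(1)[OF \<beta>(1) f x] average_integrand(1)[OF \<beta>(1) continuous_one x]
  have "\<bar>average \<beta> f x\<bar> \<le> J (\<lambda>h. s * (\<beta> (inv h \<otimes> x) * 1))"
    unfolding average_def
  proof (rule pf_abs_le[OF J mem(1) Cc_scale[OF mem(2)]])
    fix h assume "h \<in> topspace S"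
    then have "0 \<le> \<beta> (inv h \<otimes> x)" "\<bar>f h\<bar> \<le> s"
      using \<beta>(2) x HG s by auto
    then show "\<bar>\<beta> (inv h \<otimes> x) * f h\<bar> \<le> s * (\<beta> (inv h \<otimes> x) * 1)"
      using mult_right_mono[of "\<bar>f h\<bar>" s "\<beta> (inv h \<otimes> x)"] by (simp add: abs_mult mult.commute)
  qed
  also have "\<dots> = s * average \<beta> (\<lambda>_. 1) x"
    unfolding average_def by (rule pf_scale[OF J mem(2)])
  finally show ?thesis .
qed

lemma average_one_nonneg:
  assumes "\<beta> \<in> Cc T" "\<And>x. x \<in> carrier G \<Longrightarrow> 0 \<le> \<beta> x" "x \<in> carrier G"
  shows "0 \<le> average \<beta> (\<lambda>_. 1) x"
  unfolding average_def
  using assms HG by (intro pf_nonneg[OF J average_integrand(1)[OF assms(1) continuous_one assms(3)]]) auto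

text \<open>The average of 1 is invariant under \<open>H\<close> and supported on the \<open>H\<close>-saturation of a compact set, so its
  supremum is attained on that compact set.\<close>

lemma average_one_bounded:
  assumes \<beta>: "\<beta> \<in> Cc T"
  obtains B where "B > 0" "\<And>x. x \<in> carrier G \<Longrightarrow> \<bar>average \<beta> (\<lambda>_. 1) x\<bar> \<le> B"
proof -
  obtain C where C: "compactin T C" "\<And>x. x \<in> topspace T \<Longrightarrow> x \<notin> C \<Longrightarrow> \<beta> x = 0"
    using Cc_support[OF \<beta>] by metis
  obtain B where B: "B > 0" "\<And>x. x \<in> C \<Longrightarrow> \<bar>average \<beta> (\<lambda>_. 1) x\<bar> \<le> B"
    using continuous_map_bounded_on_compact[OF average_integrand(2)[OF \<beta> continuous_one] C(1)] by metis
  show thesis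
  proof (rule that[OF B(1)])
    fix x assume x: "x \<in> carrier G"
    show "\<bar>average \<beta> (\<lambda>_. 1) x\<bar> \<le> B"
    proof (cases "\<exists>h\<in>H. inv h \<otimes> x \<in> C")
      case True
      then obtain h where h: "h \<in> H" "inv h \<otimes> x \<in> C" by blast
      have "average \<beta> (\<lambda>_. 1) (inv h \<otimes> x) = average \<beta> (\<lambda>_. 1) x"
        using average_translate[OF \<beta> continuous_one, of "inv h" x] h(1) x by simp
      with B(2)[OF h(2)] show ?thesis by simp
    next
      case False
      have "average \<beta> (\<lambda>_. 1) x = J (\<lambda>_. 0)"
        unfolding average_def
        by (rule pf_cong[OF J average_integrand(1)[OF \<beta> continuous_one x]])
           (use False C(2) x HG in \<open>auto simp: topspace_eq\<close>)
      then show ?thesis using pf_zero[OF J] B(1) by simp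
    qed
  qed
qed

lemma average_linear:
  assumes \<beta>: "\<beta> \<in> Cc T" and f: "continuous_map S euclideanreal f" and g: "continuous_map S euclideanreal g"
    and x: "x \<in> carrier G"
  shows "average \<beta> (\<lambda>h. f h + g h) x = average \<beta> f x + average \<beta> g x"
    and "average \<beta> (\<lambda>h. c * f h) x = c * average \<beta> f x"
proof -
  show "average \<beta> (\<lambda>h. f h + g h) x = average \<beta> f x + average \<beta> g x"
    unfolding average_def distrib_left
    by (rule pf_add[OF J average_integrand(1)[OF \<beta> f x] average_integrand(1)[OF \<beta> g x]])
  show "average \<beta> (\<lambda>h. c * f h) x = c * average \<beta> f x"
    unfolding average_def mult.left_commute[of _ c]
    by (rule pf_scale[OF J average_integrand(1)[OF \<beta> f x]])
qed

end

text \<open>The subgroup generated by a compact symmetric neighbourhood of the identity.\<close>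

lemma (in locally_compact_group) open_sigma_compact_subgroup:
  obtains S where "\<And>n::nat. compactin T (S n)" "subgroup (\<Union>n. S n) G" "openin T (\<Union>n. S n)"
proof -
  obtain U K0 where U: "openin T U" "compactin T K0" "\<one> \<in> U" "U \<subseteq> K0"
    using compact_neighbourhood_of_one .
  define K where "K = K0 \<union> m_inv G ` K0"
  have K: "compactin T K" unfolding K_def by (intro compactin_Un U compactin_inverse)
  have KG: "K \<subseteq> carrier G" by (rule compactin_carrier[OF K])
  have K1: "\<one> \<in> K" "U \<subseteq> K" using U by (auto simp: K_def)
  have Kinv: "inv x \<in> K" if "x \<in> K" for x
    using that compactin_carrier[OF U(2)] by (auto simp: K_def)
  define S where "S n = ((\<lambda>A. A <#> K) ^^ n) K" for n
  have S_0: "S 0 = K" and S_Suc: "S (Suc n) = S n <#> K" for n by (simp_all add: S_def)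
  have S_compact: "compactin T (S n)" for n
    by (induction n) (simp_all add: S_0 S_Suc K compactin_set_mult)
  have SG: "S n \<subseteq> carrier G" for n by (rule compactin_carrier[OF S_compact])
  have S_mult: "x \<otimes> y \<in> S (Suc (m + n))" if "x \<in> S m" "y \<in> S n" for x y m n
    using that
  proof (induction n arbitrary: y)
    case 0
    then show ?case by (auto simp: S_0 S_Suc set_mult_def)
  next
    case (Suc n)
    then obtain a b where ab: "a \<in> S n" "b \<in> K" "y = a \<otimes> b" by (auto simp: S_Suc set_mult_def)
    have "x \<otimes> y = (x \<otimes> a) \<otimes> b"
      using ab Suc.prems SG KG by (metis m_assoc subsetD)
    with Suc.IH[OF Suc.prems(1) ab(1)] ab(2) show ?case
      by (auto simp: S_Suc[of "Suc (m + n)"] set_mult_def simp del: S_Suc)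
  qed
  have S_inv: "inv x \<in> S n" if "x \<in> S n" for x n
    using that
  proof (induction n arbitrary: x)
    case 0
    then show ?case by (simp add: S_0 Kinv)
  next
    case (Suc n)
    then obtain a b where ab: "a \<in> S n" "b \<in> K" "x = a \<otimes> b" by (auto simp: S_Suc set_mult_def)
    have "inv x = inv b \<otimes> inv a"
      using ab SG KG by (metis inv_mult_group subsetD)
    with S_mult[of "inv b" 0 "inv a" n] Suc.IH[OF ab(1)] Kinv[OF ab(2)] show ?case
      by (simp add: S_0)
  qed
  show thesis
  proof (rule that[of S])
    show "subgroup (\<Union>n. S n) G"
    proof (rule subgroupI)
      show "(\<Union>n. S n) \<subseteq> carrier G" using SG by blast
      have "\<one> \<in> S 0" using K1 by (simp add: S_0)
      then show "(\<Union>n. S n) \<noteq> {}" by blast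
      show "inv x \<in> (\<Union>n. S n)" if "x \<in> (\<Union>n. S n)" for x
        using that S_inv by blast
      show "x \<otimes> y \<in> (\<Union>n. S n)" if "x \<in> (\<Union>n. S n)" "y \<in> (\<Union>n. S n)" for x y
      proof -
        obtain m n where "x \<in> S m" "y \<in> S n" using \<open>x \<in> (\<Union>n. S n)\<close> \<open>y \<in> (\<Union>n. S n)\<close> by blast
        from S_mult[OF this] show ?thesis by blast
      qed
    qed
    have "\<exists>V. openin T V \<and> x \<in> V \<and> V \<subseteq> (\<Union>n. S n)" if x: "x \<in> (\<Union>n. S n)" for x
    proof -
      obtain n where n: "x \<in> S n" using x by blast
      have xG: "x \<in> carrier G" using n SG by blast
      have "openin T {y \<in> carrier G. inv x \<otimes> y \<in> U}"
        by (rule openin_translate(1)[OF U(1)]) (use xG in simp)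
      moreover have "{y \<in> carrier G. inv x \<otimes> y \<in> U} \<subseteq> (\<Union>n. S n)"
      proof
        fix y assume y: "y \<in> {y \<in> carrier G. inv x \<otimes> y \<in> U}"
        then have eq: "x \<otimes> (inv x \<otimes> y) = y" using xG by (simp add: m_assoc[symmetric])
        have "x \<otimes> (inv x \<otimes> y) \<in> S (Suc (n + 0))"
          by (rule S_mult[OF n]) (use y K1 in \<open>auto simp: S_0\<close>)
        then show "y \<in> (\<Union>n. S n)" unfolding eq by blast
      qed
      ultimately show ?thesis using xG U(3) by (intro exI[of _ "{y \<in> carrier G. inv x \<otimes> y \<in> U}"]) auto
    qed
    then show "openin T (\<Union>n. S n)" by (subst openin_subopen) blast
  qed (rule S_compact)
qed

lemma continuous_map_suminf:
  fixes f :: "nat \<Rightarrow> 'a \<Rightarrow> real"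
  assumes cont: "\<And>n. continuous_map X euclideanreal (f n)"
    and bound: "\<And>n x. x \<in> topspace X \<Longrightarrow> \<bar>f n x\<bar> \<le> M n" and M: "summable M"
  shows "continuous_map X euclideanreal (\<lambda>x. \<Sum>n. f n x)"
  unfolding continuous_map_real_iff
proof (intro ballI allI impI)
  fix x and e :: real assume x: "x \<in> topspace X" and e: "e > 0"
  have sf: "summable (\<lambda>n. f n y)" if "y \<in> topspace X" for y
    by (rule summable_comparison_test'[OF M]) (use bound[OF that] in auto)
  have "(\<lambda>n. \<Sum>k. M (k + n)) \<longlonglongrightarrow> 0"
    by (rule suminf_exist_split2[OF M])
  then have "\<forall>\<^sub>F n in sequentially. \<bar>\<Sum>k. M (k + n)\<bar> < e/3"
    using e by (auto simp: tendsto_iff dist_real_def dest!: spec[of _ "e/3"])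
  then obtain n where n: "\<bar>\<Sum>k. M (k + n)\<bar> < e/3" by (auto simp: eventually_sequentially)
  have tail: "\<bar>(\<Sum>k. f k y) - (\<Sum>k<n. f k y)\<bar> < e/3" if y: "y \<in> topspace X" for y
  proof -
    have "(\<Sum>k. f k y) - (\<Sum>k<n. f k y) = (\<Sum>k. f (k + n) y)"
      using suminf_minus_initial_segment[OF sf[OF y], of n] by simp
    also have "\<bar>\<dots>\<bar> \<le> (\<Sum>k. M (k + n))"
      using norm_suminf_le[of "\<lambda>k. f (k + n) y" "\<lambda>k. M (k + n)"] bound[OF y] summable_ignore_initial_segment[OF M, of n]
      by simp
    finally show ?thesis using n by linarith
  qed
  have "continuous_map X euclideanreal (\<lambda>x. \<Sum>k<n. f k x)"
    using cont by (intro continuous_intros) auto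
  then obtain U where U: "openin X U" "x \<in> U" "\<And>y. y \<in> U \<Longrightarrow> \<bar>(\<Sum>k<n. f k y) - (\<Sum>k<n. f k x)\<bar> < e/3"
    using x e unfolding continuous_map_real_iff by (meson divide_pos_pos zero_less_numeral)
  have "\<bar>(\<Sum>k. f k y) - (\<Sum>k. f k x)\<bar> < e" if "y \<in> U" for y
  proof -
    have "y \<in> topspace X" using that openin_subset[OF U(1)] by blast
    then show ?thesis using tail[of y] tail[OF x] U(3)[OF that] by linarith
  qed
  then show "\<exists>U. openin X U \<and> x \<in> U \<and> (\<forall>y\<in>U. \<bar>(\<Sum>k. f k y) - (\<Sum>k. f k x)\<bar> < e)"
    using U by blast
qed

context Haar_subgroup
begin

text \<open>Normalized averages \<open>\<integral> \<beta>(h\<^sup>-\<^sup>1 x) f(h) dh / \<integral> \<beta>(h\<^sup>-\<^sup>1 x) dh\<close>. The weight \<open>\<beta>\<close> must be positive somewhere on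
  every coset \<open>H x\<close>, which a single function of compact support cannot achieve in general. The double cosets of
  \<open>H\<close> and a \<open>\<sigma>\<close>-compact open subgroup are open and partition \<open>G\<close>; on each of them the averages are
  summed over a sequence of functions of compact support that depends only on the representative
  \<open>r x\<close> of the double coset.\<close>

theorem equivariant_extension:
  obtains E :: "('a \<Rightarrow> real) \<Rightarrow> 'a \<Rightarrow> real" where
    "\<And>f. f \<in> Cb S \<Longrightarrow> E f \<in> Cb T"
    "\<And>f s x. f \<in> Cb S \<Longrightarrow> (\<And>h. h \<in> H \<Longrightarrow> \<bar>f h\<bar> \<le> s) \<Longrightarrow> x \<in> carrier G \<Longrightarrow> \<bar>E f x\<bar> \<le> s"
    "\<And>f g x. f \<in> Cb S \<Longrightarrow> g \<in> Cb S \<Longrightarrow> x \<in> carrier G \<Longrightarrow> E (\<lambda>h. f h + g h) x = E f x + E g x"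
    "\<And>c f x. f \<in> Cb S \<Longrightarrow> x \<in> carrier G \<Longrightarrow> E (\<lambda>h. c * f h) x = c * E f x"
    "\<And>x. x \<in> carrier G \<Longrightarrow> E (\<lambda>_. 1) x = 1"
    "\<And>f t x. f \<in> Cb S \<Longrightarrow> t \<in> H \<Longrightarrow> x \<in> carrier G \<Longrightarrow> E (\<lambda>h. f (t \<otimes> h)) x = E f (t \<otimes> x)"
proof -
  obtain L where L: "\<And>n::nat. compactin T (L n)" "subgroup (\<Union>n. L n) G" "openin T (\<Union>n. L n)"
    using open_sigma_compact_subgroup by metis
  define G0 where "G0 = (\<Union>n. L n)"
  have G0G: "g \<in> carrier G" if "g \<in> G0" for g using L(2) that subgroup.subset unfolding G0_def by blast
  have G0: "g \<otimes> k \<in> G0" "inv g \<in> G0" "\<one> \<in> G0" if "g \<in> G0" "k \<in> G0" for g k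
    using L(2) that unfolding G0_def[symmetric]
    by (auto simp: subgroup.m_closed subgroup.m_inv_closed subgroup.one_closed)
  have one_G0: "\<one> \<in> G0" using L(2) unfolding G0_def[symmetric] by (rule subgroup.one_closed)
  define D where "D x = {h \<otimes> x \<otimes> g |h g. h \<in> H \<and> g \<in> G0}" for x
  have DG: "y \<in> carrier G" if "x \<in> carrier G" "y \<in> D x" for x y
    using that HG G0G by (auto simp: D_def)
  have D_self: "x \<in> D x" if "x \<in> carrier G" for x
  proof -
    have "x = \<one> \<otimes> x \<otimes> \<one>" using that by simp
    then show ?thesis using one_G0 H_closed(3) unfolding D_def by blast
  qed
  have D_sub: "D y \<subseteq> D x" if "x \<in> carrier G" "y \<in> D x" for x y
  proof
    fix z assume "z \<in> D y"
    then obtain h g where z: "z = h \<otimes> y \<otimes> g" "h \<in> H" "g \<in> G0" by (auto simp: D_def)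
    obtain h' g' where y: "y = h' \<otimes> x \<otimes> g'" "h' \<in> H" "g' \<in> G0" using \<open>y \<in> D x\<close> by (auto simp: D_def)
    have "z = (h \<otimes> h') \<otimes> x \<otimes> (g' \<otimes> g)"
      using z y that(1) HG G0G by (simp add: m_assoc)
    then show "z \<in> D x" using z y G0 unfolding D_def by (metis (mono_tags, lifting) H_closed(1) mem_Collect_eq)
  qed
  have D_eq: "D y = D x" if x: "x \<in> carrier G" and y: "y \<in> D x" for x y
  proof -
    obtain h g where hg: "y = h \<otimes> x \<otimes> g" "h \<in> H" "g \<in> G0" using y by (auto simp: D_def)
    have "x = inv h \<otimes> y \<otimes> inv g"
      using hg x HG G0G by (simp add: m_assoc) (simp add: m_assoc[symmetric])
    then have "x \<in> D y" using hg G0 unfolding D_def by (metis (mono_tags, lifting) H_closed(2) mem_Collect_eq)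
    then show ?thesis using D_sub[OF x y] D_sub[OF DG[OF x y]] by blast
  qed
  have D_open: "openin T (D x)" if x: "x \<in> carrier G" for x
  proof (subst openin_subopen, intro ballI)
    fix y assume y: "y \<in> D x"
    have yG: "y \<in> carrier G" by (rule DG[OF x y])
    have "openin T {z \<in> carrier G. inv y \<otimes> z \<in> G0}"
      unfolding G0_def by (rule openin_translate(1)[OF L(3)]) (use yG in simp)
    moreover have "z \<in> D x" if z: "z \<in> carrier G" "inv y \<otimes> z \<in> G0" for z
    proof -
      have "z = \<one> \<otimes> y \<otimes> (inv y \<otimes> z)" using z yG by (simp add: m_assoc[symmetric])
      then have "z \<in> D y" using z(2) H_closed(3) unfolding D_def by blast
      then show ?thesis using D_sub[OF x y] by blast
    qed
    ultimately show "\<exists>V. openin T V \<and> y \<in> V \<and> V \<subseteq> D x"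
      using yG one_G0 by (intro exI[of _ "{z \<in> carrier G. inv y \<otimes> z \<in> G0}"]) auto
  qed
  define r where "r x = (SOME y. y \<in> D x)" for x
  have r_mem: "r x \<in> D x" if "x \<in> carrier G" for x
    unfolding r_def using D_self[OF that] by (rule someI)
  have r_eq: "r y = r x" if "x \<in> carrier G" "y \<in> D x" for x y
    using D_eq[OF that] by (simp add: r_def)
  \<comment> \<open>the \<open>n\<close>-th weight is positive on the \<open>n\<close>-th compact piece of the coset of \<open>y\<close>, and scaled down for the series to converge\<close>
  define P where "P y n \<beta> \<longleftrightarrow> \<beta> \<in> Cc T \<and> (\<forall>x\<in>carrier G. 0 \<le> \<beta> x) \<and>
      (\<forall>x\<in>carrier G. average \<beta> (\<lambda>_. 1) x \<le> (1/2)^n) \<and> (\<forall>g\<in>L n. \<beta> (y \<otimes> g) > 0)" for y n \<beta>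
  have "\<exists>\<beta>. P y n \<beta>" if y: "y \<in> carrier G" for y n
  proof -
    have "compactin T ((\<lambda>g. y \<otimes> g) ` L n)"
      by (rule image_compactin[OF L(1) continuous_translate(1)[OF y]])
    then obtain b where b: "b \<in> Cc T" "\<And>x. x \<in> topspace T \<Longrightarrow> 0 \<le> b x" "\<And>x. x \<in> (\<lambda>g. y \<otimes> g) ` L n \<Longrightarrow> b x = 1"
      using bump_function[OF locally_compact hausdorff, of "(\<lambda>g. y \<otimes> g) ` L n" "topspace T"]
      by (metis compactin_subset_topspace openin_topspace)
    obtain B where B: "B > 0" "\<And>x. x \<in> carrier G \<Longrightarrow> \<bar>average b (\<lambda>_. 1) x\<bar> \<le> B"
      using average_one_bounded[OF b(1)] by metis
    define c where "c = (1/2)^n / B"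
    have c: "c > 0" using B by (simp add: c_def)
    have "average (\<lambda>x. c * b x) (\<lambda>_. 1) x = c * average b (\<lambda>_. 1) x" if "x \<in> carrier G" for x
      using pf_scale[OF J average_integrand(1)[OF b(1) continuous_one that], of c]
      by (simp add: average_def)
    moreover have "c * average b (\<lambda>_. 1) x \<le> (1/2)^n" if "x \<in> carrier G" for x
    proof -
      have "c * average b (\<lambda>_. 1) x \<le> c * B"
        using B(2)[OF that] c by (intro mult_left_mono) auto
      then show ?thesis using B(1) by (simp add: c_def)
    qed
    ultimately show ?thesis
      using b c unfolding P_def by (intro exI[of _ "\<lambda>x. c * b x"]) (auto simp: topspace_eq intro: Cc_scale)
  qed
  then obtain \<beta> where "\<And>y n. y \<in> carrier G \<Longrightarrow> P y n (\<beta> y n)" by metis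
  then have \<beta>: "\<And>y n. y \<in> carrier G \<Longrightarrow> \<beta> y n \<in> Cc T"
    "\<And>y n x. y \<in> carrier G \<Longrightarrow> x \<in> carrier G \<Longrightarrow> 0 \<le> \<beta> y n x"
    "\<And>y n x. y \<in> carrier G \<Longrightarrow> x \<in> carrier G \<Longrightarrow> average (\<beta> y n) (\<lambda>_. 1) x \<le> (1/2)^n"
    "\<And>y n g. y \<in> carrier G \<Longrightarrow> g \<in> L n \<Longrightarrow> \<beta> y n (y \<otimes> g) > 0"
    unfolding P_def by blast+
  have geo: "summable (\<lambda>n. s * (1/2)^n)" for s :: real
    by (intro summable_mult summable_geometric) simp
  define N where "N y f x = (\<Sum>n. average (\<beta> y n) f x)" for y f x
  have term_le: "\<bar>average (\<beta> y n) f x\<bar> \<le> s * (1/2)^n"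
    if "y \<in> carrier G" "x \<in> carrier G" "continuous_map S euclideanreal f" "\<And>h. h \<in> H \<Longrightarrow> \<bar>f h\<bar> \<le> s" for y n f s x
  proof -
    have "s \<ge> 0" using that(4)[OF H_closed(3)] by linarith
    have "\<bar>average (\<beta> y n) f x\<bar> \<le> s * average (\<beta> y n) (\<lambda>_. 1) x"
      using that \<beta> by (intro average_abs_le) auto
    also have "\<dots> \<le> s * (1/2)^n" using \<beta>(3)[OF that(1,2)] \<open>s \<ge> 0\<close> by (intro mult_left_mono) auto
    finally show ?thesis .
  qed
  have N_summable: "summable (\<lambda>n. average (\<beta> y n) f x)"
    if "y \<in> carrier G" "x \<in> carrier G" "f \<in> Cb S" for y f x
  proof -
    have "\<exists>s. \<forall>h\<in>H. \<bar>f h\<bar> \<le> s" by (rule Cb_S_bounded[OF that(3)])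
    then obtain s where "\<And>h. h \<in> H \<Longrightarrow> \<bar>f h\<bar> \<le> s" by blast
    then show ?thesis
      using term_le[OF that(1,2) Cb_continuous[OF that(3)]] by (intro summable_comparison_test'[OF geo[of s]]) auto
  qed
  have N_cont: "continuous_map T euclideanreal (N y f)" if y: "y \<in> carrier G" and f: "f \<in> Cb S" for y f
  proof -
    have "\<exists>s. \<forall>h\<in>H. \<bar>f h\<bar> \<le> s" by (rule Cb_S_bounded[OF f])
    then obtain s where s: "\<And>h. h \<in> H \<Longrightarrow> \<bar>f h\<bar> \<le> s" by blast
    have "continuous_map T euclideanreal (\<lambda>x. \<Sum>n. average (\<beta> y n) f x)"
    proof (rule continuous_map_suminf[OF _ _ geo[of s]])
      show "continuous_map T euclideanreal (average (\<beta> y n) f)" for n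
        by (rule average_integrand(2)[OF \<beta>(1)[OF y] Cb_continuous[OF f]])
      show "\<bar>average (\<beta> y n) f x\<bar> \<le> s * (1/2)^n" if "x \<in> topspace T" for n x
        using term_le[OF y _ Cb_continuous[OF f] s] that by (simp add: topspace_eq)
    qed
    then show ?thesis by (simp add: N_def[abs_def])
  qed
  have one_Cb: "(\<lambda>_. 1) \<in> Cb S" by (rule CbI[of _ _ 1]) auto
  have N_one_pos: "N (r x) (\<lambda>_. 1) x > 0" if x: "x \<in> carrier G" for x
  proof -
    have rG: "r x \<in> carrier G" using DG[OF x r_mem[OF x]] .
    have "x \<in> D (r x)" using D_eq[OF x r_mem[OF x]] D_self[OF x] by simp
    then obtain h g where hg: "x = h \<otimes> r x \<otimes> g" "h \<in> H" "g \<in> G0" by (auto simp: D_def)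
    obtain n where n: "g \<in> L n" using hg(3) by (auto simp: G0_def)
    have "inv h \<otimes> x = r x \<otimes> g"
    proof -
      have "inv h \<otimes> (h \<otimes> r x \<otimes> g) = r x \<otimes> g"
        using hg(2,3) rG HG G0G by (simp add: m_assoc) (simp add: m_assoc[symmetric])
      then show ?thesis using hg(1) by simp
    qed
    then have "\<beta> (r x) n (inv h \<otimes> x) > 0" using \<beta>(4)[OF rG n] by simp
    then have pos: "average (\<beta> (r x) n) (\<lambda>_. 1) x > 0"
      unfolding average_def
      using \<beta>(2)[OF rG] x hg(2) HG
      by (intro J_pos[OF average_integrand(1)[OF \<beta>(1)[OF rG] continuous_one x], where h=h]) auto
    have "(\<Sum>k\<in>{n}. average (\<beta> (r x) k) (\<lambda>_. 1) x) \<le> N (r x) (\<lambda>_. 1) x"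
      unfolding N_def
      by (rule sum_le_suminf[OF N_summable[OF rG x one_Cb]])
         (simp_all add: average_one_nonneg[OF \<beta>(1)[OF rG] \<beta>(2)[OF rG] x])
    with pos show ?thesis by simp
  qed
  define E where "E f x = N (r x) f x / N (r x) (\<lambda>_. 1) x" for f x
  have rG: "r x \<in> carrier G" if "x \<in> carrier G" for x using DG[OF that r_mem[OF that]] .
  have E_le: "\<bar>E f x\<bar> \<le> s" if f: "f \<in> Cb S" and s: "\<And>h. h \<in> H \<Longrightarrow> \<bar>f h\<bar> \<le> s" and x: "x \<in> carrier G" for f s x
  proof -
    have "norm (\<Sum>n. average (\<beta> (r x) n) f x) \<le> (\<Sum>n. s * average (\<beta> (r x) n) (\<lambda>_. 1) x)"
    proof (rule norm_suminf_le)
      show "norm (average (\<beta> (r x) n) f x) \<le> s * average (\<beta> (r x) n) (\<lambda>_. 1) x" for n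
        using average_abs_le[OF \<beta>(1)[OF rG[OF x]] \<beta>(2)[OF rG[OF x]] Cb_continuous[OF f] s x] by simp
    qed (intro summable_mult N_summable[OF rG[OF x] x one_Cb])
    also have "\<dots> = s * N (r x) (\<lambda>_. 1) x"
      unfolding N_def by (rule suminf_mult[OF N_summable[OF rG[OF x] x one_Cb]])
    finally have "\<bar>N (r x) f x\<bar> \<le> s * N (r x) (\<lambda>_. 1) x" by (simp add: N_def)
    moreover have "\<bar>E f x\<bar> = \<bar>N (r x) f x\<bar> / N (r x) (\<lambda>_. 1) x"
      unfolding E_def abs_divide using N_one_pos[OF x] by (simp only: abs_of_pos)
    ultimately show ?thesis using N_one_pos[OF x] by (simp only: pos_divide_le_eq)
  qed
  have E_Cb: "E f \<in> Cb T" if f: "f \<in> Cb S" for f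
  proof -
    have "\<exists>s. \<forall>h\<in>H. \<bar>f h\<bar> \<le> s" by (rule Cb_S_bounded[OF f])
    then obtain s where s: "\<And>h. h \<in> H \<Longrightarrow> \<bar>f h\<bar> \<le> s" by blast
    have "continuous_map T euclideanreal (E f)"
      unfolding continuous_map_real_iff
    proof (intro ballI allI impI)
      fix x and e :: real assume "x \<in> topspace T" and e: "e > 0"
      then have x: "x \<in> carrier G" by (simp add: topspace_eq)
      define y where "y = r x"
      have y: "y \<in> carrier G" unfolding y_def by (rule rG[OF x])
      define a where "a = N y (\<lambda>_. 1) x / 2"
      have a: "a > 0" using N_one_pos[OF x] by (simp add: a_def y_def)
      have "continuous_map T euclideanreal (\<lambda>z. N y f z / max a (N y (\<lambda>_. 1) z))"
        using N_cont[OF y f] N_cont[OF y one_Cb] a by (intro continuous_intros) auto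
      then obtain U where U: "openin T U" "x \<in> U"
        "\<And>z. z \<in> U \<Longrightarrow> \<bar>N y f z / max a (N y (\<lambda>_. 1) z) - N y f x / max a (N y (\<lambda>_. 1) x)\<bar> < e"
        using \<open>x \<in> topspace T\<close> e unfolding continuous_map_real_iff by meson
      define W where "W = {z \<in> topspace T. N y (\<lambda>_. 1) z \<in> {a<..}}"
      have W: "openin T W" "x \<in> W"
        unfolding W_def using openin_continuous_map_preimage[OF N_cont[OF y one_Cb], of "{a<..}"] a \<open>x \<in> topspace T\<close>
        by (auto simp: a_def)
      have E_eq: "E f z = N y f z / max a (N y (\<lambda>_. 1) z)" if "z \<in> W" "z \<in> D x" for z
        using that r_eq[OF x] by (auto simp: E_def y_def W_def)
      show "\<exists>U. openin T U \<and> x \<in> U \<and> (\<forall>z\<in>U. \<bar>E f z - E f x\<bar> < e)"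
      proof (intro exI[of _ "U \<inter> W \<inter> D x"] conjI ballI)
        show "openin T (U \<inter> W \<inter> D x)" using U(1) W(1) D_open[OF x] by auto
        show "x \<in> U \<inter> W \<inter> D x" using U(2) W(2) D_self[OF x] by auto
        show "\<bar>E f z - E f x\<bar> < e" if "z \<in> U \<inter> W \<inter> D x" for z
          using U(3)[of z] E_eq[of z] E_eq[of x] that W(2) D_self[OF x] by simp
      qed
    qed
    then show ?thesis
      by (rule CbI[of _ _ s]) (use E_le[OF f s] in \<open>simp add: topspace_eq\<close>)
  qed
  show thesis
  proof (rule that[of E])
    show "E f \<in> Cb T" if "f \<in> Cb S" for f by (rule E_Cb[OF that])
    show "\<bar>E f x\<bar> \<le> s" if "f \<in> Cb S" "\<And>h. h \<in> H \<Longrightarrow> \<bar>f h\<bar> \<le> s" "x \<in> carrier G" for f s x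
      by (rule E_le[OF that])
  next
    fix f g x assume f: "f \<in> Cb S" and g: "g \<in> Cb S" and x: "x \<in> carrier G"
    show "E (\<lambda>h. f h + g h) x = E f x + E g x"
      using suminf_add[OF N_summable[OF rG[OF x] x f] N_summable[OF rG[OF x] x g]]
        average_linear(1)[OF \<beta>(1)[OF rG[OF x]] Cb_continuous[OF f] Cb_continuous[OF g] x]
      by (simp add: E_def N_def flip: add_divide_distrib)
  next
    fix c f x assume f: "f \<in> Cb S" and x: "x \<in> carrier G"
    show "E (\<lambda>h. c * f h) x = c * E f x"
      using suminf_mult[OF N_summable[OF rG[OF x] x f], of c]
        average_linear(2)[OF \<beta>(1)[OF rG[OF x]] Cb_continuous[OF f] Cb_continuous[OF f] x]
      by (simp add: E_def N_def)
  next
    fix x assume "x \<in> carrier G"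
    then have "N (r x) (\<lambda>_. 1) x \<noteq> 0" using N_one_pos[of x] by simp
    then show "E (\<lambda>_. 1) x = 1" by (simp add: E_def)
  next
    fix f t x assume f: "f \<in> Cb S" and t: "t \<in> H" and x: "x \<in> carrier G"
    have "t \<otimes> x = t \<otimes> x \<otimes> \<one>" using t x HG by simp
    then have "t \<otimes> x \<in> D x"
      using t one_G0 unfolding D_def by (intro CollectI exI[of _ t] exI[of _ "\<one>"] conjI)
    then have "r (t \<otimes> x) = r x" by (rule r_eq[OF x])
    then show "E (\<lambda>h. f (t \<otimes> h)) x = E f (t \<otimes> x)"
      using average_translate[OF \<beta>(1)[OF rG[OF x]] Cb_continuous[OF f] t x]
        average_translate[OF \<beta>(1)[OF rG[OF x]] continuous_one t x]
      by (simp add: E_def N_def)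
  qed
qed

end

section \<open>Separation of points in locally convex spaces\<close>

definition sublinear_on :: "'v::real_vector set \<Rightarrow> ('v \<Rightarrow> real) \<Rightarrow> bool" where
  "sublinear_on W p \<longleftrightarrow> (\<forall>x\<in>W. \<forall>y\<in>W. p (x + y) \<le> p x + p y) \<and>
     (\<forall>x\<in>W. \<forall>c>0. p (c *\<^sub>R x) = c * p x)"

lemma sublinear_on_zero:
  assumes "subspace W" "sublinear_on W p"
  shows "p 0 = 0"
  using assms(2)[unfolded sublinear_on_def] subspace_0[OF assms(1)] scaleR_zero_right[of 2]
  by (metis less_numeral_extra(1) mult_2 add_cancel_right_right zero_less_numeral)

lemma sublinear_on_lower:
  assumes "subspace W" "sublinear_on W p" "x \<in> W"
  shows "- p (- x) \<le> p x"
proof -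
  have "p (x + - x) \<le> p x + p (- x)"
    using assms subspace_neg[OF assms(1,3)] unfolding sublinear_on_def by blast
  then show ?thesis using sublinear_on_zero[OF assms(1,2)] by simp
qed

text \<open>This step replaces one-dimensional extensions in the Hahn-Banach theorem. Pushing \<open>p\<close> down along the
  ray through \<open>y\<close> gives \<open>q x = inf\<^sub>t (p (x + t y) - t p y)\<close>; a minimal sublinear functional cannot be
  pushed down, hence is linear.\<close>

lemma sublinear_on_ray:
  fixes p :: "'v::real_vector \<Rightarrow> real"
  assumes W: "subspace W" and p: "sublinear_on W p" and y: "y \<in> W"
  obtains q where "sublinear_on W q" "\<And>x. x \<in> W \<Longrightarrow> q x \<le> p (x + y) - p y" "\<And>x. x \<in> W \<Longrightarrow> q x \<le> p x"
proof -
  have p_add: "p (a + b) \<le> p a + p b" if "a \<in> W" "b \<in> W" for a b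
    using p that by (auto simp: sublinear_on_def)
  have p_scale: "p (c *\<^sub>R a) = c * p a" if "a \<in> W" "c \<ge> 0" for c a
    using p that sublinear_on_zero[OF W p] by (cases "c = 0") (auto simp: sublinear_on_def)
  have mem: "x + t *\<^sub>R y \<in> W" if "x \<in> W" for x t
    using W y that by (simp add: subspace_add subspace_scale)
  define Q where "Q x = (\<lambda>t. p (x + t *\<^sub>R y) - t * p y) ` {0..}" for x
  define q where "q x = Inf (Q x)" for x
  have lower: "- p (- x) \<le> p (x + t *\<^sub>R y) - t * p y" if x: "x \<in> W" and t: "t \<ge> 0" for x t
  proof -
    have "t * p y = p ((x + t *\<^sub>R y) + (- x))" using p_scale[OF y t] by simp
    also have "\<dots> \<le> p (x + t *\<^sub>R y) + p (- x)"
      by (rule p_add[OF mem[OF x] subspace_neg[OF W x]])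
    finally show ?thesis by simp
  qed
  have bdd: "bdd_below (Q x)" if "x \<in> W" for x
    using lower[OF that] by (auto simp: Q_def intro!: bdd_belowI2[of _ "- p (- x)"])
  have q_le: "q x \<le> p (x + t *\<^sub>R y) - t * p y" if "x \<in> W" "t \<ge> 0" for x t
    unfolding q_def by (rule cInf_lower[OF _ bdd[OF that(1)]]) (use that in \<open>auto simp: Q_def\<close>)
  have q_ge: "b \<le> q x" if "\<And>t. t \<ge> 0 \<Longrightarrow> b \<le> p (x + t *\<^sub>R y) - t * p y" for b x
    unfolding q_def by (rule cInf_greatest) (use that in \<open>auto simp: Q_def\<close>)
  have q_add: "q (a + b) \<le> q a + q b" if a: "a \<in> W" and b: "b \<in> W" for a b
  proof -
    have "q (a + b) - (p (a + s *\<^sub>R y) - s * p y) \<le> p (b + t *\<^sub>R y) - t * p y" if s: "s \<ge> 0" and t: "t \<ge> 0" for s t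
    proof -
      have "q (a + b) \<le> p ((a + b) + (s + t) *\<^sub>R y) - (s + t) * p y"
        using s t by (intro q_le subspace_add[OF W a b]) auto
      also have "(a + b) + (s + t) *\<^sub>R y = (a + s *\<^sub>R y) + (b + t *\<^sub>R y)"
        by (simp add: algebra_simps)
      also have "p \<dots> \<le> p (a + s *\<^sub>R y) + p (b + t *\<^sub>R y)" by (rule p_add[OF mem[OF a] mem[OF b]])
      finally show ?thesis by (simp add: algebra_simps)
    qed
    then have "q (a + b) - q b \<le> p (a + s *\<^sub>R y) - s * p y" if "s \<ge> 0" for s
      using q_ge[of "q (a + b) - (p (a + s *\<^sub>R y) - s * p y)" b] that by fastforce
    then have "q (a + b) - q b \<le> q a" by (rule q_ge)
    then show ?thesis by simp
  qed
  have q_scale_le: "c * q x \<le> q (c *\<^sub>R x)" if x: "x \<in> W" and c: "c > 0" for x c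
  proof (rule q_ge)
    fix t :: real assume t: "t \<ge> 0"
    have "c * q x \<le> c * (p (x + (t / c) *\<^sub>R y) - (t / c) * p y)"
      using q_le[OF x, of "t / c"] t c by (intro mult_left_mono) auto
    also have "\<dots> = p (c *\<^sub>R (x + (t / c) *\<^sub>R y)) - t * p y"
      using p_scale[OF mem[OF x], of c "t / c"] c by (simp add: right_diff_distrib)
    also have "c *\<^sub>R (x + (t / c) *\<^sub>R y) = c *\<^sub>R x + t *\<^sub>R y"
      using c by (simp add: scaleR_add_right)
    finally show "c * q x \<le> p (c *\<^sub>R x + t *\<^sub>R y) - t * p y" .
  qed
  have q_scale: "q (c *\<^sub>R x) = c * q x" if x: "x \<in> W" and c: "c > 0" for x c
  proof (rule antisym[OF _ q_scale_le[OF x c]])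
    have "(1 / c) * q (c *\<^sub>R x) \<le> q ((1 / c) *\<^sub>R (c *\<^sub>R x))"
      using c by (intro q_scale_le subspace_scale[OF W x]) auto
    then show "q (c *\<^sub>R x) \<le> c * q x" using c by (simp add: field_simps)
  qed
  show thesis
  proof (rule that[of q])
    show "sublinear_on W q" using q_add q_scale by (auto simp: sublinear_on_def)
    show "q x \<le> p (x + y) - p y" if "x \<in> W" for x using q_le[OF that, of 1] by simp
    show "q x \<le> p x" if "x \<in> W" for x using q_le[OF that, of 0] by simp
  qed
qed

text \<open>Zorn's lemma gives a minimal sublinear functional below \<open>p\<close>. Functionals are normalized to 0 outside
  \<open>W\<close>, so that the order is antisymmetric.\<close>

theorem Hahn_Banach:
  fixes p :: "'v::real_vector \<Rightarrow> real"
  assumes W: "subspace W" and p: "sublinear_on W p"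
  obtains f where "\<And>x y. x \<in> W \<Longrightarrow> y \<in> W \<Longrightarrow> f (x + y) = f x + f y"
    "\<And>c x. x \<in> W \<Longrightarrow> f (c *\<^sub>R x) = c * f x" "\<And>x. x \<in> W \<Longrightarrow> f x \<le> p x"
proof -
  define A where "A = {q. sublinear_on W q \<and> (\<forall>x\<in>W. q x \<le> p x) \<and> (\<forall>x. x \<notin> W \<longrightarrow> q x = 0)}"
  define R where "R a b \<longleftrightarrow> (\<forall>x. b x \<le> a x)" for a b :: "'v \<Rightarrow> real"
  have cut: "(\<lambda>x. if x \<in> W then q x else 0) \<in> A" if "sublinear_on W q" "\<And>x. x \<in> W \<Longrightarrow> q x \<le> p x" for q
    using that W by (simp add: A_def sublinear_on_def subspace_add subspace_scale)
  have "\<exists>m\<in>A. \<forall>a\<in>A. R m a \<longrightarrow> a = m"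
  proof (rule predicate_Zorn)
    show "partial_order_on A (relation_of R A)"
      unfolding partial_order_on_def preorder_on_def refl_on_def trans_def antisym_def relation_of_def R_def
      by (auto intro: order_trans intro!: ext antisym)
    fix C assume C: "C \<in> Chains (relation_of R A)"
    have CA: "a \<in> A" if "a \<in> C" for a
      using C that by (auto simp: Chains_def relation_of_def)
    have Ccomp: "(\<forall>x. b x \<le> a x) \<or> (\<forall>x. a x \<le> b x)" if "a \<in> C" "b \<in> C" for a b
      using C that by (auto simp: Chains_def relation_of_def R_def)
    show "\<exists>u\<in>A. \<forall>a\<in>C. R a u"
    proof (cases "C = {}")
      case True
      then show ?thesis using cut[OF p] by auto
    next
      case False
      define u where "u x = (INF a\<in>C. a x)" for x
      have bdd: "bdd_below ((\<lambda>a. a x) ` C)" if x: "x \<in> W" for x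
      proof (rule bdd_belowI2)
        fix a assume "a \<in> C"
        then have a: "sublinear_on W a" "a (- x) \<le> p (- x)"
          using CA subspace_neg[OF W x] by (auto simp: A_def)
        then show "- p (- x) \<le> a x" using sublinear_on_lower[OF W a(1) x] by linarith
      qed
      have u_le: "u x \<le> a x" if "x \<in> W" "a \<in> C" for x a
        unfolding u_def by (rule cINF_lower[OF bdd[OF that(1)] that(2)])
      have u_ge: "b \<le> u x" if "\<And>a. a \<in> C \<Longrightarrow> b \<le> a x" for b x
        unfolding u_def using False that by (rule cINF_greatest)
      have "sublinear_on W u"
        unfolding sublinear_on_def
      proof (intro conjI ballI allI impI)
        fix x y assume x: "x \<in> W" and y: "y \<in> W"
        have "u (x + y) - a x \<le> b y" if a: "a \<in> C" and b: "b \<in> C" for a b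
        proof -
          obtain c where c: "c \<in> C" "c x \<le> a x" "c y \<le> b y" using Ccomp[OF a b] a b by blast
          have "u (x + y) \<le> c (x + y)" by (rule u_le[OF subspace_add[OF W x y] c(1)])
          also have "\<dots> \<le> c x + c y" using CA[OF c(1)] x y by (auto simp: A_def sublinear_on_def)
          finally show ?thesis using c by linarith
        qed
        then have "u (x + y) - a x \<le> u y" if "a \<in> C" for a using that by (intro u_ge) auto
        then have "u (x + y) - u y \<le> u x" by (intro u_ge) (simp add: algebra_simps)
        then show "u (x + y) \<le> u x + u y" by simp
      next
        fix x and c :: real assume x: "x \<in> W" and c: "c > 0"
        have hom: "a (c *\<^sub>R x) = c * a x" if "a \<in> C" for a
          using CA[OF that] x c by (auto simp: A_def sublinear_on_def)
        show "u (c *\<^sub>R x) = c * u x"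
        proof (rule antisym)
          have "u (c *\<^sub>R x) / c \<le> u x"
          proof (rule u_ge)
            fix a assume a: "a \<in> C"
            then show "u (c *\<^sub>R x) / c \<le> a x"
              using u_le[OF subspace_scale[OF W x] a, of c] hom[OF a] c by (simp add: field_simps)
          qed
          then show "u (c *\<^sub>R x) \<le> c * u x" using c by (simp add: field_simps)
          show "c * u x \<le> u (c *\<^sub>R x)"
          proof (rule u_ge)
            fix a assume a: "a \<in> C"
            show "c * u x \<le> a (c *\<^sub>R x)"
              unfolding hom[OF a] using u_le[OF x a] c by simp
          qed
        qed
      qed
      moreover have "u x \<le> p x" if x: "x \<in> W" for x
      proof -
        obtain a where a: "a \<in> C" using False by blast
        have "a x \<le> p x" using CA[OF a] x by (auto simp: A_def)
        with u_le[OF x a] show ?thesis by linarith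
      qed
      ultimately have "(\<lambda>x. if x \<in> W then u x else 0) \<in> A" by (rule cut)
      moreover have "R a (\<lambda>x. if x \<in> W then u x else 0)" if "a \<in> C" for a
        using u_le[OF _ that] CA[OF that] by (auto simp: R_def A_def)
      ultimately show ?thesis by blast
    qed
  qed
  then obtain m where m: "m \<in> A" and minimal: "\<And>a. a \<in> A \<Longrightarrow> R m a \<Longrightarrow> a = m" by blast
  have mW: "sublinear_on W m" "\<And>x. x \<in> W \<Longrightarrow> m x \<le> p x" using m by (auto simp: A_def)
  have add: "m (x + y) = m x + m y" if x: "x \<in> W" and y: "y \<in> W" for x y
  proof -
    obtain q where q: "sublinear_on W q" "\<And>x. x \<in> W \<Longrightarrow> q x \<le> m (x + y) - m y" "\<And>x. x \<in> W \<Longrightarrow> q x \<le> m x"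
      using sublinear_on_ray[OF W mW(1) y] by metis
    have "(\<lambda>x. if x \<in> W then q x else 0) \<in> A"
      by (rule cut[OF q(1)]) (use q(3) mW(2) in \<open>blast intro: order_trans\<close>)
    moreover have "R m (\<lambda>x. if x \<in> W then q x else 0)" using q(3) m by (auto simp: R_def A_def)
    ultimately have "(\<lambda>x. if x \<in> W then q x else 0) = m" by (rule minimal)
    then have "q x = m x" using x by (auto dest: fun_cong[of _ _ x])
    then have "m x + m y \<le> m (x + y)" using q(2)[OF x] by linarith
    then show ?thesis using mW(1) x y unfolding sublinear_on_def by (intro antisym) auto
  qed
  have neg: "m (- x) = - m x" if x: "x \<in> W" for x
    using add[OF x subspace_neg[OF W x]] sublinear_on_zero[OF W mW(1)] by simp
  have scale: "m (c *\<^sub>R x) = c * m x" if x: "x \<in> W" for c x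
  proof -
    have pos: "m (c *\<^sub>R x) = c * m x" if "c > 0" for c
      using mW(1) x that by (auto simp: sublinear_on_def)
    consider "c > 0" | "c = 0" | "- c > 0" by linarith
    then show ?thesis
    proof cases
      case 3
      then show ?thesis using pos[OF 3] neg[OF subspace_scale[OF W x, of c]] by simp
    qed (use pos sublinear_on_zero[OF W mW(1)] in auto)
  qed
  show thesis by (rule that[OF add scale mW(2)])
qed

text \<open>The gauge of a convex neighbourhood of 0 that misses \<open>y\<close> is sublinear and at least 1 at \<open>y\<close>. Push it
  down along the ray through \<open>y\<close> before the Hahn-Banach theorem is applied: the linear functional
  obtained is at least 1 at \<open>y\<close> and, being below the gauge, continuous.\<close>

theorem locally_convex_separation:
  fixes E :: "'v::real_vector topology"
  assumes E: "locally_convex_tvs E" and y: "y \<in> topspace E" "y \<noteq> 0"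
  obtains f where "continuous_map E euclideanreal f"
    "\<And>a b. a \<in> topspace E \<Longrightarrow> b \<in> topspace E \<Longrightarrow> f (a + b) = f a + f b"
    "\<And>c a. a \<in> topspace E \<Longrightarrow> f (c *\<^sub>R a) = c * f a" "f y \<noteq> 0"
proof -
  define W where "W = topspace E"
  have W: "subspace W" and haus: "Hausdorff_space E"
    and cadd: "continuous_map (prod_topology E E) E (\<lambda>(x, y). x + y)"
    and cscale: "continuous_map (prod_topology euclideanreal E) E (\<lambda>(c, x). c *\<^sub>R x)"
    and lc: "\<And>U. openin E U \<Longrightarrow> 0 \<in> U \<Longrightarrow> \<exists>V. openin E V \<and> 0 \<in> V \<and> convex V \<and> V \<subseteq> U"
    using E by (auto simp: locally_convex_tvs_def W_def)
  have yW: "y \<in> W" using y by (simp add: W_def)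
  have "0 \<in> topspace E" using subspace_0[OF W] by (simp add: W_def)
  then obtain U where U: "openin E U" "0 \<in> U" "y \<notin> U"
    using haus y unfolding Hausdorff_space_def disjnt_iff by metis
  obtain V where V: "openin E V" "0 \<in> V" "convex V" "V \<subseteq> U" using lc[OF U(1,2)] by blast
  have yV: "y \<notin> V" using U V by blast
  have scale_cont: "continuous_map E E (\<lambda>x. c *\<^sub>R (x - x0))" if x0: "x0 \<in> W" for c x0
  proof -
    have "- x0 \<in> topspace E" using subspace_neg[OF W x0] by (simp add: W_def)
    then have "continuous_map E (prod_topology E E) (\<lambda>x. (x, - x0))"
      by (simp add: continuous_map_paired)
    from continuous_map_compose[OF this cadd] have "continuous_map E E (\<lambda>x. x - x0)" by (simp add: o_def)
    then have "continuous_map E (prod_topology euclideanreal E) (\<lambda>x. (c, x - x0))"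
      by (simp add: continuous_map_paired)
    from continuous_map_compose[OF this cscale] show ?thesis by (simp add: o_def)
  qed
  define P where "P x = {t. t > 0 \<and> (1 / t) *\<^sub>R x \<in> V}" for x
  define p where "p x = Inf (P x)" for x
  have P_ne: "P x \<noteq> {}" if x: "x \<in> W" for x
  proof -
    have "continuous_map euclideanreal (prod_topology euclideanreal E) (\<lambda>c. (c, x))"
      using x by (simp add: continuous_map_paired W_def)
    from continuous_map_compose[OF this cscale] have "continuous_map euclideanreal E (\<lambda>c. c *\<^sub>R x)"
      by (simp add: o_def)
    from openin_continuous_map_preimage[OF this V(1)] have "open {c. c *\<^sub>R x \<in> V}" by simp
    moreover have "0 \<in> {c. c *\<^sub>R x \<in> V}" using V(2) by simp
    ultimately obtain d where d: "d > 0" "ball 0 d \<subseteq> {c. c *\<^sub>R x \<in> V}"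
      by (meson open_contains_ball)
    have "d / 2 \<in> ball 0 d" using d(1) by (simp add: dist_real_def)
    then have "(d / 2) *\<^sub>R x \<in> V" using d(2) by blast
    then have "2 / d \<in> P x" using d(1) by (simp add: P_def)
    then show ?thesis by blast
  qed
  have bdd: "bdd_below (P x)" for x by (auto simp: P_def intro!: bdd_belowI[of _ 0])
  have p_le: "p x \<le> t" if "t \<in> P x" for x t
    unfolding p_def by (rule cInf_lower[OF that bdd])
  have p_ge: "b \<le> p x" if "x \<in> W" "\<And>t. t \<in> P x \<Longrightarrow> b \<le> t" for b x
    unfolding p_def by (rule cInf_greatest[OF P_ne[OF that(1)] that(2)])
  have p_sub: "sublinear_on W p"
    unfolding sublinear_on_def
  proof (intro conjI ballI allI impI)
    fix a b assume a: "a \<in> W" and b: "b \<in> W"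
    have "p (a + b) - s \<le> t" if s: "s \<in> P a" and t: "t \<in> P b" for s t
    proof -
      have st: "s > 0" "t > 0" using s t by (auto simp: P_def)
      have "(s / (s + t)) *\<^sub>R ((1 / s) *\<^sub>R a) + (t / (s + t)) *\<^sub>R ((1 / t) *\<^sub>R b) \<in> V"
        using s t st by (intro convexD[OF V(3)]) (auto simp: P_def simp flip: add_divide_distrib)
      moreover have "(s / (s + t)) *\<^sub>R ((1 / s) *\<^sub>R a) + (t / (s + t)) *\<^sub>R ((1 / t) *\<^sub>R b) = (1 / (s + t)) *\<^sub>R (a + b)"
        using st by (simp add: scaleR_add_right)
      ultimately have "s + t \<in> P (a + b)" using st by (simp add: P_def)
      from p_le[OF this] show ?thesis by simp
    qed
    then have "p (a + b) - s \<le> p b" if "s \<in> P a" for s using that b by (intro p_ge) auto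
    then have "p (a + b) - p b \<le> p a" using a by (intro p_ge) (auto simp: algebra_simps)
    then show "p (a + b) \<le> p a + p b" by simp
  next
    fix a and c :: real assume a: "a \<in> W" and c: "c > 0"
    have mem: "c * t \<in> P (c *\<^sub>R a)" if "t \<in> P a" "c > 0" for t c a
      using that by (simp add: P_def)
    show "p (c *\<^sub>R a) = c * p a"
    proof (rule antisym)
      have "p (c *\<^sub>R a) / c \<le> p a"
        using p_le[OF mem[OF _ c]] c a by (intro p_ge) (auto simp: field_simps)
      then show "p (c *\<^sub>R a) \<le> c * p a" using c by (simp add: field_simps)
      show "c * p a \<le> p (c *\<^sub>R a)"
      proof (rule p_ge[OF subspace_scale[OF W a]])
        fix t assume "t \<in> P (c *\<^sub>R a)"
        then have "(1 / c) * t \<in> P ((1 / c) *\<^sub>R (c *\<^sub>R a))" using c by (intro mem) auto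
        then have "t / c \<in> P a" using c by simp
        from p_le[OF this] show "c * p a \<le> t" using c by (simp add: field_simps)
      qed
    qed
  qed
  have p_y: "1 \<le> p y"
  proof (rule p_ge[OF yW])
    fix t assume t: "t \<in> P y"
    show "1 \<le> t"
    proof (rule ccontr)
      assume "\<not> 1 \<le> t"
      then have "t *\<^sub>R ((1 / t) *\<^sub>R y) + (1 - t) *\<^sub>R 0 \<in> V"
        using t V(2) by (intro convexD[OF V(3)]) (auto simp: P_def)
      then show False using t yV by (simp add: P_def)
    qed
  qed
  obtain q where q: "sublinear_on W q" "\<And>x. x \<in> W \<Longrightarrow> q x \<le> p (x + y) - p y" "\<And>x. x \<in> W \<Longrightarrow> q x \<le> p x"
    using sublinear_on_ray[OF W p_sub yW] by metis
  obtain f where f: "\<And>x y. x \<in> W \<Longrightarrow> y \<in> W \<Longrightarrow> f (x + y) = f x + f y"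
    "\<And>c x. x \<in> W \<Longrightarrow> f (c *\<^sub>R x) = c * f x" "\<And>x. x \<in> W \<Longrightarrow> f x \<le> q x"
    using Hahn_Banach[OF W q(1)] by metis
  have "- f y = f (- y)" using f(2)[OF yW, of "-1"] by simp
  also have "\<dots> \<le> q (- y)" by (rule f(3)[OF subspace_neg[OF W yW]])
  also have "\<dots> \<le> - p y" using q(2)[OF subspace_neg[OF W yW]] sublinear_on_zero[OF W p_sub] by simp
  finally have fy: "f y \<ge> 1" using p_y by linarith
  have f_small: "f x \<le> e" if e: "e > 0" and x: "x \<in> W" and mem: "(1 / e) *\<^sub>R x \<in> V" for e x
  proof -
    have "f x \<le> p x" using f(3)[OF x] q(3)[OF x] by linarith
    also have "\<dots> \<le> e" using e mem by (intro p_le) (simp add: P_def)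
    finally show ?thesis .
  qed
  have "continuous_map E euclideanreal f"
    unfolding continuous_map_real_iff
  proof (intro ballI allI impI)
    fix x0 and e :: real assume "x0 \<in> topspace E" and e: "e > 0"
    then have x0: "x0 \<in> W" by (simp add: W_def)
    define O1 where "O1 = {x \<in> topspace E. (2 / e) *\<^sub>R (x - x0) \<in> V}"
    define O2 where "O2 = {x \<in> topspace E. (- 2 / e) *\<^sub>R (x - x0) \<in> V}"
    have op: "openin E O1" "openin E O2"
      unfolding O1_def O2_def by (rule openin_continuous_map_preimage[OF scale_cont[OF x0] V(1)])+
    have "\<bar>f x - f x0\<bar> < e" if x: "x \<in> O1 \<inter> O2" for x
    proof -
      have xW: "x \<in> W" using x by (simp add: O1_def W_def)
      have d: "x - x0 \<in> W" "- (x - x0) \<in> W" using subspace_diff[OF W xW x0] subspace_neg[OF W subspace_diff[OF W xW x0]] by blast+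
      have diff: "f (x - x0) = f x - f x0"
        using f(1)[OF d(1) x0] by simp
      have "f (x - x0) \<le> e / 2" using x e by (intro f_small d(1)) (auto simp: O1_def)
      moreover have "f (- (x - x0)) \<le> e / 2"
      proof (rule f_small[OF _ d(2)])
        have "(- 2 / e) *\<^sub>R (x - x0) = (1 / (e / 2)) *\<^sub>R - (x - x0)"
          by (simp only: scaleR_minus_right minus_divide_left scaleR_minus_left[symmetric]) simp
        moreover have "(- 2 / e) *\<^sub>R (x - x0) \<in> V" using x by (simp only: O2_def Int_iff mem_Collect_eq)
        ultimately show "(1 / (e / 2)) *\<^sub>R - (x - x0) \<in> V" by simp
      qed (use e in simp)
      moreover have "f (- (x - x0)) = - f (x - x0)" using f(2)[OF d(1), of "-1"] by simp
      ultimately show ?thesis using diff e by linarith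
    qed
    moreover have "x0 \<in> O1 \<inter> O2" using \<open>x0 \<in> topspace E\<close> V(2) by (simp add: O1_def O2_def)
    ultimately show "\<exists>U. openin E U \<and> x0 \<in> U \<and> (\<forall>y\<in>U. \<bar>f y - f x0\<bar> < e)"
      using op by (intro exI[of _ "O1 \<inter> O2"]) auto
  qed
  then show thesis using that[of f] f fy by (auto simp: W_def)
qed

section \<open>Invariant means give fixed points\<close>

definition affine_functional :: "'v::real_vector topology \<Rightarrow> ('v \<Rightarrow> real) \<Rightarrow> bool" where
  "affine_functional E \<phi> \<longleftrightarrow> continuous_map E euclideanreal \<phi> \<and>
     (\<forall>x\<in>topspace E. \<forall>y\<in>topspace E. \<forall>t. \<phi> ((1 - t) *\<^sub>R x + t *\<^sub>R y) = (1 - t) * \<phi> x + t * \<phi> y)"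

lemma affine_functional_add:
  assumes "affine_functional E \<phi>" "affine_functional E \<psi>"
  shows "affine_functional E (\<lambda>x. \<phi> x + \<psi> x)"
  using assms unfolding affine_functional_def
  by (auto intro!: continuous_map_add simp: distrib_left)

lemma affine_functional_scale:
  assumes "affine_functional E \<phi>"
  shows "affine_functional E (\<lambda>x. c * \<phi> x)"
  using assms unfolding affine_functional_def
  by (auto intro!: continuous_map_real_mult_left simp: distrib_left)

lemma affine_functional_const: "affine_functional E (\<lambda>x. c)"
  by (auto simp: affine_functional_def algebra_simps)

text \<open>By compactness of \<open>K\<close> finitely many functions suffice. For these, minimize over \<open>K\<close> the squared
  distance between the vector of values and the vector of values of the state. The first variation at
  the minimum is a non-negative affine function on \<open>K\<close>, and applying the state to it shows that the
  minimum is 0. This gives the barycentre of the state without integrating vectors.\<close>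

lemma state_is_evaluation:
  fixes E :: "'v::real_vector topology"
  assumes K: "convex K" "compactin E K" "K \<noteq> {}"
    and add: "\<And>\<phi> \<psi>. affine_functional E \<phi> \<Longrightarrow> affine_functional E \<psi> \<Longrightarrow> l (\<lambda>x. \<phi> x + \<psi> x) = l \<phi> + l \<psi>"
    and scale: "\<And>c \<phi>. affine_functional E \<phi> \<Longrightarrow> l (\<lambda>x. c * \<phi> x) = c * l \<phi>"
    and one: "l (\<lambda>_. 1) = 1"
    and pos: "\<And>\<phi>. affine_functional E \<phi> \<Longrightarrow> (\<And>x. x \<in> K \<Longrightarrow> 0 \<le> \<phi> x) \<Longrightarrow> 0 \<le> l \<phi>"
  obtains p where "p \<in> K" "\<And>\<phi>. affine_functional E \<phi> \<Longrightarrow> \<phi> p = l \<phi>"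
proof -
  have KE: "K \<subseteq> topspace E" by (rule compactin_subset_topspace[OF K(2)])
  have finite_case: "\<exists>k\<in>K. \<forall>\<phi>\<in>F. \<phi> k = l \<phi>" if F: "finite F" "\<And>\<phi>. \<phi> \<in> F \<Longrightarrow> affine_functional E \<phi>" for F
  proof -
    define D where "D k = (\<Sum>\<phi>\<in>F. (\<phi> k - l \<phi>)^2)" for k
    have "continuous_map E euclideanreal D"
      unfolding D_def using F by (intro continuous_intros) (auto simp: affine_functional_def)
    from image_compactin[OF K(2) this] have "compact (D ` K)" by simp
    then obtain k0 where k0: "k0 \<in> K" "\<And>k. k \<in> K \<Longrightarrow> D k0 \<le> D k"
      using compact_attains_inf[of "D ` K"] K(3) by auto
    define a where "a \<phi> = \<phi> k0 - l \<phi>" for \<phi>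
    have variation: "0 \<le> (\<Sum>\<phi>\<in>F. a \<phi> * (\<phi> k - \<phi> k0))" if k: "k \<in> K" for k
    proof (rule ccontr)
      define A where "A = (\<Sum>\<phi>\<in>F. a \<phi> * (\<phi> k - \<phi> k0))"
      define B where "B = (\<Sum>\<phi>\<in>F. (\<phi> k - \<phi> k0)^2)"
      assume "\<not> ?thesis"
      then have A: "A < 0" by (simp add: A_def)
      have B: "B \<ge> 0" by (simp add: B_def sum_nonneg)
      have quad: "0 \<le> 2 * t * A + t^2 * B" if t: "0 \<le> t" "t \<le> 1" for t
      proof -
        have "(1 - t) *\<^sub>R k0 + t *\<^sub>R k \<in> K"
          using convexD[OF K(1) k0(1) k, of "1 - t" t] t by simp
        then have "D k0 \<le> D ((1 - t) *\<^sub>R k0 + t *\<^sub>R k)" by (rule k0(2))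
        also have "\<dots> = (\<Sum>\<phi>\<in>F. (a \<phi>)^2 + 2 * t * (a \<phi> * (\<phi> k - \<phi> k0)) + t^2 * (\<phi> k - \<phi> k0)^2)"
          unfolding D_def
        proof (rule sum.cong[OF refl])
          fix \<phi> assume "\<phi> \<in> F"
          then have "\<phi> ((1 - t) *\<^sub>R k0 + t *\<^sub>R k) = (1 - t) * \<phi> k0 + t * \<phi> k"
            using F(2) k0(1) k KE unfolding affine_functional_def by blast
          then have "\<phi> ((1 - t) *\<^sub>R k0 + t *\<^sub>R k) - l \<phi> = a \<phi> + t * (\<phi> k - \<phi> k0)"
            by (simp add: a_def algebra_simps)
          then have "(\<phi> ((1 - t) *\<^sub>R k0 + t *\<^sub>R k) - l \<phi>)^2 = (a \<phi> + t * (\<phi> k - \<phi> k0))^2"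
            by (simp only:)
          then show "(\<phi> ((1 - t) *\<^sub>R k0 + t *\<^sub>R k) - l \<phi>)^2 =
              (a \<phi>)^2 + 2 * t * (a \<phi> * (\<phi> k - \<phi> k0)) + t^2 * (\<phi> k - \<phi> k0)^2"
            by (simp add: power2_sum power_mult_distrib)
        qed
        also have "\<dots> = D k0 + 2 * t * A + t^2 * B"
          by (simp add: D_def A_def B_def a_def sum.distrib sum_distrib_left)
        finally show ?thesis by simp
      qed
      \<comment> \<open>a short step in the direction of \<open>k\<close> would decrease the distance\<close>
      define t where "t = min 1 (- A / (B + 1))"
      have t: "0 < t" "t \<le> 1" "t * (B + 1) \<le> - A"
      proof -
        show "0 < t" "t \<le> 1" using divide_neg_pos[OF A, of "B + 1"] B by (auto simp: t_def)
        have "t * (B + 1) \<le> (- A / (B + 1)) * (B + 1)" using B by (intro mult_right_mono) (auto simp: t_def)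
        then show "t * (B + 1) \<le> - A" using B by simp
      qed
      have "t * B \<le> - A" using t B by (simp add: algebra_simps)
      then have "2 * A + t * B < 0" using A by linarith
      then have "t * (2 * A + t * B) < 0" using t(1) by (simp add: mult_pos_neg)
      then have "2 * t * A + t^2 * B < 0" by (simp add: power2_eq_square algebra_simps)
      with quad[of t] t show False by simp
    qed
    define c where "c = (\<Sum>\<phi>\<in>F. a \<phi> * \<phi> k0)"
    have sum_aff: "affine_functional E (\<lambda>x. \<Sum>\<phi>\<in>P. a \<phi> * \<phi> x) \<and> l (\<lambda>x. \<Sum>\<phi>\<in>P. a \<phi> * \<phi> x) = (\<Sum>\<phi>\<in>P. a \<phi> * l \<phi>)"
      if "finite P" "P \<subseteq> F" for P
      using that
    proof (induction P rule: finite_induct)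
      case empty
      have "l (\<lambda>_. 0) = 0" using scale[OF affine_functional_const[of E 0], of 0] by simp
      then show ?case by (simp add: affine_functional_const)
    next
      case (insert \<phi> P)
      then have "affine_functional E \<phi>" using F(2) by blast
      with insert show ?case
        using add[OF affine_functional_scale, of \<phi> _ "a \<phi>"] scale[of \<phi> "a \<phi>"]
          affine_functional_add[OF affine_functional_scale, of E \<phi> _ "a \<phi>"] by simp
    qed
    have const: "l (\<lambda>_. - c) = - c"
      using scale[OF affine_functional_const[of E 1], of "- c"] one by simp
    have "0 \<le> l (\<lambda>x. (\<Sum>\<phi>\<in>F. a \<phi> * \<phi> x) + (- c))"
    proof (rule pos)
      show "affine_functional E (\<lambda>x. (\<Sum>\<phi>\<in>F. a \<phi> * \<phi> x) + (- c))"
        using sum_aff[OF F(1) order_refl] by (intro affine_functional_add affine_functional_const) auto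
      show "0 \<le> (\<Sum>\<phi>\<in>F. a \<phi> * \<phi> x) + (- c)" if "x \<in> K" for x
        using variation[OF that] by (simp add: c_def right_diff_distrib sum_subtractf)
    qed
    then have "0 \<le> (\<Sum>\<phi>\<in>F. a \<phi> * l \<phi>) - c"
      using add[OF conjunct1[OF sum_aff[OF F(1) order_refl]] affine_functional_const[of E "- c"]]
        sum_aff[OF F(1) order_refl] const by simp
    also have "\<dots> = - (\<Sum>\<phi>\<in>F. (a \<phi>)^2)"
    proof -
      have "(\<Sum>\<phi>\<in>F. a \<phi> * l \<phi>) - c = (\<Sum>\<phi>\<in>F. a \<phi> * l \<phi> - a \<phi> * \<phi> k0)"
        by (simp add: c_def sum_subtractf)
      also have "\<dots> = (\<Sum>\<phi>\<in>F. - ((a \<phi>)^2))"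
        by (intro sum.cong refl) (simp add: a_def power2_eq_square algebra_simps)
      finally show ?thesis by (simp add: sum_negf)
    qed
    finally have "(\<Sum>\<phi>\<in>F. (a \<phi>)^2) = 0"
      using sum_nonneg[of F "\<lambda>\<phi>. (a \<phi>)^2"] by simp
    then have "a \<phi> = 0" if "\<phi> \<in> F" for \<phi>
      using that F(1) by (simp add: sum_nonneg_eq_0_iff)
    then show ?thesis using k0(1) by (auto simp: a_def)
  qed
  define Z where "Z \<phi> = {x \<in> topspace E. \<phi> x \<in> {l \<phi>}}" for \<phi>
  have "K \<inter> \<Inter>(Z ` {\<phi>. affine_functional E \<phi>}) \<noteq> {}"
  proof -
    have closed: "closedin E C" if "C \<in> Z ` {\<phi>. affine_functional E \<phi>}" for C
      using that closedin_continuous_map_preimage[of E euclideanreal _ "{l _}"]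
      by (auto simp: Z_def affine_functional_def)
    have fip: "K \<inter> \<Inter>\<F> \<noteq> {}" if \<F>: "finite \<F>" "\<F> \<subseteq> Z ` {\<phi>. affine_functional E \<phi>}" for \<F>
    proof -
      obtain F where F: "finite F" "F \<subseteq> {\<phi>. affine_functional E \<phi>}" "\<F> = Z ` F"
        using finite_subset_image[OF \<F>] by blast
      then obtain k where "k \<in> K" "\<forall>\<phi>\<in>F. \<phi> k = l \<phi>" using finite_case[of F] by blast
      then have "k \<in> K \<inter> \<Inter>\<F>" using KE by (auto simp: F(3) Z_def)
      then show ?thesis by blast
    qed
    show ?thesis using K(2) closed fip unfolding compactin_fip by blast
  qed
  then obtain p where "p \<in> K" "\<And>\<phi>. affine_functional E \<phi> \<Longrightarrow> p \<in> Z \<phi>" by blast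
  then show thesis by (intro that[of p]) (auto simp: Z_def)
qed

text \<open>Of positivity only the bound by the supremum is recorded; together with the value 1 at the constant 1
  it implies positivity.\<close>

definition mean_on :: "('a \<Rightarrow> real) set \<Rightarrow> 'a set \<Rightarrow> (('a \<Rightarrow> real) \<Rightarrow> real) \<Rightarrow> bool" where
  "mean_on F Y n \<longleftrightarrow>
     (\<forall>f\<in>F. \<forall>g\<in>F. n (\<lambda>x. f x + g x) = n f + n g) \<and>
     (\<forall>c. \<forall>f\<in>F. n (\<lambda>x. c * f x) = c * n f) \<and>
     (\<forall>f\<in>F. \<forall>s. (\<forall>y\<in>Y. \<bar>f y\<bar> \<le> s) \<longrightarrow> \<bar>n f\<bar> \<le> s) \<and>
     n (\<lambda>_. 1) = 1"

lemma mean_on_add: "mean_on F Y n \<Longrightarrow> f \<in> F \<Longrightarrow> g \<in> F \<Longrightarrow> n (\<lambda>x. f x + g x) = n f + n g"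
  by (simp add: mean_on_def)

lemma mean_on_scale: "mean_on F Y n \<Longrightarrow> f \<in> F \<Longrightarrow> n (\<lambda>x. c * f x) = c * n f"
  by (simp add: mean_on_def)

lemma mean_on_bound: "mean_on F Y n \<Longrightarrow> f \<in> F \<Longrightarrow> (\<And>y. y \<in> Y \<Longrightarrow> \<bar>f y\<bar> \<le> s) \<Longrightarrow> \<bar>n f\<bar> \<le> s"
  by (simp add: mean_on_def)

lemma mean_on_one: "mean_on F Y n \<Longrightarrow> n (\<lambda>_. 1) = 1"
  by (simp add: mean_on_def)

lemma mean_on_cong:
  assumes n: "mean_on F Y n" and f: "f \<in> F" and g: "g \<in> F" "(\<lambda>x. (-1) * g x) \<in> F"
    and fg: "(\<lambda>x. f x + (-1) * g x) \<in> F" "\<And>y. y \<in> Y \<Longrightarrow> f y = g y"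
  shows "n f = n g"
proof -
  have "n (\<lambda>x. f x + (-1) * g x) = n f + n (\<lambda>x. (-1) * g x)" by (rule mean_on_add[OF n f g(2)])
  also have "n (\<lambda>x. (-1) * g x) = (-1) * n g" by (rule mean_on_scale[OF n g(1)])
  finally have eq: "n (\<lambda>x. f x + (-1) * g x) = n f - n g" by simp
  have "\<bar>n (\<lambda>x. f x + (-1) * g x)\<bar> \<le> 0"
    by (rule mean_on_bound[OF n fg(1)]) (use fg(2) in simp)
  then show ?thesis using eq by simp
qed

text \<open>The mean of \<open>\<phi>\<close> along the orbit of a point \<open>x0\<close> is a state on the affine functions. It is evaluation at
  some \<open>p\<close> in \<open>K\<close>, and invariance of the mean says that affine functions do not distinguish \<open>p\<close> from
  its translates.\<close>

theorem (in locally_compact_group) amenable_if_invariant_mean: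
  assumes n: "mean_on (Cb T) (carrier G) n"
    and inv: "\<And>f t. f \<in> Cb T \<Longrightarrow> t \<in> carrier G \<Longrightarrow> n (\<lambda>x. f (t \<otimes> x)) = n f"
  shows "amenable TYPE('v::real_vector) G T"
  unfolding amenable_def
proof (intro allI impI, elim conjE)
  fix E :: "'v topology" and \<alpha> K
  assume ccs: "convex_compact_space G T E \<alpha> K" and ne: "K \<noteq> {}"
  have E: "locally_convex_tvs E" and act: "group_action G (topspace E) \<alpha>"
    and aff: "\<And>g. g \<in> carrier G \<Longrightarrow> affine_map_on (topspace E) (\<alpha> g)"
    and cont: "\<And>g. g \<in> carrier G \<Longrightarrow> continuous_map E E (\<alpha> g)"
    and orbit: "\<And>x. x \<in> topspace E \<Longrightarrow> continuous_map T E (\<lambda>g. \<alpha> g x)"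
    and K: "convex K" "compactin E K" "\<And>g x. g \<in> carrier G \<Longrightarrow> x \<in> K \<Longrightarrow> \<alpha> g x \<in> K"
    using ccs unfolding convex_compact_space_def by blast+
  have KE: "K \<subseteq> topspace E" by (rule compactin_subset_topspace[OF K(2)])
  obtain x0 where x0: "x0 \<in> K" using ne by blast
  have n_add: "n (\<lambda>x. f x + g x) = n f + n g" if "f \<in> Cb T" "g \<in> Cb T" for f g
    by (rule mean_on_add[OF n that])
  have n_scale: "n (\<lambda>x. c * f x) = c * n f" if "f \<in> Cb T" for c f
    by (rule mean_on_scale[OF n that])
  have n_bound: "\<bar>n f\<bar> \<le> s" if "f \<in> Cb T" "\<And>y. y \<in> carrier G \<Longrightarrow> \<bar>f y\<bar> \<le> s" for f s
    by (rule mean_on_bound[OF n that])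
  have n_one: "n (\<lambda>_. 1) = 1" by (rule mean_on_one[OF n])
  have const: "(\<lambda>_. c) \<in> Cb T" for c :: real by (rule CbI[of _ _ "\<bar>c\<bar>"]) auto
  have orb: "(\<lambda>g. \<phi> (\<alpha> g x0)) \<in> Cb T" if "affine_functional E \<phi>" for \<phi>
  proof -
    have \<phi>: "continuous_map E euclideanreal \<phi>" using that by (simp add: affine_functional_def)
    obtain B where B: "\<And>x. x \<in> K \<Longrightarrow> \<bar>\<phi> x\<bar> \<le> B"
      using continuous_map_bounded_on_compact[OF \<phi> K(2)] by metis
    have "continuous_map T euclideanreal (\<lambda>g. \<phi> (\<alpha> g x0))"
      using continuous_map_compose[OF orbit \<phi>] x0 KE by (auto simp: o_def)
    then show ?thesis
      by (rule CbI[of _ _ B]) (use B K(3) x0 in \<open>auto simp: topspace_eq\<close>)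
  qed
  define l where "l \<phi> = n (\<lambda>g. \<phi> (\<alpha> g x0))" for \<phi>
  obtain p where p: "p \<in> K" "\<And>\<phi>. affine_functional E \<phi> \<Longrightarrow> \<phi> p = l \<phi>"
  proof (rule state_is_evaluation[OF K(1,2) ne, of l])
    fix \<phi> assume \<phi>: "affine_functional E \<phi>" and nn: "\<And>x. x \<in> K \<Longrightarrow> 0 \<le> \<phi> x"
    obtain B where B: "\<And>g. g \<in> carrier G \<Longrightarrow> \<bar>\<phi> (\<alpha> g x0)\<bar> \<le> B"
      using orb[OF \<phi>] by (auto simp: Cb_def topspace_eq)
    have "\<bar>n (\<lambda>g. B + (-1) * \<phi> (\<alpha> g x0))\<bar> \<le> B"
    proof (rule n_bound)
      show "(\<lambda>g. B + (-1) * \<phi> (\<alpha> g x0)) \<in> Cb T"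
        using orb[OF affine_functional_add[OF affine_functional_const affine_functional_scale[OF \<phi>]]] .
      fix g assume g: "g \<in> carrier G"
      show "\<bar>B + (-1) * \<phi> (\<alpha> g x0)\<bar> \<le> B"
        using B[OF g] nn[OF K(3)[OF g x0]] by (simp add: abs_le_iff)
    qed
    moreover have "n (\<lambda>g. B + (-1) * \<phi> (\<alpha> g x0)) = B - l \<phi>"
      using n_add[OF const[of B] orb[OF affine_functional_scale[OF \<phi>, of "-1"]]]
        n_scale[OF orb[OF \<phi>], of "-1"] n_scale[OF const[of 1], of B] n_one by (simp add: l_def)
    ultimately show "0 \<le> l \<phi>" by linarith
  qed (use n_add n_scale orb n_one in \<open>auto simp: l_def\<close>)
  have fixed: "\<alpha> h p = p" if h: "h \<in> carrier G" for h
  proof (rule ccontr)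
    assume ne: "\<alpha> h p \<noteq> p"
    have W: "subspace (topspace E)" using E by (simp add: locally_convex_tvs_def)
    have pE: "p \<in> topspace E" "\<alpha> h p \<in> topspace E" using p(1) K(3)[OF h p(1)] KE by auto
    have d: "\<alpha> h p - p \<in> topspace E" "\<alpha> h p - p \<noteq> 0" using subspace_diff[OF W pE(2,1)] ne by auto
    obtain \<phi> where \<phi>: "continuous_map E euclideanreal \<phi>"
      "\<And>a b. a \<in> topspace E \<Longrightarrow> b \<in> topspace E \<Longrightarrow> \<phi> (a + b) = \<phi> a + \<phi> b"
      "\<And>c a. a \<in> topspace E \<Longrightarrow> \<phi> (c *\<^sub>R a) = c * \<phi> a" "\<phi> (\<alpha> h p - p) \<noteq> 0"
      using locally_convex_separation[OF E d] by metis
    have \<phi>_aff: "affine_functional E \<phi>"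
      using \<phi>(1-3) W by (simp add: affine_functional_def subspace_scale)
    have \<phi>h_aff: "affine_functional E (\<lambda>x. \<phi> (\<alpha> h x))"
      unfolding affine_functional_def
    proof (intro conjI ballI allI)
      show "continuous_map E euclideanreal (\<lambda>x. \<phi> (\<alpha> h x))"
        using continuous_map_compose[OF cont[OF h] \<phi>(1)] by (simp add: o_def)
      fix x y t assume xy: "x \<in> topspace E" "y \<in> topspace E"
      have "\<alpha> h x \<in> topspace E" "\<alpha> h y \<in> topspace E"
        using continuous_map_image_subset_topspace[OF cont[OF h]] xy by auto
      moreover have "\<alpha> h ((1 - t) *\<^sub>R x + t *\<^sub>R y) = (1 - t) *\<^sub>R \<alpha> h x + t *\<^sub>R \<alpha> h y"
        using aff[OF h] xy unfolding affine_map_on_def by blast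
      ultimately show "\<phi> (\<alpha> h ((1 - t) *\<^sub>R x + t *\<^sub>R y)) = (1 - t) * \<phi> (\<alpha> h x) + t * \<phi> (\<alpha> h y)"
        using \<phi>_aff by (simp add: affine_functional_def)
    qed
    have "\<phi> (\<alpha> h p) = l (\<lambda>x. \<phi> (\<alpha> h x))" by (rule p(2)[OF \<phi>h_aff])
    also have "\<dots> = n (\<lambda>g. \<phi> (\<alpha> (h \<otimes> g) x0))"
    proof -
      have eq: "\<alpha> h (\<alpha> g x0) = \<alpha> (h \<otimes> g) x0" if "g \<in> carrier G" for g
        using group_action.composition_rule[OF act _ h that] x0 KE by auto
      have "n (\<lambda>g. \<phi> (\<alpha> h (\<alpha> g x0))) = n (\<lambda>g. \<phi> (\<alpha> (h \<otimes> g) x0))"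
      proof -
        let ?f = "\<lambda>g. \<phi> (\<alpha> h (\<alpha> g x0))" and ?g = "\<lambda>g. \<phi> (\<alpha> (h \<otimes> g) x0)"
        have f: "?f \<in> Cb T" by (rule orb[OF \<phi>h_aff])
        obtain B where B: "\<And>g. g \<in> carrier G \<Longrightarrow> \<bar>?f g\<bar> \<le> B"
          using f by (auto simp: Cb_def topspace_eq)
        have cg: "continuous_map T euclideanreal ?g"
          by (rule continuous_map_eq[OF Cb_continuous[OF f]]) (use eq in \<open>auto simp: topspace_eq\<close>)
        have g: "?g \<in> Cb T" by (rule CbI[OF cg, of B]) (use B eq in \<open>auto simp: topspace_eq\<close>)
        have mg: "(\<lambda>x. (-1) * ?g x) \<in> Cb T"
          using g by (auto simp: Cb_def intro!: continuous_map_minus)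
        have "(\<lambda>x. ?f x + (-1) * ?g x) \<in> Cb T"
          using Cb_continuous[OF f] Cb_continuous[OF mg]
          by (intro CbI[of _ _ 0] continuous_map_add) (simp_all add: topspace_eq eq)
        from mean_on_cong[OF n f g mg this] show ?thesis by (simp add: eq)
      qed
      then show ?thesis by (simp add: l_def)
    qed
    also have "\<dots> = l \<phi>" using inv[OF orb[OF \<phi>_aff] h] by (simp add: l_def)
    also have "\<dots> = \<phi> p" by (rule p(2)[OF \<phi>_aff, symmetric])
    finally have "\<phi> (\<alpha> h p) = \<phi> p" .
    moreover have "\<phi> (\<alpha> h p) = \<phi> (\<alpha> h p - p) + \<phi> p" using \<phi>(2)[OF d(1) pE(1)] by simp
    ultimately show False using \<phi>(4) by simp
  qed
  with p(1) show "\<exists>x\<in>K. \<forall>g\<in>carrier G. \<alpha> g x = x" by blast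
qed

section \<open>Relative amenability gives an invariant mean on uniformly continuous functions\<close>

lemma locally_convex_pointwise_topology:
  fixes W :: "('b \<Rightarrow> real) set"
  assumes W: "subspace W"
  shows "locally_convex_tvs (subtopology (product_topology (\<lambda>_. euclideanreal) UNIV) W)"
proof -
  define X where "X = product_topology (\<lambda>_::'b. euclideanreal) UNIV"
  define E where "E = subtopology X W"
  have topX: "topspace X = UNIV" by (simp add: X_def PiE_UNIV_domain)
  then have topE: "topspace E = W" by (simp add: E_def)
  have coord: "continuous_map E euclideanreal (\<lambda>x. x f)" for f
    unfolding E_def X_def
    by (rule continuous_map_from_subtopology[OF continuous_map_product_projection]) simp
  have into: "continuous_map Z E F" if "\<And>f. continuous_map Z euclideanreal (\<lambda>z. F z f)" "F \<in> topspace Z \<rightarrow> W"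
    for Z :: "'c topology" and F
    using that unfolding E_def X_def
    by (auto simp: continuous_map_in_subtopology continuous_map_componentwise_UNIV)
  have "continuous_map (prod_topology E E) E (\<lambda>z. fst z + snd z)"
  proof (rule into)
    fix f
    have "continuous_map (prod_topology E E) euclideanreal (\<lambda>z. fst z f + snd z f)"
      using continuous_map_compose[OF continuous_map_fst coord] continuous_map_compose[OF continuous_map_snd coord]
      by (intro continuous_map_add) (auto simp: o_def)
    then show "continuous_map (prod_topology E E) euclideanreal (\<lambda>z. (fst z + snd z) f)" by simp
  qed (use subspace_add[OF W] topE in auto)
  moreover have "continuous_map (prod_topology euclideanreal E) E (\<lambda>z. fst z *\<^sub>R snd z)"
  proof (rule into)
    fix f
    have "continuous_map (prod_topology euclideanreal E) euclideanreal (\<lambda>z. fst z * snd z f)"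
      using continuous_map_fst continuous_map_compose[OF continuous_map_snd coord]
      by (intro continuous_map_real_mult) (auto simp: o_def)
    then show "continuous_map (prod_topology euclideanreal E) euclideanreal (\<lambda>z. (fst z *\<^sub>R snd z) f)" by simp
  qed (use subspace_scale[OF W] topE in auto)
  moreover have "Hausdorff_space E"
    unfolding E_def X_def by (intro Hausdorff_space_subtopology) (simp add: Hausdorff_space_product_topology)
  moreover have "\<exists>V. openin E V \<and> 0 \<in> V \<and> convex V \<and> V \<subseteq> U" if U: "openin E U" "0 \<in> U" for U
  proof -
    obtain U' where U': "openin X U'" "U = U' \<inter> W" using U(1) by (auto simp: E_def openin_subtopology)
    then have "0 \<in> U'" using U(2) by simp
    then obtain u where u: "finite {i. u i \<noteq> UNIV}" "\<And>i. open (u i)" "0 \<in> PiE UNIV u" "PiE UNIV u \<subseteq> U'"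
      using U'(1) unfolding X_def openin_product_topology_alt by auto
    define F where "F = {i. u i \<noteq> UNIV}"
    have "0 \<in> u i" for i using u(3) by (auto simp: PiE_UNIV_domain Pi_iff)
    then have "\<exists>e>0. ball 0 e \<subseteq> u i" for i
      using u(2)[of i] open_contains_ball by blast
    then obtain r where r: "\<And>i. r i > 0" "\<And>i. ball 0 (r i) \<subseteq> u i" by metis
    define B where "B i = (if i \<in> F then ball (0::real) (r i) else UNIV)" for i
    have "openin X (PiE UNIV B)"
      unfolding X_def by (subst openin_PiE_gen) (use u(1) in \<open>auto simp: B_def F_def intro: rev_finite_subset\<close>)
    moreover have "PiE UNIV B \<inter> W \<subseteq> U"
    proof -
      have "B i \<subseteq> u i" for i using r(2)[of i] by (auto simp: B_def F_def)
      then have "PiE UNIV B \<subseteq> PiE UNIV u" by (intro PiE_mono) auto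
      then show ?thesis using u(4) U'(2) by blast
    qed
    moreover have "0 \<in> PiE UNIV B" using r(1) by (auto simp: B_def PiE_UNIV_domain)
    moreover have "convex (PiE UNIV B \<inter> W)"
    proof (rule convex_Int[OF _ subspace_imp_convex[OF W]])
      have cB: "convex (B i)" for i by (simp add: B_def)
      show "convex (PiE UNIV B)"
        unfolding convex_def PiE_UNIV_domain
      proof (intro ballI allI impI Pi_I)
        fix x y :: "'b \<Rightarrow> real" and a b :: real and i
        assume "x \<in> Pi UNIV B" "y \<in> Pi UNIV B" "0 \<le> a" "0 \<le> b" "a + b = 1"
        then show "(a *\<^sub>R x + b *\<^sub>R y) i \<in> B i"
          using convexD[OF cB[of i], of "x i" "y i" a b] by auto
      qed
    qed
    ultimately show ?thesis
      using subspace_0[OF W] by (intro exI[of _ "PiE UNIV B \<inter> W"]) (auto simp: E_def openin_subtopology)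
  qed
  ultimately show ?thesis
    unfolding locally_convex_tvs_def X_def[symmetric] E_def[symmetric] topE
    using W by (auto simp: case_prod_unfold)
qed

context locally_compact_group
begin

text \<open>Boundedness and uniform continuity with respect to translations on the left, as needed for the action
  \<open>f \<mapsto> f (v \<cdot>)\<close> to have norm-continuous orbits.\<close>

definition UC :: "('a \<Rightarrow> real) set" where
  "UC = {f. (\<exists>B. \<forall>x\<in>carrier G. \<bar>f x\<bar> \<le> B) \<and>
     (\<forall>e>0. \<exists>V. openin T V \<and> \<one> \<in> V \<and> (\<forall>v\<in>V. \<forall>x\<in>carrier G. \<bar>f (v \<otimes> x) - f x\<bar> \<le> e))}"

lemma UC_bounded:
  assumes "f \<in> UC"
  obtains B where "\<And>x. x \<in> carrier G \<Longrightarrow> \<bar>f x\<bar> \<le> B"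
proof -
  have "\<exists>B. \<forall>x\<in>carrier G. \<bar>f x\<bar> \<le> B" using assms by (simp add: UC_def)
  then obtain B where "\<forall>x\<in>carrier G. \<bar>f x\<bar> \<le> B" ..
  then show thesis by (intro that[of B]) simp
qed

lemma UC_uniform:
  assumes "f \<in> UC" "e > 0"
  obtains V where "openin T V" "\<one> \<in> V" "\<And>v x. v \<in> V \<Longrightarrow> x \<in> carrier G \<Longrightarrow> \<bar>f (v \<otimes> x) - f x\<bar> \<le> e"
proof -
  have "\<exists>V. openin T V \<and> \<one> \<in> V \<and> (\<forall>v\<in>V. \<forall>x\<in>carrier G. \<bar>f (v \<otimes> x) - f x\<bar> \<le> e)"
    using assms by (simp add: UC_def)
  then show thesis using that by (elim exE conjE) simp
qed

lemma UCI:
  assumes "\<And>x. x \<in> carrier G \<Longrightarrow> \<bar>f x\<bar> \<le> B"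
    and "\<And>e. e > 0 \<Longrightarrow> \<exists>V. openin T V \<and> \<one> \<in> V \<and> (\<forall>v\<in>V. \<forall>x\<in>carrier G. \<bar>f (v \<otimes> x) - f x\<bar> \<le> e)"
  shows "f \<in> UC"
  unfolding UC_def using assms by (intro CollectI conjI exI[of _ B] ballI allI impI) simp_all

lemma UC_add:
  assumes f: "f \<in> UC" and g: "g \<in> UC"
  shows "(\<lambda>x. f x + g x) \<in> UC"
proof -
  obtain A where A: "\<And>x. x \<in> carrier G \<Longrightarrow> \<bar>f x\<bar> \<le> A" using UC_bounded[OF f] by blast
  obtain B where B: "\<And>x. x \<in> carrier G \<Longrightarrow> \<bar>g x\<bar> \<le> B" using UC_bounded[OF g] by blast
  show ?thesis
  proof (rule UCI[of _ "A + B"])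
    show "\<bar>f x + g x\<bar> \<le> A + B" if "x \<in> carrier G" for x using A[OF that] B[OF that] by linarith
    fix e :: real assume "e > 0"
    then have e: "e/2 > 0" by simp
    obtain V where V: "openin T V" "\<one> \<in> V" "\<And>v x. v \<in> V \<Longrightarrow> x \<in> carrier G \<Longrightarrow> \<bar>f (v \<otimes> x) - f x\<bar> \<le> e/2"
      using UC_uniform[OF f e] by metis
    obtain V' where V': "openin T V'" "\<one> \<in> V'" "\<And>v x. v \<in> V' \<Longrightarrow> x \<in> carrier G \<Longrightarrow> \<bar>g (v \<otimes> x) - g x\<bar> \<le> e/2"
      using UC_uniform[OF g e] by metis
    show "\<exists>V. openin T V \<and> \<one> \<in> V \<and> (\<forall>v\<in>V. \<forall>x\<in>carrier G. \<bar>f (v \<otimes> x) + g (v \<otimes> x) - (f x + g x)\<bar> \<le> e)"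
    proof (intro exI[of _ "V \<inter> V'"] conjI ballI)
      fix v x assume v: "v \<in> V \<inter> V'" and x: "x \<in> carrier G"
      show "\<bar>f (v \<otimes> x) + g (v \<otimes> x) - (f x + g x)\<bar> \<le> e"
      proof -
        have "\<bar>f (v \<otimes> x) - f x\<bar> \<le> e/2" "\<bar>g (v \<otimes> x) - g x\<bar> \<le> e/2"
          using V(3) V'(3) v x by blast+
        then show ?thesis by linarith
      qed
    qed (use V V' in auto)
  qed
qed

lemma UC_scale:
  assumes f: "f \<in> UC"
  shows "(\<lambda>x. c * f x) \<in> UC"
proof -
  obtain A where A: "\<And>x. x \<in> carrier G \<Longrightarrow> \<bar>f x\<bar> \<le> A" using UC_bounded[OF f] by blast
  show ?thesis
  proof (rule UCI[of _ "\<bar>c\<bar> * A"])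
    show "\<bar>c * f x\<bar> \<le> \<bar>c\<bar> * A" if "x \<in> carrier G" for x
      using A[OF that] by (simp add: abs_mult mult_left_mono)
    fix e :: real assume e: "e > 0"
    then have "e / (\<bar>c\<bar> + 1) > 0" by simp
    then obtain V where V: "openin T V" "\<one> \<in> V" "\<And>v x. v \<in> V \<Longrightarrow> x \<in> carrier G \<Longrightarrow> \<bar>f (v \<otimes> x) - f x\<bar> \<le> e / (\<bar>c\<bar> + 1)"
      using UC_uniform[OF f] by metis
    have "\<bar>c * f (v \<otimes> x) - c * f x\<bar> \<le> e" if "v \<in> V" "x \<in> carrier G" for v x
    proof -
      have "\<bar>c * f (v \<otimes> x) - c * f x\<bar> = \<bar>c\<bar> * \<bar>f (v \<otimes> x) - f x\<bar>"
        by (simp add: abs_mult flip: right_diff_distrib)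
      also have "\<dots> \<le> (\<bar>c\<bar> + 1) * (e / (\<bar>c\<bar> + 1))"
        using V(3)[OF that] by (intro mult_mono) auto
      also have "\<dots> = e" by simp
      finally show ?thesis .
    qed
    with V show "\<exists>V. openin T V \<and> \<one> \<in> V \<and> (\<forall>v\<in>V. \<forall>x\<in>carrier G. \<bar>c * f (v \<otimes> x) - c * f x\<bar> \<le> e)"
      by blast
  qed
qed

lemma UC_const: "(\<lambda>_. c) \<in> UC"
proof (rule UCI[of _ "\<bar>c\<bar>"])
  show "\<exists>V. openin T V \<and> \<one> \<in> V \<and> (\<forall>v\<in>V. \<forall>x\<in>carrier G. \<bar>c - c\<bar> \<le> e)" if "e > 0" for e
  proof (intro exI conjI ballI)
    show "openin T (carrier G)" using openin_topspace[of T] by (simp only: topspace_eq)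
  qed (use that in simp_all)
qed simp

lemma UC_uniform_limit:
  assumes "\<And>e. e > 0 \<Longrightarrow> \<exists>g\<in>UC. \<forall>x\<in>carrier G. \<bar>f x - g x\<bar> \<le> e"
  shows "f \<in> UC"
proof -
  have "\<exists>g\<in>UC. \<forall>x\<in>carrier G. \<bar>f x - g x\<bar> \<le> 1" by (rule assms) simp
  then obtain g where g: "g \<in> UC" "\<forall>x\<in>carrier G. \<bar>f x - g x\<bar> \<le> 1" by blast
  obtain B where B: "\<And>x. x \<in> carrier G \<Longrightarrow> \<bar>g x\<bar> \<le> B" using UC_bounded[OF g(1)] by blast
  show ?thesis
  proof (rule UCI[of _ "B + 1"])
    show "\<bar>f x\<bar> \<le> B + 1" if "x \<in> carrier G" for x using B[OF that] bspec[OF g(2) that] by linarith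
    fix e :: real assume "e > 0"
    then have e: "e/3 > 0" by simp
    obtain k where k: "k \<in> UC" "\<And>x. x \<in> carrier G \<Longrightarrow> \<bar>f x - k x\<bar> \<le> e/3" using assms[OF e] by blast
    obtain V where V: "openin T V" "\<one> \<in> V" "\<And>v x. v \<in> V \<Longrightarrow> x \<in> carrier G \<Longrightarrow> \<bar>k (v \<otimes> x) - k x\<bar> \<le> e/3"
      using UC_uniform[OF k(1) e] by metis
    have "\<bar>f (v \<otimes> x) - f x\<bar> \<le> e" if v: "v \<in> V" and x: "x \<in> carrier G" for v x
    proof -
      have "v \<otimes> x \<in> carrier G" using v x openin_carrier[OF V(1)] by auto
      from k(2)[OF this] k(2)[OF x] V(3)[OF v x] show ?thesis by linarith
    qed
    with V show "\<exists>V. openin T V \<and> \<one> \<in> V \<and> (\<forall>v\<in>V. \<forall>x\<in>carrier G. \<bar>f (v \<otimes> x) - f x\<bar> \<le> e)"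
      by blast
  qed
qed

text \<open>Uniform continuity of \<open>f\<close> at a translate: \<open>t v = (t v t\<^sup>-\<^sup>1) t\<close>.\<close>

lemma UC_translate:
  assumes f: "f \<in> UC" and t: "t \<in> carrier G"
  shows "(\<lambda>x. f (t \<otimes> x)) \<in> UC"
proof -
  obtain B where B: "\<And>x. x \<in> carrier G \<Longrightarrow> \<bar>f x\<bar> \<le> B" using UC_bounded[OF f] by blast
  show ?thesis
  proof (rule UCI[of _ B])
    show "\<bar>f (t \<otimes> x)\<bar> \<le> B" if "x \<in> carrier G" for x using B t that by simp
    fix e :: real assume e: "e > 0"
    obtain V where V: "openin T V" "\<one> \<in> V" "\<And>v x. v \<in> V \<Longrightarrow> x \<in> carrier G \<Longrightarrow> \<bar>f (v \<otimes> x) - f x\<bar> \<le> e"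
      using UC_uniform[OF f e] by metis
    define V' where "V' = {v \<in> carrier G. t \<otimes> v \<otimes> inv t \<in> V}"
    have "continuous_map T T (\<lambda>v. t \<otimes> v \<otimes> inv t)"
      using t by (intro continuous_map_mult) (auto simp: topspace_eq)
    from openin_continuous_map_preimage[OF this V(1)] have "openin T V'" by (simp add: V'_def topspace_eq)
    moreover have "\<one> \<in> V'" using t V(2) by (simp add: V'_def)
    moreover have "\<bar>f (t \<otimes> (v \<otimes> x)) - f (t \<otimes> x)\<bar> \<le> e" if v: "v \<in> V'" and x: "x \<in> carrier G" for v x
    proof -
      have "t \<otimes> (v \<otimes> x) = (t \<otimes> v \<otimes> inv t) \<otimes> (t \<otimes> x)"
      proof -
        have "inv t \<otimes> (t \<otimes> x) = x" using t x by (simp add: m_assoc[symmetric])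
        then show ?thesis using v x t by (simp add: V'_def m_assoc)
      qed
      with V(3)[of "t \<otimes> v \<otimes> inv t" "t \<otimes> x"] v x t show ?thesis by (simp add: V'_def)
    qed
    ultimately show "\<exists>V. openin T V \<and> \<one> \<in> V \<and> (\<forall>v\<in>V. \<forall>x\<in>carrier G. \<bar>f (t \<otimes> (v \<otimes> x)) - f (t \<otimes> x)\<bar> \<le> e)"
      by blast
  qed
qed

text \<open>This makes the action on means jointly continuous.\<close>

lemma UC_translate_continuous:
  assumes f: "f \<in> UC" and t: "t \<in> carrier G" and e: "e > 0"
  obtains U where "openin T U" "t \<in> U" "\<And>u x. u \<in> U \<Longrightarrow> x \<in> carrier G \<Longrightarrow> \<bar>f (u \<otimes> x) - f (t \<otimes> x)\<bar> \<le> e"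
proof -
  obtain V where V: "openin T V" "\<one> \<in> V" "\<And>v x. v \<in> V \<Longrightarrow> x \<in> carrier G \<Longrightarrow> \<bar>f (v \<otimes> x) - f x\<bar> \<le> e"
    using UC_uniform[OF f e] by metis
  show thesis
  proof (rule that[of "{u \<in> carrier G. u \<otimes> inv t \<in> V}"])
    show "openin T {u \<in> carrier G. u \<otimes> inv t \<in> V}" by (rule openin_translate(2)[OF V(1)]) (use t in simp)
    show "t \<in> {u \<in> carrier G. u \<otimes> inv t \<in> V}" using t V(2) by simp
    fix u x assume u: "u \<in> {u \<in> carrier G. u \<otimes> inv t \<in> V}" and x: "x \<in> carrier G"
    have "inv t \<otimes> (t \<otimes> x) = x" using t x by (simp add: m_assoc[symmetric])
    then have "u \<otimes> x = (u \<otimes> inv t) \<otimes> (t \<otimes> x)" using u x t by (simp add: m_assoc)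
    with V(3)[of "u \<otimes> inv t" "t \<otimes> x"] u x t show "\<bar>f (u \<otimes> x) - f (t \<otimes> x)\<bar> \<le> e" by simp
  qed
qed

text \<open>The test space consists of the means on \<open>UC\<close>, inside the bounded linear functionals on \<open>UC\<close> with
  pointwise convergence. Functionals are set to 0 outside \<open>UC\<close>, so that the means form a closed subset
  of a product of compact intervals. A mean fixed by \<open>H\<close> is an invariant mean.\<close>

theorem mean_if_relatively_amenable:
  assumes "relatively_amenable TYPE(('a \<Rightarrow> real) \<Rightarrow> real) G T H" and HG: "H \<subseteq> carrier G"
  obtains m where "mean_on UC (carrier G) m" "\<And>f h. f \<in> UC \<Longrightarrow> h \<in> H \<Longrightarrow> m (\<lambda>x. f (h \<otimes> x)) = m f"
proof -
  define lin where "lin x \<longleftrightarrow> (\<forall>f\<in>UC. \<forall>g\<in>UC. x (\<lambda>y. f y + g y) = x f + x g) \<and>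
      (\<forall>c. \<forall>f\<in>UC. x (\<lambda>y. c * f y) = c * x f) \<and> (\<forall>f. f \<notin> UC \<longrightarrow> x f = 0)" for x :: "('a \<Rightarrow> real) \<Rightarrow> real"
  define bd where "bd C x \<longleftrightarrow> (\<forall>f\<in>UC. \<forall>s. (\<forall>y\<in>carrier G. \<bar>f y\<bar> \<le> s) \<longrightarrow> \<bar>x f\<bar> \<le> C * s)"
    for C and x :: "('a \<Rightarrow> real) \<Rightarrow> real"
  define W where "W = {x. lin x \<and> (\<exists>C\<ge>0. bd C x)}"
  define X where "X = product_topology (\<lambda>_::'a \<Rightarrow> real. euclideanreal) UNIV"
  define E where "E = subtopology X W"
  define K where "K = {x \<in> W. bd 1 x \<and> x (\<lambda>_. 1) = 1}"
  define act where "act g x f = (if f \<in> UC then x (\<lambda>y. f (g \<otimes> y)) else 0)" for g and x :: "('a \<Rightarrow> real) \<Rightarrow> real" and f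
  define \<alpha> where "\<alpha> g = restrict (act g) W" for g
  have bdD: "\<bar>x f\<bar> \<le> C * s" if "bd C x" "f \<in> UC" "\<And>y. y \<in> carrier G \<Longrightarrow> \<bar>f y\<bar> \<le> s" for C x f s
    using that by (simp add: bd_def)
  have lin_add: "x (\<lambda>y. f y + g y) = x f + x g" if "x \<in> W" "f \<in> UC" "g \<in> UC" for x f g
    using that by (simp add: W_def lin_def)
  have lin_scale: "x (\<lambda>y. c * f y) = c * x f" if "x \<in> W" "f \<in> UC" for x c f
    using that by (simp add: W_def lin_def)
  have s_nonneg: "0 \<le> s" if "\<And>y. y \<in> carrier G \<Longrightarrow> \<bar>f y\<bar> \<le> s" for f :: "'a \<Rightarrow> real" and s
    using that[OF one_closed] by linarith
  have W_sub: "subspace W"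
    unfolding subspace_def
  proof (intro conjI ballI allI)
    show "0 \<in> W" using s_nonneg by (auto simp: W_def lin_def bd_def intro!: exI[of _ 0])
    fix x y assume x: "x \<in> W" and y: "y \<in> W"
    obtain C D where CD: "C \<ge> 0" "bd C x" "D \<ge> 0" "bd D y" using x y by (auto simp: W_def)
    have "bd (C + D) (x + y)"
      unfolding bd_def
    proof (intro ballI allI impI)
      fix f s assume f: "f \<in> UC" "\<forall>y\<in>carrier G. \<bar>f y\<bar> \<le> s"
      have "\<bar>x f\<bar> \<le> C * s" "\<bar>y f\<bar> \<le> D * s" using bdD[OF CD(2) f(1)] bdD[OF CD(4) f(1)] f(2) by auto
      then show "\<bar>(x + y) f\<bar> \<le> (C + D) * s" by (simp add: distrib_right)
    qed
    moreover have "lin (x + y)" using x y by (simp add: W_def lin_def algebra_simps)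
    ultimately show "x + y \<in> W" using CD by (auto simp: W_def intro!: exI[of _ "C + D"])
  next
    fix c x assume x: "x \<in> W"
    obtain C where C: "C \<ge> 0" "bd C x" using x by (auto simp: W_def)
    have "bd (\<bar>c\<bar> * C) (c *\<^sub>R x)"
      unfolding bd_def
    proof (intro ballI allI impI)
      fix f s assume f: "f \<in> UC" "\<forall>y\<in>carrier G. \<bar>f y\<bar> \<le> s"
      have "\<bar>x f\<bar> \<le> C * s" using bdD[OF C(2) f(1)] f(2) by auto
      then show "\<bar>(c *\<^sub>R x) f\<bar> \<le> (\<bar>c\<bar> * C) * s" by (simp add: abs_mult mult.assoc mult_left_mono)
    qed
    moreover have "lin (c *\<^sub>R x)" using x by (simp add: W_def lin_def algebra_simps)
    ultimately show "c *\<^sub>R x \<in> W" using C by (auto simp: W_def intro!: exI[of _ "\<bar>c\<bar> * C"])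
  qed
  have topX: "topspace X = UNIV" by (simp add: X_def PiE_UNIV_domain)
  then have topE: "topspace E = W" by (simp add: E_def)
  have KW: "K \<subseteq> W" by (auto simp: K_def)
  have coord: "continuous_map E euclideanreal (\<lambda>x. x f)" for f
    unfolding E_def X_def
    by (rule continuous_map_from_subtopology[OF continuous_map_product_projection]) simp
  have into: "continuous_map Z E F" if "\<And>f. continuous_map Z euclideanreal (\<lambda>z. F z f)" "F \<in> topspace Z \<rightarrow> W"
    for Z :: "'c topology" and F
    using that unfolding E_def X_def
    by (auto simp: continuous_map_in_subtopology continuous_map_componentwise_UNIV)
  have W_diff: "\<bar>x f - x g\<bar> \<le> C * s" if x: "x \<in> W" "bd C x" and fg: "f \<in> UC" "g \<in> UC" "\<And>y. y \<in> carrier G \<Longrightarrow> \<bar>f y - g y\<bar> \<le> s"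
    for x C f g s
  proof -
    have "\<bar>x (\<lambda>y. f y + (-1) * g y)\<bar> \<le> C * s"
      by (rule bdD[OF x(2) UC_add[OF fg(1) UC_scale[OF fg(2)]]]) (use fg(3) in simp)
    moreover have "x (\<lambda>y. f y + (-1) * g y) = x f + x (\<lambda>y. (-1) * g y)"
      by (rule lin_add[OF x(1) fg(1) UC_scale[OF fg(2)]])
    moreover have "x (\<lambda>y. (-1) * g y) = (-1) * x g"
      by (rule lin_scale[OF x(1) fg(2)])
    ultimately show ?thesis by simp
  qed
  have W_cong: "x f = x g" if x: "x \<in> W" and fg: "f \<in> UC" "g \<in> UC" "\<And>y. y \<in> carrier G \<Longrightarrow> f y = g y" for x f g
  proof -
    obtain C where "bd C x" using x by (auto simp: W_def)
    from W_diff[OF x this fg(1,2), of 0] fg(3) show ?thesis by simp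
  qed
  have act_lin: "lin (act g x)" if x: "x \<in> W" and g: "g \<in> carrier G" for x g
  proof -
    have "x (\<lambda>y. f (g \<otimes> y) + k (g \<otimes> y)) = x (\<lambda>y. f (g \<otimes> y)) + x (\<lambda>y. k (g \<otimes> y))" if "f \<in> UC" "k \<in> UC" for f k
      by (rule lin_add[OF x UC_translate[OF that(1) g] UC_translate[OF that(2) g]])
    moreover have "x (\<lambda>y. c * f (g \<otimes> y)) = c * x (\<lambda>y. f (g \<otimes> y))" if "f \<in> UC" for c f
      by (rule lin_scale[OF x UC_translate[OF that g]])
    ultimately show ?thesis by (simp add: lin_def act_def UC_add UC_scale)
  qed
  have act_bd: "bd C (act g x)" if "bd C x" "g \<in> carrier G" for C x g
    using that by (auto simp: bd_def act_def UC_translate)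
  have act_W: "act g x \<in> W" if "x \<in> W" "g \<in> carrier G" for g x
    using act_lin[OF that] act_bd[OF _ that(2)] that(1) unfolding W_def by blast
  have act_act: "act g (act h x) = act (g \<otimes> h) x" if x: "x \<in> W" and g: "g \<in> carrier G" and h: "h \<in> carrier G" for g h x
  proof
    fix f
    have "x (\<lambda>y. f (g \<otimes> (h \<otimes> y))) = x (\<lambda>y. f (g \<otimes> h \<otimes> y))" if f: "f \<in> UC"
      by (rule W_cong[OF x UC_translate[OF UC_translate[OF f g] h] UC_translate[OF f]])
         (use g h in \<open>auto simp: m_assoc\<close>)
    then show "act g (act h x) f = act (g \<otimes> h) x f" using g by (simp add: act_def UC_translate)
  qed
  have act_one: "act \<one> x = x" if x: "x \<in> W" for x
  proof
    fix f
    have "x (\<lambda>y. f (\<one> \<otimes> y)) = x f" if f: "f \<in> UC"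
      by (rule W_cong[OF x UC_translate[OF f one_closed] f]) simp
    then show "act \<one> x f = x f" using x by (auto simp: act_def W_def lin_def)
  qed
  have \<alpha>_Bij: "\<alpha> g \<in> Bij W" if g: "g \<in> carrier G" for g
  proof -
    have "bij_betw (\<alpha> g) W W"
    proof (rule bij_betwI)
      show "\<alpha> g \<in> W \<rightarrow> W" "\<alpha> (inv g) \<in> W \<rightarrow> W" using act_W g by (auto simp: \<alpha>_def)
      show "\<alpha> (inv g) (\<alpha> g x) = x" "\<alpha> g (\<alpha> (inv g) x) = x" if "x \<in> W" for x
        using that g act_W act_act[OF that] act_one[OF that] by (simp_all add: \<alpha>_def)
    qed
    then show ?thesis by (simp add: Bij_def \<alpha>_def)
  qed
  have "\<alpha> \<in> hom G (BijGroup W)"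
  proof (rule homI)
    show "\<alpha> g \<in> carrier (BijGroup W)" if "g \<in> carrier G" for g using \<alpha>_Bij[OF that] by (simp add: BijGroup_def)
    show "\<alpha> (g \<otimes> h) = \<alpha> g \<otimes>\<^bsub>BijGroup W\<^esub> \<alpha> h" if g: "g \<in> carrier G" and h: "h \<in> carrier G" for g h
    proof
      fix x
      show "\<alpha> (g \<otimes> h) x = (\<alpha> g \<otimes>\<^bsub>BijGroup W\<^esub> \<alpha> h) x"
        using act_act[OF _ g h, of x] act_W[OF _ h, of x] \<alpha>_Bij[OF g] \<alpha>_Bij[OF h]
        by (cases "x \<in> W") (simp_all add: BijGroup_def compose_def \<alpha>_def)
    qed
  qed
  then have action: "group_action G W \<alpha>"
    by (intro group_action.intro group_hom.intro group_hom_axioms.intro group_BijGroup is_group)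
  have x_tr_cont: "continuous_map T euclideanreal (\<lambda>g. act g x f)" if x: "x \<in> W" for x f
  proof (cases "f \<in> UC")
    case True
    obtain C where C: "C \<ge> 0" "bd C x" using x by (auto simp: W_def)
    show ?thesis
      unfolding continuous_map_real_iff
    proof (intro ballI allI impI)
      fix t and e :: real assume "t \<in> topspace T" and e: "e > 0"
      then have t: "t \<in> carrier G" by (simp add: topspace_eq)
      have d: "e / (C + 1) > 0" "C * (e / (C + 1)) < e" using e C(1) by (auto simp: field_simps)
      obtain U where U: "openin T U" "t \<in> U" "\<And>u x. u \<in> U \<Longrightarrow> x \<in> carrier G \<Longrightarrow> \<bar>f (u \<otimes> x) - f (t \<otimes> x)\<bar> \<le> e / (C + 1)"
        using UC_translate_continuous[OF True t d(1)] by metis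
      have "\<bar>act u x f - act t x f\<bar> < e" if u: "u \<in> U" for u
      proof -
        have "u \<in> carrier G" using u openin_carrier[OF U(1)] by blast
        from W_diff[OF x C(2) UC_translate[OF True this] UC_translate[OF True t] U(3)[OF u]] d(2)
        show ?thesis using True by (simp add: act_def)
      qed
      with U show "\<exists>U. openin T U \<and> t \<in> U \<and> (\<forall>u\<in>U. \<bar>act u x f - act t x f\<bar> < e)" by blast
    qed
  qed (simp add: act_def)
  have convK: "convex K"
    unfolding convex_def
  proof (intro ballI allI impI)
    fix x y and a b :: real assume x: "x \<in> K" and y: "y \<in> K" and ab: "0 \<le> a" "0 \<le> b" "a + b = 1"
    have "bd 1 (a *\<^sub>R x + b *\<^sub>R y)"
      unfolding bd_def
    proof (intro ballI allI impI)
      fix f s assume f: "f \<in> UC" "\<forall>y\<in>carrier G. \<bar>f y\<bar> \<le> s"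
      have "\<bar>x f\<bar> \<le> s" "\<bar>y f\<bar> \<le> s" using x y f by (auto simp: K_def bd_def)
      then have "\<bar>a * x f\<bar> \<le> a * s" "\<bar>b * y f\<bar> \<le> b * s" using ab by (auto simp: abs_mult mult_left_mono)
      then have "\<bar>a * x f + b * y f\<bar> \<le> (a + b) * s" by (simp only: distrib_right)
      then show "\<bar>(a *\<^sub>R x + b *\<^sub>R y) f\<bar> \<le> 1 * s" using ab by simp
    qed
    moreover have "a *\<^sub>R x + b *\<^sub>R y \<in> W"
      using x y by (intro subspace_add[OF W_sub] subspace_scale[OF W_sub]) (auto simp: K_def)
    ultimately show "a *\<^sub>R x + b *\<^sub>R y \<in> K" using x y ab by (simp add: K_def)
  qed
  have compK: "compactin E K"
  proof -
    define Bd where "Bd f = (if f \<in> UC then (SUP y\<in>carrier G. \<bar>f y\<bar>) else 0)" for f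
    define Box where "Box = PiE UNIV (\<lambda>f. {- Bd f .. Bd f})"
    have box: "compactin X Box" unfolding X_def Box_def by (subst compactin_PiE) auto
    have sup: "\<bar>f y\<bar> \<le> Bd f" if f: "f \<in> UC" and y: "y \<in> carrier G" for f y
    proof -
      obtain B where "\<And>x. x \<in> carrier G \<Longrightarrow> \<bar>f x\<bar> \<le> B" using UC_bounded[OF f] by blast
      then have "bdd_above ((\<lambda>y. \<bar>f y\<bar>) ` carrier G)" by (intro bdd_aboveI2[of _ _ B])
      from cSUP_upper[OF y this] show ?thesis using f by (simp add: Bd_def)
    qed
    have KBox: "K \<subseteq> Box"
    proof
      fix x assume x: "x \<in> K"
      have "\<bar>x f\<bar> \<le> Bd f" for f
        using x sup[of f] by (cases "f \<in> UC") (auto simp: K_def W_def lin_def bd_def Bd_def)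
      then show "x \<in> Box" by (auto simp: Box_def PiE_UNIV_domain abs_le_iff minus_le_iff)
    qed
    have cc: "continuous_map X euclideanreal (\<lambda>x. x f)" for f
      unfolding X_def by (rule continuous_map_product_projection) simp
    have closed_all: "closedin X {x. \<forall>i. F i x = (0::real)}" if "\<And>i. continuous_map X euclideanreal (F i)" for F :: "'i \<Rightarrow> _"
    proof -
      have "closedin X {x \<in> topspace X. F i x \<in> {0}}" for i
        by (rule closedin_continuous_map_preimage[OF that]) simp
      then have "closedin X (\<Inter>i. {x \<in> topspace X. F i x \<in> {0}})" by (intro closedin_Inter) auto
      moreover have "(\<Inter>i. {x \<in> topspace X. F i x \<in> {0}}) = {x. \<forall>i. F i x = 0}" by (auto simp: topX)
      ultimately show ?thesis by simp
    qed
    \<comment> \<open>the conditions that define \<open>K\<close>, each written as the vanishing of a continuous function\<close>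
    define F1 where "F1 p x = (if fst p \<in> UC \<and> snd p \<in> UC then x (\<lambda>y. fst p y + snd p y) - (x (fst p) + x (snd p)) else 0)"
      for p and x :: "('a \<Rightarrow> real) \<Rightarrow> real"
    define F2 where "F2 p x = (if snd p \<in> UC then x (\<lambda>y. fst p * snd p y) - fst p * x (snd p) else 0)"
      for p and x :: "('a \<Rightarrow> real) \<Rightarrow> real"
    define F3 where "F3 f x = (if f \<in> UC then 0 else x f)" for f and x :: "('a \<Rightarrow> real) \<Rightarrow> real"
    define F4 where "F4 p x = (if snd p \<in> UC \<and> (\<forall>y\<in>carrier G. \<bar>snd p y\<bar> \<le> fst p) then max 0 (\<bar>x (snd p)\<bar> - fst p) else 0)"
      for p and x :: "('a \<Rightarrow> real) \<Rightarrow> real"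
    define F5 where "F5 u x = x (\<lambda>_. 1) - 1" for u :: unit and x :: "('a \<Rightarrow> real) \<Rightarrow> real"
    have "continuous_map X euclideanreal (F1 p)" for p
      unfolding F1_def using cc by (cases "fst p \<in> UC \<and> snd p \<in> UC") (auto intro!: continuous_map_diff continuous_map_add)
    moreover have "continuous_map X euclideanreal (F2 p)" for p
      unfolding F2_def using cc by (cases "snd p \<in> UC") (auto intro!: continuous_map_diff continuous_map_real_mult_left)
    moreover have "continuous_map X euclideanreal (F3 f)" for f
      unfolding F3_def using cc by (cases "f \<in> UC") auto
    moreover have "continuous_map X euclideanreal (F4 p)" for p
      unfolding F4_def using cc
      by (cases "snd p \<in> UC \<and> (\<forall>y\<in>carrier G. \<bar>snd p y\<bar> \<le> fst p)")
         (auto intro!: continuous_map_real_max continuous_map_diff continuous_map_real_abs)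
    moreover have "continuous_map X euclideanreal (F5 u)" for u
      unfolding F5_def using cc by (auto intro!: continuous_map_diff)
    ultimately have "closedin X ({x. \<forall>p. F1 p x = 0} \<inter> {x. \<forall>p. F2 p x = 0} \<inter> {x. \<forall>f. F3 f x = 0} \<inter>
        {x. \<forall>p. F4 p x = 0} \<inter> {x. \<forall>u. F5 u x = 0})"
      by (intro closedin_Int closed_all)
    moreover have mem: "x \<in> K \<longleftrightarrow> (\<forall>p. F1 p x = 0) \<and> (\<forall>p. F2 p x = 0) \<and> (\<forall>f. F3 f x = 0) \<and> (\<forall>p. F4 p x = 0) \<and> (\<forall>u. F5 u x = 0)" for x
    proof -
      have 1: "(\<forall>p. F1 p x = 0) \<longleftrightarrow> (\<forall>f\<in>UC. \<forall>g\<in>UC. x (\<lambda>y. f y + g y) = x f + x g)"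
        by (simp add: F1_def split_paired_All Ball_def) metis
      have 2: "(\<forall>p. F2 p x = 0) \<longleftrightarrow> (\<forall>c. \<forall>f\<in>UC. x (\<lambda>y. c * f y) = c * x f)"
        by (simp add: F2_def split_paired_All Ball_def)
      have 3: "(\<forall>f. F3 f x = 0) \<longleftrightarrow> (\<forall>f. f \<notin> UC \<longrightarrow> x f = 0)" by (simp add: F3_def)
      have max0: "max 0 (a - s) = 0 \<longleftrightarrow> a \<le> s" for a s :: real by auto
      have 4: "(\<forall>p. F4 p x = 0) \<longleftrightarrow> bd 1 x"
        by (auto simp: F4_def split_paired_All bd_def max0)
      have 5: "(\<forall>u. F5 u x = 0) \<longleftrightarrow> x (\<lambda>_. 1) = 1" by (simp add: F5_def)
      have "x \<in> K \<longleftrightarrow> lin x \<and> bd 1 x \<and> x (\<lambda>_. 1) = 1"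
        unfolding K_def W_def using zero_le_one by blast
      then show ?thesis unfolding 1 2 3 4 5 lin_def by blast
    qed
    have "{x. \<forall>p. F1 p x = 0} \<inter> {x. \<forall>p. F2 p x = 0} \<inter> {x. \<forall>f. F3 f x = 0} \<inter>
        {x. \<forall>p. F4 p x = 0} \<inter> {x. \<forall>u. F5 u x = 0} = K"
      by (rule Set.set_eqI) (simp only: mem Int_iff mem_Collect_eq conj_assoc)
    ultimately have "closedin X K" by simp
    then have "compactin X K" using closed_compactin[OF box KBox] by simp
    then show ?thesis using KW by (simp add: E_def compactin_subtopology)
  qed
  have K_act: "act g x \<in> K" if x: "x \<in> K" and g: "g \<in> carrier G" for x g
    using x act_W[OF _ g, of x] act_bd[OF _ g, of 1 x] by (auto simp: K_def act_def UC_const)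
  have \<alpha>K: "\<alpha> g x = act g x" if "x \<in> K" for g x using that KW by (auto simp: \<alpha>_def)
  have joint: "continuous_map (prod_topology T (subtopology E K)) (subtopology E K) (\<lambda>(g, x). \<alpha> g x)"
  proof -
    define Z where "Z = prod_topology T (subtopology E K)"
    have topZ: "topspace Z = carrier G \<times> K" using KW by (auto simp: Z_def topspace_eq topE)
    have "continuous_map Z E (\<lambda>z. act (fst z) (snd z))"
    proof (rule into)
      show "(\<lambda>z. act (fst z) (snd z)) \<in> topspace Z \<rightarrow> W" using K_act KW by (auto simp: topZ)
      fix f
      show "continuous_map Z euclideanreal (\<lambda>z. act (fst z) (snd z) f)"
      proof (cases "f \<in> UC")
        case True
        show ?thesis
          unfolding continuous_map_real_iff
        proof (intro ballI allI impI)
          fix z and e :: real assume z: "z \<in> topspace Z" and e: "e > 0"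
          obtain t x where tx: "z = (t, x)" "t \<in> carrier G" "x \<in> K" using z by (auto simp: topZ)
          have "e/2 > 0" using e by simp
          then obtain U where U: "openin T U" "t \<in> U" "\<And>u y. u \<in> U \<Longrightarrow> y \<in> carrier G \<Longrightarrow> \<bar>f (u \<otimes> y) - f (t \<otimes> y)\<bar> \<le> e/2"
            using UC_translate_continuous[OF True tx(2)] by metis
          have "continuous_map (subtopology E K) euclideanreal (\<lambda>x. x (\<lambda>y. f (t \<otimes> y)))"
            by (rule continuous_map_from_subtopology[OF coord])
          moreover have "x \<in> topspace (subtopology E K)" using tx(3) KW by (auto simp: topE)
          ultimately have "\<exists>V. openin (subtopology E K) V \<and> x \<in> V \<and>
              (\<forall>x'\<in>V. \<bar>x' (\<lambda>y. f (t \<otimes> y)) - x (\<lambda>y. f (t \<otimes> y))\<bar> < e/2)"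
            using \<open>e/2 > 0\<close> unfolding continuous_map_real_iff by blast
          then obtain V where V: "openin (subtopology E K) V" "x \<in> V"
              "\<And>x'. x' \<in> V \<Longrightarrow> \<bar>x' (\<lambda>y. f (t \<otimes> y)) - x (\<lambda>y. f (t \<otimes> y))\<bar> < e/2"
            by blast
          have "\<bar>act u x' f - act t x f\<bar> < e" if u: "u \<in> U" and x': "x' \<in> V" for u x'
          proof -
            have uG: "u \<in> carrier G" using u openin_carrier[OF U(1)] by blast
            have x'K: "x' \<in> K" using x' openin_subset[OF V(1)] by auto
            then have "x' \<in> W" "bd 1 x'" using KW by (auto simp: K_def)
            from W_diff[OF this UC_translate[OF True uG] UC_translate[OF True tx(2)] U(3)[OF u]] V(3)[OF x']
            have "\<bar>x' (\<lambda>y. f (u \<otimes> y)) - x (\<lambda>y. f (t \<otimes> y))\<bar> < e" by linarith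
            then show ?thesis using True by (simp add: act_def)
          qed
          then show "\<exists>O'. openin Z O' \<and> z \<in> O' \<and> (\<forall>z'\<in>O'. \<bar>act (fst z') (snd z') f - act (fst z) (snd z) f\<bar> < e)"
            using U V tx(1) unfolding Z_def
            by (intro exI[of _ "U \<times> V"]) (auto simp: openin_prod_Times_iff)
        qed
      qed (simp add: act_def)
    qed
    then have "continuous_map Z (subtopology E K) (\<lambda>z. act (fst z) (snd z))"
      using K_act by (auto simp: continuous_map_in_subtopology topZ)
    then have "continuous_map Z (subtopology E K) (\<lambda>(g, x). \<alpha> g x)"
      by (rule continuous_map_eq) (auto simp: topZ \<alpha>K)
    then show ?thesis by (simp add: Z_def)
  qed
  have "convex_compact_space G T E \<alpha> K"
    unfolding convex_compact_space_def topE
  proof (intro conjI ballI)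
    show "locally_convex_tvs E" unfolding E_def X_def by (rule locally_convex_pointwise_topology[OF W_sub])
    fix g assume g: "g \<in> carrier G"
    show "affine_map_on W (\<alpha> g)"
      unfolding affine_map_on_def
    proof (intro ballI allI)
      fix x y and t :: real assume "x \<in> W" "y \<in> W"
      moreover from this have "(1 - t) *\<^sub>R x + t *\<^sub>R y \<in> W"
        by (intro subspace_add[OF W_sub] subspace_scale[OF W_sub])
      ultimately show "\<alpha> g ((1 - t) *\<^sub>R x + t *\<^sub>R y) = (1 - t) *\<^sub>R \<alpha> g x + t *\<^sub>R \<alpha> g y"
        by (auto simp: \<alpha>_def act_def fun_eq_iff)
    qed
    have "continuous_map E E (act g)"
    proof (rule into)
      show "continuous_map E euclideanreal (\<lambda>x. act g x f)" for f
        by (cases "f \<in> UC") (simp_all add: act_def coord)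
    qed (use act_W[OF _ g] topE in auto)
    then show "continuous_map E E (\<alpha> g)"
      by (rule continuous_map_eq) (simp add: topE \<alpha>_def)
    show "\<alpha> g ` K \<subseteq> K" using K_act[OF _ g] \<alpha>K by auto
  next
    fix x assume x: "x \<in> W"
    have "continuous_map T E (\<lambda>g. act g x)"
      by (rule into[OF x_tr_cont[OF x]]) (use act_W[OF x] in \<open>auto simp: topspace_eq\<close>)
    then show "continuous_map T E (\<lambda>g. \<alpha> g x)" using x by (simp add: \<alpha>_def)
  qed (fact action convK compK joint)+
  moreover have "(\<lambda>f. if f \<in> UC then f \<one> else 0) \<in> K"
  proof -
    have "bd 1 (\<lambda>f. if f \<in> UC then f \<one> else 0)" by (auto simp: bd_def)
    moreover have "lin (\<lambda>f. if f \<in> UC then f \<one> else 0)" by (auto simp: lin_def UC_add UC_scale)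
    ultimately show ?thesis by (auto simp: K_def W_def UC_const intro: exI[of _ 1])
  qed
  ultimately obtain x where x: "x \<in> K" "\<And>h. h \<in> H \<Longrightarrow> \<alpha> h x = x"
    using assms(1) unfolding relatively_amenable_def by blast
  show thesis
  proof (rule that[of x])
    show "mean_on UC (carrier G) x"
      using x(1) by (simp add: mean_on_def K_def W_def lin_def bd_def)
    fix f h assume "f \<in> UC" "h \<in> H"
    then have "act h x f = x f" using x(2)[of h] \<alpha>K[OF x(1), of h] by simp
    then show "x (\<lambda>y. f (h \<otimes> y)) = x f" using \<open>f \<in> UC\<close> by (simp add: act_def)
  qed
qed

end

section \<open>The coset space\<close>

text \<open>A closed subgroup with a left Haar integral \<open>J\<close>, and a quasi-invariant measure \<open>M\<close> on the space of
  its left cosets.\<close>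

locale quasi_invariant = Haar_subgroup G T H J for G (structure) and T H J +
  fixes M
  assumes quasi_invariant: "quasi_invariant_measure G T H M"
begin

abbreviation X where "X \<equiv> coset_topology G T H"

lemma topspace_X: "topspace X = lcosets H"
  by (rule topspace_coset_topology)

lemma coset_in_X: "x \<in> carrier G \<Longrightarrow> x <# H \<in> topspace X"
  unfolding topspace_X LCOSETS_def by blast

lemma in_X_cases:
  assumes "C \<in> topspace X"
  obtains x where "x \<in> carrier G" "C = x <# H"
  using assms unfolding topspace_X LCOSETS_def by blast

lemma H_sub: "H \<subseteq> carrier G"
  using subgroup.subset[OF sub] .

lemma coset_action: "g \<in> carrier G \<Longrightarrow> x \<in> carrier G \<Longrightarrow> g <# (x <# H) = (g \<otimes> x) <# H"
  by (rule lcos_m_assoc[OF H_sub])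

lemma coset_mult: "x \<in> carrier G \<Longrightarrow> h \<in> H \<Longrightarrow> (x \<otimes> h) <# H = x <# H"
proof -
  assume x: "x \<in> carrier G" and h: "h \<in> H"
  have "h <# H = H"
  proof
    show "h <# H \<subseteq> H" using h by (auto simp: l_coset_def)
    show "H \<subseteq> h <# H"
    proof
      fix k assume k: "k \<in> H"
      have "k = h \<otimes> (inv h \<otimes> k)" using h k HG by (simp add: m_assoc[symmetric])
      then show "k \<in> h <# H" using h k unfolding l_coset_def by (metis H_closed(1,2) UN_I singletonI)
    qed
  qed
  then show ?thesis using coset_action[of x h] coset_action[of x \<one>] x h HG lcos_m_assoc[OF H_sub x, of h] by simp
qed

lemma coset_elem: "x \<in> carrier G \<Longrightarrow> y \<in> x <# H \<Longrightarrow> \<exists>h\<in>H. y = x \<otimes> h"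
  by (auto simp: l_coset_def)

lemma coset_self: "x \<in> carrier G \<Longrightarrow> x \<in> x <# H"
  using lcos_self sub by blast

lemma continuous_on_X: "continuous_map X Z F \<longleftrightarrow> continuous_map T Z (\<lambda>x. F (x <# H))"
  using continuous_compose_quotient_map_eq[OF quotient_map_coset_topology, of Z F] by (simp add: o_def)

lemma continuous_coset: "continuous_map T X (\<lambda>x. x <# H)"
  by (rule quotient_imp_continuous_map[OF quotient_map_coset_topology])

lemma continuous_action: "g \<in> carrier G \<Longrightarrow> continuous_map X X (\<lambda>C. g <# C)"
proof -
  assume g: "g \<in> carrier G"
  have "continuous_map T X (\<lambda>x. (g \<otimes> x) <# H)"
    using continuous_map_compose[OF continuous_translate(1)[OF g] continuous_coset] by (simp add: o_def)
  then show ?thesis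
    unfolding continuous_on_X by (rule continuous_map_eq) (use coset_action g in \<open>auto simp: topspace_eq\<close>)
qed

text \<open>Integration along a coset, with respect to the translate of the Haar measure of \<open>H\<close>. The representative
  is arbitrary: another one changes the integrand by a translation by an element of \<open>H\<close>.\<close>

definition flat :: "('a \<Rightarrow> real) \<Rightarrow> 'a set \<Rightarrow> real" where
  "flat f C = J (\<lambda>h. f ((SOME x. x \<in> C) \<otimes> h))"

lemma flat_integrand:
  assumes f: "f \<in> Cc T"
  shows "x \<in> carrier G \<Longrightarrow> (\<lambda>h. f (x \<otimes> h)) \<in> Cc S"
    and "continuous_map T euclideanreal (\<lambda>x. J (\<lambda>h. f (x \<otimes> h)))"
proof -
  have "continuous_map (prod_topology T S) T (\<lambda>z. fst z \<otimes> snd z)"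
    by (intro continuous_map_mult continuous_map_fst continuous_map_into_fulltopology[OF continuous_map_snd])
  from continuous_map_compose[OF this Cc_continuous[OF f]]
  have cont: "continuous_map (prod_topology T S) euclideanreal (\<lambda>(x, h). f (x \<otimes> h))"
    by (simp add: o_def case_prod_unfold)
  obtain C where C: "compactin T C" "\<And>x. x \<in> topspace T \<Longrightarrow> x \<notin> C \<Longrightarrow> f x = 0"
    using Cc_support[OF f] by metis
  have supp: "\<exists>D. compactin T D \<and> (\<forall>x\<in>K. \<forall>h\<in>H - D. f (x \<otimes> h) = 0)" if K: "compactin T K" for K
  proof (intro exI[of _ "m_inv G ` K <#> C"] conjI ballI)
    show "compactin T (m_inv G ` K <#> C)"
      by (intro compactin_set_mult compactin_inverse K C)
    fix x h assume x: "x \<in> K" and h: "h \<in> H - (m_inv G ` K <#> C)"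
    have G: "x \<in> carrier G" "h \<in> carrier G" using compactin_carrier[OF K] x h HG by auto
    have "h = inv x \<otimes> (x \<otimes> h)" using G by (simp add: m_assoc[symmetric])
    then have "x \<otimes> h \<notin> C" using h x unfolding set_mult_def by blast
    then show "f (x \<otimes> h) = 0" using C(2) G by (simp add: topspace_eq)
  qed
  show "x \<in> carrier G \<Longrightarrow> (\<lambda>h. f (x \<otimes> h)) \<in> Cc S" by (rule integral_parameter(1)[OF cont supp])
  show "continuous_map T euclideanreal (\<lambda>x. J (\<lambda>h. f (x \<otimes> h)))" by (rule integral_parameter(2)[OF cont supp])
qed

lemma flat_coset:
  assumes f: "f \<in> Cc T" and x: "x \<in> carrier G"
  shows "flat f (x <# H) = J (\<lambda>h. f (x \<otimes> h))"
proof -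
  have "(SOME y. y \<in> x <# H) \<in> x <# H" using coset_self[OF x] by (rule someI)
  then obtain k where k: "k \<in> H" "(SOME y. y \<in> x <# H) = x \<otimes> k" using coset_elem[OF x] by blast
  have "flat f (x <# H) = J (\<lambda>h. f (x \<otimes> k \<otimes> h))" by (simp add: flat_def k(2))
  also have "\<dots> = J (\<lambda>h. f (x \<otimes> (k \<otimes> h)))"
    by (rule pf_cong[OF J flat_integrand(1)[OF f]]) (use x k HG in \<open>auto simp: m_assoc\<close>)
  also have "\<dots> = J (\<lambda>h. f (x \<otimes> h))"
    by (rule J_translate[OF flat_integrand(1)[OF f x] k(1)])
  finally show ?thesis .
qed

lemma flat_continuous:
  assumes f: "f \<in> Cc T"
  shows "continuous_map X euclideanreal (flat f)"
  unfolding continuous_on_X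
proof (rule continuous_map_eq[OF flat_integrand(2)[OF f]])
  show "J (\<lambda>h. f (x \<otimes> h)) = flat f (x <# H)" if "x \<in> topspace T" for x
    using flat_coset[OF f, of x] that by (simp add: topspace_eq)
qed

lemma flat_add:
  assumes "f \<in> Cc T" "g \<in> Cc T" "C \<in> topspace X"
  shows "flat (\<lambda>x. f x + g x) C = flat f C + flat g C"
proof -
  obtain x where x: "x \<in> carrier G" "C = x <# H" using in_X_cases[OF assms(3)] .
  show ?thesis
    unfolding x(2) flat_coset[OF assms(1) x(1)] flat_coset[OF assms(2) x(1)] flat_coset[OF Cc_add[OF assms(1,2)] x(1)]
    by (rule pf_add[OF J flat_integrand(1)[OF assms(1) x(1)] flat_integrand(1)[OF assms(2) x(1)]])
qed

lemma flat_mult: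
  assumes f: "f \<in> Cc T" and F: "continuous_map X euclideanreal F" and C: "C \<in> topspace X"
  shows "flat (\<lambda>x. F (x <# H) * f x) C = F C * flat f C"
proof -
  obtain x where x: "x \<in> carrier G" "C = x <# H" using in_X_cases[OF C] .
  have Ff: "(\<lambda>x. F (x <# H) * f x) \<in> Cc T" using F f continuous_on_X by (intro Cc_mult) auto
  have "flat (\<lambda>x. F (x <# H) * f x) C = J (\<lambda>h. F C * f (x \<otimes> h))"
    unfolding x(2) flat_coset[OF Ff x(1)]
    by (rule pf_cong[OF J flat_integrand(1)[OF Ff x(1)]]) (use x HG in \<open>auto simp: coset_mult\<close>)
  also have "\<dots> = F C * flat f C"
    unfolding x(2) flat_coset[OF f x(1)] by (rule pf_scale[OF J flat_integrand(1)[OF f x(1)]])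
  finally show ?thesis .
qed

lemma flat_scale:
  assumes "f \<in> Cc T" "C \<in> topspace X"
  shows "flat (\<lambda>x. c * f x) C = c * flat f C"
  by (rule flat_mult[OF assms(1) _ assms(2), of "\<lambda>_. c"]) simp

lemma flat_abs_le:
  assumes f: "f \<in> Cc T" and g: "g \<in> Cc T" and C: "C \<in> topspace X"
    and le: "\<And>x. x \<in> carrier G \<Longrightarrow> \<bar>f x\<bar> \<le> g x"
  shows "\<bar>flat f C\<bar> \<le> flat g C"
proof -
  obtain x where x: "x \<in> carrier G" "C = x <# H" using in_X_cases[OF C] .
  show ?thesis
    unfolding x(2) flat_coset[OF f x(1)] flat_coset[OF g x(1)]
    by (rule pf_abs_le[OF J flat_integrand(1)[OF f x(1)] flat_integrand(1)[OF g x(1)]]) (use x HG le in auto)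
qed

lemma flat_nonneg:
  assumes "f \<in> Cc T" "\<And>x. x \<in> carrier G \<Longrightarrow> 0 \<le> f x" "C \<in> topspace X"
  shows "0 \<le> flat f C"
  using flat_abs_le[OF assms(1,1,3)] assms(2) abs_ge_zero[of "flat f C"] by (simp add: abs_of_nonneg)

lemma flat_pos:
  assumes f: "f \<in> Cc T" "\<And>x. x \<in> carrier G \<Longrightarrow> 0 \<le> f x" and x: "x \<in> carrier G" "0 < f x"
  shows "0 < flat f (x <# H)"
  unfolding flat_coset[OF f(1) x(1)]
proof (rule J_pos[OF flat_integrand(1)[OF f(1) x(1)]])
  show "0 \<le> f (x \<otimes> h)" if "h \<in> H" for h using f(2) x(1) HG[OF that] by simp
  show "\<one> \<in> H" by simp
  show "0 < f (x \<otimes> \<one>)" using x by simp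
qed

text \<open>A closed set in the coset space is a closed set of the group saturated under \<open>H\<close>, and
  compact times closed is closed.\<close>

lemma image_coset_closed:
  assumes C: "compactin T C"
  shows "closedin X ((\<lambda>x. x <# H) ` C)"
proof -
  have CG: "C \<subseteq> carrier G" by (rule compactin_carrier[OF C])
  define R where "R = {z \<in> topspace (prod_topology (subtopology T C) T). inv (fst z) \<otimes> snd z \<in> H}"
  have "continuous_map (prod_topology (subtopology T C) T) T (\<lambda>z. inv (fst z) \<otimes> snd z)"
    by (intro continuous_map_mult continuous_map_inv continuous_map_snd
          continuous_map_into_fulltopology[OF continuous_map_fst])
  from closedin_continuous_map_preimage[OF this closed]
  have "closedin (prod_topology (subtopology T C) T) R" by (simp add: R_def)
  moreover have "compact_space (subtopology T C)" using C by (rule compact_space_subtopology)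
  ultimately have "closedin T (snd ` R)" using closed_map_snd unfolding closed_map_def by blast
  moreover have "{x \<in> topspace T. x <# H \<in> (\<lambda>x. x <# H) ` C} = snd ` R"
  proof (intro Set.set_eqI iffI)
    fix x assume x: "x \<in> {x \<in> topspace T. x <# H \<in> (\<lambda>x. x <# H) ` C}"
    then obtain c where c: "c \<in> C" "x <# H = c <# H" by blast
    have xG: "x \<in> carrier G" using x by (simp add: topspace_eq)
    have "x \<in> c <# H" using coset_self[OF xG] c(2) by simp
    then obtain h where h: "h \<in> H" "x = c \<otimes> h" using coset_elem c(1) CG by blast
    have "inv c \<otimes> x = h" using h c(1) CG HG by (auto simp: m_assoc[symmetric])
    then have "(c, x) \<in> R" using c(1) CG xG h(1) by (auto simp: R_def topspace_eq)
    then show "x \<in> snd ` R" by (metis image_eqI snd_conv)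
  next
    fix x assume "x \<in> snd ` R"
    then obtain c where c: "c \<in> C" "x \<in> carrier G" "inv c \<otimes> x \<in> H" by (auto simp: R_def topspace_eq)
    have "x = c \<otimes> (inv c \<otimes> x)" using c CG by (simp add: m_assoc[symmetric] subset_iff)
    then have "x <# H = c <# H" using coset_mult[of c "inv c \<otimes> x"] c CG by auto
    then show "x \<in> {x \<in> topspace T. x <# H \<in> (\<lambda>x. x <# H) ` C}" using c by (auto simp: topspace_eq)
  qed
  ultimately have "closedin T {x \<in> topspace T. x <# H \<in> (\<lambda>x. x <# H) ` C}" by simp
  moreover have "(\<lambda>x. x <# H) ` C \<subseteq> topspace X" using CG coset_in_X by blast
  ultimately show ?thesis
    using quotient_map_coset_topology[unfolded quotient_map_closedin, THEN conjunct2, rule_format] by blast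
qed

lemma flat_supp:
  assumes f: "f \<in> Cc T" and C: "\<And>x. x \<in> carrier G \<Longrightarrow> x \<notin> C \<Longrightarrow> f x = 0"
    and D: "D \<in> topspace X" "D \<notin> (\<lambda>x. x <# H) ` C"
  shows "flat f D = 0"
proof -
  obtain x where x: "x \<in> carrier G" "D = x <# H" using in_X_cases[OF D(1)] .
  have "f (x \<otimes> h) = 0" if "h \<in> H" for h
  proof -
    have "x \<otimes> h \<notin> C" using D(2) coset_mult[OF x(1) that] x(2) by (metis image_eqI)
    then show ?thesis using C x(1) that HG by simp
  qed
  then have "J (\<lambda>h. f (x \<otimes> h)) = J (\<lambda>_. 0)"
    by (intro pf_cong[OF J flat_integrand(1)[OF f x(1)]]) (use HG in auto)
  then show ?thesis using x pf_zero[OF J] by (simp add: flat_coset[OF f])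
qed

text \<open>The quotient map is open, so the images of interiors of compact sets form an open cover.\<close>

lemma compact_lift:
  assumes A: "compactin X A"
  obtains C where "compactin T C" "A \<subseteq> (\<lambda>x. x <# H) ` C"
proof -
  have "\<exists>U K. openin T U \<and> compactin T K \<and> x \<in> U \<and> U \<subseteq> K" if "x \<in> carrier G" for x
    using locally_compact that unfolding locally_compact_space_def topspace_eq by blast
  then obtain U K where UK: "\<And>x. x \<in> carrier G \<Longrightarrow> openin T (U x) \<and> compactin T (K x) \<and> x \<in> U x \<and> U x \<subseteq> K x"
    by metis
  have op: "openin X ((\<lambda>x. x <# H) ` U x)" if x: "x \<in> carrier G" for x
    unfolding openin_coset_topology
  proof
    have UG: "U x \<subseteq> carrier G" using UK[OF x] openin_carrier by blast
    then show "(\<lambda>x. x <# H) ` U x \<subseteq> lcosets H" using coset_in_X topspace_X by blast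
    have "{y \<in> topspace T. y <# H \<in> (\<lambda>x. x <# H) ` U x} = (\<Union>h\<in>H. {y \<in> carrier G. y \<otimes> h \<in> U x})"
    proof (intro Set.set_eqI iffI)
      fix y assume "y \<in> {y \<in> topspace T. y <# H \<in> (\<lambda>x. x <# H) ` U x}"
      then obtain u where u: "u \<in> U x" "y \<in> carrier G" "y <# H = u <# H" by (auto simp: topspace_eq)
      have "u \<in> y <# H" using coset_self[of u] u UG by auto
      then obtain h where "h \<in> H" "u = y \<otimes> h" using coset_elem[OF u(2)] by blast
      with u show "y \<in> (\<Union>h\<in>H. {y \<in> carrier G. y \<otimes> h \<in> U x})" by blast
    next
      fix y assume "y \<in> (\<Union>h\<in>H. {y \<in> carrier G. y \<otimes> h \<in> U x})"
      then obtain h where h: "h \<in> H" "y \<in> carrier G" "y \<otimes> h \<in> U x" by blast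
      then have "y <# H = (y \<otimes> h) <# H" using coset_mult by simp
      with h show "y \<in> {y \<in> topspace T. y <# H \<in> (\<lambda>x. x <# H) ` U x}" by (auto simp: topspace_eq)
    qed
    moreover have "openin T (\<Union>h\<in>H. {y \<in> carrier G. y \<otimes> h \<in> U x})"
      using UK[OF x] HG openin_translate(2) by (intro openin_Union) auto
    ultimately show "openin T {y \<in> topspace T. y <# H \<in> (\<lambda>x. x <# H) ` U x}" by simp
  qed
  have cover: "\<exists>x\<in>carrier G. D \<in> (\<lambda>x. x <# H) ` U x" if "D \<in> A" for D
  proof -
    have "D \<in> topspace X" using that compactin_subset_topspace[OF A] by blast
    then obtain x where "x \<in> carrier G" "D = x <# H" using in_X_cases by blast
    then show ?thesis using UK by blast
  qed
  obtain P where P: "finite P" "P \<subseteq> carrier G" "\<And>D. D \<in> A \<Longrightarrow> \<exists>x\<in>P. D \<in> (\<lambda>x. x <# H) ` U x"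
    using compactin_subcover_image[OF A, of "carrier G" "\<lambda>x. (\<lambda>x. x <# H) ` U x", OF op cover] by metis
  show thesis
  proof (rule that[of "\<Union>(K ` P)"])
    show "compactin T (\<Union>(K ` P))" using P UK by (intro compactin_Union) auto
    show "A \<subseteq> (\<lambda>x. x <# H) ` \<Union>(K ` P)"
    proof
      fix D assume "D \<in> A"
      then obtain x where x: "x \<in> P" "D \<in> (\<lambda>x. x <# H) ` U x" using P(3) by blast
      have "U x \<subseteq> K x" using UK P(2) x(1) by blast
      then show "D \<in> (\<lambda>x. x <# H) ` \<Union>(K ` P)" using x by blast
    qed
  qed
qed

section \<open>The measure on the coset space\<close>

lemma radon: "radon_measure X M"
  using quasi_invariant by (simp add: quasi_invariant_measure_def)

lemma space_M: "space M = topspace X"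
  using radon unfolding radon_measure_def by blast

lemma sets_M: "sets M = sigma_sets (topspace X) {U. openin X U}"
proof -
  have "{U. openin X U} \<subseteq> Pow (topspace X)" using openin_subset by blast
  moreover have "sets M = sets (borel_of X)" using radon unfolding radon_measure_def by blast
  ultimately show ?thesis by (simp add: borel_of_def sets_measure_of)
qed

lemma open_sets: "openin X U \<Longrightarrow> U \<in> sets M"
  unfolding sets_M by (rule sigma_sets.Basic) simp

lemma closed_sets:
  assumes "closedin X C"
  shows "C \<in> sets M"
proof -
  have "openin X (topspace X - C)" "C \<subseteq> topspace X" using assms by (auto simp: closedin_def)
  then have "space M - (topspace X - C) \<in> sets M" using open_sets by blast
  moreover have "space M - (topspace X - C) = C" using \<open>C \<subseteq> topspace X\<close> by (auto simp: space_M)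
  ultimately show ?thesis by simp
qed

lemma continuous_measurable:
  fixes F :: "'a set \<Rightarrow> real"
  assumes "continuous_map X euclideanreal F"
  shows "F \<in> borel_measurable M"
proof (rule borel_measurableI)
  fix U :: "real set" assume "open U"
  then have "openin X {C \<in> topspace X. F C \<in> U}" by (intro openin_continuous_map_preimage[OF assms]) simp
  moreover have "F -` U \<inter> space M = {C \<in> topspace X. F C \<in> U}" by (auto simp: space_M)
  ultimately show "F -` U \<inter> space M \<in> sets M" using open_sets by simp
qed

lemma action_measurable:
  assumes g: "g \<in> carrier G"
  shows "(\<lambda>C. g <# C) \<in> measurable M M"
proof (rule measurable_sigma_sets[OF sets_M])
  show "{U. openin X U} \<subseteq> Pow (topspace X)" using openin_subset by blast
  show "(\<lambda>C. g <# C) \<in> space M \<rightarrow> topspace X"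
    using continuous_map_funspace[OF continuous_action[OF g]] by (simp add: space_M)
  fix U assume "U \<in> {U. openin X U}"
  then have "openin X {C \<in> topspace X. g <# C \<in> U}"
    by (intro openin_continuous_map_preimage[OF continuous_action[OF g]]) simp
  moreover have "(\<lambda>C. g <# C) -` U \<inter> space M = {C \<in> topspace X. g <# C \<in> U}" by (auto simp: space_M)
  ultimately show "(\<lambda>C. g <# C) -` U \<inter> space M \<in> sets M" using open_sets by simp
qed

lemma action_cancel:
  assumes g: "g \<in> carrier G" and C: "C \<in> topspace X"
  shows "inv g <# (g <# C) = C"
proof -
  obtain x where x: "x \<in> carrier G" "C = x <# H" using in_X_cases[OF C] .
  have "inv g \<otimes> (g \<otimes> x) = x" using g x(1) by (simp add: m_assoc[symmetric])
  then show ?thesis using coset_action[OF g x(1)] coset_action[of "inv g" "g \<otimes> x"] g x by simp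
qed

text \<open>Through this lemma quasi-invariance enters the comparison of a density with a smoothed measure.\<close>

lemma null_translate:
  assumes g: "g \<in> carrier G" and N: "N \<in> sets M" "emeasure M {C \<in> space M. g <# C \<in> N} = 0"
  shows "N \<in> null_sets M"
proof -
  have "emeasure (translate_measure G g M) N = emeasure M ((\<lambda>C. g <# C) -` N \<inter> space M)"
    unfolding translate_measure_def by (rule emeasure_distr[OF action_measurable[OF g] N(1)])
  also have "(\<lambda>C. g <# C) -` N \<inter> space M = {C \<in> space M. g <# C \<in> N}" by auto
  finally have "N \<in> null_sets (translate_measure G g M)"
    using N by (simp add: null_sets_def translate_measure_def)
  then show ?thesis
    using quasi_invariant g by (simp add: quasi_invariant_measure_def)
qed

lemma compact_finite: "compactin X C \<Longrightarrow> C \<in> sets M \<Longrightarrow> emeasure M C < \<infinity>"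
  using radon unfolding radon_measure_def by blast

lemma flat_bounded:
  assumes f: "f \<in> Cc T"
  obtains B where "B > 0" "\<And>D. D \<in> topspace X \<Longrightarrow> \<bar>flat f D\<bar> \<le> B"
proof -
  obtain C where C: "compactin T C" "\<And>x. x \<in> topspace T \<Longrightarrow> x \<notin> C \<Longrightarrow> f x = 0"
    using Cc_support[OF f] by metis
  have c: "compactin X ((\<lambda>x. x <# H) ` C)" by (rule image_compactin[OF C(1) continuous_coset])
  obtain B where B: "B > 0" "\<And>D. D \<in> (\<lambda>x. x <# H) ` C \<Longrightarrow> \<bar>flat f D\<bar> \<le> B"
    using continuous_map_bounded_on_compact[OF flat_continuous[OF f] c] by metis
  show thesis
  proof (rule that[OF B(1)])
    show "\<bar>flat f D\<bar> \<le> B" if "D \<in> topspace X" for D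
      using flat_supp[OF f _ that, of C] C(2) B that by (cases "D \<in> (\<lambda>x. x <# H) ` C") (auto simp: topspace_eq)
  qed
qed

lemma flat_integrable:
  assumes f: "f \<in> Cc T"
  shows "integrable M (flat f)"
proof -
  obtain C where C: "compactin T C" "\<And>x. x \<in> topspace T \<Longrightarrow> x \<notin> C \<Longrightarrow> f x = 0"
    using Cc_support[OF f] by metis
  have c: "compactin X ((\<lambda>x. x <# H) ` C)" by (rule image_compactin[OF C(1) continuous_coset])
  have s: "(\<lambda>x. x <# H) ` C \<in> sets M" by (rule closed_sets[OF image_coset_closed[OF C(1)]])
  obtain B where B: "B > 0" "\<And>D. D \<in> topspace X \<Longrightarrow> \<bar>flat f D\<bar> \<le> B" using flat_bounded[OF f] by metis
  show ?thesis
  proof (rule integrableI_bounded_set[OF s continuous_measurable[OF flat_continuous[OF f]] compact_finite[OF c s]])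
    show "AE x in M. x \<in> (\<lambda>x. x <# H) ` C \<longrightarrow> norm (flat f x) \<le> B"
      using B(2) by (intro AE_I2) (simp add: space_M)
    show "AE x in M. x \<notin> (\<lambda>x. x <# H) ` C \<longrightarrow> flat f x = 0"
      using flat_supp[OF f, of C] C(2) by (intro AE_I2) (simp add: space_M topspace_eq)
  qed
qed

lemma bounded_mult_integrable:
  fixes F w :: "'a set \<Rightarrow> real"
  assumes w: "integrable M w" and F: "F \<in> borel_measurable M" "\<And>C. C \<in> space M \<Longrightarrow> \<bar>F C\<bar> \<le> B"
  shows "integrable M (\<lambda>C. F C * w C)"
proof (rule Bochner_Integration.integrable_bound[OF integrable_mult_right[OF w, of B]])
  show "(\<lambda>C. F C * w C) \<in> borel_measurable M" using F(1) w by measurable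
  show "AE x in M. norm (F x * w x) \<le> norm (B * w x)"
  proof (rule AE_I2)
    fix C assume "C \<in> space M"
    then have "\<bar>F C\<bar> \<le> \<bar>B\<bar>" using F(2) by fastforce
    then show "norm (F C * w C) \<le> norm (B * w C)" by (simp add: abs_mult mult_right_mono)
  qed
qed

text \<open>From \<open>\<bar>\<bar>a\<bar>\<^sup>2 - \<bar>b\<bar>\<^sup>2\<bar> \<le> \<bar>a - b\<bar> (\<bar>a\<bar> + \<bar>b\<bar>)\<close>, a vector that \<open>g\<close> moves little in \<open>L\<^sup>2\<close> has a density that
  \<open>g\<close> moves little in \<open>L\<^sup>1\<close>. The Radon-Nikodym derivative may be infinite, where its real value is 0;
  almost everywhere this happens only where the translate of \<open>v\<close> vanishes.\<close>

lemma almost_invariant_density: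
  assumes g: "g \<in> carrier G" and v: "square_integrable M v" "l2_norm M v = 1"
    and e: "l2_norm M (\<lambda>x. quasi_regular G M g v x - v x) < e"
    and F: "F \<in> borel_measurable M" "\<And>C. C \<in> space M \<Longrightarrow> \<bar>F C\<bar> \<le> 1"
  shows "\<bar>(\<integral>C. F (g <# C) * (cmod (v C))\<^sup>2 \<partial>M) - (\<integral>C. F C * (cmod (v C))\<^sup>2 \<partial>M)\<bar> \<le> 5 * e"
proof -
  define w where "w C = (cmod (v C))\<^sup>2" for C
  define u where "u C = w (inv g <# C)" for C
  define N where "N = translate_measure G g M"
  define R where "R = RN_deriv M N"
  define pv where "pv = quasi_regular G M g v"
  define a where "a C = cmod (pv C)" for C
  have ig: "inv g \<in> carrier G" using g by simp
  note meas [measurable] = action_measurable[OF g] action_measurable[OF ig]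
  have vm [measurable]: "v \<in> borel_measurable M" and w: "integrable M w" "\<And>C. w C \<ge> 0"
    using v(1) by (auto simp: square_integrable_def w_def[abs_def])
  have w1: "(\<integral>C. w C \<partial>M) = 1" using v(2) by (simp add: l2_norm_def w_def)
  have wm [measurable]: "w \<in> borel_measurable M" using w(1) by measurable
  have um [measurable]: "u \<in> borel_measurable M" unfolding u_def by measurable
  obtain r where r: "r \<in> borel_measurable M" "density M r = N"
    using quasi_invariant g unfolding quasi_invariant_measure_def N_def by blast
  have RN: "density M R = N" unfolding R_def by (rule RN_derivI[OF r])
  have Rm [measurable]: "R \<in> borel_measurable M" unfolding R_def by (rule borel_measurable_RN_deriv)
  have N_eq: "N = distr M M (\<lambda>C. g <# C)" by (simp add: N_def translate_measure_def)
  have a2: "(a C)\<^sup>2 = enn2real (R C) * u C" for C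
    by (simp add: a_def pv_def quasi_regular_def norm_mult power_mult_distrib u_def w_def R_def N_def)
  have pvm [measurable]: "pv \<in> borel_measurable M"
    unfolding pv_def quasi_regular_def[abs_def] by measurable
  have am [measurable]: "a \<in> borel_measurable M" unfolding a_def by measurable
  have u_action: "u (g <# C) = w C" if "C \<in> space M" for C
    using action_cancel[OF g, of C] that by (simp add: u_def space_M)
  have transfer: "(\<integral>\<^sup>+C. k (g <# C) * ennreal (w C) \<partial>M) = (\<integral>\<^sup>+C. R C * (k C * ennreal (u C)) \<partial>M)"
    if k [measurable]: "k \<in> borel_measurable M" for k :: "'a set \<Rightarrow> ennreal"
  proof -
    have "(\<integral>\<^sup>+C. k (g <# C) * ennreal (w C) \<partial>M) = (\<integral>\<^sup>+C. k (g <# C) * ennreal (u (g <# C)) \<partial>M)"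
      using u_action by (intro nn_integral_cong) simp
    also have "\<dots> = (\<integral>\<^sup>+C. k C * ennreal (u C) \<partial>N)"
      unfolding N_eq by (rule nn_integral_distr[symmetric]) measurable
    also have "\<dots> = (\<integral>\<^sup>+C. R C * (k C * ennreal (u C)) \<partial>M)"
      unfolding RN[symmetric] by (rule nn_integral_density) measurable
    finally show ?thesis .
  qed
  have nn1: "(\<integral>\<^sup>+C. ennreal (w C) \<partial>M) = 1"
    using nn_integral_eq_integral[OF w(1)] w(2) w1 by simp
  have Ru: "(\<integral>\<^sup>+C. R C * ennreal (u C) \<partial>M) = 1"
    using transfer[of "\<lambda>_. 1"] nn1 by simp
  have "AE C in M. R C * ennreal (u C) \<noteq> \<infinity>"
    by (rule nn_integral_PInf_AE) (use Ru in auto)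
  then have Rfin: "AE C in M. R C * ennreal (u C) = ennreal ((a C)\<^sup>2)"
  proof (rule AE_mp, intro AE_I2 impI)
    fix C assume fin: "R C * ennreal (u C) \<noteq> \<infinity>"
    show "R C * ennreal (u C) = ennreal ((a C)\<^sup>2)"
    proof (cases "u C = 0")
      case True
      then show ?thesis by (simp add: a2)
    next
      case False
      then have "u C > 0" using w(2) by (simp add: u_def less_le)
      then have "R C \<noteq> \<infinity>" using fin by (auto simp: ennreal_mult_eq_top_iff)
      then have "R C = ennreal (enn2real (R C))" by (simp add: less_top)
      then show ?thesis
        using w(2) by (metis a2 enn2real_nonneg ennreal_mult u_def)
    qed
  qed
  have transfer': "(\<integral>\<^sup>+C. k (g <# C) * ennreal (w C) \<partial>M) = (\<integral>\<^sup>+C. k C * ennreal ((a C)\<^sup>2) \<partial>M)"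
    if k: "k \<in> borel_measurable M" for k :: "'a set \<Rightarrow> ennreal"
    unfolding transfer[OF k]
  proof (rule nn_integral_cong_AE, rule AE_mp[OF Rfin], intro AE_I2 impI)
    fix C assume "R C * ennreal (u C) = ennreal ((a C)\<^sup>2)"
    then show "R C * (k C * ennreal (u C)) = k C * ennreal ((a C)\<^sup>2)" by (metis mult.left_commute)
  qed
  have ia: "integrable M (\<lambda>C. (a C)\<^sup>2)" and ia1: "(\<integral>C. (a C)\<^sup>2 \<partial>M) = 1"
  proof -
    have 1: "(\<integral>\<^sup>+C. ennreal ((a C)\<^sup>2) \<partial>M) = 1" using transfer'[of "\<lambda>_. 1"] nn1 by simp
    show "integrable M (\<lambda>C. (a C)\<^sup>2)"
      by (rule integrableI_nn_integral_finite[where x=1]) (use 1 in auto)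
    then show "(\<integral>C. (a C)\<^sup>2 \<partial>M) = 1" using 1 by (subst integral_eq_nn_integral) auto
  qed
  have real_transfer: "(\<integral>C. F (g <# C) * w C \<partial>M) = (\<integral>C. F C * (a C)\<^sup>2 \<partial>M)"
    if F [measurable]: "F \<in> borel_measurable M" and F0: "\<And>C. C \<in> space M \<Longrightarrow> 0 \<le> F C" for F :: "'a set \<Rightarrow> real"
  proof -
    have F0': "0 \<le> F (g <# C)" if "C \<in> space M" for C
      using F0 measurable_space[OF meas(1) that] by simp
    have "(\<integral>C. F (g <# C) * w C \<partial>M) = enn2real (\<integral>\<^sup>+C. ennreal (F (g <# C) * w C) \<partial>M)"
      using F0' w(2) by (intro integral_eq_nn_integral) auto
    also have "(\<integral>\<^sup>+C. ennreal (F (g <# C) * w C) \<partial>M) = (\<integral>\<^sup>+C. ennreal (F (g <# C)) * ennreal (w C) \<partial>M)"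
      using F0' w(2) by (intro nn_integral_cong) (simp add: ennreal_mult)
    also have "\<dots> = (\<integral>\<^sup>+C. ennreal (F C) * ennreal ((a C)\<^sup>2) \<partial>M)"
      by (rule transfer'[of "\<lambda>C. ennreal (F C)"]) measurable
    also have "\<dots> = (\<integral>\<^sup>+C. ennreal (F C * (a C)\<^sup>2) \<partial>M)"
      using F0 by (intro nn_integral_cong) (simp add: ennreal_mult)
    also have "enn2real \<dots> = (\<integral>C. F C * (a C)\<^sup>2 \<partial>M)"
      using F0 by (intro integral_eq_nn_integral[symmetric]) auto
    finally show ?thesis .
  qed
  have e0: "e > 0"
  proof -
    have "0 \<le> l2_norm M (\<lambda>x. quasi_regular G M g v x - v x)"
      unfolding l2_norm_def by (intro real_sqrt_ge_zero integral_nonneg_AE) auto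
    then show ?thesis using e by linarith
  qed
  define d where "d C = (cmod (pv C - v C))\<^sup>2" for C
  have id: "integrable M d"
  proof (rule Bochner_Integration.integrable_bound)
    show "integrable M (\<lambda>C. 2 * (a C)\<^sup>2 + 2 * w C)" using ia w(1) by auto
    show "d \<in> borel_measurable M" unfolding d_def by measurable
    show "AE C in M. norm (d C) \<le> norm (2 * (a C)\<^sup>2 + 2 * w C)"
    proof (rule AE_I2)
      fix C
      have "d C \<le> (a C + cmod (v C))\<^sup>2"
        unfolding d_def a_def by (intro power_mono norm_triangle_ineq4) auto
      also have "\<dots> \<le> 2 * (a C)\<^sup>2 + 2 * w C"
        using sum_squares_bound[of "a C" "cmod (v C)"] by (simp add: w_def power2_sum)
      finally show "norm (d C) \<le> norm (2 * (a C)\<^sup>2 + 2 * w C)"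
        by (simp add: d_def w_def)
    qed
  qed
  have de: "(\<integral>C. d C \<partial>M) \<le> e\<^sup>2"
  proof -
    have "sqrt (\<integral>C. d C \<partial>M) < e" using e by (simp add: l2_norm_def d_def pv_def)
    moreover have "0 \<le> (\<integral>C. d C \<partial>M)" by (intro integral_nonneg_AE) (simp add: d_def)
    ultimately show ?thesis by (metis less_imp_le real_sqrt_ge_zero real_sqrt_pow2 power_mono)
  qed
  have pointwise: "\<bar>(a C)\<^sup>2 - w C\<bar> \<le> d C / (2 * e) + e * ((a C)\<^sup>2 + w C)" for C
  proof -
    define b where "b = cmod (v C)"
    have ab: "\<bar>a C - b\<bar> \<le> cmod (pv C - v C)" unfolding a_def b_def by (rule norm_triangle_ineq3)
    define x where "x = \<bar>a C - b\<bar>"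
    define y where "y = a C + b"
    have x2: "x\<^sup>2 \<le> d C" unfolding x_def d_def using power_mono[OF ab, of 2] by simp
    have y2: "y\<^sup>2 \<le> 2 * ((a C)\<^sup>2 + w C)"
      using sum_squares_bound[of "a C" b] by (simp add: y_def w_def b_def power2_sum)
    have "\<bar>(a C)\<^sup>2 - w C\<bar> = x * y"
    proof -
      have "(a C)\<^sup>2 - w C = (a C - b) * (a C + b)" by (simp add: w_def b_def power2_eq_square algebra_simps)
      moreover have "0 \<le> a C + b" by (simp add: a_def b_def)
      ultimately show ?thesis by (simp add: x_def y_def abs_mult)
    qed
    moreover have "x * y \<le> x\<^sup>2 / (2 * e) + e * y\<^sup>2 / 2"
    proof -
      have "0 \<le> (x - e * y)\<^sup>2 / (2 * e)" using e0 by simp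
      also have "\<dots> = x\<^sup>2 / (2 * e) + e * y\<^sup>2 / 2 - x * y"
        using e0 by (simp add: power2_eq_square field_simps)
      finally show ?thesis by simp
    qed
    moreover have "x\<^sup>2 / (2 * e) \<le> d C / (2 * e)" using x2 e0 by (intro divide_right_mono) auto
    moreover have "e * y\<^sup>2 / 2 \<le> e * ((a C)\<^sup>2 + w C)" using mult_left_mono[OF y2, of "e / 2"] e0 by simp
    ultimately show ?thesis by linarith
  qed
  have iaw: "integrable M (\<lambda>C. (a C)\<^sup>2 - w C)" using ia w(1) by auto
  have L1: "(\<integral>C. \<bar>(a C)\<^sup>2 - w C\<bar> \<partial>M) \<le> 5 / 2 * e"
  proof -
    have "(\<integral>C. \<bar>(a C)\<^sup>2 - w C\<bar> \<partial>M) \<le> (\<integral>C. d C / (2 * e) + e * ((a C)\<^sup>2 + w C) \<partial>M)"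
      using iaw id ia w(1) pointwise by (intro integral_mono) auto
    also have "\<dots> = (\<integral>C. d C \<partial>M) / (2 * e) + e * 2"
      using id ia w(1) ia1 w1 by simp
    also have "\<dots> \<le> e\<^sup>2 / (2 * e) + e * 2" using de e0 by (intro add_right_mono divide_right_mono) auto
    also have "\<dots> = 5 / 2 * e" using e0 by (simp add: power2_eq_square field_simps)
    finally show ?thesis .
  qed
  \<comment> \<open>a shift makes the test function non-negative, as needed to compare with integrals of extended reals\<close>
  define F' where "F' C = (F C + 1) / 2" for C
  have F'm [measurable]: "F' \<in> borel_measurable M" unfolding F'_def using F(1) by measurable
  have F'01: "0 \<le> F' C" "\<bar>F' C\<bar> \<le> 1" if "C \<in> space M" for C using F(2)[OF that] by (auto simp: F'_def)
  have gsp: "g <# C \<in> space M" if "C \<in> space M" for C using measurable_space[OF meas(1) that] .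
  have i1: "integrable M (\<lambda>C. F' (g <# C) * w C)" "integrable M (\<lambda>C. F' C * w C)"
    using F'01 gsp by (auto intro!: bounded_mult_integrable[OF w(1), where B=1])
  have ia': "integrable M (\<lambda>C. F' C * (a C)\<^sup>2)"
    using F'01 by (intro bounded_mult_integrable[OF ia, where B=1]) auto
  have "(\<integral>C. F' (g <# C) * w C \<partial>M) - (\<integral>C. F' C * w C \<partial>M) = (\<integral>C. F' C * ((a C)\<^sup>2 - w C) \<partial>M)"
    using real_transfer[OF F'm F'01(1)] ia' i1(2) by (simp add: right_diff_distrib)
  also have "\<bar>\<dots>\<bar> \<le> (\<integral>C. \<bar>F' C * ((a C)\<^sup>2 - w C)\<bar> \<partial>M)" by (rule integral_abs_bound)
  also have "\<dots> \<le> (\<integral>C. \<bar>(a C)\<^sup>2 - w C\<bar> \<partial>M)"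
  proof (rule integral_mono)
    show "integrable M (\<lambda>C. \<bar>F' C * ((a C)\<^sup>2 - w C)\<bar>)"
      using F'01 by (intro integrable_abs bounded_mult_integrable[OF iaw, where B=1]) auto
    show "\<bar>F' C * ((a C)\<^sup>2 - w C)\<bar> \<le> \<bar>(a C)\<^sup>2 - w C\<bar>" if "C \<in> space M" for C
      using mult_right_mono[OF F'01(2)[OF that], of "\<bar>(a C)\<^sup>2 - w C\<bar>"] by (simp add: abs_mult)
  qed (use iaw in auto)
  finally have F'_le: "\<bar>(\<integral>C. F' (g <# C) * w C \<partial>M) - (\<integral>C. F' C * w C \<partial>M)\<bar> \<le> 5 / 2 * e" using L1 by linarith
  have "(\<integral>C. F (g <# C) * w C \<partial>M) = (\<integral>C. 2 * (F' (g <# C) * w C) - w C \<partial>M)"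
    by (intro Bochner_Integration.integral_cong refl) (simp add: F'_def field_simps)
  also have "\<dots> = 2 * (\<integral>C. F' (g <# C) * w C \<partial>M) - 1" using i1 w(1) w1 by simp
  finally have A: "(\<integral>C. F (g <# C) * w C \<partial>M) = 2 * (\<integral>C. F' (g <# C) * w C \<partial>M) - 1" .
  have "(\<integral>C. F C * w C \<partial>M) = (\<integral>C. 2 * (F' C * w C) - w C \<partial>M)"
    by (intro Bochner_Integration.integral_cong refl) (simp add: F'_def field_simps)
  also have "\<dots> = 2 * (\<integral>C. F' C * w C \<partial>M) - 1" using i1 w(1) w1 by simp
  finally have B: "(\<integral>C. F C * w C \<partial>M) = 2 * (\<integral>C. F' C * w C \<partial>M) - 1" .
  show ?thesis using A B F'_le unfolding w_def by linarith
qed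

text \<open>Cut the density where it is very small or very large. What remains lives on a set of finite measure,
  and an open neighbourhood of it of finite measure is exhausted by compact sets.\<close>

lemma density_tight:
  fixes w :: "'a set \<Rightarrow> real"
  assumes w: "integrable M w" "\<And>C. 0 \<le> w C" and e: "e > 0"
  obtains A where "compactin X A" "A \<in> sets M" "(\<integral>C. indicator (space M - A) C * w C \<partial>M) \<le> e"
proof -
  have wm [measurable]: "w \<in> borel_measurable M" using w(1) by measurable
  \<comment> \<open>the part of the density that is cut off; it tends to 0\<close>
  define c where "c n C = (if w C \<le> 1 / real (Suc n) then w C else 0) + (w C - min (w C) (real n))" for n C
  have cm [measurable]: "c n \<in> borel_measurable M" for n unfolding c_def by measurable
  have lim: "(\<lambda>n. c n C) \<longlonglongrightarrow> 0" for C
  proof (rule tendsto_eventually)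
    show "\<forall>\<^sub>F n in sequentially. c n C = 0"
    proof (cases "w C = 0")
      case True
      then show ?thesis by (simp add: c_def)
    next
      case False
      then have pos: "w C > 0" using w(2)[of C] by linarith
      obtain m where m: "1 / real (Suc m) < w C"
        using reals_Archimedean[OF pos] by (auto simp: inverse_eq_divide)
      obtain k where k: "w C \<le> real k" using real_arch_simple by blast
      show ?thesis
        unfolding eventually_sequentially
      proof (intro exI[of _ "max m k"] allI impI)
        fix n assume n: "max m k \<le> n"
        have "1 / real (Suc n) \<le> 1 / real (Suc m)" using n by (intro divide_left_mono) auto
        then have "1 / real (Suc n) < w C" using m by linarith
        moreover have "w C \<le> real n" using k n by (simp add: le_trans)
        ultimately show "c n C = 0" by (simp add: c_def)
      qed
    qed
  qed
  have "(\<lambda>n. \<integral>C. c n C \<partial>M) \<longlonglongrightarrow> (\<integral>C. 0 \<partial>M)"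
  proof (rule integral_dominated_convergence)
    show "integrable M (\<lambda>C. 2 * w C)" using w(1) by auto
    show "AE C in M. norm (c n C) \<le> 2 * w C" for n
      using w(2) by (intro AE_I2) (auto simp: c_def min_def)
  qed (use lim in auto)
  then have "(\<lambda>n. \<integral>C. c n C \<partial>M) \<longlonglongrightarrow> 0" by simp
  then have "\<forall>\<^sub>F n in sequentially. (\<integral>C. c n C \<partial>M) < e / 2"
    using e by (intro order_tendstoD) auto
  then obtain n where n: "(\<integral>C. c n C \<partial>M) < e / 2" by (auto simp: eventually_sequentially)
  have ci: "integrable M (c n)"
    by (rule Bochner_Integration.integrable_bound[OF integrable_mult_right[OF w(1), of 2]])
       (use w(2) in \<open>auto simp: c_def min_def\<close>)
  define D where "D = {C \<in> space M. 1 / real (Suc n) < w C}"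
  have D: "D \<in> sets M" unfolding D_def by measurable
  have Dfin: "emeasure M D < \<infinity>"
  proof -
    have "integrable M (indicator D :: _ \<Rightarrow> real)"
    proof (rule Bochner_Integration.integrable_bound[OF integrable_mult_right[OF w(1), of "real (Suc n)"]])
      show "AE C in M. norm (indicator D C :: real) \<le> norm (real (Suc n) * w C)"
        using w(2) by (intro AE_I2) (auto simp: D_def indicator_def field_simps)
    qed (use D in auto)
    then show ?thesis using D by (simp add: integrable_indicator_iff)
  qed
  have outer: "emeasure M D = (INF U\<in>{U. openin X U \<and> D \<subseteq> U}. emeasure M U)"
    using radon D unfolding radon_measure_def by blast
  then have "(INF U\<in>{U. openin X U \<and> D \<subseteq> U}. emeasure M U) < \<infinity>" using Dfin by simp
  then obtain U where U: "openin X U" "D \<subseteq> U" "emeasure M U < \<infinity>" by (auto simp: INF_less_iff)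
  have Us: "U \<in> sets M" by (rule open_sets[OF U(1)])
  define \<eta> where "\<eta> = e / (2 * (real n + 1))"
  have \<eta>: "\<eta> > 0" "real n * \<eta> \<le> e / 2" using e by (auto simp: \<eta>_def field_simps)
  have inner: "emeasure M U = (SUP C\<in>{C. compactin X C \<and> C \<in> sets M \<and> C \<subseteq> U}. emeasure M C)"
    using radon U(1) unfolding radon_measure_def by blast
  obtain A where A: "compactin X A" "A \<in> sets M" "A \<subseteq> U" "measure M U - \<eta> < measure M A"
  proof (cases "measure M U - \<eta> < 0")
    case True
    have "measure M {} = 0" by simp
    then show thesis using that[of "{}"] True by auto
  next
    case False
    have "ennreal (measure M U - \<eta>) < emeasure M U"
      using U(3) False \<eta>(1) by (simp add: emeasure_eq_ennreal_measure less_top ennreal_less_iff)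
    then obtain C where C: "compactin X C" "C \<in> sets M" "C \<subseteq> U" "ennreal (measure M U - \<eta>) < emeasure M C"
      unfolding inner less_SUP_iff by blast
    have "emeasure M C \<noteq> \<infinity>" using compact_finite[OF C(1,2)] by simp
    then have "measure M U - \<eta> < measure M C"
      using C(4) False by (simp add: emeasure_eq_ennreal_measure ennreal_less_iff)
    then show thesis using that C by blast
  qed
  have UA: "measure M (U - A) \<le> \<eta>" "emeasure M (U - A) < \<infinity>"
  proof -
    have "measure M (U - A) = measure M U - measure M A"
      using U(3) Us A by (intro measure_Diff) auto
    then show "measure M (U - A) \<le> \<eta>" using A(4) by simp
    show "emeasure M (U - A) < \<infinity>" using emeasure_mono[of "U - A" U M] Us U(3) by (auto intro: le_less_trans)
  qed
  have UAi: "integrable M (indicator (U - A) :: _ \<Rightarrow> real)" using UA(2) Us A(2) by (simp add: integrable_indicator_iff)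
  show thesis
  proof (rule that[OF A(1,2)])
    have "(\<integral>C. indicator (space M - A) C * w C \<partial>M) \<le> (\<integral>C. c n C + real n * indicator (U - A) C \<partial>M)"
    proof (rule integral_mono)
      show "integrable M (\<lambda>C. indicator (space M - A) C * w C)"
        using A(2) by (intro bounded_mult_integrable[OF w(1), where B=1]) (auto simp: indicator_def)
      show "integrable M (\<lambda>C. c n C + real n * indicator (U - A) C)" using ci UAi by auto
      fix C assume C: "C \<in> space M"
      show "indicator (space M - A) C * w C \<le> c n C + real n * indicator (U - A) C"
      proof (cases "C \<in> A \<or> w C \<le> 1 / real (Suc n)")
        case True
        then show ?thesis using w(2)[of C] by (auto simp: c_def indicator_def min_def)
      next
        case False
        then have "C \<in> U - A" using U(2) C by (auto simp: D_def)
        then show ?thesis using False w(2)[of C] by (auto simp: c_def indicator_def min_def)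
      qed
    qed
    also have "\<dots> = (\<integral>C. c n C \<partial>M) + real n * measure M (U - A)"
      using ci UAi Us A(2) by (simp add: less_imp_le)
    also have "\<dots> \<le> e / 2 + real n * \<eta>" using n UA(1) by (intro add_mono mult_left_mono) auto
    also have "\<dots> \<le> e" using \<eta>(2) by simp
    finally show "(\<integral>C. indicator (space M - A) C * w C \<partial>M) \<le> e" .
  qed
qed

end

section \<open>Charges and uniformly continuous functions\<close>

lemma Cc_if_norm_continuous:
  assumes Q: "compactin X Q" and supp: "\<And>h. h \<in> topspace X - Q \<Longrightarrow> k h = 0"
    and cont: "\<And>h (e::real). h \<in> topspace X \<Longrightarrow> e > 0 \<Longrightarrow> \<exists>U. openin X U \<and> h \<in> U \<and> (\<forall>u\<in>U. \<bar>k u - k h\<bar> \<le> e)"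
  shows "k \<in> Cc X"
proof (rule CcI[OF _ Q])
  show "continuous_map X euclideanreal k"
    unfolding continuous_map_real_iff
  proof (intro ballI allI impI)
    fix h and e :: real assume "h \<in> topspace X" "e > 0"
    then obtain U where "openin X U" "h \<in> U" "\<And>u. u \<in> U \<Longrightarrow> \<bar>k u - k h\<bar> \<le> e/2"
      using cont[of h "e/2"] by auto
    with \<open>e > 0\<close> show "\<exists>U. openin X U \<and> h \<in> U \<and> (\<forall>u\<in>U. \<bar>k u - k h\<bar> < e)"
      by (intro exI[of _ U]) fastforce
  qed
qed (use supp in auto)

context locally_compact_group
begin

abbreviation cont :: "('a \<Rightarrow> real) \<Rightarrow> bool" where
  "cont f \<equiv> continuous_map T euclideanreal f"

text \<open>Signed measures of total variation at most \<open>D\<close> on the compact set \<open>C\<close>, as functionals. They act on all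
  continuous functions, so that they can be translated and multiplied freely.\<close>

definition charge :: "'a set \<Rightarrow> real \<Rightarrow> (('a \<Rightarrow> real) \<Rightarrow> real) \<Rightarrow> bool" where
  "charge C D \<nu> \<longleftrightarrow> compactin T C \<and> C \<noteq> {} \<and> 0 \<le> D \<and>
     (\<forall>f g. cont f \<longrightarrow> cont g \<longrightarrow> \<nu> (\<lambda>x. f x + g x) = \<nu> f + \<nu> g) \<and>
     (\<forall>c f. cont f \<longrightarrow> \<nu> (\<lambda>x. c * f x) = c * \<nu> f) \<and>
     (\<forall>f s. cont f \<longrightarrow> (\<forall>x\<in>C. \<bar>f x\<bar> \<le> s) \<longrightarrow> \<bar>\<nu> f\<bar> \<le> D * s)"

text \<open>Norm continuity of the right translates. By a classical theorem this characterizes the measures that are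
  absolutely continuous with respect to Haar measure.\<close>

definition right_continuous :: "(('a \<Rightarrow> real) \<Rightarrow> real) \<Rightarrow> bool" where
  "right_continuous \<nu> \<longleftrightarrow> (\<forall>e>0. \<exists>V. openin T V \<and> \<one> \<in> V \<and>
     (\<forall>v\<in>V. \<forall>f s. cont f \<longrightarrow> (\<forall>x\<in>carrier G. \<bar>f x\<bar> \<le> s) \<longrightarrow> \<bar>\<nu> (\<lambda>x. f (x \<otimes> v)) - \<nu> f\<bar> \<le> e * s))"

lemma chargeI:
  assumes "compactin T C" "C \<noteq> {}" "0 \<le> D"
    and "\<And>f g. cont f \<Longrightarrow> cont g \<Longrightarrow> \<nu> (\<lambda>x. f x + g x) = \<nu> f + \<nu> g"
    and "\<And>c f. cont f \<Longrightarrow> \<nu> (\<lambda>x. c * f x) = c * \<nu> f"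
    and "\<And>f s. cont f \<Longrightarrow> (\<And>x. x \<in> C \<Longrightarrow> \<bar>f x\<bar> \<le> s) \<Longrightarrow> \<bar>\<nu> f\<bar> \<le> D * s"
  shows "charge C D \<nu>"
  using assms by (simp add: charge_def)

context
  fixes C D \<nu>
  assumes \<nu>: "charge C D \<nu>"
begin

lemma charge_compact: "compactin T C"
  and charge_bound_nonneg: "0 \<le> D"
  and charge_add: "cont f \<Longrightarrow> cont g \<Longrightarrow> \<nu> (\<lambda>x. f x + g x) = \<nu> f + \<nu> g"
  and charge_scale: "cont f \<Longrightarrow> \<nu> (\<lambda>x. c * f x) = c * \<nu> f"
  and charge_bound: "cont f \<Longrightarrow> (\<And>x. x \<in> C \<Longrightarrow> \<bar>f x\<bar> \<le> s) \<Longrightarrow> \<bar>\<nu> f\<bar> \<le> D * s"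
  and charge_nonempty: "C \<noteq> {}"
  using \<nu> by (simp_all add: charge_def)

lemma charge_diff: "cont f \<Longrightarrow> cont g \<Longrightarrow> \<nu> (\<lambda>x. f x - g x) = \<nu> f - \<nu> g"
  using charge_add[of f "\<lambda>x. (-1) * g x"] charge_scale[of g "-1"] by (simp add: continuous_map_minus)

lemma charge_close:
  assumes "cont f" "cont g" "\<And>x. x \<in> C \<Longrightarrow> \<bar>f x - g x\<bar> \<le> s"
  shows "\<bar>\<nu> f - \<nu> g\<bar> \<le> D * s"
  using charge_bound[of "\<lambda>x. f x - g x" s] charge_diff[OF assms(1,2)] assms by (simp add: continuous_map_diff)

lemma charge_cong: "cont f \<Longrightarrow> cont g \<Longrightarrow> (\<And>x. x \<in> C \<Longrightarrow> f x = g x) \<Longrightarrow> \<nu> f = \<nu> g"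
  using charge_close[of f g 0] by simp

end

lemma cont_right: "cont f \<Longrightarrow> t \<in> carrier G \<Longrightarrow> cont (\<lambda>x. f (x \<otimes> t))"
  using continuous_map_compose[OF continuous_translate(2)] by (simp add: o_def)

lemma cont_left: "cont f \<Longrightarrow> t \<in> carrier G \<Longrightarrow> cont (\<lambda>x. f (t \<otimes> x))"
  using continuous_map_compose[OF continuous_translate(1)] by (simp add: o_def)

lemma Cb_left_translate:
  assumes f: "f \<in> Cb T" and t: "t \<in> carrier G"
  shows "(\<lambda>x. f (t \<otimes> x)) \<in> Cb T"
proof -
  obtain s where "\<And>x. x \<in> carrier G \<Longrightarrow> \<bar>f x\<bar> \<le> s" using f by (auto simp: Cb_def topspace_eq)
  then show ?thesis using t by (intro CbI[OF cont_left[OF Cb_continuous[OF f] t], of s]) (simp add: topspace_eq)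
qed

lemma charge_mult:
  assumes \<nu>: "charge C D \<nu>" and b: "cont b" "\<And>x. x \<in> carrier G \<Longrightarrow> \<bar>b x\<bar> \<le> B"
  shows "charge C (D * B) (\<lambda>f. \<nu> (\<lambda>x. b x * f x))"
proof (rule chargeI)
  have B: "B \<ge> 0" using b(2)[OF one_closed] by linarith
  note C = charge_compact[OF \<nu>] and D = charge_bound_nonneg[OF \<nu>]
  show "compactin T C" by (rule C)
  show "C \<noteq> {}" by (rule charge_nonempty[OF \<nu>])
  show "0 \<le> D * B" using D B by simp
  have bf: "cont (\<lambda>x. b x * f x)" if "cont f" for f using b(1) that by (rule continuous_map_real_mult)
  show "\<nu> (\<lambda>x. b x * (f x + g x)) = \<nu> (\<lambda>x. b x * f x) + \<nu> (\<lambda>x. b x * g x)" if "cont f" "cont g" for f g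
    using charge_add[OF \<nu> bf[OF that(1)] bf[OF that(2)]] by (simp add: distrib_left)
  show "\<nu> (\<lambda>x. b x * (c * f x)) = c * \<nu> (\<lambda>x. b x * f x)" if "cont f" for c f
    using charge_scale[OF \<nu> bf[OF that], of c] by (simp add: mult.left_commute)
  fix f s assume f: "cont f" and s: "\<And>x. x \<in> C \<Longrightarrow> \<bar>f x\<bar> \<le> s"
  have "\<bar>\<nu> (\<lambda>x. b x * f x)\<bar> \<le> D * (B * s)"
  proof (rule charge_bound[OF \<nu> bf[OF f]])
    fix x assume x: "x \<in> C"
    then have "x \<in> carrier G" using compactin_carrier[OF C] by blast
    from mult_mono[OF b(2)[OF this] s[OF x] B] show "\<bar>b x * f x\<bar> \<le> B * s" by (simp add: abs_mult)
  qed
  then show "\<bar>\<nu> (\<lambda>x. b x * f x)\<bar> \<le> D * B * s" by (simp add: mult.assoc)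
qed

text \<open>The function \<open>b\<close> is uniformly continuous on the support \<open>C\<close>, so moving it by \<open>v\<close> costs little.\<close>

lemma right_continuous_mult:
  assumes \<nu>: "charge C D \<nu>" and R: "right_continuous \<nu>" and b: "cont b" "\<And>x. x \<in> carrier G \<Longrightarrow> \<bar>b x\<bar> \<le> B"
  shows "right_continuous (\<lambda>f. \<nu> (\<lambda>x. b x * f x))"
  unfolding right_continuous_def
proof (intro allI impI)
  fix e :: real assume e: "e > 0"
  have B: "B \<ge> 0" using b(2)[OF one_closed] by linarith
  note C = charge_compact[OF \<nu>] and D = charge_bound_nonneg[OF \<nu>]
  define e1 where "e1 = e / (2 * (B + 1))"
  define e2 where "e2 = e / (2 * (D + 1))"
  have e12: "e1 > 0" "e1 * B \<le> e/2" "e2 > 0" "D * e2 \<le> e/2"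
    using e B D by (auto simp: e1_def e2_def field_simps)
  obtain V1 where V1: "openin T V1" "\<one> \<in> V1"
    "\<And>v f s. v \<in> V1 \<Longrightarrow> cont f \<Longrightarrow> (\<forall>x\<in>carrier G. \<bar>f x\<bar> \<le> s) \<Longrightarrow> \<bar>\<nu> (\<lambda>x. f (x \<otimes> v)) - \<nu> f\<bar> \<le> e1 * s"
    using R e12(1) unfolding right_continuous_def by meson
  have "continuous_map (prod_topology T T) T (\<lambda>z. snd z \<otimes> fst z)"
    by (intro continuous_map_mult continuous_map_fst continuous_map_snd)
  from continuous_map_compose[OF this b(1)]
  have "continuous_map (prod_topology T T) euclideanreal (\<lambda>(v, x). b (x \<otimes> v))" by (simp add: o_def case_prod_unfold)
  from tube_continuity[OF this C _ e12(3), of \<one>] obtain V2 where V2: "openin T V2" "\<one> \<in> V2"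
    "\<And>v x. v \<in> V2 \<Longrightarrow> x \<in> C \<Longrightarrow> \<bar>b (x \<otimes> v) - b (x \<otimes> \<one>)\<bar> < e2"
    by (auto simp: topspace_eq)
  show "\<exists>V. openin T V \<and> \<one> \<in> V \<and> (\<forall>v\<in>V. \<forall>f s. cont f \<longrightarrow> (\<forall>x\<in>carrier G. \<bar>f x\<bar> \<le> s) \<longrightarrow>
      \<bar>\<nu> (\<lambda>x. b x * f (x \<otimes> v)) - \<nu> (\<lambda>x. b x * f x)\<bar> \<le> e * s)"
  proof (intro exI[of _ "V1 \<inter> V2"] conjI ballI allI impI)
    fix v f s assume v: "v \<in> V1 \<inter> V2" and f: "cont f" and s: "\<forall>x\<in>carrier G. \<bar>f x\<bar> \<le> s"
    have vG: "v \<in> carrier G" using v openin_carrier[OF V1(1)] by blast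
    have s0: "s \<ge> 0" using bspec[OF s one_closed] by linarith
    have bf: "cont (\<lambda>x. b x * f x)" using b(1) f by (rule continuous_map_real_mult)
    have fv: "cont (\<lambda>x. b x * f (x \<otimes> v))" using b(1) cont_right[OF f vG] by (rule continuous_map_real_mult)
    have bfv: "cont (\<lambda>x. b (x \<otimes> v) * f (x \<otimes> v))" using cont_right[OF bf vG] .
    have "\<bar>\<nu> (\<lambda>x. b (x \<otimes> v) * f (x \<otimes> v)) - \<nu> (\<lambda>x. b x * f x)\<bar> \<le> e1 * (B * s)"
    proof (rule V1(3)[OF _ bf])
      show "\<forall>x\<in>carrier G. \<bar>b x * f x\<bar> \<le> B * s"
        using mult_mono[OF b(2) _ B] s by (simp add: abs_mult)
    qed (use v in blast)
    also have "\<dots> = (e1 * B) * s" by simp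
    also have "\<dots> \<le> e/2 * s" using e12(2) s0 by (rule mult_right_mono)
    finally have 1: "\<bar>\<nu> (\<lambda>x. b (x \<otimes> v) * f (x \<otimes> v)) - \<nu> (\<lambda>x. b x * f x)\<bar> \<le> e/2 * s" .
    have "\<bar>\<nu> (\<lambda>x. b x * f (x \<otimes> v)) - \<nu> (\<lambda>x. b (x \<otimes> v) * f (x \<otimes> v))\<bar> \<le> D * (e2 * s)"
    proof (rule charge_close[OF \<nu> fv bfv])
      fix x assume x: "x \<in> C"
      have xG: "x \<in> carrier G" using compactin_carrier[OF C] x by blast
      have "\<bar>b x - b (x \<otimes> v)\<bar> \<le> e2" using V2(3)[of v x] v x xG by (simp add: abs_minus_commute)
      moreover have "\<bar>f (x \<otimes> v)\<bar> \<le> s" using s xG vG by simp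
      ultimately have "\<bar>b x - b (x \<otimes> v)\<bar> * \<bar>f (x \<otimes> v)\<bar> \<le> e2 * s" using e12(3) by (intro mult_mono) auto
      then show "\<bar>b x * f (x \<otimes> v) - b (x \<otimes> v) * f (x \<otimes> v)\<bar> \<le> e2 * s"
        by (simp add: abs_mult flip: left_diff_distrib)
    qed
    also have "\<dots> = (D * e2) * s" by simp
    also have "\<dots> \<le> e/2 * s" using e12(4) s0 by (rule mult_right_mono)
    finally have 2: "\<bar>\<nu> (\<lambda>x. b x * f (x \<otimes> v)) - \<nu> (\<lambda>x. b (x \<otimes> v) * f (x \<otimes> v))\<bar> \<le> e/2 * s" .
    have "e/2 * s + e/2 * s = e * s" by simp
    with 1 2 show "\<bar>\<nu> (\<lambda>x. b x * f (x \<otimes> v)) - \<nu> (\<lambda>x. b x * f x)\<bar> \<le> e * s" by linarith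
  qed (use V1 V2 in auto)
qed

text \<open>Moving \<open>g\<close> by \<open>v\<close> on the left amounts to moving the charge by \<open>v\<close> on the right. This is how functions that
  are merely bounded and continuous come within the reach of a mean on \<open>UC\<close>.\<close>

lemma charge_convolution_UC:
  assumes \<nu>: "charge C D \<nu>" and R: "right_continuous \<nu>" and k: "cont k" "\<And>x. x \<in> carrier G \<Longrightarrow> \<bar>k x\<bar> \<le> s"
  shows "(\<lambda>g. \<nu> (\<lambda>x. k (x \<otimes> g))) \<in> UC"
proof (rule UCI[of _ "D * s"])
  note C = charge_compact[OF \<nu>]
  have CG: "C \<subseteq> carrier G" by (rule compactin_carrier[OF C])
  have s0: "s \<ge> 0" using k(2)[OF one_closed] by linarith
  show "\<bar>\<nu> (\<lambda>x. k (x \<otimes> g))\<bar> \<le> D * s" if g: "g \<in> carrier G" for g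
    using CG g k(2) by (intro charge_bound[OF \<nu> cont_right[OF k(1) g]]) auto
  fix e :: real assume e: "e > 0"
  have "e / (s + 1) > 0" using e s0 by simp
  then obtain V where V: "openin T V" "\<one> \<in> V"
    "\<And>v f t. v \<in> V \<Longrightarrow> cont f \<Longrightarrow> (\<forall>x\<in>carrier G. \<bar>f x\<bar> \<le> t) \<Longrightarrow> \<bar>\<nu> (\<lambda>x. f (x \<otimes> v)) - \<nu> f\<bar> \<le> e / (s + 1) * t"
    using R unfolding right_continuous_def by meson
  have "\<bar>\<nu> (\<lambda>x. k (x \<otimes> (v \<otimes> g))) - \<nu> (\<lambda>x. k (x \<otimes> g))\<bar> \<le> e" if v: "v \<in> V" and g: "g \<in> carrier G" for v g
  proof -
    have vG: "v \<in> carrier G" using v openin_carrier[OF V(1)] by blast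
    have kg: "cont (\<lambda>x. k (x \<otimes> g))" by (rule cont_right[OF k(1) g])
    have "\<nu> (\<lambda>x. k (x \<otimes> (v \<otimes> g))) = \<nu> (\<lambda>x. k (x \<otimes> v \<otimes> g))"
      using CG vG g by (intro charge_cong[OF \<nu>] cont_right[OF k(1)] cont_right[OF kg]) (auto simp: m_assoc)
    moreover have "\<bar>\<nu> (\<lambda>x. k (x \<otimes> v \<otimes> g)) - \<nu> (\<lambda>x. k (x \<otimes> g))\<bar> \<le> e / (s + 1) * s"
      using k(2) g by (intro V(3)[OF v kg]) auto
    moreover have "e / (s + 1) * s \<le> e" using e s0 by (simp add: field_simps)
    ultimately show ?thesis by linarith
  qed
  with V(1,2) show "\<exists>V. openin T V \<and> \<one> \<in> V \<and>
      (\<forall>v\<in>V. \<forall>x\<in>carrier G. \<bar>\<nu> (\<lambda>xa. k (xa \<otimes> (v \<otimes> x))) - \<nu> (\<lambda>xa. k (xa \<otimes> x))\<bar> \<le> e)"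
    by blast
qed

lemma UC_sum:
  "finite P \<Longrightarrow> (\<And>p. p \<in> P \<Longrightarrow> f p \<in> UC) \<Longrightarrow> (\<lambda>x. \<Sum>p\<in>P. c p * f p x) \<in> UC"
proof (induction P rule: finite_induct)
  case empty
  then show ?case using UC_const[of 0] by simp
next
  case (insert p P)
  have "(\<lambda>x. c p * f p x + (\<Sum>p\<in>P. c p * f p x)) \<in> UC"
    using insert by (intro UC_add UC_scale) auto
  then show ?case using insert by simp
qed

text \<open>The Riemann sums converge uniformly.\<close>

lemma UC_integral:
  assumes J: "positive_functional Y J" and Y: "locally_compact_space Y" "Hausdorff_space Y"
    and Q: "compactin Y Q" and supp: "\<And>h g. h \<in> topspace Y - Q \<Longrightarrow> g \<in> carrier G \<Longrightarrow> k h g = 0"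
    and cont: "\<And>h (e::real). h \<in> topspace Y \<Longrightarrow> e > 0 \<Longrightarrow>
      \<exists>U. openin Y U \<and> h \<in> U \<and> (\<forall>u\<in>U. \<forall>g\<in>carrier G. \<bar>k u g - k h g\<bar> \<le> e)"
    and UC: "\<And>h. h \<in> topspace Y \<Longrightarrow> k h \<in> UC"
  shows "(\<lambda>g. J (\<lambda>h. k h g)) \<in> UC"
proof (rule UC_uniform_limit)
  fix e :: real assume "e > 0"
  have "\<exists>P c. finite P \<and> P \<subseteq> topspace Y \<and> (\<forall>g\<in>carrier G. \<bar>J (\<lambda>h. k h g) - (\<Sum>p\<in>P. c p * k p g)\<bar> \<le> e)"
    by (rule pf_Riemann_sum[OF J Y Q supp cont \<open>e > 0\<close>])
  then obtain P c where P: "finite P" "P \<subseteq> topspace Y"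
    "\<forall>g\<in>carrier G. \<bar>J (\<lambda>h. k h g) - (\<Sum>p\<in>P. c p * k p g)\<bar> \<le> e"
    by blast
  have "(\<lambda>g. \<Sum>p\<in>P. c p * k p g) \<in> UC" using P UC by (intro UC_sum) auto
  from P(3) this show "\<exists>f\<in>UC. \<forall>x\<in>carrier G. \<bar>J (\<lambda>h. k h x) - f x\<bar> \<le> e" by (rule bexI)
qed

end

section \<open>Invariant means and the image of a charge on the coset space\<close>

text \<open>Only the image of \<open>\<nu>\<close> on the coset space matters. For \<open>m\<close> absorbs translations by \<open>H\<close>, so \<open>x\<close> may be
  replaced by \<open>x h\<close> with \<open>h\<close> distributed over \<open>H\<close> with density \<open>b h x\<close>; after integration over \<open>h\<close> the
  integrand \<open>F\<close> is a function of the coset of \<open>x\<close>, and it is bounded by \<open>s\<close> because the density has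
  total mass at most 1.\<close>

theorem (in quasi_invariant) mean_through_cosets:
  assumes m: "mean_on UC (carrier G) m" and inv: "\<And>f h. f \<in> UC \<Longrightarrow> h \<in> H \<Longrightarrow> m (\<lambda>x. f (h \<otimes> x)) = m f"
    and \<nu>: "charge C D \<nu>" and R: "right_continuous \<nu>"
    and k: "cont k" "\<And>x. x \<in> carrier G \<Longrightarrow> \<bar>k x\<bar> \<le> s"
    and D': "\<And>F t. continuous_map X euclideanreal F \<Longrightarrow> (\<And>A. A \<in> topspace X \<Longrightarrow> \<bar>F A\<bar> \<le> t) \<Longrightarrow>
      \<bar>\<nu> (\<lambda>x. F (x <# H))\<bar> \<le> D' * t"
  shows "\<bar>m (\<lambda>g. \<nu> (\<lambda>x. k (x \<otimes> g)))\<bar> \<le> D' * s"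
proof -
  note C = charge_compact[OF \<nu>] and D = charge_bound_nonneg[OF \<nu>]
  have CG: "C \<subseteq> carrier G" by (rule compactin_carrier[OF C])
  have s0: "s \<ge> 0" using k(2)[OF one_closed] by linarith
  obtain \<beta> where \<beta>: "\<beta> \<in> Cc T" "\<And>x. x \<in> carrier G \<Longrightarrow> 0 \<le> \<beta> x" "\<And>x. x \<in> carrier G \<Longrightarrow> \<beta> x \<le> 1" "\<And>x. x \<in> C \<Longrightarrow> \<beta> x = 1"
    using bump_function[OF locally_compact hausdorff C, of "topspace T"] CG
    by (metis openin_topspace topspace_eq)
  obtain L where L: "compactin T L" "\<And>x. x \<in> topspace T \<Longrightarrow> x \<notin> L \<Longrightarrow> \<beta> x = 0"
    using Cc_support[OF \<beta>(1)] by metis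
  have flat_cont: "cont (\<lambda>x. flat \<beta> (x <# H))" using flat_continuous[OF \<beta>(1)] continuous_on_X by blast
  have "flat \<beta> (x <# H) > 0" if "x \<in> C" for x
    using that CG \<beta> by (intro flat_pos) auto
  then obtain \<epsilon> where \<epsilon>: "\<epsilon> > 0" "\<And>x. x \<in> C \<Longrightarrow> flat \<beta> (x <# H) \<ge> \<epsilon>"
    using continuous_map_positive_on_compact[OF flat_cont C] by metis
  define q where "q A = inverse (max (flat \<beta> A) \<epsilon>)" for A
  have q_cont: "continuous_map X euclideanreal q"
    unfolding q_def using flat_continuous[OF \<beta>(1)] \<epsilon>(1) by (intro continuous_map_real_inverse continuous_map_real_max) auto
  have q0: "0 \<le> q A" "q A \<le> inverse \<epsilon>" for A
    using \<epsilon>(1) by (auto simp: q_def le_max_iff_disj intro!: le_imp_inverse_le)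
  have q_flat: "q A * flat \<beta> A \<le> 1" for A
    using \<epsilon>(1) by (simp add: q_def field_simps)
  have q_one: "q (x <# H) * flat \<beta> (x <# H) = 1" if "x \<in> C" for x
    using \<epsilon>(1) \<epsilon>(2)[OF that] by (simp add: q_def max_def)
  define b where "b h x = q (x <# H) * \<beta> (x \<otimes> h)" for h x
  have qx_cont: "cont (\<lambda>x. q (x <# H))" using q_cont continuous_on_X by blast
  have b_cont: "cont (b h)" if "h \<in> carrier G" for h
    unfolding b_def using qx_cont cont_right[OF Cc_continuous[OF \<beta>(1)] that] by (rule continuous_map_real_mult)
  have b_bound: "\<bar>b h x\<bar> \<le> inverse \<epsilon>" if "h \<in> carrier G" "x \<in> carrier G" for h x
  proof -
    have "q (x <# H) * \<beta> (x \<otimes> h) \<le> inverse \<epsilon> * 1"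
      using q0 \<beta>(2,3) that \<epsilon>(1) by (intro mult_mono) auto
    then show ?thesis using q0(1) \<beta>(2) that by (simp add: b_def abs_mult)
  qed
  define Q where "Q = H \<inter> (m_inv G ` C <#> L)"
  have Q: "compactin S Q" unfolding Q_def by (intro compactin_S compactin_set_mult compactin_inverse C L)
  have b_supp: "b h x = 0" if h: "h \<in> topspace S - Q" and x: "x \<in> C" for h x
  proof -
    have G: "x \<in> carrier G" "h \<in> carrier G" "h \<in> H" using x CG h HG by auto
    have "h = inv x \<otimes> (x \<otimes> h)" using G by (simp add: m_assoc[symmetric])
    then have "x \<otimes> h \<notin> L" using h x G(3) unfolding Q_def set_mult_def by blast
    then show ?thesis using L(2) G by (simp add: b_def topspace_eq)
  qed
  have sndT: "continuous_map (prod_topology S T) T snd" by (rule continuous_map_snd)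
  have fstT: "continuous_map (prod_topology S T) T fst"
    by (rule continuous_map_into_fulltopology[OF continuous_map_fst])
  have b_joint: "continuous_map (prod_topology S T) euclideanreal (\<lambda>z. b (fst z) (snd z))"
  proof -
    have "continuous_map (prod_topology S T) euclideanreal (\<lambda>z. q (snd z <# H))"
      using continuous_map_compose[OF sndT qx_cont] by (simp add: o_def)
    moreover have "continuous_map (prod_topology S T) euclideanreal (\<lambda>z. \<beta> (snd z \<otimes> fst z))"
      using continuous_map_compose[OF continuous_map_mult[OF sndT fstT] Cc_continuous[OF \<beta>(1)]] by (simp add: o_def)
    ultimately show ?thesis unfolding b_def by (rule continuous_map_real_mult)
  qed
  define p where "p h g = \<nu> (\<lambda>x. b h x * k (x \<otimes> g))" for h g
  have bk_cont: "cont (\<lambda>x. b h x * k (x \<otimes> g))" if "h \<in> carrier G" "g \<in> carrier G" for h g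
    using b_cont[OF that(1)] cont_right[OF k(1) that(2)] by (rule continuous_map_real_mult)
  have p_UC: "p h \<in> UC" if h: "h \<in> H" for h
    unfolding p_def
    by (rule charge_convolution_UC[OF charge_mult[OF \<nu> b_cont b_bound] right_continuous_mult[OF \<nu> R b_cont b_bound] k])
       (use HG[OF h] in auto)
  have p_close: "\<exists>U. openin S U \<and> h \<in> U \<and> (\<forall>u\<in>U. \<forall>g\<in>carrier G. \<bar>p u g - p h g\<bar> \<le> e)"
    if h: "h \<in> topspace S" and e: "e > 0" for h and e :: real
  proof -
    define d where "d = e / (D * s + 1)"
    have Ds: "D * s \<ge> 0" using D s0 by simp
    have d: "d > 0" "D * (d * s) \<le> e"
    proof -
      show "d > 0" using e Ds by (simp add: d_def)
      have "(D * s) * d \<le> (D * s + 1) * d" using \<open>d > 0\<close> by (intro mult_right_mono) auto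
      also have "\<dots> = e" using Ds by (simp add: d_def)
      finally show "D * (d * s) \<le> e" by (simp add: mult_ac)
    qed
    have "continuous_map (prod_topology S T) euclideanreal (\<lambda>(h, x). b h x)"
      using b_joint by (simp add: case_prod_unfold)
    from tube_continuity[OF this C h d(1)] obtain U where U: "openin S U" "h \<in> U"
      "\<And>u x. u \<in> U \<Longrightarrow> x \<in> C \<Longrightarrow> \<bar>b u x - b h x\<bar> < d" by auto
    have "\<bar>p u g - p h g\<bar> \<le> e" if u: "u \<in> U" and g: "g \<in> carrier G" for u g
    proof -
      have uG: "u \<in> carrier G" "h \<in> carrier G" using u h openin_subset[OF U(1)] HG by auto
      have "\<bar>p u g - p h g\<bar> \<le> D * (d * s)"
        unfolding p_def
      proof (rule charge_close[OF \<nu> bk_cont[OF uG(1) g] bk_cont[OF uG(2) g]])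
        fix x assume x: "x \<in> C"
        have "\<bar>b u x - b h x\<bar> * \<bar>k (x \<otimes> g)\<bar> \<le> d * s"
          using U(3)[OF u x] k(2)[of "x \<otimes> g"] x CG g d(1) by (intro mult_mono) auto
        then show "\<bar>b u x * k (x \<otimes> g) - b h x * k (x \<otimes> g)\<bar> \<le> d * s"
          by (simp add: abs_mult flip: left_diff_distrib)
      qed
      then show ?thesis using d(2) by linarith
    qed
    with U show ?thesis by blast
  qed
  have p_supp: "p h g = 0" if h: "h \<in> topspace S - Q" and g: "g \<in> carrier G" for h g
  proof -
    have hG: "h \<in> carrier G" using h HG by auto
    have "\<bar>p h g\<bar> \<le> D * 0"
      unfolding p_def by (rule charge_bound[OF \<nu> bk_cont[OF hG g]]) (use b_supp[OF h] in simp)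
    then show ?thesis by simp
  qed
  have bk_joint: "continuous_map (prod_topology S T) euclideanreal (\<lambda>(h, x). b h x * k (x \<otimes> (\<phi> h \<otimes> g)))"
    if \<phi>: "continuous_map S T \<phi>" and g: "g \<in> carrier G" for \<phi> g
  proof -
    have "continuous_map (prod_topology S T) T (\<lambda>z. snd z \<otimes> (\<phi> (fst z) \<otimes> g))"
      using continuous_map_compose[OF continuous_map_fst \<phi>] g
      by (intro continuous_map_mult sndT) (auto simp: o_def topspace_eq)
    from continuous_map_compose[OF this k(1)] b_joint show ?thesis
      by (auto simp: o_def case_prod_unfold intro!: continuous_map_real_mult)
  qed
  \<comment> \<open>the integral over \<open>H\<close> of a family \<open>b h x * k (x \<otimes> (\<phi> h \<otimes> g))\<close> can be taken inside \<open>\<nu>\<close>\<close>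
  have inside: "\<nu> (\<lambda>x. J (\<lambda>h. b h x * k (x \<otimes> (\<phi> h \<otimes> g)))) = J (\<lambda>h. \<nu> (\<lambda>x. b h x * k (x \<otimes> (\<phi> h \<otimes> g))))"
    if \<phi>: "continuous_map S T \<phi>" and g: "g \<in> carrier G"
      and JS: "cont (\<lambda>x. J (\<lambda>h. b h x * k (x \<otimes> (\<phi> h \<otimes> g))))" for \<phi> g
  proof (rule pf_interchange[OF J K.locally_compact K.hausdorff Q, where Y=C and S="{f. cont f}" and D=D])
    show "b h y * k (y \<otimes> (\<phi> h \<otimes> g)) = 0" if "h \<in> topspace S - Q" "y \<in> C" for h y using b_supp[OF that] by simp
    show "\<exists>U. openin S U \<and> h \<in> U \<and> (\<forall>u\<in>U. \<forall>y\<in>C. \<bar>b u y * k (y \<otimes> (\<phi> u \<otimes> g)) - b h y * k (y \<otimes> (\<phi> h \<otimes> g))\<bar> \<le> e)"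
      if "h \<in> topspace S" "e > 0" for h and e :: real
      using tube_continuity[OF bk_joint[OF \<phi> g] C that] by (metis (no_types, lifting) case_prod_conv less_imp_le)
    show "(\<lambda>x. b h x * k (x \<otimes> (\<phi> h \<otimes> g))) \<in> {f. cont f}" if h: "h \<in> topspace S" for h
    proof -
      have "h \<in> carrier G" "\<phi> h \<otimes> g \<in> carrier G"
        using h HG continuous_map_funspace[OF \<phi>] g by (auto simp: topspace_eq)
      then show ?thesis using bk_cont by blast
    qed
    show "(\<lambda>y. J (\<lambda>h. b h y * k (y \<otimes> (\<phi> h \<otimes> g)))) \<in> {f. cont f}" using JS by simp
  qed (use charge_add[OF \<nu>] charge_scale[OF \<nu>] charge_bound[OF \<nu>] D in
       \<open>auto intro: continuous_map_add continuous_map_real_mult_left\<close>)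
  \<comment> \<open>inserting \<open>1 = \<integral> b h x dh\<close>\<close>
  have J_b: "J (\<lambda>h. b h x * c) = q (x <# H) * flat \<beta> (x <# H) * c" if x: "x \<in> carrier G" for x c
  proof -
    have "J (\<lambda>h. (q (x <# H) * c) * \<beta> (x \<otimes> h)) = (q (x <# H) * c) * J (\<lambda>h. \<beta> (x \<otimes> h))"
      by (rule pf_scale[OF J flat_integrand(1)[OF \<beta>(1) x]])
    then show ?thesis by (simp add: b_def flat_coset[OF \<beta>(1) x] mult_ac)
  qed
  have J_p: "J (\<lambda>h. p h g) = \<nu> (\<lambda>x. k (x \<otimes> g))" if g: "g \<in> carrier G" for g
  proof -
    have kg: "cont (\<lambda>x. k (x \<otimes> g))" by (rule cont_right[OF k(1) g])
    have JS: "cont (\<lambda>x. J (\<lambda>h. b h x * k (x \<otimes> (\<one> \<otimes> g))))"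
    proof (rule continuous_map_eq)
      show "cont (\<lambda>x. q (x <# H) * flat \<beta> (x <# H) * k (x \<otimes> g))"
        by (intro continuous_map_real_mult qx_cont flat_cont kg)
    qed (use J_b g in \<open>auto simp: topspace_eq\<close>)
    have "J (\<lambda>h. p h g) = J (\<lambda>h. \<nu> (\<lambda>x. b h x * k (x \<otimes> (\<one> \<otimes> g))))" using g by (simp add: p_def)
    also have "\<dots> = \<nu> (\<lambda>x. J (\<lambda>h. b h x * k (x \<otimes> (\<one> \<otimes> g))))"
      using inside[OF _ g JS] by (simp add: topspace_eq)
    also have "\<dots> = \<nu> (\<lambda>x. k (x \<otimes> g))"
      by (rule charge_cong[OF \<nu> JS kg]) (use J_b q_one CG g in auto)
    finally show ?thesis .
  qed
  define p' where "p' h g = p h (h \<otimes> g)" for h g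
  have p'_UC: "p' h \<in> UC" if h: "h \<in> H" for h
    unfolding p'_def by (rule UC_translate[OF p_UC[OF h] HG[OF h]])
  have p'_supp: "p' h g = 0" if h: "h \<in> topspace S - Q" and g: "g \<in> carrier G" for h g
    unfolding p'_def using h g HG by (intro p_supp) auto
  have p'_close: "\<exists>U. openin S U \<and> h \<in> U \<and> (\<forall>u\<in>U. \<forall>g\<in>carrier G. \<bar>p' u g - p' h g\<bar> \<le> e)"
    if h: "h \<in> topspace S" and e: "e > 0" for h and e :: real
  proof -
    have hH: "h \<in> H" "h \<in> carrier G" using h HG by auto
    have e2: "e/2 > 0" using e by simp
    obtain U where U: "openin S U" "h \<in> U" "\<And>u g. u \<in> U \<Longrightarrow> g \<in> carrier G \<Longrightarrow> \<bar>p u g - p h g\<bar> \<le> e/2"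
      using p_close[OF h e2] by blast
    obtain V where V: "openin T V" "h \<in> V" "\<And>u g. u \<in> V \<Longrightarrow> g \<in> carrier G \<Longrightarrow> \<bar>p h (u \<otimes> g) - p h (h \<otimes> g)\<bar> \<le> e/2"
      using UC_translate_continuous[OF p_UC[OF hH(1)] hH(2) e2] by metis
    have "\<bar>p' u g - p' h g\<bar> \<le> e" if u: "u \<in> U \<inter> V" and g: "g \<in> carrier G" for u g
    proof -
      have "u \<in> carrier G" using u openin_carrier[OF V(1)] by blast
      then have "\<bar>p u (u \<otimes> g) - p h (u \<otimes> g)\<bar> \<le> e/2" "\<bar>p h (u \<otimes> g) - p h (h \<otimes> g)\<bar> \<le> e/2"
        using U(3)[of u "u \<otimes> g"] V(3)[of u g] u g by simp_all
      then show ?thesis unfolding p'_def by linarith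
    qed
    moreover have "openin S (U \<inter> (V \<inter> H))" by (rule openin_Int[OF U(1) openin_subtopology_Int[OF V(1)]])
    ultimately show ?thesis using U(2) V(2) hH(1) by (intro exI[of _ "U \<inter> (V \<inter> H)"]) auto
  qed
  have m_mono: "\<bar>m f - m g\<bar> \<le> e" if "f \<in> UC" "g \<in> UC" "\<And>x. x \<in> carrier G \<Longrightarrow> \<bar>f x - g x\<bar> \<le> e" for f g e
  proof -
    have "\<bar>m (\<lambda>x. f x + (-1) * g x)\<bar> \<le> e"
      by (rule mean_on_bound[OF m UC_add[OF that(1) UC_scale[OF that(2)]]]) (use that(3) in simp)
    then show ?thesis
      using mean_on_add[OF m that(1) UC_scale[OF that(2), of "-1"]] mean_on_scale[OF m that(2), of "-1"] by simp
  qed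
  have pull: "m (\<lambda>g. J (\<lambda>h. r h g)) = J (\<lambda>h. m (r h))" "(\<lambda>g. J (\<lambda>h. r h g)) \<in> UC" "(\<lambda>h. m (r h)) \<in> Cc S"
    if rUC: "\<And>h. h \<in> topspace S \<Longrightarrow> r h \<in> UC" and rsupp: "\<And>h g. h \<in> topspace S - Q \<Longrightarrow> g \<in> carrier G \<Longrightarrow> r h g = 0"
      and rclose: "\<And>h e. h \<in> topspace S \<Longrightarrow> e > 0 \<Longrightarrow>
        \<exists>U. openin S U \<and> h \<in> U \<and> (\<forall>u\<in>U. \<forall>g\<in>carrier G. \<bar>r u g - r h g\<bar> \<le> e)" for r :: "'a \<Rightarrow> 'a \<Rightarrow> real"
  proof -
    show UCJ: "(\<lambda>g. J (\<lambda>h. r h g)) \<in> UC"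
      by (rule UC_integral[OF J K.locally_compact K.hausdorff Q rsupp rclose rUC])
    show "m (\<lambda>g. J (\<lambda>h. r h g)) = J (\<lambda>h. m (r h))"
    proof (rule pf_interchange[OF J K.locally_compact K.hausdorff Q rsupp rclose rUC UCJ, where D=1])
      show "m (\<lambda>y. f y + g y) = m f + m g" if "f \<in> UC" "g \<in> UC" for f g by (rule mean_on_add[OF m that])
      show "m (\<lambda>y. c * f y) = c * m f" if "f \<in> UC" for c f by (rule mean_on_scale[OF m that])
      show "\<bar>m f\<bar> \<le> 1 * s" if "f \<in> UC" "\<And>y. y \<in> carrier G \<Longrightarrow> \<bar>f y\<bar> \<le> s" for f s
        using mean_on_bound[OF m that] by simp
    qed (auto intro: UC_add UC_scale UC_const)
    show "(\<lambda>h. m (r h)) \<in> Cc S"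
    proof (rule Cc_if_norm_continuous[OF Q])
      fix h assume h: "h \<in> topspace S - Q"
      have "\<bar>m (r h)\<bar> \<le> 0" using rsupp[OF h] h by (intro mean_on_bound[OF m rUC]) auto
      then show "m (r h) = 0" by simp
    next
      fix h and e :: real assume h: "h \<in> topspace S" and e: "e > 0"
      obtain U where U: "openin S U" "h \<in> U" "\<And>u g. u \<in> U \<Longrightarrow> g \<in> carrier G \<Longrightarrow> \<bar>r u g - r h g\<bar> \<le> e"
        using rclose[OF h e] by blast
      have "\<bar>m (r u) - m (r h)\<bar> \<le> e" if u: "u \<in> U" for u
      proof -
        have "u \<in> topspace S" using u openin_subset[OF U(1)] by blast
        from m_mono[OF rUC[OF this] rUC[OF h] U(3)[OF u]] show ?thesis .
      qed
      with U show "\<exists>U. openin S U \<and> h \<in> U \<and> (\<forall>u\<in>U. \<bar>m (r u) - m (r h)\<bar> \<le> e)" by blast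
    qed
  qed
  note topS = topspace_S
  have p_UC': "h \<in> topspace S \<Longrightarrow> p h \<in> UC" and p'_UC': "h \<in> topspace S \<Longrightarrow> p' h \<in> UC" for h
    using p_UC p'_UC by (simp_all only: topS)
  have F_bound: "\<bar>J (\<lambda>h. p' h g)\<bar> \<le> D' * s" if g: "g \<in> carrier G" for g
  proof -
    have kg: "cont (\<lambda>x. k (x \<otimes> g))" by (rule cont_right[OF k(1) g])
    have \<beta>k: "(\<lambda>x. \<beta> x * k (x \<otimes> g)) \<in> Cc T" by (rule Cc_mult(1)[OF \<beta>(1) kg])
    define F where "F A = q A * flat (\<lambda>x. \<beta> x * k (x \<otimes> g)) A" for A
    have F_cont: "continuous_map X euclideanreal F"
      unfolding F_def by (intro continuous_map_real_mult q_cont flat_continuous[OF \<beta>k])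
    have F_le: "\<bar>F A\<bar> \<le> s" if A: "A \<in> topspace X" for A
    proof -
      have "\<bar>flat (\<lambda>x. \<beta> x * k (x \<otimes> g)) A\<bar> \<le> flat (\<lambda>x. s * \<beta> x) A"
      proof (rule flat_abs_le[OF \<beta>k Cc_scale[OF \<beta>(1)] A])
        fix x assume x: "x \<in> carrier G"
        show "\<bar>\<beta> x * k (x \<otimes> g)\<bar> \<le> s * \<beta> x"
          using mult_left_mono[OF k(2)[of "x \<otimes> g"] \<beta>(2)[OF x]] x g \<beta>(2)[OF x] by (simp add: abs_mult mult.commute)
      qed
      also have "\<dots> = s * flat \<beta> A" by (rule flat_scale[OF \<beta>(1) A])
      finally have "q A * \<bar>flat (\<lambda>x. \<beta> x * k (x \<otimes> g)) A\<bar> \<le> q A * (s * flat \<beta> A)"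
        using q0(1) by (rule mult_left_mono)
      also have "\<dots> = s * (q A * flat \<beta> A)" by simp
      also have "\<dots> \<le> s * 1" using q_flat s0 by (rule mult_left_mono)
      finally show ?thesis using q0(1) by (simp add: F_def abs_mult)
    qed
    have J_F: "J (\<lambda>h. b h x * k (x \<otimes> (h \<otimes> g))) = F (x <# H)" if x: "x \<in> carrier G" for x
    proof -
      note mem = flat_integrand(1)[OF \<beta>k x]
      have "F (x <# H) = J (\<lambda>h. q (x <# H) * (\<beta> (x \<otimes> h) * k (x \<otimes> h \<otimes> g)))"
        unfolding F_def flat_coset[OF \<beta>k x] by (rule pf_scale[OF J mem, symmetric])
      also have "\<dots> = J (\<lambda>h. b h x * k (x \<otimes> (h \<otimes> g)))"
        by (rule pf_cong[OF J Cc_scale[OF mem]]) (use x g HG in \<open>auto simp: b_def m_assoc\<close>)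
      finally show ?thesis by simp
    qed
    have F_x: "cont (\<lambda>x. F (x <# H))" using F_cont continuous_on_X by blast
    have JS: "cont (\<lambda>x. J (\<lambda>h. b h x * k (x \<otimes> (h \<otimes> g))))"
      by (rule continuous_map_eq[OF F_x]) (use J_F in \<open>auto simp: topspace_eq\<close>)
    have "J (\<lambda>h. p' h g) = \<nu> (\<lambda>x. J (\<lambda>h. b h x * k (x \<otimes> (h \<otimes> g))))"
      using inside[of "\<lambda>h. h", OF _ g JS] continuous_map_from_S[of T "\<lambda>h. h"] by (simp add: p'_def p_def)
    also have "\<dots> = \<nu> (\<lambda>x. F (x <# H))" by (rule charge_cong[OF \<nu> JS F_x]) (use J_F CG in auto)
    finally show ?thesis using D'[OF F_cont F_le] by simp
  qed
  have "m (\<lambda>g. \<nu> (\<lambda>x. k (x \<otimes> g))) = m (\<lambda>g. J (\<lambda>h. p h g))"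
  proof -
    have 1: "(\<lambda>g. \<nu> (\<lambda>x. k (x \<otimes> g))) \<in> UC" by (rule charge_convolution_UC[OF \<nu> R k])
    have "\<bar>m (\<lambda>g. \<nu> (\<lambda>x. k (x \<otimes> g))) - m (\<lambda>g. J (\<lambda>h. p h g))\<bar> \<le> 0"
      by (rule m_mono[OF 1 pull(2)[OF p_UC' p_supp p_close]]) (use J_p in auto)
    then show ?thesis by simp
  qed
  also have "\<dots> = J (\<lambda>h. m (p h))" by (rule pull(1)[OF p_UC' p_supp p_close])
  also have "\<dots> = J (\<lambda>h. m (p' h))"
  proof (rule pf_cong[OF J pull(3)[OF p_UC' p_supp p_close]])
    fix h assume "h \<in> topspace S"
    then have "h \<in> H" by (simp only: topS)
    from inv[OF p_UC[OF this] this] show "m (p h) = m (p' h)" by (simp add: p'_def[abs_def])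
  qed
  also have "\<dots> = m (\<lambda>g. J (\<lambda>h. p' h g))" by (rule pull(1)[OF p'_UC' p'_supp p'_close, symmetric])
  also have "\<bar>\<dots>\<bar> \<le> D' * s"
    by (rule mean_on_bound[OF m pull(2)[OF p'_UC' p'_supp p'_close] F_bound])
  finally show ?thesis .
qed

section \<open>Approximating an absolutely continuous functional by densities\<close>

text \<open>A bounded positive functional; the measures on \<open>X\<close> enter only as such.\<close>

definition positive_form :: "'a topology \<Rightarrow> (('a \<Rightarrow> real) \<Rightarrow> real) \<Rightarrow> bool" where
  "positive_form X \<theta> \<longleftrightarrow>
     (\<forall>f\<in>Cb X. \<forall>g\<in>Cb X. \<theta> (\<lambda>x. f x + g x) = \<theta> f + \<theta> g) \<and>
     (\<forall>c. \<forall>f\<in>Cb X. \<theta> (\<lambda>x. c * f x) = c * \<theta> f) \<and>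
     (\<forall>f\<in>Cb X. (\<forall>x\<in>topspace X. 0 \<le> f x) \<longrightarrow> 0 \<le> \<theta> f)"

context
  fixes X :: "'a topology" and \<theta>
  assumes \<theta>: "positive_form X \<theta>"
begin

lemma form_add: "f \<in> Cb X \<Longrightarrow> g \<in> Cb X \<Longrightarrow> \<theta> (\<lambda>x. f x + g x) = \<theta> f + \<theta> g"
  and form_scale: "f \<in> Cb X \<Longrightarrow> \<theta> (\<lambda>x. c * f x) = c * \<theta> f"
  and form_nonneg: "f \<in> Cb X \<Longrightarrow> (\<And>x. x \<in> topspace X \<Longrightarrow> 0 \<le> f x) \<Longrightarrow> 0 \<le> \<theta> f"
  using \<theta> by (simp_all add: positive_form_def)

lemma form_diff: "f \<in> Cb X \<Longrightarrow> g \<in> Cb X \<Longrightarrow> \<theta> (\<lambda>x. f x - g x) = \<theta> f - \<theta> g"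
  using form_add[of f "\<lambda>x. (-1) * g x"] form_scale[of g "-1"] Cb_scale[of g X "-1"] by simp

lemma form_mono: "f \<in> Cb X \<Longrightarrow> g \<in> Cb X \<Longrightarrow> (\<And>x. x \<in> topspace X \<Longrightarrow> f x \<le> g x) \<Longrightarrow> \<theta> f \<le> \<theta> g"
  using form_nonneg[of "\<lambda>x. g x - f x"] form_diff[of g f] Cb_diff[of g X f] by simp

lemma form_abs_le:
  assumes "f \<in> Cb X" "g \<in> Cb X" "\<And>x. x \<in> topspace X \<Longrightarrow> \<bar>f x\<bar> \<le> g x"
  shows "\<bar>\<theta> f\<bar> \<le> \<theta> g"
proof -
  have "\<theta> f \<le> \<theta> g" "\<theta> (\<lambda>x. (-1) * f x) \<le> \<theta> g"
    using assms(3) by (intro form_mono assms(1,2) Cb_scale; force simp: abs_le_iff)+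
  then show ?thesis using form_scale[OF assms(1), of "-1"] by simp
qed

end

text \<open>The minimizer \<open>b\<close> of \<open>(\<theta> + \<nu>)(b\<^sup>2) - 2 \<theta>(b)\<close> is von Neumann's density of \<open>\<theta>\<close> with respect to
  \<open>\<theta> + \<nu>\<close>: the first variation vanishes there. Minimal values over continuous functions need not be
  attained, and a near-minimizer has a small first variation. Truncating a function to \<open>[0, 1]\<close> does not
  increase the quantity, so near-minimizers may be taken there.\<close>

lemma near_minimizer:
  assumes \<theta>: "positive_form X \<theta>" and \<nu>: "positive_form X \<nu>" and r: "r > 0"
  obtains b where "b \<in> Cb X" "\<And>x. x \<in> topspace X \<Longrightarrow> 0 \<le> b x" "\<And>x. x \<in> topspace X \<Longrightarrow> b x \<le> 1"
    "\<And>f. f \<in> Cb X \<Longrightarrow> (\<And>x. x \<in> topspace X \<Longrightarrow> \<bar>f x\<bar> \<le> 1) \<Longrightarrow>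
       \<bar>\<nu> (\<lambda>x. b x * f x) - \<theta> (\<lambda>x. (1 - b x) * f x)\<bar> \<le> r"
proof -
  define q where "q g = \<theta> (\<lambda>x. g x * g x - 2 * g x) + \<nu> (\<lambda>x. g x * g x)" for g
  define \<B> where "\<B> = {b \<in> Cb X. \<forall>x\<in>topspace X. 0 \<le> b x \<and> b x \<le> 1}"
  define V where "V = \<theta> (\<lambda>_. 1) + \<nu> (\<lambda>_. 1)"
  have V0: "V \<ge> 0" unfolding V_def
    by (intro add_nonneg_nonneg form_nonneg[OF \<theta>] form_nonneg[OF \<nu>] Cb_const) auto
  \<comment> \<open>the step size \<open>u\<close> and the slack \<open>u\<^sup>2\<close> balance the first and second variation\<close>
  define u where "u = 2 * r / (1 + V)"
  have u0: "u > 0" using r V0 by (simp add: u_def)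
  have uV: "u * (1 + V) = 2 * r" using V0 by (simp add: u_def)
  have below: "- \<theta> (\<lambda>_. 1) \<le> q b" if "b \<in> Cb X" for b
  proof -
    have "0 \<le> \<nu> (\<lambda>x. b x * b x)" by (intro form_nonneg[OF \<nu>] Cb_mult that) simp
    moreover have "\<theta> (\<lambda>x. (-1) * 1) \<le> \<theta> (\<lambda>x. b x * b x - 2 * b x)"
    proof (intro form_mono[OF \<theta>] Cb_scale Cb_const Cb_diff Cb_mult that)
      fix x
      have "0 \<le> (b x - 1) * (b x - 1)" by simp
      then show "-1 * 1 \<le> b x * b x - 2 * b x" by (simp add: algebra_simps)
    qed
    moreover have "\<theta> (\<lambda>x. (-1) * 1) = - \<theta> (\<lambda>_. 1)" using form_scale[OF \<theta> Cb_const, of "-1" 1] by simp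
    ultimately show ?thesis unfolding q_def by linarith
  qed
  have ne: "q ` \<B> \<noteq> {}" using Cb_const[of 0 X] by (auto simp: \<B>_def)
  have bdd: "bdd_below (q ` \<B>)" using below by (intro bdd_belowI[of _ "- \<theta> (\<lambda>_. 1)"]) (auto simp: \<B>_def)
  have "Inf (q ` \<B>) < Inf (q ` \<B>) + u * u" using u0 by simp
  then obtain b where b: "b \<in> \<B>" "q b < Inf (q ` \<B>) + u * u"
    using cInf_less_iff[OF ne bdd] by blast
  have bCb: "b \<in> Cb X" using b(1) by (simp add: \<B>_def)
  have min: "q b - u * u \<le> q g" if g: "g \<in> Cb X" for g
  proof -
    define k where "k x = max 0 (min 1 (g x))" for x
    have k: "k \<in> Cb X"
    proof (rule CbI[of _ _ 1])
      show "continuous_map X euclideanreal k"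
        unfolding k_def by (intro continuous_map_real_max continuous_map_real_min Cb_continuous[OF g]) auto
    qed (auto simp: k_def)
    have "k \<in> \<B>" using k by (auto simp: \<B>_def k_def)
    then have "Inf (q ` \<B>) \<le> q k" using bdd by (intro cInf_lower) auto
    moreover have "q k \<le> q g"
      unfolding q_def
    proof (intro add_mono form_mono[OF \<theta>] form_mono[OF \<nu>] Cb_diff Cb_mult Cb_const k g)
      fix x
      have kg: "k x * k x \<le> g x * g x" "(k x - 1) * (k x - 1) \<le> (g x - 1) * (g x - 1)"
        unfolding abs_le_square_iff[symmetric] power2_eq_square[symmetric] by (auto simp: k_def max_def min_def)
      then show "k x * k x \<le> g x * g x" by simp
      show "k x * k x - 2 * k x \<le> g x * g x - 2 * g x" using kg(2) by (simp add: algebra_simps)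
    qed
    ultimately show ?thesis using b(2) by linarith
  qed
  show thesis
  proof (rule that[OF bCb])
    fix f assume f: "f \<in> Cb X" and f1: "\<And>x. x \<in> topspace X \<Longrightarrow> \<bar>f x\<bar> \<le> 1"
    define d where "d = \<nu> (\<lambda>x. b x * f x) - \<theta> (\<lambda>x. (1 - b x) * f x)"
    have ff: "\<theta> (\<lambda>x. f x * f x) + \<nu> (\<lambda>x. f x * f x) \<le> V"
      unfolding V_def
    proof (intro add_mono form_mono[OF \<theta>] form_mono[OF \<nu>] Cb_mult f Cb_const)
      show "f x * f x \<le> 1" if "x \<in> topspace X" for x
        using f1[OF that] by (simp add: power2_eq_square[symmetric] abs_square_le_1)
      then show "f x * f x \<le> 1" if "x \<in> topspace X" for x using that by simp
    qed
    have quad: "0 \<le> u * u + 2 * t * d + t * t * V" for t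
    proof -
      have bt: "(\<lambda>x. b x + t * f x) \<in> Cb X" by (intro Cb_add Cb_scale bCb f)
      have "(\<lambda>x. (b x + t * f x) * (b x + t * f x) - 2 * (b x + t * f x)) =
          (\<lambda>x. ((b x * b x - 2 * b x) + (- 2 * t) * ((1 - b x) * f x)) + (t * t) * (f x * f x))"
        by (simp add: fun_eq_iff algebra_simps)
      then have 1: "\<theta> (\<lambda>x. (b x + t * f x) * (b x + t * f x) - 2 * (b x + t * f x)) =
          \<theta> (\<lambda>x. b x * b x - 2 * b x) + (- 2 * t) * \<theta> (\<lambda>x. (1 - b x) * f x) + (t * t) * \<theta> (\<lambda>x. f x * f x)"
        by (simp only: form_add[OF \<theta>] form_scale[OF \<theta>] Cb_add Cb_diff Cb_mult Cb_scale Cb_const bCb f)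
      have "(\<lambda>x. (b x + t * f x) * (b x + t * f x)) =
          (\<lambda>x. (b x * b x + (2 * t) * (b x * f x)) + (t * t) * (f x * f x))"
        by (simp add: fun_eq_iff algebra_simps)
      then have 2: "\<nu> (\<lambda>x. (b x + t * f x) * (b x + t * f x)) =
          \<nu> (\<lambda>x. b x * b x) + (2 * t) * \<nu> (\<lambda>x. b x * f x) + (t * t) * \<nu> (\<lambda>x. f x * f x)"
        by (simp only: form_add[OF \<nu>] form_scale[OF \<nu>] Cb_add Cb_diff Cb_mult Cb_scale Cb_const bCb f)
      have "q (\<lambda>x. b x + t * f x) = q b + 2 * t * d + t * t * (\<theta> (\<lambda>x. f x * f x) + \<nu> (\<lambda>x. f x * f x))"
        unfolding q_def 1 2 d_def by (simp add: algebra_simps)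
      moreover have "t * t * (\<theta> (\<lambda>x. f x * f x) + \<nu> (\<lambda>x. f x * f x)) \<le> t * t * V"
        using ff by (rule mult_left_mono) simp
      ultimately show ?thesis using min[OF bt] by linarith
    qed
    have "0 \<le> u * (u + 2 * d + u * V)" "0 \<le> u * (u - 2 * d + u * V)"
      using quad[of u] quad[of "- u"] by (simp_all add: algebra_simps)
    then have "0 \<le> u + 2 * d + u * V" "0 \<le> u - 2 * d + u * V"
      using u0 by (simp_all add: zero_le_mult_iff)
    then show "\<bar>d\<bar> \<le> r" using uV by (simp add: algebra_simps)
  qed (use b(1) in \<open>auto simp: \<B>_def\<close>)
qed

text \<open>A Radon-Nikodym theorem with continuous densities: if \<open>b\<close> is the density with respect to \<open>\<theta> + \<nu>\<close>,
  then \<open>b / (1 - b)\<close> is the one with respect to \<open>\<nu>\<close>. The denominator is cut off at \<open>\<epsilon>\<close>. The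
  part of \<open>\<theta>\<close> lost in this way lives where \<open>b\<close> is close to 1, which is small for \<open>\<nu>\<close>, and by
  absolute continuity for \<open>\<theta>\<close>.\<close>

theorem density_approximation:
  assumes \<theta>: "positive_form X \<theta>" and \<nu>: "positive_form X \<nu>" and one: "\<theta> (\<lambda>_. 1) \<le> 1"
    and n: "n > 0" and \<delta>: "\<delta> > 0"
    and ac: "\<And>f. f \<in> Cb X \<Longrightarrow> (\<And>x. x \<in> topspace X \<Longrightarrow> 0 \<le> f x \<and> f x \<le> 1) \<Longrightarrow> \<theta> f \<le> n * \<nu> f + \<delta>"
  obtains c where "c \<in> Cb X"
    "\<And>f. f \<in> Cb X \<Longrightarrow> (\<And>x. x \<in> topspace X \<Longrightarrow> \<bar>f x\<bar> \<le> 1) \<Longrightarrow> \<bar>\<theta> f - \<nu> (\<lambda>x. c x * f x)\<bar> \<le> 3 * \<delta>"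
proof -
  define \<epsilon> where "\<epsilon> = min (1/2) (\<delta> / (8 * n))"
  define r where "r = \<epsilon> * min \<delta> 1"
  have \<epsilon>: "\<epsilon> > 0" "\<epsilon> \<le> 1/2" "n * \<epsilon> \<le> \<delta> / 8"
    using n \<delta> mult_left_mono[of \<epsilon> "\<delta> / (8 * n)" n] by (auto simp: \<epsilon>_def)
  have r: "r > 0" "r \<le> \<epsilon>" "r / \<epsilon> \<le> \<delta>"
    using \<epsilon>(1) \<delta> mult_left_mono[of "min \<delta> 1" 1 \<epsilon>] by (auto simp: r_def)
  obtain b where b: "b \<in> Cb X" "\<And>x. x \<in> topspace X \<Longrightarrow> 0 \<le> b x" "\<And>x. x \<in> topspace X \<Longrightarrow> b x \<le> 1"
    "\<And>f. f \<in> Cb X \<Longrightarrow> (\<And>x. x \<in> topspace X \<Longrightarrow> \<bar>f x\<bar> \<le> 1) \<Longrightarrow>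
       \<bar>\<nu> (\<lambda>x. b x * f x) - \<theta> (\<lambda>x. (1 - b x) * f x)\<bar> \<le> r"
    using near_minimizer[OF \<theta> \<nu> r(1)] by metis
  define p where "p x = inverse (max (1 - b x) \<epsilon>)" for x
  have p: "0 < p x" "p x \<le> inverse \<epsilon>" "(1 - b x) * p x \<le> 1" for x
    using \<epsilon>(1) by (auto simp: p_def less_max_iff_disj field_simps intro!: le_imp_inverse_le)
  have pCb: "p \<in> Cb X"
  proof (rule CbI)
    show "continuous_map X euclideanreal p"
      unfolding p_def using \<epsilon>(1)
      by (intro continuous_map_real_inverse continuous_map_real_max continuous_map_diff Cb_continuous[OF b(1)]) auto
    show "\<bar>p x\<bar> \<le> inverse \<epsilon>" for x using p[of x] by simp
  qed
  \<comment> \<open>the part of \<open>\<theta>\<close> lost by the cut-off; it is supported where \<open>b > 1 - \<epsilon>\<close>\<close>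
  define s where "s x = 1 - (1 - b x) * p x" for x
  have sCb: "s \<in> Cb X" unfolding s_def by (intro Cb_diff Cb_mult Cb_const b(1) pCb)
  have s01: "0 \<le> s x" "s x \<le> 1" if "x \<in> topspace X" for x
    using p[of x] b(3)[OF that] by (simp_all add: s_def)
  have s_cases: "s x = 0 \<or> 1 - b x < \<epsilon>" for x
    using \<epsilon>(1) by (auto simp: s_def p_def max_def)
  have "\<nu> s \<le> \<nu> (\<lambda>x. 2 * (b x * s x))"
  proof (intro form_mono[OF \<nu>] sCb Cb_scale Cb_mult b(1))
    fix x assume x: "x \<in> topspace X"
    show "s x \<le> 2 * (b x * s x)"
    proof (cases "s x = 0")
      case False
      then have "1 \<le> 2 * b x" using s_cases[of x] \<epsilon>(2) by auto
      then show ?thesis using mult_right_mono[OF _ s01(1)[OF x]] by fastforce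
    qed simp
  qed
  also have "\<dots> = 2 * \<nu> (\<lambda>x. b x * s x)" by (intro form_scale[OF \<nu>] Cb_mult b(1) sCb)
  also have "\<nu> (\<lambda>x. b x * s x) \<le> \<theta> (\<lambda>x. (1 - b x) * s x) + r"
    using b(4)[OF sCb] s01 by (simp add: abs_le_iff)
  also have "\<theta> (\<lambda>x. (1 - b x) * s x) \<le> \<theta> (\<lambda>x. \<epsilon> * 1)"
  proof (intro form_mono[OF \<theta>] Cb_scale Cb_mult Cb_diff Cb_const b(1) sCb)
    fix x assume x: "x \<in> topspace X"
    show "(1 - b x) * s x \<le> \<epsilon> * 1"
    proof (cases "s x = 0")
      case False
      then have "1 - b x \<le> \<epsilon>" using s_cases[of x] by auto
      then show ?thesis using s01[OF x] b(3)[OF x] \<epsilon>(1) by (intro mult_mono) auto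
    qed (use \<epsilon>(1) in simp)
  qed
  also have "\<theta> (\<lambda>x. \<epsilon> * 1) = \<epsilon> * \<theta> (\<lambda>_. 1)" by (rule form_scale[OF \<theta> Cb_const])
  also have "\<epsilon> * \<theta> (\<lambda>_. 1) \<le> \<epsilon>" using mult_left_mono[OF one, of \<epsilon>] \<epsilon>(1) by simp
  finally have "\<nu> s \<le> 4 * \<epsilon>" using r(2) by simp
  then have "n * \<nu> s \<le> 4 * (n * \<epsilon>)" using mult_left_mono[of "\<nu> s" "4 * \<epsilon>" n] n by simp
  then have "n * \<nu> s \<le> \<delta> / 2" using \<epsilon>(3) by linarith
  then have \<theta>s: "\<theta> s \<le> 3 / 2 * \<delta>" using ac[OF sCb] s01 by fastforce
  show thesis
  proof (rule that[of "\<lambda>x. b x * p x"])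
    show "(\<lambda>x. b x * p x) \<in> Cb X" by (intro Cb_mult b(1) pCb)
    fix f assume f: "f \<in> Cb X" and f1: "\<And>x. x \<in> topspace X \<Longrightarrow> \<bar>f x\<bar> \<le> 1"
    define g where "g x = p x * f x" for x
    have g: "g \<in> Cb X" unfolding g_def by (intro Cb_mult pCb f)
    have "\<bar>\<epsilon> * g x\<bar> \<le> 1" if x: "x \<in> topspace X" for x
    proof -
      have "\<bar>\<epsilon> * g x\<bar> = (\<epsilon> * p x) * \<bar>f x\<bar>" using \<epsilon>(1) p(1)[of x] by (simp add: g_def abs_mult)
      also have "\<dots> \<le> 1 * 1"
      proof (rule mult_mono)
        show "\<epsilon> * p x \<le> 1" using mult_left_mono[OF p(2)[of x], of \<epsilon>] \<epsilon>(1) by simp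
      qed (use f1[OF x] in auto)
      finally show ?thesis by simp
    qed
    then have "\<bar>\<nu> (\<lambda>x. b x * (\<epsilon> * g x)) - \<theta> (\<lambda>x. (1 - b x) * (\<epsilon> * g x))\<bar> \<le> r"
      by (intro b(4) Cb_scale g)
    moreover have "\<nu> (\<lambda>x. b x * (\<epsilon> * g x)) = \<epsilon> * \<nu> (\<lambda>x. b x * g x)"
      using form_scale[OF \<nu> Cb_mult[OF b(1) g], of \<epsilon>] by (simp add: mult.left_commute)
    moreover have "\<theta> (\<lambda>x. (1 - b x) * (\<epsilon> * g x)) = \<epsilon> * \<theta> (\<lambda>x. (1 - b x) * g x)"
      using form_scale[OF \<theta> Cb_mult[OF Cb_diff[OF Cb_const b(1)] g], of \<epsilon> 1] by (simp add: mult.left_commute)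
    ultimately have "\<epsilon> * \<bar>\<nu> (\<lambda>x. b x * g x) - \<theta> (\<lambda>x. (1 - b x) * g x)\<bar> \<le> r"
      using \<epsilon>(1) by (simp add: abs_mult flip: right_diff_distrib)
    then have "\<bar>\<nu> (\<lambda>x. b x * g x) - \<theta> (\<lambda>x. (1 - b x) * g x)\<bar> \<le> r / \<epsilon>"
      using \<epsilon>(1) by (simp add: field_simps)
    then have 1: "\<bar>\<nu> (\<lambda>x. b x * g x) - \<theta> (\<lambda>x. (1 - b x) * g x)\<bar> \<le> \<delta>" using r(3) by linarith
    have "f = (\<lambda>x. s x * f x + (1 - b x) * g x)"
      by (simp add: fun_eq_iff s_def g_def algebra_simps)
    then have "\<theta> f = \<theta> (\<lambda>x. s x * f x + (1 - b x) * g x)" by (rule arg_cong)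
    also have "\<dots> = \<theta> (\<lambda>x. s x * f x) + \<theta> (\<lambda>x. (1 - b x) * g x)"
      by (intro form_add[OF \<theta>] Cb_mult Cb_diff Cb_const sCb f g b(1))
    finally have 2: "\<theta> f = \<theta> (\<lambda>x. s x * f x) + \<theta> (\<lambda>x. (1 - b x) * g x)" .
    have "\<bar>\<theta> (\<lambda>x. s x * f x)\<bar> \<le> \<theta> s"
    proof (intro form_abs_le[OF \<theta>] Cb_mult sCb f)
      show "\<bar>s x * f x\<bar> \<le> s x" if x: "x \<in> topspace X" for x
        using mult_left_mono[OF f1[OF x] s01(1)[OF x]] s01(1)[OF x] by (simp add: abs_mult)
    qed
    then have "\<bar>\<theta> f - \<nu> (\<lambda>x. b x * g x)\<bar> \<le> 3 * \<delta>" using 1 2 \<theta>s \<delta> by linarith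
    then show "\<bar>\<theta> f - \<nu> (\<lambda>x. b x * p x * f x)\<bar> \<le> 3 * \<delta>" by (simp add: g_def mult.assoc)
  qed
qed

section \<open>Smoothing a charge\<close>

context locally_compact_group
begin

lemma right_Haar_exists:
  obtains I where "positive_functional T I"
    "\<And>f t. f \<in> Cc T \<Longrightarrow> t \<in> carrier G \<Longrightarrow> I (\<lambda>x. f (x \<otimes> t)) = I f"
    "\<And>f x. f \<in> Cc T \<Longrightarrow> (\<And>x. x \<in> carrier G \<Longrightarrow> 0 \<le> f x) \<Longrightarrow> x \<in> carrier G \<Longrightarrow> 0 < f x \<Longrightarrow> 0 < I f"
proof -
  obtain J where "left_Haar J" using left_Haar_exists by blast
  then have J: "positive_functional T J" "\<And>f t. f \<in> Cc T \<Longrightarrow> t \<in> carrier G \<Longrightarrow> J (\<lambda>x. f (t \<otimes> x)) = J f"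
    "\<And>f. f \<in> Cc T \<Longrightarrow> (\<forall>x\<in>carrier G. 0 \<le> f x) \<and> (\<exists>x\<in>carrier G. 0 < f x) \<Longrightarrow> 0 < J f"
    unfolding left_Haar_def by blast+
  define I where "I f = J (\<lambda>x. f (inv x))" for f
  show thesis
  proof (rule that[of I])
    show "positive_functional T I"
      unfolding positive_functional_def I_def
      using pf_add[OF J(1) Cc_inverse Cc_inverse] pf_scale[OF J(1) Cc_inverse]
      by (auto intro!: pf_nonneg[OF J(1) Cc_inverse] simp: topspace_eq)
    fix f assume f: "f \<in> Cc T"
    show "I (\<lambda>x. f (x \<otimes> t)) = I f" if t: "t \<in> carrier G" for t
    proof -
      have "I (\<lambda>x. f (x \<otimes> t)) = J (\<lambda>x. f (inv (inv t \<otimes> x)))"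
        unfolding I_def
        by (rule pf_cong[OF J(1) Cc_inverse[OF Cc_right_translate[OF f t]]])
           (use t in \<open>simp add: topspace_eq inv_mult_group\<close>)
      also have "\<dots> = J (\<lambda>x. f (inv x))" by (rule J(2)[OF Cc_inverse[OF f]]) (use t in simp)
      finally show ?thesis by (simp add: I_def)
    qed
    show "0 < I f" if pos: "\<And>x. x \<in> carrier G \<Longrightarrow> 0 \<le> f x" and x: "x \<in> carrier G" "0 < f x" for x
      unfolding I_def
    proof (rule J(3)[OF Cc_inverse[OF f]], intro conjI ballI)
      show "\<exists>x\<in>carrier G. 0 < f (inv x)" by (rule bexI[of _ "inv x"]) (use x in simp_all)
    qed (use pos in simp)
  qed
qed

lemma cont_joint:
  assumes "cont f" "continuous_map Z T a" "continuous_map Z T b"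
  shows "continuous_map Z euclideanreal (\<lambda>z. f (a z \<otimes> b z))"
  using continuous_map_compose[OF continuous_map_mult[OF assms(2,3)] assms(1)] by (simp add: o_def)

lemma charge_translates_continuous:
  assumes \<kappa>: "charge C D \<kappa>" and f: "cont f"
  shows "cont (\<lambda>g. \<kappa> (\<lambda>y. f (g \<otimes> y)))"
  unfolding continuous_map_real_iff
proof (intro ballI allI impI)
  fix g and e :: real assume g: "g \<in> topspace T" and e: "e > 0"
  note C = charge_compact[OF \<kappa>] and D = charge_bound_nonneg[OF \<kappa>]
  define d where "d = e / (D + 1)"
  have d: "d > 0" "D * d < e" using e D by (auto simp: d_def field_simps)
  have "continuous_map (prod_topology T T) euclideanreal (\<lambda>(g, y). f (g \<otimes> y))"
    unfolding case_prod_unfold by (intro cont_joint f continuous_map_fst continuous_map_snd)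
  from tube_continuity[OF this C g d(1)] obtain U where U: "openin T U" "g \<in> U"
    "\<And>u y. u \<in> U \<Longrightarrow> y \<in> C \<Longrightarrow> \<bar>f (u \<otimes> y) - f (g \<otimes> y)\<bar> < d" by auto
  have "\<bar>\<kappa> (\<lambda>y. f (u \<otimes> y)) - \<kappa> (\<lambda>y. f (g \<otimes> y))\<bar> < e" if u: "u \<in> U" for u
  proof -
    have "\<bar>\<kappa> (\<lambda>y. f (u \<otimes> y)) - \<kappa> (\<lambda>y. f (g \<otimes> y))\<bar> \<le> D * d"
      using u g openin_carrier[OF U(1)] less_imp_le[OF U(3)[OF u]]
      by (intro charge_close[OF \<kappa>] cont_left f) (auto simp: topspace_eq)
    then show ?thesis using d(2) by linarith
  qed
  with U show "\<exists>U. openin T U \<and> g \<in> U \<and> (\<forall>y\<in>U. \<bar>\<kappa> (\<lambda>ya. f (y \<otimes> ya)) - \<kappa> (\<lambda>y. f (g \<otimes> y))\<bar> < e)"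
    by blast
qed

text \<open>The convolution of the density \<open>\<rho>\<close> with the charge \<open>\<kappa>\<close>.\<close>

definition smoothing :: "(('a \<Rightarrow> real) \<Rightarrow> real) \<Rightarrow> ('a \<Rightarrow> real) \<Rightarrow> (('a \<Rightarrow> real) \<Rightarrow> real) \<Rightarrow> ('a \<Rightarrow> real) \<Rightarrow> real" where
  "smoothing I \<rho> \<kappa> f = I (\<lambda>g. \<rho> g * \<kappa> (\<lambda>y. f (g \<otimes> y)))"

context
  fixes I \<rho> \<kappa> C D N
  assumes I: "positive_functional T I"
    and \<kappa>: "charge C D \<kappa>"
    and \<rho>: "\<rho> \<in> Cc T" "\<And>x. x \<in> carrier G \<Longrightarrow> 0 \<le> \<rho> x"
    and N: "compactin T N" "N \<noteq> {}" "\<And>x. x \<in> carrier G \<Longrightarrow> x \<notin> N \<Longrightarrow> \<rho> x = 0"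
begin

lemma smoothing_integrand: "cont f \<Longrightarrow> (\<lambda>g. \<rho> g * \<kappa> (\<lambda>y. f (g \<otimes> y))) \<in> Cc T"
  by (rule Cc_mult(1)[OF \<rho>(1) charge_translates_continuous[OF \<kappa>]])

lemma charge_smoothing: "charge (N <#> C) (I \<rho> * D) (smoothing I \<rho> \<kappa>)"
proof (rule chargeI)
  note C = charge_compact[OF \<kappa>] and D = charge_bound_nonneg[OF \<kappa>]
  have NG: "N \<subseteq> carrier G" and CG: "C \<subseteq> carrier G" using compactin_carrier N(1) C by auto
  show "compactin T (N <#> C)" by (rule compactin_set_mult[OF N(1) C])
  show "N <#> C \<noteq> {}" using N(2) charge_nonempty[OF \<kappa>] by (auto simp: set_mult_def)
  have I\<rho>: "0 \<le> I \<rho>" using \<rho> by (intro pf_nonneg[OF I]) (auto simp: topspace_eq)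
  then show "0 \<le> I \<rho> * D" using D by simp
  fix f assume f: "cont f"
  note fi = smoothing_integrand[OF f]
  show "smoothing I \<rho> \<kappa> (\<lambda>x. f x + g x) = smoothing I \<rho> \<kappa> f + smoothing I \<rho> \<kappa> g" if g: "cont g" for g
  proof -
    have "smoothing I \<rho> \<kappa> (\<lambda>x. f x + g x) =
        I (\<lambda>t. \<rho> t * \<kappa> (\<lambda>y. f (t \<otimes> y)) + \<rho> t * \<kappa> (\<lambda>y. g (t \<otimes> y)))"
      unfolding smoothing_def
      by (rule pf_cong[OF I smoothing_integrand[OF continuous_map_add[OF f g]]])
         (simp add: charge_add[OF \<kappa> cont_left[OF f] cont_left[OF g]] topspace_eq distrib_left)
    also have "\<dots> = smoothing I \<rho> \<kappa> f + smoothing I \<rho> \<kappa> g"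
      unfolding smoothing_def by (rule pf_add[OF I fi smoothing_integrand[OF g]])
    finally show ?thesis .
  qed
  show "smoothing I \<rho> \<kappa> (\<lambda>x. c * f x) = c * smoothing I \<rho> \<kappa> f" for c
  proof -
    have "smoothing I \<rho> \<kappa> (\<lambda>x. c * f x) = I (\<lambda>t. c * (\<rho> t * \<kappa> (\<lambda>y. f (t \<otimes> y))))"
      unfolding smoothing_def
      by (rule pf_cong[OF I smoothing_integrand[OF continuous_map_real_mult_left[OF f]]])
         (simp add: charge_scale[OF \<kappa> cont_left[OF f]] topspace_eq)
    also have "\<dots> = c * smoothing I \<rho> \<kappa> f" unfolding smoothing_def by (rule pf_scale[OF I fi])
    finally show ?thesis .
  qed
  fix s assume s: "\<And>x. x \<in> N <#> C \<Longrightarrow> \<bar>f x\<bar> \<le> s"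
  have "\<bar>smoothing I \<rho> \<kappa> f\<bar> \<le> I (\<lambda>g. (D * s) * \<rho> g)"
    unfolding smoothing_def
  proof (rule pf_abs_le[OF I fi Cc_scale[OF \<rho>(1)]])
    fix g assume "g \<in> topspace T"
    then have g: "g \<in> carrier G" by (simp add: topspace_eq)
    show "\<bar>\<rho> g * \<kappa> (\<lambda>y. f (g \<otimes> y))\<bar> \<le> (D * s) * \<rho> g"
    proof (cases "g \<in> N")
      case True
      have "\<bar>\<kappa> (\<lambda>y. f (g \<otimes> y))\<bar> \<le> D * s"
        using True by (intro charge_bound[OF \<kappa> cont_left[OF f g]] s) (auto simp: set_mult_def)
      then show ?thesis using mult_left_mono[OF _ \<rho>(2)[OF g]] \<rho>(2)[OF g] by (simp add: abs_mult mult.commute[of "D * s"])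
    qed (use N(3) g in simp)
  qed
  also have "\<dots> = I \<rho> * D * s" using pf_scale[OF I \<rho>(1), of "D * s"] by simp
  finally show "\<bar>smoothing I \<rho> \<kappa> f\<bar> \<le> I \<rho> * D * s" .
qed

lemma smoothing_inner:
  assumes f: "cont f"
  shows "y \<in> carrier G \<Longrightarrow> (\<lambda>g. \<rho> g * f (g \<otimes> y)) \<in> Cc T"
    and "cont (\<lambda>y. I (\<lambda>g. \<rho> g * f (g \<otimes> y)))"
    and "smoothing I \<rho> \<kappa> f = \<kappa> (\<lambda>y. I (\<lambda>g. \<rho> g * f (g \<otimes> y)))"
proof -
  note C = charge_compact[OF \<kappa>]
  have joint: "continuous_map (prod_topology T T) euclideanreal (\<lambda>(y, g). \<rho> g * f (g \<otimes> y))"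
    unfolding case_prod_unfold
    using continuous_map_compose[OF continuous_map_snd Cc_continuous[OF \<rho>(1)], of T]
    by (intro continuous_map_real_mult cont_joint f continuous_map_fst continuous_map_snd) (simp add: o_def)
  have supp: "\<exists>U K. openin T U \<and> y \<in> U \<and> compactin T K \<and> (\<forall>u\<in>U. \<forall>g\<in>topspace T - K. \<rho> g * f (g \<otimes> u) = 0)"
    if "y \<in> topspace T" for y
  proof (intro exI conjI ballI)
    show "openin T (topspace T)" by simp
    show "compactin T N" by (rule N(1))
    show "\<rho> g * f (g \<otimes> u) = 0" if "g \<in> topspace T - N" for g u using that N(3) by (simp add: topspace_eq)
  qed (rule that)
  show "y \<in> carrier G \<Longrightarrow> (\<lambda>g. \<rho> g * f (g \<otimes> y)) \<in> Cc T"
    using continuous_map_pf_parameter(1)[OF I locally_compact hausdorff joint supp] by (simp add: topspace_eq)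
  show JS: "cont (\<lambda>y. I (\<lambda>g. \<rho> g * f (g \<otimes> y)))"
    by (rule continuous_map_pf_parameter(2)[OF I locally_compact hausdorff joint supp])
  have joint': "continuous_map (prod_topology T T) euclideanreal (\<lambda>(g, y). \<rho> g * f (g \<otimes> y))"
    unfolding case_prod_unfold
    using continuous_map_compose[OF continuous_map_fst Cc_continuous[OF \<rho>(1)], of T]
    by (intro continuous_map_real_mult cont_joint f continuous_map_fst continuous_map_snd) (simp add: o_def)
  have fg: "cont (\<lambda>y. \<rho> g * f (g \<otimes> y))" if "g \<in> carrier G" for g
    by (rule continuous_map_real_mult_left[OF cont_left[OF f that]])
  have "\<kappa> (\<lambda>y. I (\<lambda>g. \<rho> g * f (g \<otimes> y))) = I (\<lambda>g. \<kappa> (\<lambda>y. \<rho> g * f (g \<otimes> y)))"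
  proof (rule pf_interchange[OF I locally_compact hausdorff N(1), where Y=C and S="{f. cont f}" and D=D])
    show "\<exists>U. openin T U \<and> h \<in> U \<and> (\<forall>u\<in>U. \<forall>y\<in>C. \<bar>\<rho> u * f (u \<otimes> y) - \<rho> h * f (h \<otimes> y)\<bar> \<le> e)"
      if "h \<in> topspace T" "e > 0" for h and e :: real
      using tube_continuity[OF joint' C that] by (metis (no_types, lifting) case_prod_conv less_imp_le)
  qed (use N(3) fg JS charge_add[OF \<kappa>] charge_scale[OF \<kappa>] charge_bound[OF \<kappa>] charge_bound_nonneg[OF \<kappa>] in
       \<open>auto simp: topspace_eq intro: continuous_map_add continuous_map_real_mult_left\<close>)
  also have "\<dots> = smoothing I \<rho> \<kappa> f"
    unfolding smoothing_def
    by (rule pf_cong[OF I smoothing_integrand[OF f], symmetric])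
       (simp add: charge_scale[OF \<kappa> cont_left[OF f]] topspace_eq)
  finally show "smoothing I \<rho> \<kappa> f = \<kappa> (\<lambda>y. I (\<lambda>g. \<rho> g * f (g \<otimes> y)))" by simp
qed

text \<open>A right translation by \<open>u\<close> of a point \<open>g y\<close> is a right translation by \<open>y u y\<^sup>-\<^sup>1\<close> of its factor \<open>g\<close>.
  By invariance of \<open>I\<close> it can be moved to \<open>\<rho>\<close>, which is uniformly continuous, and \<open>y u y\<^sup>-\<^sup>1\<close> is close to
  the identity uniformly for \<open>y\<close> in the compact set \<open>C\<close>.\<close>

lemma right_continuous_smoothing:
  assumes inv: "\<And>f t. f \<in> Cc T \<Longrightarrow> t \<in> carrier G \<Longrightarrow> I (\<lambda>x. f (x \<otimes> t)) = I f"
  shows "right_continuous (smoothing I \<rho> \<kappa>)"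
  unfolding right_continuous_def
proof (intro allI impI)
  fix e :: real assume e: "e > 0"
  note C = charge_compact[OF \<kappa>] and D = charge_bound_nonneg[OF \<kappa>]
  have CG: "C \<subseteq> carrier G" by (rule compactin_carrier[OF C])
  have NG: "N \<subseteq> carrier G" by (rule compactin_carrier[OF N(1)])
  obtain V0 K where K: "openin T V0" "compactin T K" "\<one> \<in> V0" "V0 \<subseteq> K"
    using compact_neighbourhood_of_one .
  have KG: "K \<subseteq> carrier G" by (rule compactin_carrier[OF K(2)])
  define Q where "Q = N \<union> (N <#> m_inv G ` K)"
  have Q: "compactin T Q" unfolding Q_def by (intro compactin_Un compactin_set_mult compactin_inverse N K)
  obtain \<psi> where \<psi>: "\<psi> \<in> Cc T" "\<And>x. x \<in> topspace T \<Longrightarrow> 0 \<le> \<psi> x" "\<And>x. x \<in> Q \<Longrightarrow> \<psi> x = 1"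
    using bump_function[OF locally_compact hausdorff Q, of "topspace T"] compactin_subset_topspace[OF Q]
    by (metis openin_topspace)
  have I\<psi>: "0 \<le> I \<psi>" by (rule pf_nonneg[OF I \<psi>(1,2)])
  define d where "d = e / (D * I \<psi> + 1)"
  have DI: "0 \<le> D * I \<psi>" using D I\<psi> by simp
  have d: "d > 0" "D * I \<psi> * d \<le> e" using e DI by (auto simp: d_def field_simps)
  obtain V1 where V1: "openin T V1" "\<one> \<in> V1" "\<And>v x. v \<in> V1 \<Longrightarrow> x \<in> carrier G \<Longrightarrow> \<bar>\<rho> (x \<otimes> v) - \<rho> x\<bar> < d"
    using Cc_uniformly_continuous[OF \<rho>(1) d(1)] by metis
  have V01: "openin T (V0 \<inter> V1)" using K(1) V1(1) by blast
  define W where "W = {z \<in> topspace (prod_topology T T). snd z \<otimes> (inv fst z \<otimes> inv snd z) \<in> V0 \<inter> V1}"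
  have "openin (prod_topology T T) W"
    unfolding W_def
    by (intro openin_continuous_map_preimage[OF _ V01] continuous_map_mult continuous_map_inv continuous_map_fst continuous_map_snd)
  moreover have "{\<one>} \<times> C \<subseteq> W" using CG K(3) V1(2) by (auto simp: W_def topspace_eq)
  moreover have "compactin T {\<one>}" by (simp add: topspace_eq)
  ultimately obtain U V where U: "openin T U" "{\<one>} \<subseteq> U" "C \<subseteq> V" "U \<times> V \<subseteq> W"
    using Wallace_theorem_prod_topology[OF _ C] by metis
  show "\<exists>V. openin T V \<and> \<one> \<in> V \<and> (\<forall>v\<in>V. \<forall>f s. cont f \<longrightarrow> (\<forall>x\<in>carrier G. \<bar>f x\<bar> \<le> s) \<longrightarrow>
      \<bar>smoothing I \<rho> \<kappa> (\<lambda>x. f (x \<otimes> v)) - smoothing I \<rho> \<kappa> f\<bar> \<le> e * s)"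
  proof (intro exI[of _ U] conjI ballI allI impI)
    fix u f s assume u: "u \<in> U" and f: "cont f" and s: "\<forall>x\<in>carrier G. \<bar>f x\<bar> \<le> s"
    have uG: "u \<in> carrier G" using u openin_carrier[OF U(1)] by blast
    have s0: "s \<ge> 0" using bspec[OF s one_closed] by linarith
    have fu: "cont (\<lambda>x. f (x \<otimes> u))" by (rule cont_right[OF f uG])
    have "\<bar>I (\<lambda>g. \<rho> g * f (g \<otimes> y \<otimes> u)) - I (\<lambda>g. \<rho> g * f (g \<otimes> y))\<bar> \<le> I \<psi> * (d * s)" if y: "y \<in> C" for y
    proof -
      have yG: "y \<in> carrier G" using y CG by blast
      define v where "v = y \<otimes> (inv u \<otimes> inv y)"
      have vG: "v \<in> carrier G" using yG uG by (simp add: v_def)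
      have "(u, y) \<in> W" using U(3,4) u y by blast
      then have v: "v \<in> V0" "v \<in> V1" by (simp_all add: W_def v_def)
      have vK: "v \<in> K" using v(1) K(4) by blast
      have vy: "inv v \<otimes> y = y \<otimes> u"
        using yG uG by (simp add: v_def inv_mult_group m_assoc)
      have memv: "(\<lambda>g. \<rho> (g \<otimes> v) * f (g \<otimes> y)) \<in> Cc T"
        by (rule Cc_mult(1)[OF Cc_right_translate[OF \<rho>(1) vG] cont_right[OF f yG]])
      have mem: "(\<lambda>g. \<rho> g * f (g \<otimes> y)) \<in> Cc T" by (rule smoothing_inner(1)[OF f yG])
      have "I (\<lambda>g. \<rho> g * f (g \<otimes> y \<otimes> u)) = I (\<lambda>g. \<rho> (g \<otimes> inv v \<otimes> v) * f (g \<otimes> inv v \<otimes> y))"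
        by (rule pf_cong[OF I smoothing_inner(1)[OF fu yG]])
           (use yG uG vG vy in \<open>simp add: topspace_eq m_assoc\<close>)
      also have "\<dots> = I (\<lambda>g. \<rho> (g \<otimes> v) * f (g \<otimes> y))" by (rule inv[OF memv]) (use vG in simp)
      finally have "I (\<lambda>g. \<rho> g * f (g \<otimes> y \<otimes> u)) - I (\<lambda>g. \<rho> g * f (g \<otimes> y)) =
          I (\<lambda>g. \<rho> (g \<otimes> v) * f (g \<otimes> y) - \<rho> g * f (g \<otimes> y))"
        using pf_diff[OF I memv mem] by simp
      also have "\<bar>\<dots>\<bar> \<le> I (\<lambda>g. (d * s) * \<psi> g)"
      proof (rule pf_abs_le[OF I Cc_diff[OF memv mem] Cc_scale[OF \<psi>(1)]])
        fix g assume "g \<in> topspace T"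
        then have g: "g \<in> carrier G" by (simp add: topspace_eq)
        show "\<bar>\<rho> (g \<otimes> v) * f (g \<otimes> y) - \<rho> g * f (g \<otimes> y)\<bar> \<le> d * s * \<psi> g"
        proof (cases "g \<in> Q")
          case True
          have "\<bar>\<rho> (g \<otimes> v) - \<rho> g\<bar> * \<bar>f (g \<otimes> y)\<bar> \<le> d * s"
            using V1(3)[OF v(2) g] s g yG d(1) by (intro mult_mono) auto
          then show ?thesis using \<psi>(3)[OF True] by (simp add: abs_mult flip: left_diff_distrib)
        next
          case False
          have "g \<otimes> v \<notin> N"
          proof
            assume "g \<otimes> v \<in> N"
            moreover have "g = (g \<otimes> v) \<otimes> inv v" using g vG by (simp add: m_assoc)
            ultimately show False using False vK unfolding Q_def set_mult_def by blast
          qed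
          moreover have "g \<notin> N" using False by (simp add: Q_def)
          ultimately have "\<rho> (g \<otimes> v) = 0" "\<rho> g = 0" using N(3) g vG by auto
          then show ?thesis using \<psi>(2)[of g] g d(1) s0 by (simp add: topspace_eq)
        qed
      qed
      also have "\<dots> = I \<psi> * (d * s)" using pf_scale[OF I \<psi>(1), of "d * s"] by simp
      finally show ?thesis .
    qed
    then have "\<bar>smoothing I \<rho> \<kappa> (\<lambda>x. f (x \<otimes> u)) - smoothing I \<rho> \<kappa> f\<bar> \<le> D * (I \<psi> * (d * s))"
      unfolding smoothing_inner(3)[OF f] smoothing_inner(3)[OF fu]
      by (intro charge_close[OF \<kappa> smoothing_inner(2)[OF fu] smoothing_inner(2)[OF f]]) simp
    also have "\<dots> = (D * I \<psi> * d) * s" by simp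
    also have "\<dots> \<le> e * s" using d(2) s0 by (rule mult_right_mono)
    finally show "\<bar>smoothing I \<rho> \<kappa> (\<lambda>x. f (x \<otimes> u)) - smoothing I \<rho> \<kappa> f\<bar> \<le> e * s" .
  qed (use U in auto)
qed

end

end

section \<open>Absolute continuity\<close>

context quasi_invariant
begin

text \<open>The measure on the group that disintegrates into the Haar measures of the cosets and the measure \<open>M\<close> on
  the coset space, multiplied by a weight.\<close>

definition weighted :: "('a \<Rightarrow> real) \<Rightarrow> ('a \<Rightarrow> real) \<Rightarrow> real" where
  "weighted \<beta> f = (\<integral>C. flat (\<lambda>x. \<beta> x * f x) C \<partial>M)"

lemma charge_weighted:
  assumes \<beta>: "\<beta> \<in> Cc T" "\<And>x. x \<in> carrier G \<Longrightarrow> 0 \<le> \<beta> x"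
    and L: "compactin T L" "L \<noteq> {}" "\<And>x. x \<in> carrier G \<Longrightarrow> x \<notin> L \<Longrightarrow> \<beta> x = 0"
  shows "charge L (\<integral>C. flat \<beta> C \<partial>M) (weighted \<beta>)"
proof (rule chargeI[OF L(1,2)])
  have flat0: "0 \<le> flat \<beta> C" if "C \<in> topspace X" for C by (rule flat_nonneg[OF \<beta> that])
  show "0 \<le> (\<integral>C. flat \<beta> C \<partial>M)" using flat0 by (intro integral_nonneg_AE AE_I2) (simp add: space_M)
  fix f assume f: "cont f"
  note \<beta>f = Cc_mult(1)[OF \<beta>(1) f]
  show "weighted \<beta> (\<lambda>x. f x + g x) = weighted \<beta> f + weighted \<beta> g" if g: "cont g" for g
  proof -
    note \<beta>g = Cc_mult(1)[OF \<beta>(1) g]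
    have "weighted \<beta> (\<lambda>x. f x + g x) = (\<integral>C. flat (\<lambda>x. \<beta> x * f x) C + flat (\<lambda>x. \<beta> x * g x) C \<partial>M)"
      unfolding weighted_def distrib_left
      by (intro Bochner_Integration.integral_cong refl flat_add[OF \<beta>f \<beta>g]) (simp add: space_M)
    then show ?thesis
      unfolding weighted_def using flat_integrable[OF \<beta>f] flat_integrable[OF \<beta>g] by simp
  qed
  show "weighted \<beta> (\<lambda>x. c * f x) = c * weighted \<beta> f" for c
  proof -
    have "weighted \<beta> (\<lambda>x. c * f x) = (\<integral>C. c * flat (\<lambda>x. \<beta> x * f x) C \<partial>M)"
      unfolding weighted_def mult.left_commute[of _ c]
      by (intro Bochner_Integration.integral_cong refl flat_scale[OF \<beta>f]) (simp add: space_M)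
    then show ?thesis unfolding weighted_def by simp
  qed
  fix s assume s: "\<And>x. x \<in> L \<Longrightarrow> \<bar>f x\<bar> \<le> s"
  have "\<bar>weighted \<beta> f\<bar> \<le> (\<integral>C. \<bar>flat (\<lambda>x. \<beta> x * f x) C\<bar> \<partial>M)"
    unfolding weighted_def by (rule integral_abs_bound)
  also have "\<dots> \<le> (\<integral>C. s * flat \<beta> C \<partial>M)"
  proof (rule integral_mono)
    show "integrable M (\<lambda>C. \<bar>flat (\<lambda>x. \<beta> x * f x) C\<bar>)" by (rule integrable_abs[OF flat_integrable[OF \<beta>f]])
    show "integrable M (\<lambda>C. s * flat \<beta> C)" using flat_integrable[OF \<beta>(1)] by simp
    fix C assume "C \<in> space M"
    then have C: "C \<in> topspace X" by (simp add: space_M)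
    have "\<bar>flat (\<lambda>x. \<beta> x * f x) C\<bar> \<le> flat (\<lambda>x. s * \<beta> x) C"
    proof (rule flat_abs_le[OF \<beta>f Cc_scale[OF \<beta>(1)] C])
      fix x assume x: "x \<in> carrier G"
      show "\<bar>\<beta> x * f x\<bar> \<le> s * \<beta> x"
      proof (cases "x \<in> L")
        case True
        then show ?thesis using mult_left_mono[OF s[OF True] \<beta>(2)[OF x]] \<beta>(2)[OF x] by (simp add: abs_mult mult.commute)
      qed (use L(3) x in simp)
    qed
    then show "\<bar>flat (\<lambda>x. \<beta> x * f x) C\<bar> \<le> s * flat \<beta> C" by (simp add: flat_scale[OF \<beta>(1) C])
  qed
  also have "\<dots> = (\<integral>C. flat \<beta> C \<partial>M) * s" by simp
  finally show "\<bar>weighted \<beta> f\<bar> \<le> (\<integral>C. flat \<beta> C \<partial>M) * s" .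
qed

lemma weighted_nonneg:
  assumes \<beta>: "\<beta> \<in> Cc T" "\<And>x. x \<in> carrier G \<Longrightarrow> 0 \<le> \<beta> x" and f: "cont f" "\<And>x. x \<in> carrier G \<Longrightarrow> 0 \<le> f x"
  shows "0 \<le> weighted \<beta> f"
  unfolding weighted_def
  using \<beta>(2) f(2) by (intro integral_nonneg_AE AE_I2 flat_nonneg[OF Cc_mult(1)[OF \<beta>(1) f(1)]]) (simp_all add: space_M)

lemma weighted_coset:
  assumes \<beta>: "\<beta> \<in> Cc T" and F: "continuous_map X euclideanreal F" and g: "g \<in> carrier G"
  shows "weighted \<beta> (\<lambda>y. F ((g \<otimes> y) <# H)) = (\<integral>C. F (g <# C) * flat \<beta> C \<partial>M)"
  unfolding weighted_def
proof (intro Bochner_Integration.integral_cong refl)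
  fix C assume "C \<in> space M"
  then have C: "C \<in> topspace X" by (simp add: space_M)
  obtain x where x: "x \<in> carrier G" "C = x <# H" using in_X_cases[OF C] .
  have Fg: "continuous_map X euclideanreal (\<lambda>C. F (g <# C))"
    using continuous_map_compose[OF continuous_action[OF g] F] by (simp add: o_def)
  have Fx: "cont (\<lambda>x. F ((g \<otimes> x) <# H))"
    using continuous_map_compose[OF continuous_translate(1)[OF g]] F continuous_on_X by (fastforce simp: o_def)
  have "flat (\<lambda>y. \<beta> y * F ((g \<otimes> y) <# H)) C = flat (\<lambda>y. F (g <# (y <# H)) * \<beta> y) C"
    unfolding x(2) flat_coset[OF Cc_mult(1)[OF \<beta> Fx] x(1)]
      flat_coset[OF Cc_mult(2)[OF \<beta> Fg[unfolded continuous_on_X]] x(1)]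
    by (rule pf_cong[OF J flat_integrand(1)[OF Cc_mult(1)[OF \<beta> Fx] x(1)]])
       (use x g HG coset_action in \<open>auto simp: mult.commute\<close>)
  then show "flat (\<lambda>y. \<beta> y * F ((g \<otimes> y) <# H)) C = F (g <# C) * flat \<beta> C"
    using flat_mult[OF \<beta> Fg C] by simp
qed

text \<open>If the density \<open>w\<close> were not dominated, there would be functions \<open>f k\<close> with values in \<open>[0, 1]\<close> and
  integrals summable for the smoothed measure but not small for \<open>w\<close>. By compactness
  \<open>\<Sum>k. f k (g C)\<close> is integrable against \<open>flat \<beta>\<close> for a single \<open>g\<close>. As \<open>g\<close> preserves null sets,
  \<open>f k\<close> tends to 0 almost everywhere on \<open>A\<close>, which contradicts dominated convergence.\<close>

lemma absolutely_continuous: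
  fixes w :: "'a set \<Rightarrow> real"
  assumes I: "positive_functional T I"
      "\<And>f x. f \<in> Cc T \<Longrightarrow> (\<And>x. x \<in> carrier G \<Longrightarrow> 0 \<le> f x) \<Longrightarrow> x \<in> carrier G \<Longrightarrow> 0 < f x \<Longrightarrow> 0 < I f"
    and \<rho>: "\<rho> \<in> Cc T" "\<And>x. x \<in> carrier G \<Longrightarrow> 0 \<le> \<rho> x" "\<rho> \<one> = 1"
    and N: "compactin T N" "N \<noteq> {}" "\<And>x. x \<in> carrier G \<Longrightarrow> x \<notin> N \<Longrightarrow> \<rho> x = 0"
    and \<beta>: "\<beta> \<in> Cc T" "\<And>x. x \<in> carrier G \<Longrightarrow> 0 \<le> \<beta> x"
    and A: "A \<in> sets M" "\<And>g C. g \<in> N \<Longrightarrow> C \<in> A \<Longrightarrow> 0 < flat \<beta> (inv g <# C)"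
    and w: "integrable M w" "\<And>C. 0 \<le> w C"
    and \<delta>: "\<delta> > 0" "(\<integral>C. indicator (space M - A) C * w C \<partial>M) \<le> \<delta> / 2"
  shows "\<exists>n>0. \<forall>F\<in>Cb X. (\<forall>C\<in>topspace X. 0 \<le> F C \<and> F C \<le> 1) \<longrightarrow>
    (\<integral>C. F C * w C \<partial>M) \<le> n * smoothing I \<rho> (weighted \<beta>) (\<lambda>x. F (x <# H)) + \<delta>"
proof (rule ccontr)
  assume not: "\<not> ?thesis"
  have NG: "N \<subseteq> carrier G" by (rule compactin_carrier[OF N(1)])
  obtain L where L: "compactin T L" "L \<noteq> {}" "\<And>x. x \<in> carrier G \<Longrightarrow> x \<notin> L \<Longrightarrow> \<beta> x = 0"
    using Cc_support_nonempty[OF \<beta>(1)] by metis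
  note \<kappa> = charge_weighted[OF \<beta> L]
  note smoothing = smoothing_integrand[OF I(1) \<kappa> \<rho>(1,2) N]
  define \<nu> where "\<nu> F = smoothing I \<rho> (weighted \<beta>) (\<lambda>x. F (x <# H))" for F
  define W where "W = (\<integral>C. w C \<partial>M)"
  have W0: "W \<ge> 0" unfolding W_def using w(2) by (intro integral_nonneg_AE) auto
  have ex: "\<exists>F. F \<in> Cb X \<and> (\<forall>C\<in>topspace X. 0 \<le> F C \<and> F C \<le> 1) \<and> 2 ^ k * \<nu> F + \<delta> < (\<integral>C. F C * w C \<partial>M)"
    for k :: nat
  proof (rule ccontr)
    assume *: "\<not> ?thesis"
    have "\<forall>F\<in>Cb X. (\<forall>C\<in>topspace X. 0 \<le> F C \<and> F C \<le> 1) \<longrightarrow> (\<integral>C. F C * w C \<partial>M) \<le> 2 ^ k * \<nu> F + \<delta>"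
    proof (intro ballI impI)
      fix F assume "F \<in> Cb X" "\<forall>C\<in>topspace X. 0 \<le> F C \<and> F C \<le> 1"
      with * have "\<not> 2 ^ k * \<nu> F + \<delta> < (\<integral>C. F C * w C \<partial>M)" by blast
      then show "(\<integral>C. F C * w C \<partial>M) \<le> 2 ^ k * \<nu> F + \<delta>" by (rule leI)
    qed
    moreover have "(2::real) ^ k > 0" by simp
    ultimately show False using not unfolding \<nu>_def by blast
  qed
  from choice[OF allI[OF ex]] obtain f where
    "\<forall>k. f k \<in> Cb X \<and> (\<forall>C\<in>topspace X. 0 \<le> f k C \<and> f k C \<le> 1) \<and> 2 ^ k * \<nu> (f k) + \<delta> < (\<integral>C. f k C * w C \<partial>M)" ..
  then have f: "\<And>k. f k \<in> Cb X" "\<And>k C. C \<in> topspace X \<Longrightarrow> 0 \<le> f k C \<and> f k C \<le> 1"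
    "\<And>k::nat. 2 ^ k * \<nu> (f k) + \<delta> < (\<integral>C. f k C * w C \<partial>M)"
    by blast+
  have fc: "continuous_map X euclideanreal (f k)" for k by (rule Cb_continuous[OF f(1)])
  have fx: "cont (\<lambda>x. f k (x <# H))" for k using fc continuous_on_X by blast
  have fm [measurable]: "f k \<in> borel_measurable M" for k by (rule continuous_measurable[OF fc])
  have \<beta>m [measurable]: "flat \<beta> \<in> borel_measurable M" by (rule continuous_measurable[OF flat_continuous[OF \<beta>(1)]])
  have flat0: "0 \<le> flat \<beta> C" if "C \<in> topspace X" for C by (rule flat_nonneg[OF \<beta> that])
  define t where "t k g = weighted \<beta> (\<lambda>y. f k ((g \<otimes> y) <# H))" for k g
  have t_eq: "t k g = (\<integral>C. f k (g <# C) * flat \<beta> C \<partial>M)" if "g \<in> carrier G" for k g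
    unfolding t_def by (rule weighted_coset[OF \<beta>(1) fc that])
  have gX: "g <# C \<in> topspace X" if "g \<in> carrier G" "C \<in> topspace X" for g C
    using continuous_map_funspace[OF continuous_action[OF that(1)]] that(2) by auto
  have t0: "0 \<le> t k g" if g: "g \<in> carrier G" for k g
    unfolding t_eq[OF g]
  proof (rule integral_nonneg_AE, rule AE_I2)
    fix C assume "C \<in> space M"
    then have C: "C \<in> topspace X" by (simp add: space_M)
    then show "0 \<le> f k (g <# C) * flat \<beta> C" using f(2) gX[OF g C] flat0[OF C] by simp
  qed
  have t_cont: "cont (t k)" for k
    unfolding t_def by (rule charge_translates_continuous[OF \<kappa> fx])
  have \<rho>t: "(\<lambda>g. \<rho> g * t k g) \<in> Cc T" for k by (rule Cc_mult(1)[OF \<rho>(1) t_cont])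
  have \<nu>_eq: "\<nu> (f k) = I (\<lambda>g. \<rho> g * t k g)" for k by (simp add: \<nu>_def smoothing_def t_def)
  have \<nu>0: "0 \<le> \<nu> (f k)" for k
    unfolding \<nu>_eq using \<rho>(2) t0 by (intro pf_nonneg[OF I(1) \<rho>t]) (simp add: topspace_eq)
  have fw: "integrable M (\<lambda>C. f k C * w C)" for k
    using f(2) by (intro bounded_mult_integrable[OF w(1) fm, where B=1]) (simp add: space_M)
  have \<nu>_small: "\<nu> (f k) \<le> W * (1/2) ^ k" for k
  proof -
    have "(\<integral>C. f k C * w C \<partial>M) \<le> W"
      unfolding W_def
    proof (rule integral_mono[OF fw w(1)])
      fix C assume "C \<in> space M"
      then show "f k C * w C \<le> w C" using f(2)[of C k] mult_right_mono[OF _ w(2), of "f k C" 1 C] by (simp add: space_M)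
    qed
    then have "2 ^ k * \<nu> (f k) \<le> W" using f(3)[of k] \<delta>(1) by linarith
    then show ?thesis by (simp add: field_simps power_divide)
  qed
  define s where "s K g = (\<Sum>k<K. t k g)" for K g
  have s_cont: "cont (s K)" for K unfolding s_def by (intro continuous_map_sum t_cont) simp
  have s_mono: "s K g \<le> s K' g" if "K \<le> K'" "g \<in> carrier G" for K K' g
    unfolding s_def using that t0 by (intro sum_mono2) auto
  have s_int: "I (\<lambda>g. \<rho> g * s K g) \<le> 2 * W" for K
  proof -
    have "I (\<lambda>g. \<rho> g * s K g) = I (\<lambda>g. \<Sum>k<K. \<rho> g * t k g)" by (simp add: s_def sum_distrib_left)
    also have "\<dots> = (\<Sum>k<K. \<nu> (f k))" unfolding \<nu>_eq by (rule pf_sum[OF I(1)]) (use \<rho>t in auto)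
    also have "\<dots> \<le> (\<Sum>k<K. W * (1/2) ^ k)" by (intro sum_mono \<nu>_small)
    also have "\<dots> = W * (\<Sum>k<K. (1/2) ^ k)" by (simp add: sum_distrib_left)
    also have "\<dots> \<le> W * 2" using W0 by (intro mult_left_mono) (simp_all add: sum_gp_strict)
    finally show ?thesis by simp
  qed
  \<comment> \<open>the partial sums are bounded at some point of \<open>\<rho> \<ge> 1/2\<close>\<close>
  define \<rho>' where "\<rho>' x = max (\<rho> x - 1/2) 0" for x
  have \<rho>': "\<rho>' \<in> Cc T"
  proof (rule CcI[OF _ N(1)])
    show "cont \<rho>'"
      unfolding \<rho>'_def by (intro continuous_map_real_max continuous_map_diff Cc_continuous[OF \<rho>(1)]) auto
  qed (use N(3) in \<open>simp add: \<rho>'_def topspace_eq\<close>)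
  have I\<rho>': "0 < I \<rho>'" by (rule I(2)[OF \<rho>', of \<one>]) (use \<rho>(3) in \<open>auto simp: \<rho>'_def\<close>)
  define Q where "Q = N \<inter> {x \<in> topspace T. \<rho> x \<in> {1/2..}}"
  have Q: "compactin T Q"
    unfolding Q_def
    by (rule compact_Int_closedin[OF N(1) closedin_continuous_map_preimage[OF Cc_continuous[OF \<rho>(1)]]]) simp
  have "\<exists>g\<in>Q. \<exists>R. \<forall>K. s K g \<le> R"
  proof (rule ccontr)
    define R where "R = (2 * W + 1) / I \<rho>'"
    have R0: "R \<ge> 0" using W0 I\<rho>' by (simp add: R_def)
    assume "\<not> (\<exists>g\<in>Q. \<exists>R. \<forall>K. s K g \<le> R)"
    then have "\<exists>K. R < s K g" if "g \<in> Q" for g using that by (meson not_le)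
    then have cover: "\<exists>K\<in>UNIV. g \<in> {x \<in> topspace T. s K x \<in> {R<..}}" if "g \<in> Q" for g
      using that by (auto simp: Q_def)
    have op: "openin T {x \<in> topspace T. s K x \<in> {R<..}}" for K
      by (rule openin_continuous_map_preimage[OF s_cont]) simp
    obtain P where P: "finite P" "\<And>g. g \<in> Q \<Longrightarrow> \<exists>K\<in>P. g \<in> {x \<in> topspace T. s K x \<in> {R<..}}"
      using compactin_subcover_image[OF Q op cover] by metis
    define K where "K = Max (insert 0 P)"
    have K: "R \<le> s K g" if gQ: "g \<in> Q" for g
    proof -
      obtain K' where K': "K' \<in> P" "R < s K' g" "g \<in> carrier G" using P(2)[OF gQ] by (auto simp: topspace_eq)
      have "K' \<le> K" unfolding K_def using P(1) K'(1) by simp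
      then show ?thesis using s_mono[OF _ K'(3)] K'(2) by fastforce
    qed
    have "R * I \<rho>' = I (\<lambda>g. R * \<rho>' g)" by (rule pf_scale[OF I(1) \<rho>', symmetric])
    also have "\<dots> \<le> I (\<lambda>g. \<rho> g * s K g)"
    proof (rule pf_mono[OF I(1) Cc_scale[OF \<rho>'] Cc_mult(1)[OF \<rho>(1) s_cont]])
      fix g assume "g \<in> topspace T"
      then have g: "g \<in> carrier G" by (simp add: topspace_eq)
      have s0: "0 \<le> s K g" unfolding s_def using t0[OF g] by (intro sum_nonneg) auto
      show "R * \<rho>' g \<le> \<rho> g * s K g"
      proof (cases "g \<in> Q")
        case True
        have "R * \<rho>' g \<le> s K g * \<rho> g" using K[OF True] s0 \<rho>(2)[OF g] by (intro mult_mono) (auto simp: \<rho>'_def)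
        then show ?thesis by (simp add: mult.commute)
      next
        case False
        then have "\<rho>' g = 0" using N(3)[OF g] g by (cases "g \<in> N") (auto simp: Q_def \<rho>'_def topspace_eq)
        then show ?thesis using s0 \<rho>(2)[OF g] by simp
      qed
    qed
    also have "\<dots> \<le> 2 * W" by (rule s_int)
    finally show False using I\<rho>' by (simp add: R_def)
  qed
  then obtain g R where g: "g \<in> Q" and R: "\<And>K. s K g \<le> R" by blast
  have gG: "g \<in> carrier G" and igG: "inv g \<in> carrier G" and gN: "g \<in> N" using g NG by (auto simp: Q_def)
  note [measurable] = action_measurable[OF gG] action_measurable[OF igG]
  define u where "u k C = f k (g <# C) * flat \<beta> C" for k C
  have um [measurable]: "u k \<in> borel_measurable M" for k unfolding u_def by measurable
  have u0: "0 \<le> u k C" if "C \<in> space M" for k C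
    using that f(2) gX[OF gG] flat0 by (simp add: u_def space_M)
  have u_int: "integrable M (u k)" for k
    unfolding u_def using f(2) gX[OF gG]
    by (intro bounded_mult_integrable[OF flat_integrable[OF \<beta>(1)], where B=1]) (auto simp: space_M)
  have "(\<integral>\<^sup>+C. (\<Sum>k. ennreal (u k C)) \<partial>M) = (\<Sum>k. \<integral>\<^sup>+C. ennreal (u k C) \<partial>M)"
    by (rule nn_integral_suminf) measurable
  also have "\<dots> = (\<Sum>k. ennreal (t k g))"
    using u0 by (simp add: t_eq[OF gG] u_def[symmetric] nn_integral_eq_integral[OF u_int])
  also have "\<dots> \<le> ennreal R"
  proof (rule suminf_le_const)
    show "summable (\<lambda>k. ennreal (t k g))" by (rule summableI)
    show "(\<Sum>k<K. ennreal (t k g)) \<le> ennreal R" for K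
      using R[of K] t0[OF gG] by (simp add: s_def sum_ennreal ennreal_leI)
  qed
  finally have "(\<integral>\<^sup>+C. (\<Sum>k. ennreal (u k C)) \<partial>M) \<noteq> \<infinity>" using le_less_trans[OF _ ennreal_less_top, of _ R] by fastforce
  then have fin: "AE C in M. (\<Sum>k. ennreal (u k C)) \<noteq> \<infinity>" by (intro nn_integral_PInf_AE) auto
  \<comment> \<open>outside this null set the series converges, and its general term is \<open>f k D\<close> times a positive constant\<close>
  define B where "B = {D \<in> A. (\<Sum>k. ennreal (f k D * flat \<beta> (inv g <# D))) = \<infinity>}"
  have "B = A \<inter> {D \<in> space M. (\<Sum>k. ennreal (f k D * flat \<beta> (inv g <# D))) = \<infinity>}"
    using sets.sets_into_space[OF A(1)] by (auto simp: B_def)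
  then have Bm: "B \<in> sets M" using A(1) by simp
  have "AE C in M. \<not> g <# C \<in> B"
    using fin
  proof (rule AE_mp, intro AE_I2 impI)
    fix C assume C: "C \<in> space M" and "(\<Sum>k. ennreal (u k C)) \<noteq> \<infinity>"
    then show "\<not> g <# C \<in> B" using action_cancel[OF gG, of C] by (simp add: B_def u_def space_M)
  qed
  then have "emeasure M {C \<in> space M. g <# C \<in> B} = 0" by (rule emeasure_eq_0_AE)
  then have "B \<in> null_sets M" by (rule null_translate[OF gG Bm])
  then have AE_B: "AE D in M. D \<notin> B" by (rule AE_not_in)
  have "(\<lambda>k. \<integral>D. indicator A D * (f k D * w D) \<partial>M) \<longlonglongrightarrow> (\<integral>D. 0 \<partial>M)"
  proof (rule integral_dominated_convergence[OF _ _ w(1)])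
    show "AE D in M. (\<lambda>k. indicator A D * (f k D * w D)) \<longlonglongrightarrow> 0"
      using AE_B
    proof (rule AE_mp, intro AE_I2 impI)
      fix D assume D: "D \<in> space M" and DB: "D \<notin> B"
      show "(\<lambda>k. indicator A D * (f k D * w D)) \<longlonglongrightarrow> 0"
      proof (cases "D \<in> A")
        case True
        define c where "c = flat \<beta> (inv g <# D)"
        have c: "c > 0" unfolding c_def by (rule A(2)[OF gN True])
        have "(\<Sum>k. ennreal (f k D * c)) \<noteq> \<infinity>" using DB True by (simp add: B_def c_def)
        then have "summable (\<lambda>k. f k D * c)"
          using f(2) D c by (intro summable_suminf_not_top) (auto simp: space_M)
        then have "(\<lambda>k. f k D * c * (w D / c)) \<longlonglongrightarrow> 0 * (w D / c)"
          by (intro tendsto_mult_right summable_LIMSEQ_zero)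
        then show ?thesis using True c by simp
      qed simp
    qed
    show "AE D in M. norm (indicator A D * (f k D * w D)) \<le> w D" for k
    proof (rule AE_I2)
      fix D assume "D \<in> space M"
      then have "\<bar>f k D\<bar> * w D \<le> 1 * w D" using f(2) w(2) by (intro mult_right_mono) (auto simp: space_M)
      then show "norm (indicator A D * (f k D * w D)) \<le> w D" using w(2)[of D] by (simp add: abs_mult indicator_def)
    qed
    show "(\<lambda>D. indicator A D * (f k D * w D)) \<in> borel_measurable M" for k
      using A(1) w(1) by measurable
  qed simp
  then have "(\<lambda>k. \<integral>D. indicator A D * (f k D * w D) \<partial>M) \<longlonglongrightarrow> 0" by simp
  then have "\<forall>\<^sub>F k in sequentially. (\<integral>D. indicator A D * (f k D * w D) \<partial>M) < \<delta> / 2"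
    using \<delta>(1) by (intro order_tendstoD) auto
  then obtain k where k: "(\<integral>D. indicator A D * (f k D * w D) \<partial>M) < \<delta> / 2" by (auto simp: eventually_sequentially)
  have iA: "integrable M (\<lambda>D. indicator A D * (f k D * w D))"
    using A(1) by (intro bounded_mult_integrable[OF fw, where B=1]) (auto simp: indicator_def)
  have iA': "integrable M (\<lambda>D. indicator (space M - A) D * w D)"
    using A(1) by (intro bounded_mult_integrable[OF w(1), where B=1]) (auto simp: indicator_def)
  have "(\<integral>D. f k D * w D \<partial>M) \<le> (\<integral>D. indicator A D * (f k D * w D) + indicator (space M - A) D * w D \<partial>M)"
  proof (rule integral_mono[OF fw Bochner_Integration.integrable_add[OF iA iA']])
    fix D assume D: "D \<in> space M"
    then have "f k D * w D \<le> 1 * w D" using f(2) w(2) by (intro mult_right_mono) (auto simp: space_M)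
    then show "f k D * w D \<le> indicator A D * (f k D * w D) + indicator (space M - A) D * w D"
      using D by (simp add: indicator_def)
  qed
  also have "\<dots> \<le> \<delta>" using iA iA' k \<delta>(2) by simp
  finally have "(\<integral>D. f k D * w D \<partial>M) \<le> \<delta>" .
  moreover have "0 \<le> 2 ^ k * \<nu> (f k)" using \<nu>0 by simp
  ultimately show False using f(3)[of k] by linarith
qed

end

section \<open>Approximate invariant means on the subgroup\<close>

lemma (in locally_compact_group) charge_translate_difference:
  assumes \<mu>: "charge C D \<mu>" and R: "right_continuous \<mu>" and h: "h \<in> carrier G"
  shows "charge ((\<lambda>x. h \<otimes> x) ` C \<union> C) (2 * D) (\<lambda>f. \<mu> (\<lambda>x. f (h \<otimes> x)) - \<mu> f)"
    and "right_continuous (\<lambda>f. \<mu> (\<lambda>x. f (h \<otimes> x)) - \<mu> f)"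
proof -
  note C = charge_compact[OF \<mu>] and D = charge_bound_nonneg[OF \<mu>]
  have CG: "C \<subseteq> carrier G" by (rule compactin_carrier[OF C])
  show "charge ((\<lambda>x. h \<otimes> x) ` C \<union> C) (2 * D) (\<lambda>f. \<mu> (\<lambda>x. f (h \<otimes> x)) - \<mu> f)"
  proof (rule chargeI)
    show "compactin T ((\<lambda>x. h \<otimes> x) ` C \<union> C)"
      by (intro compactin_Un C image_compactin[OF C continuous_translate(1)[OF h]])
    show "(\<lambda>x. h \<otimes> x) ` C \<union> C \<noteq> {}" using charge_nonempty[OF \<mu>] by blast
    show "0 \<le> 2 * D" using D by simp
    fix f assume f: "cont f"
    note fh = cont_left[OF f h]
    show "\<mu> (\<lambda>x. f (h \<otimes> x) + g (h \<otimes> x)) - \<mu> (\<lambda>x. f x + g x) = \<mu> (\<lambda>x. f (h \<otimes> x)) - \<mu> f + (\<mu> (\<lambda>x. g (h \<otimes> x)) - \<mu> g)"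
      if g: "cont g" for g
      using charge_add[OF \<mu> fh cont_left[OF g h]] charge_add[OF \<mu> f g] by simp
    show "\<mu> (\<lambda>x. c * f (h \<otimes> x)) - \<mu> (\<lambda>x. c * f x) = c * (\<mu> (\<lambda>x. f (h \<otimes> x)) - \<mu> f)" for c
      using charge_scale[OF \<mu> fh, of c] charge_scale[OF \<mu> f, of c] by (simp add: right_diff_distrib)
    fix s assume s: "\<And>x. x \<in> (\<lambda>x. h \<otimes> x) ` C \<union> C \<Longrightarrow> \<bar>f x\<bar> \<le> s"
    have "\<bar>\<mu> (\<lambda>x. f (h \<otimes> x))\<bar> \<le> D * s" by (rule charge_bound[OF \<mu> fh]) (use s in blast)
    moreover have "\<bar>\<mu> f\<bar> \<le> D * s" by (rule charge_bound[OF \<mu> f]) (use s in blast)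
    ultimately show "\<bar>\<mu> (\<lambda>x. f (h \<otimes> x)) - \<mu> f\<bar> \<le> 2 * D * s" by linarith
  qed
  show "right_continuous (\<lambda>f. \<mu> (\<lambda>x. f (h \<otimes> x)) - \<mu> f)"
    unfolding right_continuous_def
  proof (intro allI impI)
    fix e :: real assume "e > 0"
    then have "e / 2 > 0" by simp
    then obtain V where V: "openin T V" "\<one> \<in> V"
      "\<And>v f s. v \<in> V \<Longrightarrow> cont f \<Longrightarrow> (\<forall>x\<in>carrier G. \<bar>f x\<bar> \<le> s) \<Longrightarrow> \<bar>\<mu> (\<lambda>x. f (x \<otimes> v)) - \<mu> f\<bar> \<le> e / 2 * s"
      using R unfolding right_continuous_def by meson
    show "\<exists>V. openin T V \<and> \<one> \<in> V \<and> (\<forall>v\<in>V. \<forall>f s. cont f \<longrightarrow> (\<forall>x\<in>carrier G. \<bar>f x\<bar> \<le> s) \<longrightarrow>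
        \<bar>\<mu> (\<lambda>x. f (h \<otimes> x \<otimes> v)) - \<mu> (\<lambda>x. f (x \<otimes> v)) - (\<mu> (\<lambda>x. f (h \<otimes> x)) - \<mu> f)\<bar> \<le> e * s)"
    proof (intro exI[of _ V] conjI ballI allI impI V)
      fix v f s assume v: "v \<in> V" and f: "cont f" and s: "\<forall>x\<in>carrier G. \<bar>f x\<bar> \<le> s"
      have vG: "v \<in> carrier G" using v openin_carrier[OF V(1)] by blast
      note fh = cont_left[OF f h]
      have "\<mu> (\<lambda>x. f (h \<otimes> x \<otimes> v)) = \<mu> (\<lambda>x. f (h \<otimes> (x \<otimes> v)))"
        by (rule charge_cong[OF \<mu> cont_left[OF cont_right[OF f vG] h] cont_right[OF fh vG]])
           (use h vG CG in \<open>auto simp: m_assoc\<close>)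
      moreover have "\<bar>\<mu> (\<lambda>x. f (h \<otimes> (x \<otimes> v))) - \<mu> (\<lambda>x. f (h \<otimes> x))\<bar> \<le> e / 2 * s"
        by (rule V(3)[OF v fh]) (use s h in simp)
      moreover have "\<bar>\<mu> (\<lambda>x. f (x \<otimes> v)) - \<mu> f\<bar> \<le> e / 2 * s" by (rule V(3)[OF v f s])
      moreover have "e / 2 * s + e / 2 * s = e * s" by simp
      ultimately show "\<bar>\<mu> (\<lambda>x. f (h \<otimes> x \<otimes> v)) - \<mu> (\<lambda>x. f (x \<otimes> v)) - (\<mu> (\<lambda>x. f (h \<otimes> x)) - \<mu> f)\<bar> \<le> e * s"
        by linarith
    qed
  qed
qed

context quasi_invariant
begin

text \<open>By tightness the density lives on a compact set \<open>A\<close>, up to a small error. A weight \<open>\<beta>\<close> that is positive on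
  all translates of \<open>A\<close> by a neighbourhood of the identity gives a smoothed measure on the group whose
  image dominates the density; it is then multiplied by an approximate density from the coset space.\<close>

lemma density_lift:
  fixes w :: "'a set \<Rightarrow> real"
  assumes w: "integrable M w" "\<And>C. 0 \<le> w C" "(\<integral>C. w C \<partial>M) = 1" and \<delta>: "\<delta> > 0"
  obtains \<mu> C D where "charge C D \<mu>" "right_continuous \<mu>"
    "\<And>F s. continuous_map X euclideanreal F \<Longrightarrow> (\<And>A. A \<in> topspace X \<Longrightarrow> \<bar>F A\<bar> \<le> s) \<Longrightarrow>
      \<bar>\<mu> (\<lambda>x. F (x <# H)) - (\<integral>A. F A * w A \<partial>M)\<bar> \<le> \<delta> * s"
proof -
  define d where "d = \<delta> / 3"
  have d: "d > 0" "3 * d = \<delta>" using \<delta> by (simp_all add: d_def)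
  have "d / 2 > 0" using d by simp
  then obtain A where A: "compactin X A" "A \<in> sets M" "(\<integral>C. indicator (space M - A) C * w C \<partial>M) \<le> d / 2"
    using density_tight[OF w(1,2)] by metis
  obtain CA where CA: "compactin T CA" "A \<subseteq> (\<lambda>x. x <# H) ` CA" using compact_lift[OF A(1)] .
  have CAG: "CA \<subseteq> carrier G" by (rule compactin_carrier[OF CA(1)])
  obtain I where I: "positive_functional T I"
    "\<And>f t. f \<in> Cc T \<Longrightarrow> t \<in> carrier G \<Longrightarrow> I (\<lambda>x. f (x \<otimes> t)) = I f"
    "\<And>f x. f \<in> Cc T \<Longrightarrow> (\<And>x. x \<in> carrier G \<Longrightarrow> 0 \<le> f x) \<Longrightarrow> x \<in> carrier G \<Longrightarrow> 0 < f x \<Longrightarrow> 0 < I f"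
    using right_Haar_exists by blast
  obtain U N where U: "openin T U" "compactin T N" "\<one> \<in> U" "U \<subseteq> N" using compact_neighbourhood_of_one .
  have NG: "N \<subseteq> carrier G" by (rule compactin_carrier[OF U(2)])
  obtain \<rho> where \<rho>: "\<rho> \<in> Cc T" "\<And>x. x \<in> carrier G \<Longrightarrow> 0 \<le> \<rho> x" "\<rho> \<one> = 1"
    "\<And>x. x \<in> carrier G \<Longrightarrow> x \<notin> U \<Longrightarrow> \<rho> x = 0"
    using bump_at_one[OF U(1,3)] by metis
  have N: "compactin T N" "N \<noteq> {}" "\<And>x. x \<in> carrier G \<Longrightarrow> x \<notin> N \<Longrightarrow> \<rho> x = 0"
    using U \<rho>(4) by auto
  \<comment> \<open>so that \<open>\<beta>\<close> is positive at some point of every coset \<open>g\<^sup>-\<^sup>1 C\<close> with \<open>g\<close> in \<open>N\<close> and \<open>C\<close> in \<open>A\<close>\<close>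
  define Q where "Q = m_inv G ` N <#> CA"
  have Q: "compactin T Q" unfolding Q_def by (intro compactin_set_mult compactin_inverse N CA)
  obtain \<beta> where \<beta>: "\<beta> \<in> Cc T" "\<And>x. x \<in> topspace T \<Longrightarrow> 0 \<le> \<beta> x" "\<And>x. x \<in> Q \<Longrightarrow> \<beta> x = 1"
    using bump_function[OF locally_compact hausdorff Q, of "topspace T"] compactin_subset_topspace[OF Q]
    by (metis openin_topspace)
  have \<beta>0: "\<And>x. x \<in> carrier G \<Longrightarrow> 0 \<le> \<beta> x" using \<beta>(2) by (simp add: topspace_eq)
  have flat_A: "0 < flat \<beta> (inv g <# C)" if g: "g \<in> N" and C: "C \<in> A" for g C
  proof -
    obtain x where x: "x \<in> CA" "C = x <# H" using CA(2) C by blast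
    have G: "g \<in> carrier G" "x \<in> carrier G" using g x(1) NG CAG by auto
    have "inv g \<otimes> x \<in> Q" using g x(1) unfolding Q_def set_mult_def by blast
    then have "0 < flat \<beta> ((inv g \<otimes> x) <# H)" using G by (intro flat_pos[OF \<beta>(1) \<beta>0]) (auto simp: \<beta>(3))
    then show ?thesis using coset_action[of "inv g" x] G x(2) by simp
  qed
  obtain L where L: "compactin T L" "L \<noteq> {}" "\<And>x. x \<in> carrier G \<Longrightarrow> x \<notin> L \<Longrightarrow> \<beta> x = 0"
    using Cc_support_nonempty[OF \<beta>(1)] by metis
  note \<kappa> = charge_weighted[OF \<beta>(1) \<beta>0 L]
  define \<sigma> where "\<sigma> = smoothing I \<rho> (weighted \<beta>)"
  have \<sigma>: "charge (N <#> L) (I \<rho> * (\<integral>C. flat \<beta> C \<partial>M)) \<sigma>"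
    unfolding \<sigma>_def by (rule charge_smoothing[OF I(1) \<kappa> \<rho>(1,2) N])
  have \<sigma>R: "right_continuous \<sigma>"
    unfolding \<sigma>_def by (rule right_continuous_smoothing[OF I(1) \<kappa> \<rho>(1,2) N I(2)])
  define \<nu> where "\<nu> F = \<sigma> (\<lambda>x. F (x <# H))" for F
  define \<theta> where "\<theta> F = (\<integral>C. F C * w C \<partial>M)" for F
  have lift: "cont (\<lambda>x. F (x <# H))" if "F \<in> Cb X" for F
    using Cb_continuous[OF that] continuous_on_X by blast
  have \<nu>: "positive_form X \<nu>"
    unfolding positive_form_def
  proof (intro conjI ballI allI impI)
    show "\<nu> (\<lambda>x. f x + g x) = \<nu> f + \<nu> g" if "f \<in> Cb X" "g \<in> Cb X" for f g
      unfolding \<nu>_def using charge_add[OF \<sigma> lift[OF that(1)] lift[OF that(2)]] .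
    show "\<nu> (\<lambda>x. c * f x) = c * \<nu> f" if "f \<in> Cb X" for c f
      unfolding \<nu>_def using charge_scale[OF \<sigma> lift[OF that]] .
    fix f assume f: "f \<in> Cb X" and f0: "\<forall>C\<in>topspace X. 0 \<le> f C"
    have wn: "0 \<le> weighted \<beta> (\<lambda>y. f ((g \<otimes> y) <# H))" if g: "g \<in> carrier G" for g
      using f0 g coset_in_X by (intro weighted_nonneg[OF \<beta>(1) \<beta>0 cont_left[OF lift[OF f] g]]) auto
    show "0 \<le> \<nu> f"
      unfolding \<nu>_def \<sigma>_def smoothing_def
      by (intro pf_nonneg[OF I(1) smoothing_integrand[OF I(1) \<kappa> \<rho>(1,2) N lift[OF f]]])
         (auto simp: topspace_eq intro!: mult_nonneg_nonneg \<rho>(2) wn)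
  qed
  have \<theta>i: "integrable M (\<lambda>C. f C * w C)" if f: "f \<in> Cb X" for f
  proof -
    obtain B where "\<And>C. C \<in> topspace X \<Longrightarrow> \<bar>f C\<bar> \<le> B" using f by (auto simp: Cb_def)
    then show ?thesis
      by (intro bounded_mult_integrable[OF w(1) continuous_measurable[OF Cb_continuous[OF f]]]) (simp add: space_M)
  qed
  have \<theta>: "positive_form X \<theta>"
    unfolding positive_form_def
  proof (intro conjI ballI allI impI)
    show "\<theta> (\<lambda>x. f x + g x) = \<theta> f + \<theta> g" if "f \<in> Cb X" "g \<in> Cb X" for f g
      unfolding \<theta>_def using \<theta>i[OF that(1)] \<theta>i[OF that(2)] by (simp add: distrib_right)
    show "\<theta> (\<lambda>x. c * f x) = c * \<theta> f" if "f \<in> Cb X" for c f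
      unfolding \<theta>_def by (simp add: mult.assoc)
    show "0 \<le> \<theta> f" if "f \<in> Cb X" "\<forall>C\<in>topspace X. 0 \<le> f C" for f
      unfolding \<theta>_def using that(2) w(2) by (intro integral_nonneg_AE AE_I2) (simp add: space_M)
  qed
  have "\<exists>n>0. \<forall>F\<in>Cb X. (\<forall>C\<in>topspace X. 0 \<le> F C \<and> F C \<le> 1) \<longrightarrow>
    (\<integral>C. F C * w C \<partial>M) \<le> n * smoothing I \<rho> (weighted \<beta>) (\<lambda>x. F (x <# H)) + d"
    by (rule absolutely_continuous[OF I(1,3) \<rho>(1-3) N \<beta>(1) \<beta>0 A(2) flat_A w(1,2) d(1) A(3)])
  then obtain n where n: "n > 0"
    "\<And>F. F \<in> Cb X \<Longrightarrow> (\<And>C. C \<in> topspace X \<Longrightarrow> 0 \<le> F C \<and> F C \<le> 1) \<Longrightarrow> \<theta> F \<le> n * \<nu> F + d"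
    unfolding \<theta>_def \<nu>_def \<sigma>_def by blast
  have "\<theta> (\<lambda>_. 1) \<le> 1" using w(3) by (simp add: \<theta>_def)
  then obtain c where c: "c \<in> Cb X"
    "\<And>f. f \<in> Cb X \<Longrightarrow> (\<And>x. x \<in> topspace X \<Longrightarrow> \<bar>f x\<bar> \<le> 1) \<Longrightarrow> \<bar>\<theta> f - \<nu> (\<lambda>x. c x * f x)\<bar> \<le> 3 * d"
    using density_approximation[OF \<theta> \<nu> _ n(1) d(1) n(2)] by metis
  obtain B where B: "\<And>C. C \<in> topspace X \<Longrightarrow> \<bar>c C\<bar> \<le> B" using c(1) by (auto simp: Cb_def)
  have cB: "\<bar>c (x <# H)\<bar> \<le> B" if "x \<in> carrier G" for x using B coset_in_X[OF that] by blast
  define \<mu> where "\<mu> f = \<sigma> (\<lambda>x. c (x <# H) * f x)" for f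
  have \<mu>: "charge (N <#> L) (I \<rho> * (\<integral>C. flat \<beta> C \<partial>M) * B) \<mu>"
    unfolding \<mu>_def by (rule charge_mult[OF \<sigma> lift[OF c(1)] cB])
  show thesis
  proof (rule that[OF \<mu>])
    show "right_continuous \<mu>"
      unfolding \<mu>_def by (rule right_continuous_mult[OF \<sigma> \<sigma>R lift[OF c(1)] cB])
    fix F s assume Fc: "continuous_map X euclideanreal F" and Fs: "\<And>A. A \<in> topspace X \<Longrightarrow> \<bar>F A\<bar> \<le> s"
    have F: "F \<in> Cb X" by (rule CbI[OF Fc Fs])
    have "0 \<le> s" using Fs[OF coset_in_X[OF one_closed]] by linarith
    have \<mu>F: "\<mu> (\<lambda>x. F (x <# H)) = \<nu> (\<lambda>x. c x * F x)" by (simp add: \<mu>_def \<nu>_def)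
    show "\<bar>\<mu> (\<lambda>x. F (x <# H)) - (\<integral>A. F A * w A \<partial>M)\<bar> \<le> \<delta> * s"
    proof (cases "s = 0")
      case True
      have zero: "F A = 0" if "A \<in> topspace X" for A using Fs[OF that] True by simp
      have "\<bar>\<mu> (\<lambda>x. F (x <# H))\<bar> \<le> I \<rho> * (\<integral>C. flat \<beta> C \<partial>M) * B * 0"
        using zero coset_in_X compactin_carrier[OF charge_compact[OF \<mu>]]
        by (intro charge_bound[OF \<mu> lift[OF F]]) auto
      moreover have "(\<integral>A. F A * w A \<partial>M) = (\<integral>A. 0 \<partial>M)"
        by (intro Bochner_Integration.integral_cong refl) (simp add: zero space_M)
      ultimately show ?thesis using True by simp
    next
      case False
      then have s: "s > 0" using \<open>0 \<le> s\<close> by simp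
      have "\<bar>\<theta> (\<lambda>x. inverse s * F x) - \<nu> (\<lambda>x. c x * (inverse s * F x))\<bar> \<le> 3 * d"
      proof (rule c(2)[OF Cb_scale[OF F]])
        show "\<bar>inverse s * F x\<bar> \<le> 1" if "x \<in> topspace X" for x
          using Fs[OF that] s by (simp add: abs_mult field_simps)
      qed
      moreover have "\<theta> (\<lambda>x. inverse s * F x) = inverse s * \<theta> F" by (rule form_scale[OF \<theta> F])
      moreover have "\<nu> (\<lambda>x. c x * (inverse s * F x)) = inverse s * \<nu> (\<lambda>x. c x * F x)"
        using form_scale[OF \<nu> Cb_mult[OF c(1) F], of "inverse s"] by (simp add: mult.left_commute)
      ultimately have "inverse s * \<bar>\<theta> F - \<nu> (\<lambda>x. c x * F x)\<bar> \<le> \<delta>"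
        using s d(2) by (simp add: abs_mult flip: right_diff_distrib)
      then have "\<bar>\<theta> F - \<nu> (\<lambda>x. c x * F x)\<bar> \<le> \<delta> * s" using s by (simp add: field_simps)
      then show ?thesis unfolding \<mu>F \<theta>_def by (simp add: abs_minus_commute)
    qed
  qed
qed

lemma almost_invariant_density_bounded:
  assumes g: "g \<in> carrier G" and v: "square_integrable M v" "l2_norm M v = 1"
    and e: "l2_norm M (\<lambda>x. quasi_regular G M g v x - v x) < e"
    and F: "continuous_map X euclideanreal F" "\<And>C. C \<in> topspace X \<Longrightarrow> \<bar>F C\<bar> \<le> s"
  shows "\<bar>(\<integral>C. F (g <# C) * (cmod (v C))\<^sup>2 \<partial>M) - (\<integral>C. F C * (cmod (v C))\<^sup>2 \<partial>M)\<bar> \<le> 5 * e * s"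
proof (cases "s = 0")
  case True
  have z: "F C = 0" "F (g <# C) = 0" if "C \<in> space M" for C
    using F(2) that continuous_map_funspace[OF continuous_action[OF g]] True by (auto simp: space_M)
  have "(\<integral>C. F (g <# C) * (cmod (v C))\<^sup>2 \<partial>M) = (\<integral>C. 0 \<partial>M)" "(\<integral>C. F C * (cmod (v C))\<^sup>2 \<partial>M) = (\<integral>C. 0 \<partial>M)"
    by (intro Bochner_Integration.integral_cong refl; simp add: z)+
  then show ?thesis using True by simp
next
  case False
  moreover have "0 \<le> s" using F(2)[OF coset_in_X[OF one_closed]] by linarith
  ultimately have s: "s > 0" by simp
  define F' where "F' C = inverse s * F C" for C
  have "\<bar>(\<integral>C. F' (g <# C) * (cmod (v C))\<^sup>2 \<partial>M) - (\<integral>C. F' C * (cmod (v C))\<^sup>2 \<partial>M)\<bar> \<le> 5 * e"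
  proof (rule almost_invariant_density[OF g v e])
    show "F' \<in> borel_measurable M"
      unfolding F'_def by (intro continuous_measurable continuous_map_real_mult_left F(1))
    show "\<bar>F' C\<bar> \<le> 1" if "C \<in> space M" for C
      using F(2)[of C] that s by (simp add: F'_def abs_mult space_M field_simps)
  qed
  then have "inverse s * \<bar>(\<integral>C. F (g <# C) * (cmod (v C))\<^sup>2 \<partial>M) - (\<integral>C. F C * (cmod (v C))\<^sup>2 \<partial>M)\<bar> \<le> 5 * e"
    using s by (simp add: F'_def mult.assoc abs_mult flip: right_diff_distrib)
  then show ?thesis using s by (simp add: field_simps)
qed

definition almost_invariant_mean :: "'a set \<Rightarrow> real \<Rightarrow> (('a \<Rightarrow> real) \<Rightarrow> real) \<Rightarrow> bool" where
  "almost_invariant_mean Q \<delta> n \<longleftrightarrow>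
     (\<forall>f\<in>Cb S. \<forall>g\<in>Cb S. n (\<lambda>x. f x + g x) = n f + n g) \<and>
     (\<forall>c. \<forall>f\<in>Cb S. n (\<lambda>x. c * f x) = c * n f) \<and>
     (\<forall>f\<in>Cb S. \<forall>s. (\<forall>h\<in>H. \<bar>f h\<bar> \<le> s) \<longrightarrow> \<bar>n f\<bar> \<le> (1 + \<delta>) * s) \<and>
     \<bar>n (\<lambda>_. 1) - 1\<bar> \<le> \<delta> \<and>
     (\<forall>f\<in>Cb S. \<forall>s. \<forall>h\<in>Q. (\<forall>h\<in>H. \<bar>f h\<bar> \<le> s) \<longrightarrow> \<bar>n (\<lambda>x. f (h \<otimes> x)) - n f\<bar> \<le> \<delta> * s)"

text \<open>The extension to \<open>G\<close> of a function on \<open>H\<close> is averaged on the left with a charge \<open>\<mu>\<close> lifted from the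
  density of an almost invariant vector, and on the right with the mean on \<open>UC\<close>. A translation by \<open>h\<close> of
  the function becomes the charge \<open>h \<mu> - \<mu>\<close>, whose image on the coset space is small.\<close>

lemma almost_invariant_mean_exists:
  assumes m: "mean_on UC (carrier G) m" "\<And>f h. f \<in> UC \<Longrightarrow> h \<in> H \<Longrightarrow> m (\<lambda>x. f (h \<otimes> x)) = m f"
    and weak: "weakly_contains_trivial S M (quasi_regular G M)"
    and Q: "finite Q" "Q \<subseteq> H" and \<delta>: "\<delta> > 0"
  shows "\<exists>n. almost_invariant_mean Q \<delta> n"
proof -
  obtain E :: "('a \<Rightarrow> real) \<Rightarrow> 'a \<Rightarrow> real" where E: "\<And>f. f \<in> Cb S \<Longrightarrow> E f \<in> Cb T"
    "\<And>f s x. f \<in> Cb S \<Longrightarrow> (\<And>h. h \<in> H \<Longrightarrow> \<bar>f h\<bar> \<le> s) \<Longrightarrow> x \<in> carrier G \<Longrightarrow> \<bar>E f x\<bar> \<le> s"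
    "\<And>f g x. f \<in> Cb S \<Longrightarrow> g \<in> Cb S \<Longrightarrow> x \<in> carrier G \<Longrightarrow> E (\<lambda>h. f h + g h) x = E f x + E g x"
    "\<And>c f x. f \<in> Cb S \<Longrightarrow> x \<in> carrier G \<Longrightarrow> E (\<lambda>h. c * f h) x = c * E f x"
    "\<And>x. x \<in> carrier G \<Longrightarrow> E (\<lambda>_. 1) x = 1"
    "\<And>f t x. f \<in> Cb S \<Longrightarrow> t \<in> H \<Longrightarrow> x \<in> carrier G \<Longrightarrow> E (\<lambda>h. f (t \<otimes> h)) x = E f (t \<otimes> x)"
    using equivariant_extension by blast
  have "compactin S Q" using Q HG by (intro finite_imp_compactin) (auto simp: topspace_eq)
  \<comment> \<open>\<open>almost_invariant_density\<close> loses a factor 5\<close>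
  moreover have "\<delta> / 10 > 0" using \<delta> by simp
  ultimately obtain v where v: "square_integrable M v" "l2_norm M v = 1"
    "\<And>h. h \<in> Q \<Longrightarrow> l2_norm M (\<lambda>x. quasi_regular G M h v x - v x) < \<delta> / 10"
    using weak unfolding weakly_contains_trivial_def by blast
  define w where "w C = (cmod (v C))\<^sup>2" for C
  have w: "integrable M w" "\<And>C. 0 \<le> w C" "(\<integral>C. w C \<partial>M) = 1"
    using v(1,2) by (auto simp: square_integrable_def w_def[abs_def] l2_norm_def)
  have \<delta>4: "\<delta> / 4 > 0" using \<delta> by simp
  obtain \<mu> C D where \<mu>: "charge C D \<mu>" "right_continuous \<mu>"
    "\<And>F s. continuous_map X euclideanreal F \<Longrightarrow> (\<And>A. A \<in> topspace X \<Longrightarrow> \<bar>F A\<bar> \<le> s) \<Longrightarrow>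
      \<bar>\<mu> (\<lambda>x. F (x <# H)) - (\<integral>A. F A * w A \<partial>M)\<bar> \<le> \<delta> / 4 * s"
    by (rule density_lift[OF w \<delta>4], erule (1) that, blast)
  have CG: "C \<subseteq> carrier G" by (rule compactin_carrier[OF charge_compact[OF \<mu>(1)]])
  define \<Phi> where "\<Phi> k = m (\<lambda>g. \<mu> (\<lambda>x. k (x \<otimes> g)))" for k
  have UC: "(\<lambda>g. \<mu> (\<lambda>x. k (x \<otimes> g))) \<in> UC" if k: "k \<in> Cb T" for k
  proof -
    obtain s where "\<And>x. x \<in> carrier G \<Longrightarrow> \<bar>k x\<bar> \<le> s" using k by (auto simp: Cb_def topspace_eq)
    then show ?thesis by (rule charge_convolution_UC[OF \<mu>(1,2) Cb_continuous[OF k]])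
  qed
  have m_cong: "m f = m g" if "f \<in> UC" "g \<in> UC" "\<And>x. x \<in> carrier G \<Longrightarrow> f x = g x" for f g
    by (rule mean_on_cong[OF m(1) that(1,2) UC_scale[OF that(2)] UC_add[OF that(1) UC_scale[OF that(2)]] that(3)])
  have \<Phi>_eq: "\<Phi> k = m p" if k: "k \<in> Cb T" and p: "p \<in> UC" and "\<And>g. g \<in> carrier G \<Longrightarrow> \<mu> (\<lambda>x. k (x \<otimes> g)) = p g" for k p
    unfolding \<Phi>_def by (rule m_cong[OF UC[OF k] p that(3)])
  have kg: "cont (\<lambda>x. k (x \<otimes> g))" if "k \<in> Cb T" "g \<in> carrier G" for k g
    by (rule cont_right[OF Cb_continuous[OF that(1)] that(2)])
  define n where "n f = \<Phi> (E f)" for f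
  have "almost_invariant_mean Q \<delta> n"
    unfolding almost_invariant_mean_def
  proof (intro conjI ballI allI impI)
    fix f assume f: "f \<in> Cb S"
    show "n (\<lambda>x. f x + g x) = n f + n g" if g: "g \<in> Cb S" for g
    proof -
      have "n (\<lambda>x. f x + g x) = m (\<lambda>t. \<mu> (\<lambda>x. E f (x \<otimes> t)) + \<mu> (\<lambda>x. E g (x \<otimes> t)))"
        unfolding n_def
      proof (rule \<Phi>_eq[OF E(1)[OF Cb_add[OF f g]] UC_add[OF UC[OF E(1)[OF f]] UC[OF E(1)[OF g]]]])
        fix t assume t: "t \<in> carrier G"
        note Ef = kg[OF E(1)[OF f] t] and Eg = kg[OF E(1)[OF g] t]
        have "\<mu> (\<lambda>x. E (\<lambda>x. f x + g x) (x \<otimes> t)) = \<mu> (\<lambda>x. E f (x \<otimes> t) + E g (x \<otimes> t))"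
          by (rule charge_cong[OF \<mu>(1) kg[OF E(1)[OF Cb_add[OF f g]] t] continuous_map_add[OF Ef Eg]])
             (use E(3)[OF f g] CG t in auto)
        then show "\<mu> (\<lambda>x. E (\<lambda>x. f x + g x) (x \<otimes> t)) = \<mu> (\<lambda>x. E f (x \<otimes> t)) + \<mu> (\<lambda>x. E g (x \<otimes> t))"
          using charge_add[OF \<mu>(1) Ef Eg] by simp
      qed
      then show ?thesis
        unfolding n_def \<Phi>_def using mean_on_add[OF m(1) UC[OF E(1)[OF f]] UC[OF E(1)[OF g]]] by simp
    qed
    show "n (\<lambda>x. c * f x) = c * n f" for c
    proof -
      have "n (\<lambda>x. c * f x) = m (\<lambda>t. c * \<mu> (\<lambda>x. E f (x \<otimes> t)))"
        unfolding n_def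
      proof (rule \<Phi>_eq[OF E(1)[OF Cb_scale[OF f]] UC_scale[OF UC[OF E(1)[OF f]]]])
        fix t assume t: "t \<in> carrier G"
        note Ef = kg[OF E(1)[OF f] t]
        have "\<mu> (\<lambda>x. E (\<lambda>x. c * f x) (x \<otimes> t)) = \<mu> (\<lambda>x. c * E f (x \<otimes> t))"
          by (rule charge_cong[OF \<mu>(1) kg[OF E(1)[OF Cb_scale[OF f]] t] continuous_map_real_mult_left[OF Ef]])
             (use E(4)[OF f] CG t in auto)
        then show "\<mu> (\<lambda>x. E (\<lambda>x. c * f x) (x \<otimes> t)) = c * \<mu> (\<lambda>x. E f (x \<otimes> t))"
          using charge_scale[OF \<mu>(1) Ef] by simp
      qed
      then show ?thesis
        unfolding n_def \<Phi>_def using mean_on_scale[OF m(1) UC[OF E(1)[OF f]]] by simp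
    qed
    fix s assume s: "\<forall>h\<in>H. \<bar>f h\<bar> \<le> s"
    have s0: "0 \<le> s" using bspec[OF s H_closed(3)] by linarith
    have Es: "\<bar>E f x\<bar> \<le> s" if "x \<in> carrier G" for x using E(2)[OF f _ that] s by blast
    show "\<bar>n f\<bar> \<le> (1 + \<delta>) * s"
      unfolding n_def \<Phi>_def
    proof (rule mean_through_cosets[OF m \<mu>(1,2) Cb_continuous[OF E(1)[OF f]] Es])
      fix F t assume F: "continuous_map X euclideanreal F" and t: "\<And>A. A \<in> topspace X \<Longrightarrow> \<bar>F A\<bar> \<le> t"
      have t0: "0 \<le> t" using t[OF coset_in_X[OF one_closed]] by linarith
      have Fw: "integrable M (\<lambda>C. F C * w C)"
        using t by (intro bounded_mult_integrable[OF w(1) continuous_measurable[OF F], where B=t]) (simp add: space_M)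
      have "\<bar>(\<integral>A. F A * w A \<partial>M)\<bar> \<le> (\<integral>A. \<bar>F A * w A\<bar> \<partial>M)" by (rule integral_abs_bound)
      also have "\<dots> \<le> (\<integral>A. t * w A \<partial>M)"
      proof (rule integral_mono)
        show "\<bar>F A * w A\<bar> \<le> t * w A" if "A \<in> space M" for A
          using mult_right_mono[OF t w(2)] that w(2) by (simp add: abs_mult space_M)
      qed (use Fw w(1) in auto)
      also have "\<dots> = t" using w(3) by simp
      finally have "\<bar>\<mu> (\<lambda>x. F (x <# H))\<bar> \<le> t + \<delta> / 4 * t" using \<mu>(3)[OF F t] by linarith
      also have "\<dots> \<le> (1 + \<delta>) * t" using t0 \<delta> by (simp add: algebra_simps)
      finally show "\<bar>\<mu> (\<lambda>x. F (x <# H))\<bar> \<le> (1 + \<delta>) * t" .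
    qed
    fix h assume h: "h \<in> Q"
    have hH: "h \<in> H" and hG: "h \<in> carrier G" using h Q(2) HG by auto
    define \<nu> where "\<nu> f = \<mu> (\<lambda>x. f (h \<otimes> x)) - \<mu> f" for f
    have \<nu>: "charge ((\<lambda>x. h \<otimes> x) ` C \<union> C) (2 * D) \<nu>" "right_continuous \<nu>"
      unfolding \<nu>_def by (rule charge_translate_difference[OF \<mu>(1,2) hG])+
    have \<nu>UC: "(\<lambda>g. \<nu> (\<lambda>x. E f (x \<otimes> g))) \<in> UC"
      by (rule charge_convolution_UC[OF \<nu> Cb_continuous[OF E(1)[OF f]] Es])
    have fh: "(\<lambda>x. f (h \<otimes> x)) \<in> Cb S" using K.Cb_left_translate[OF f] hH by simp
    have "n (\<lambda>x. f (h \<otimes> x)) = m (\<lambda>g. \<nu> (\<lambda>x. E f (x \<otimes> g)) + \<mu> (\<lambda>x. E f (x \<otimes> g)))"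
      unfolding n_def
    proof (rule \<Phi>_eq[OF E(1)[OF fh] UC_add[OF \<nu>UC UC[OF E(1)[OF f]]]])
      fix t assume t: "t \<in> carrier G"
      have "\<mu> (\<lambda>x. E (\<lambda>x. f (h \<otimes> x)) (x \<otimes> t)) = \<mu> (\<lambda>x. E f (h \<otimes> x \<otimes> t))"
        by (rule charge_cong[OF \<mu>(1) kg[OF E(1)[OF fh] t] cont_left[OF kg[OF E(1)[OF f] t] hG]])
           (use E(6)[OF f hH] CG hG t in \<open>auto simp: m_assoc\<close>)
      then show "\<mu> (\<lambda>x. E (\<lambda>x. f (h \<otimes> x)) (x \<otimes> t)) = \<nu> (\<lambda>x. E f (x \<otimes> t)) + \<mu> (\<lambda>x. E f (x \<otimes> t))"
        by (simp add: \<nu>_def)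
    qed
    then have "n (\<lambda>x. f (h \<otimes> x)) - n f = m (\<lambda>g. \<nu> (\<lambda>x. E f (x \<otimes> g)))"
      unfolding n_def \<Phi>_def using mean_on_add[OF m(1) \<nu>UC UC[OF E(1)[OF f]]] by simp
    moreover have "\<bar>m (\<lambda>g. \<nu> (\<lambda>x. E f (x \<otimes> g)))\<bar> \<le> \<delta> * s"
    \<comment> \<open>the error is \<delta>/4 for each of the two lifted densities and \<delta>/2 for the almost invariance of \<open>v\<close>\<close>
    proof (rule mean_through_cosets[OF m \<nu> Cb_continuous[OF E(1)[OF f]] Es])
      fix F t assume F: "continuous_map X euclideanreal F" and t: "\<And>A. A \<in> topspace X \<Longrightarrow> \<bar>F A\<bar> \<le> t"
      have Fx: "cont (\<lambda>x. F (x <# H))" using F continuous_on_X by blast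
      have Fh: "continuous_map X euclideanreal (\<lambda>A. F (h <# A))"
        using continuous_map_compose[OF continuous_action[OF hG] F] by (simp add: o_def)
      have th: "\<bar>F (h <# A)\<bar> \<le> t" if "A \<in> topspace X" for A
        using t continuous_map_funspace[OF continuous_action[OF hG]] that by blast
      have "\<mu> (\<lambda>x. F ((h \<otimes> x) <# H)) = \<mu> (\<lambda>x. F (h <# (x <# H)))"
        using CG hG coset_action
        by (intro charge_cong[OF \<mu>(1) cont_left[OF Fx hG] Fh[unfolded continuous_on_X]]) auto
      moreover have "\<bar>\<mu> (\<lambda>x. F (h <# (x <# H))) - (\<integral>A. F (h <# A) * w A \<partial>M)\<bar> \<le> \<delta> / 4 * t"
        by (rule \<mu>(3)[OF Fh th])
      moreover have "\<bar>(\<integral>A. F (h <# A) * w A \<partial>M) - (\<integral>A. F A * w A \<partial>M)\<bar> \<le> 5 * (\<delta> / 10) * t"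
        unfolding w_def by (rule almost_invariant_density_bounded[OF hG v(1,2) v(3)[OF h] F t])
      moreover have "\<bar>\<mu> (\<lambda>x. F (x <# H)) - (\<integral>A. F A * w A \<partial>M)\<bar> \<le> \<delta> / 4 * t" by (rule \<mu>(3)[OF F t])
      moreover have "\<delta> / 4 * t + 5 * (\<delta> / 10) * t + \<delta> / 4 * t = \<delta> * t" by simp
      ultimately show "\<bar>\<nu> (\<lambda>x. F (x <# H))\<bar> \<le> \<delta> * t" unfolding \<nu>_def by linarith
    qed
    ultimately show "\<bar>n (\<lambda>x. f (h \<otimes> x)) - n f\<bar> \<le> \<delta> * s" by simp
  next
    have one: "(\<lambda>_. 1) \<in> Cb S" by (rule Cb_const)
    have "n (\<lambda>_. 1) = m (\<lambda>g. \<mu> (\<lambda>_. 1) * 1)"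
      unfolding n_def
    proof (rule \<Phi>_eq[OF E(1)[OF one] UC_const])
      fix g assume g: "g \<in> carrier G"
      have "\<mu> (\<lambda>x. E (\<lambda>_. 1) (x \<otimes> g)) = \<mu> (\<lambda>_. 1)"
        by (rule charge_cong[OF \<mu>(1) kg[OF E(1)[OF one] g]]) (use E(5) CG g in auto)
      then show "\<mu> (\<lambda>x. E (\<lambda>_. 1) (x \<otimes> g)) = \<mu> (\<lambda>_. 1) * 1" by simp
    qed
    also have "\<dots> = \<mu> (\<lambda>_. 1)" using mean_on_scale[OF m(1) UC_const, of "\<mu> (\<lambda>_. 1)" 1] mean_on_one[OF m(1)] by simp
    finally show "\<bar>n (\<lambda>_. 1) - 1\<bar> \<le> \<delta>" using \<mu>(3)[of "\<lambda>_. 1" 1] w(3) \<delta> by simp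
  qed
  then show ?thesis by blast
qed

text \<open>A cluster point of the almost invariant means, as \<open>Q\<close> grows and \<open>\<delta>\<close> tends to 0.\<close>

lemma invariant_mean_exists:
  assumes m: "mean_on UC (carrier G) m" "\<And>f h. f \<in> UC \<Longrightarrow> h \<in> H \<Longrightarrow> m (\<lambda>x. f (h \<otimes> x)) = m f"
    and weak: "weakly_contains_trivial S M (quasi_regular G M)"
  obtains n where "mean_on (Cb S) H n" "\<And>f h. f \<in> Cb S \<Longrightarrow> h \<in> H \<Longrightarrow> n (\<lambda>x. f (h \<otimes> x)) = n f"
proof -
  define A where "A Q \<delta> = {n. almost_invariant_mean Q \<delta> n \<and> (\<forall>f. f \<notin> Cb S \<longrightarrow> n f = 0)}" for Q \<delta>
  define \<A> where "\<A> = {A Q \<delta> |Q \<delta>. finite Q \<and> Q \<subseteq> H \<and> 0 < \<delta> \<and> \<delta> \<le> 1}"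
  \<comment> \<open>any bound of \<open>f\<close> will do; functionals are set to 0 outside \<open>Cb S\<close>\<close>
  define B where "B f = (if f \<in> Cb S then 2 * (SOME s. \<forall>h\<in>H. \<bar>f h\<bar> \<le> s) else 0)" for f :: "'a \<Rightarrow> real"
  have bound: "\<bar>p f\<bar> \<le> B f" if K: "K \<in> \<A>" and p: "p \<in> K" for K p f
  proof (cases "f \<in> Cb S")
    case True
    obtain Q \<delta> where Q: "K = A Q \<delta>" "\<delta> \<le> 1" using K by (auto simp: \<A>_def)
    define s where "s = (SOME s. \<forall>h\<in>H. \<bar>f h\<bar> \<le> s)"
    have s: "\<forall>h\<in>H. \<bar>f h\<bar> \<le> s" unfolding s_def by (rule someI_ex[OF Cb_S_bounded[OF True]])
    have "0 \<le> s" using bspec[OF s H_closed(3)] by linarith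
    moreover have "\<bar>p f\<bar> \<le> (1 + \<delta>) * s" using p True s unfolding Q A_def almost_invariant_mean_def by blast
    moreover have "(1 + \<delta>) * s \<le> 2 * s" using Q(2) \<open>0 \<le> s\<close> by (intro mult_right_mono) auto
    ultimately show ?thesis using True by (simp add: B_def s_def)
  next
    case False
    then show ?thesis using K p by (auto simp: \<A>_def A_def B_def)
  qed
  have congS: "almost_invariant_mean Q \<delta> (\<lambda>f. if f \<in> Cb S then n f else 0)"
    if n: "almost_invariant_mean Q \<delta> n" and Q: "Q \<subseteq> H" for Q \<delta> n
  proof -
    have "(\<lambda>x. f (h \<otimes> x)) \<in> Cb S" if "f \<in> Cb S" "h \<in> Q" for f h
      using K.Cb_left_translate[OF that(1), of h] that(2) Q by auto
    then show ?thesis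
      using n unfolding almost_invariant_mean_def by (simp add: Cb_add Cb_scale Cb_const)
  qed
  have ne: "K \<noteq> {}" if K: "K \<in> \<A>" for K
  proof -
    obtain Q \<delta> where Q: "K = A Q \<delta>" "finite Q" "Q \<subseteq> H" "0 < \<delta>" using K by (auto simp: \<A>_def)
    obtain n where "almost_invariant_mean Q \<delta> n" using almost_invariant_mean_exists[OF m weak Q(2,3,4)] by blast
    from congS[OF this Q(3)] have "(\<lambda>f. if f \<in> Cb S then n f else 0) \<in> K" by (simp add: Q(1) A_def)
    then show ?thesis by blast
  qed
  have in\<A>: "A Q \<delta> \<in> \<A>" if "finite Q" "Q \<subseteq> H" "0 < \<delta>" "\<delta> \<le> 1" for Q \<delta>
    using that by (auto simp: \<A>_def)
  have mono: "almost_invariant_mean Q \<delta> n" if n: "almost_invariant_mean Q' \<delta>' n" and Q: "Q \<subseteq> Q'" and \<delta>: "\<delta>' \<le> \<delta>" for Q Q' \<delta> \<delta>' n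
  proof -
    have le: "x \<le> \<delta>' * s \<Longrightarrow> x \<le> \<delta> * s" "x \<le> (1 + \<delta>') * s \<Longrightarrow> x \<le> (1 + \<delta>) * s"
      if s: "\<forall>h\<in>H. \<bar>f h\<bar> \<le> s" for x s and f :: "'a \<Rightarrow> real"
    proof -
      have "0 \<le> s" using bspec[OF s H_closed(3)] by linarith
      then have "\<delta>' * s \<le> \<delta> * s" using \<delta> by (rule mult_right_mono[rotated])
      then show "x \<le> \<delta>' * s \<Longrightarrow> x \<le> \<delta> * s" "x \<le> (1 + \<delta>') * s \<Longrightarrow> x \<le> (1 + \<delta>) * s"
        by (simp_all add: distrib_right)
    qed
    show ?thesis
      unfolding almost_invariant_mean_def
    proof (intro conjI ballI allI impI)
      show "\<bar>n (\<lambda>_. 1) - 1\<bar> \<le> \<delta>" using n \<delta> unfolding almost_invariant_mean_def by linarith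
      show "\<bar>n f\<bar> \<le> (1 + \<delta>) * s" if "f \<in> Cb S" "\<forall>h\<in>H. \<bar>f h\<bar> \<le> s" for f s
        by (rule le(2)[OF that(2)]) (use n that in \<open>simp add: almost_invariant_mean_def\<close>)
      show "\<bar>n (\<lambda>x. f (h \<otimes> x)) - n f\<bar> \<le> \<delta> * s" if "f \<in> Cb S" "h \<in> Q" "\<forall>h\<in>H. \<bar>f h\<bar> \<le> s" for f s h
      proof (rule le(1)[OF that(3)])
        have "h \<in> Q'" using that(2) Q by blast
        then show "\<bar>n (\<lambda>x. f (h \<otimes> x)) - n f\<bar> \<le> \<delta>' * s" using n that(1,3) unfolding almost_invariant_mean_def by blast
      qed
    qed (use n in \<open>simp_all add: almost_invariant_mean_def\<close>)
  qed
  have dir: "\<exists>K''\<in>\<A>. K'' \<subseteq> K \<inter> K'" if K: "K \<in> \<A>" and K': "K' \<in> \<A>" for K K'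
  proof -
    obtain Q \<delta> where Q: "K = A Q \<delta>" "finite Q" "Q \<subseteq> H" "0 < \<delta>" "\<delta> \<le> 1" using K by (auto simp: \<A>_def)
    obtain Q' \<delta>' where Q': "K' = A Q' \<delta>'" "finite Q'" "Q' \<subseteq> H" "0 < \<delta>'" "\<delta>' \<le> 1" using K' by (auto simp: \<A>_def)
    show ?thesis
    proof (rule bexI[of _ "A (Q \<union> Q') (min \<delta> \<delta>')"])
      show "A (Q \<union> Q') (min \<delta> \<delta>') \<subseteq> K \<inter> K'"
        unfolding Q(1) Q'(1) A_def by (auto elim!: mono)
    qed (use Q Q' in \<open>intro in\<A>, auto\<close>)
  qed
  have "\<A> \<noteq> {}" using in\<A>[of "{}" 1] by auto
  then obtain n where n: "\<And>K F e. K \<in> \<A> \<Longrightarrow> finite F \<Longrightarrow> e > 0 \<Longrightarrow> \<exists>p\<in>K. \<forall>a\<in>F. \<bar>n a - p a\<bar> < e"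
    using pointwise_cluster_point[of \<A> B] bound ne dir by metis
  have near: "\<exists>p. almost_invariant_mean Q e p \<and> (\<forall>a\<in>F. \<bar>n a - p a\<bar> < e)"
    if "finite Q" "Q \<subseteq> H" "finite F" "0 < e" "e \<le> 1" for Q F and e :: real
    using n[OF in\<A>[OF that(1,2,4,5)] that(3,4)] by (auto simp: A_def)
  have small: "x \<le> y" if c: "0 \<le> c" and le: "\<And>e. 0 < e \<Longrightarrow> e \<le> 1 \<Longrightarrow> x \<le> y + e * c" for x y c :: real
  proof (rule field_le_epsilon)
    fix e :: real assume e: "e > 0"
    define d where "d = min 1 (e / (c + 1))"
    have d: "0 < d" "d \<le> 1" "d \<le> e / (c + 1)" using e c by (auto simp: d_def)
    have "d * c \<le> e / (c + 1) * (c + 1)" using d c e by (intro mult_mono) auto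
    then show "x \<le> y + e" using le[OF d(1,2)] c by simp
  qed
  have add: "n (\<lambda>x. f x + g x) = n f + n g" if f: "f \<in> Cb S" and g: "g \<in> Cb S" for f g
  proof -
    have "\<bar>n (\<lambda>x. f x + g x) - (n f + n g)\<bar> \<le> 0"
    proof (rule small[of 3])
      fix e :: real assume e: "0 < e" "e \<le> 1"
      obtain p where p: "almost_invariant_mean {} e p" "\<forall>a\<in>{f, g, \<lambda>x. f x + g x}. \<bar>n a - p a\<bar> < e"
        using near[of "{}" "{f, g, \<lambda>x. f x + g x}" e] e by auto
      have "p (\<lambda>x. f x + g x) = p f + p g" using p(1) f g unfolding almost_invariant_mean_def by blast
      moreover have "\<bar>n f - p f\<bar> < e" "\<bar>n g - p g\<bar> < e" "\<bar>n (\<lambda>x. f x + g x) - p (\<lambda>x. f x + g x)\<bar> < e"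
        using p(2) by simp_all
      ultimately show "\<bar>n (\<lambda>x. f x + g x) - (n f + n g)\<bar> \<le> 0 + e * 3" by linarith
    qed simp
    then show ?thesis by simp
  qed
  have scale: "n (\<lambda>x. c * f x) = c * n f" if f: "f \<in> Cb S" for c f
  proof -
    have "\<bar>n (\<lambda>x. c * f x) - c * n f\<bar> \<le> 0"
    proof (rule small[of "1 + \<bar>c\<bar>"])
      fix e :: real assume e: "0 < e" "e \<le> 1"
      obtain p where p: "almost_invariant_mean {} e p" "\<forall>a\<in>{f, \<lambda>x. c * f x}. \<bar>n a - p a\<bar> < e"
        using near[of "{}" "{f, \<lambda>x. c * f x}" e] e by auto
      have "p (\<lambda>x. c * f x) = c * p f" using p(1) f unfolding almost_invariant_mean_def by blast
      moreover have "\<bar>n (\<lambda>x. c * f x) - p (\<lambda>x. c * f x)\<bar> < e" using p(2) by simp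
      moreover have "\<bar>c * n f - c * p f\<bar> \<le> \<bar>c\<bar> * e"
        using p(2) mult_left_mono[of "\<bar>n f - p f\<bar>" e "\<bar>c\<bar>"] by (simp add: abs_mult flip: right_diff_distrib)
      moreover have "e * (1 + \<bar>c\<bar>) = e + \<bar>c\<bar> * e" by (simp add: algebra_simps)
      ultimately show "\<bar>n (\<lambda>x. c * f x) - c * n f\<bar> \<le> 0 + e * (1 + \<bar>c\<bar>)" by linarith
    qed simp
    then show ?thesis by simp
  qed
  have norm: "\<bar>n f\<bar> \<le> s" if f: "f \<in> Cb S" and s: "\<forall>h\<in>H. \<bar>f h\<bar> \<le> s" for f s
  proof (rule small[of "s + 1"])
    show "0 \<le> s + 1" using bspec[OF s H_closed(3)] by linarith
    fix e :: real assume e: "0 < e" "e \<le> 1"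
    obtain p where p: "almost_invariant_mean {} e p" "\<forall>a\<in>{f}. \<bar>n a - p a\<bar> < e" using near[of "{}" "{f}" e] e by auto
    have "\<bar>p f\<bar> \<le> (1 + e) * s" using p(1) f s unfolding almost_invariant_mean_def by blast
    moreover have "\<bar>n f - p f\<bar> < e" using p(2) by simp
    moreover have "(1 + e) * s + e = s + e * (s + 1)" by (simp add: algebra_simps)
    ultimately show "\<bar>n f\<bar> \<le> s + e * (s + 1)" by linarith
  qed
  have one: "n (\<lambda>_. 1) = 1"
  proof -
    have "\<bar>n (\<lambda>_. 1) - 1\<bar> \<le> 0"
    proof (rule small[of 2])
      fix e :: real assume e: "0 < e" "e \<le> 1"
      obtain p where p: "almost_invariant_mean {} e p" "\<forall>a\<in>{\<lambda>_. 1}. \<bar>n a - p a\<bar> < e" using near[of "{}" "{\<lambda>_. 1}" e] e by auto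
      have "\<bar>p (\<lambda>_. 1) - 1\<bar> \<le> e" using p(1) unfolding almost_invariant_mean_def by blast
      then show "\<bar>n (\<lambda>_. 1) - 1\<bar> \<le> 0 + e * 2" using p(2) by simp
    qed simp
    then show ?thesis by simp
  qed
  have inv: "n (\<lambda>x. f (h \<otimes> x)) = n f" if f: "f \<in> Cb S" and h: "h \<in> H" for f h
  proof -
    obtain s where s: "\<forall>h\<in>H. \<bar>f h\<bar> \<le> s" using Cb_S_bounded[OF f] by blast
    have "\<bar>n (\<lambda>x. f (h \<otimes> x)) - n f\<bar> \<le> 0"
    proof (rule small[of "s + 2"])
      show "0 \<le> s + 2" using bspec[OF s H_closed(3)] by linarith
      fix e :: real assume e: "0 < e" "e \<le> 1"
      obtain p where p: "almost_invariant_mean {h} e p" "\<forall>a\<in>{f, \<lambda>x. f (h \<otimes> x)}. \<bar>n a - p a\<bar> < e"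
        using near[of "{h}" "{f, \<lambda>x. f (h \<otimes> x)}" e] e h by auto
      have "\<bar>p (\<lambda>x. f (h \<otimes> x)) - p f\<bar> \<le> e * s" using p(1) f s unfolding almost_invariant_mean_def by blast
      moreover have "\<bar>n f - p f\<bar> < e" "\<bar>n (\<lambda>x. f (h \<otimes> x)) - p (\<lambda>x. f (h \<otimes> x))\<bar> < e" using p(2) by simp_all
      moreover have "e * (s + 2) = e * s + 2 * e" by (simp add: algebra_simps)
      ultimately show "\<bar>n (\<lambda>x. f (h \<otimes> x)) - n f\<bar> \<le> 0 + e * (s + 2)" by linarith
    qed
    then show ?thesis by simp
  qed
  show thesis
  proof (rule that[of n])
    show "mean_on (Cb S) H n" unfolding mean_on_def using add scale norm one by simp
  qed (rule inv)
qed

end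

theorem proposition3:
  fixes G :: "('g, 'b) monoid_scheme" and T :: "'g topology" and H :: "'g set"
    and M :: "'g set measure"
  assumes "locally_compact_group G T"
    and "subgroup H G" and "closedin T H"
    and "quasi_invariant_measure G T H M"
    and "weakly_contains_trivial (subtopology T H) M (quasi_regular G M)"
    and "relatively_amenable TYPE(('g \<Rightarrow> real) \<Rightarrow> real) G T H"
  shows "amenable TYPE('v::real_vector) (G\<lparr>carrier := H\<rparr>) (subtopology T H)"
proof -
  interpret locally_compact_group G T by (rule assms(1))
  interpret K: locally_compact_group "G\<lparr>carrier := H\<rparr>" "subtopology T H"
    by (rule locally_compact_group_subgroup[OF assms(2,3)])
  obtain J where J: "K.left_Haar J" using K.left_Haar_exists by blast
  interpret quasi_invariant G T H J M
    by (intro quasi_invariant.intro Haar_subgroup.intro Haar_subgroup_axioms.intro quasi_invariant_axioms.intro assms J)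
  obtain m where m: "mean_on UC (carrier G) m" "\<And>f h. f \<in> UC \<Longrightarrow> h \<in> H \<Longrightarrow> m (\<lambda>x. f (h \<otimes>\<^bsub>G\<^esub> x)) = m f"
    using mean_if_relatively_amenable[OF assms(6) subgroup.subset[OF assms(2)]] by blast
  obtain n where n: "mean_on (Cb (subtopology T H)) H n"
    "\<And>f h. f \<in> Cb (subtopology T H) \<Longrightarrow> h \<in> H \<Longrightarrow> n (\<lambda>x. f (h \<otimes>\<^bsub>G\<^esub> x)) = n f"
    using invariant_mean_exists[OF m assms(5)] by blast
  show ?thesis
    by (rule K.amenable_if_invariant_mean[of n]) (use n in simp_all)
qed

end
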